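(* Let $\mu_1,\mu_2,a_1,a_2,\beta>0$, $2<p<4$, and $\alpha_1,\alpha_2<0$. Consider the problem of finding $(\lambda_1,\lambda_2,u,v)\in\mathbb{R}^2\times H^1(\mathbb{R}^4,\mathbb{R}^2)$ with $$\begin{cases}-\Delta u+\lambda_1u=\mu_1u^3+\alpha_1|u|^{p-2}u+\beta v^2u & \text{in }\mathbb{R}^4,\\ -\Delta v+\lambda_2v=\mu_2v^3+\alpha_2|v|^{p-2}v+\beta u^2v & \text{in }\mathbb{R}^4,\end{cases}\qquad \int_{\mathbb{R}^4}u^2=a_1^2,\quad \int_{\mathbb{R}^4}v^2=a_2^2 .$$ Then this problem has no positive solution $(u,v)\in H^1(\mathbb{R}^4,\mathbb{R}^2)$ (for any $\lambda_1,\lambda_2\in\mathbb{R}$), and, if $p>\frac83$, it has no non-trivial radial solution $(u,v)\in H^1(\mathbb{R}^4,\mathbb{R}^2)$ (for any $\lambda_1,\lambda_2\in\mathbb{R}$).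
   Context: Functions are real valued; solutions are weak solutions. "Positive" means $u>0$ and $v>0$ in $\mathbb{R}^4$; "radial" means that both $u$ and $v$ are radially symmetric about the origin. The numbers $\lambda_1,\lambda_2$ are unknowns (Lagrange multipliers). *)

theory Defs
  imports "HOL-Analysis.Analysis"
begin

primrec C_k :: "nat \<Rightarrow> ('a::euclidean_space \<Rightarrow> real) \<Rightarrow> bool" where
  "C_k 0 f \<longleftrightarrow> continuous_on UNIV f"
| "C_k (Suc k) f \<longleftrightarrow> f differentiable_on UNIV \<and>
     (\<forall>b\<in>Basis. C_k k (\<lambda>x. frechet_derivative f (at x) b))"

definition test_function :: "('a::euclidean_space \<Rightarrow> real) \<Rightarrow> bool" where
  "test_function \<phi> \<longleftrightarrow> (\<forall>k. C_k k \<phi>) \<and> compact (closure {x. \<phi> x \<noteq> 0})"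

definition grad :: "('a::euclidean_space \<Rightarrow> real) \<Rightarrow> 'a \<Rightarrow> 'a" where
  "grad \<phi> x = (\<Sum>b\<in>Basis. frechet_derivative \<phi> (at x) b *\<^sub>R b)"

definition L2 :: "('a::euclidean_space \<Rightarrow> 'b::euclidean_space) \<Rightarrow> bool" where
  "L2 f \<longleftrightarrow> f \<in> borel_measurable lebesgue \<and> integrable lebesgue (\<lambda>x. (norm (f x))\<^sup>2)"

definition weak_gradient :: "('a::euclidean_space \<Rightarrow> real) \<Rightarrow> ('a \<Rightarrow> 'a) \<Rightarrow> bool" where
  "weak_gradient u g \<longleftrightarrow>
     (\<forall>\<phi>. test_function \<phi> \<longrightarrow> (\<forall>b\<in>Basis.
        (LINT x|lebesgue. u x * (grad \<phi> x \<bullet> b)) = - (LINT x|lebesgue. (g x \<bullet> b) * \<phi> x)))"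

text \<open>Elements of \<open>H\<^sup>1\<close> are represented by functions; properties of such elements are
  therefore stated up to null sets below.\<close>

definition H1 :: "('a::euclidean_space \<Rightarrow> real) \<Rightarrow> bool" where
  "H1 u \<longleftrightarrow> L2 u \<and> (\<exists>g. L2 g \<and> weak_gradient u g)"

text \<open>\<open>weak_eq l u F\<close>: the function \<open>u\<close> is a weak solution of \<open>- \<Delta>u + l u = F\<close>.
  The weak gradient is unique up to null sets, so the existential quantifier merely names it.
  In the system below \<open>F\<close> is built from \<open>H\<^sup>1\<close> functions with at most cubic growth, hence it is
  locally integrable by the Sobolev embedding of \<open>H\<^sup>1\<close> into \<open>L\<^sup>4\<close> in dimension four,
  and every integral occurring here is a genuine one.\<close>

definition weak_eq :: "real \<Rightarrow> (real^4 \<Rightarrow> real) \<Rightarrow> (real^4 \<Rightarrow> real) \<Rightarrow> bool" where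
  "weak_eq l u F \<longleftrightarrow>
     (\<exists>g. L2 g \<and> weak_gradient u g \<and>
       (\<forall>\<phi>. test_function \<phi> \<longrightarrow>
          (LINT x|lebesgue. g x \<bullet> grad \<phi> x) + l * (LINT x|lebesgue. u x * \<phi> x)
            = (LINT x|lebesgue. F x * \<phi> x)))"

definition normalized_solution ::
  "real \<Rightarrow> real \<Rightarrow> real \<Rightarrow> real \<Rightarrow> real \<Rightarrow> real \<Rightarrow> real \<Rightarrow> real \<Rightarrow>
   real \<Rightarrow> real \<Rightarrow> (real^4 \<Rightarrow> real) \<Rightarrow> (real^4 \<Rightarrow> real) \<Rightarrow> bool" where
  "normalized_solution \<mu>1 \<mu>2 \<alpha>1 \<alpha>2 \<beta> p a1 a2 l1 l2 u v \<longleftrightarrow>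
     H1 u \<and> H1 v \<and>
     weak_eq l1 u (\<lambda>x. \<mu>1 * u x ^ 3 + \<alpha>1 * (\<bar>u x\<bar> powr (p - 2) * u x) + \<beta> * (v x)\<^sup>2 * u x) \<and>
     weak_eq l2 v (\<lambda>x. \<mu>2 * v x ^ 3 + \<alpha>2 * (\<bar>v x\<bar> powr (p - 2) * v x) + \<beta> * (u x)\<^sup>2 * v x) \<and>
     (LINT x|lebesgue. (u x)\<^sup>2) = a1\<^sup>2 \<and>
     (LINT x|lebesgue. (v x)\<^sup>2) = a2\<^sup>2"

definition positive_ae :: "(real^4 \<Rightarrow> real) \<Rightarrow> bool" where
  "positive_ae u \<longleftrightarrow> (AE x in lebesgue. u x > 0)"

definition zero_ae :: "(real^4 \<Rightarrow> real) \<Rightarrow> bool" where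
  "zero_ae u \<longleftrightarrow> (AE x in lebesgue. u x = 0)"

definition radial_ae :: "(real^4 \<Rightarrow> real) \<Rightarrow> bool" where
  "radial_ae u \<longleftrightarrow> (\<exists>\<rho>. AE x in lebesgue. u x = \<rho> (norm x))"

end

theory Submission
  imports Defs
begin

text \<open>
  By Sobolev's inequality and a Brezis--Kato bootstrap the nonlinear terms are square integrable,
  so the mollified equation may be tested with \<open>\<phi> \<partial>\<^sub>b u\<close>. This yields the conservation law of the
  energy-momentum tensor and hence Pohozaev's identity. In dimension four the cubic terms are scale
  invariant, so that combination with the energy identity leaves
  \<open>\<lambda>\<^sub>1 |u|\<^sup>2 + \<lambda>\<^sub>2 |v|\<^sup>2 = (4/p - 1) \<integral> (\<alpha>\<^sub>1 |u|\<^sup>p + \<alpha>\<^sub>2 |v|\<^sup>p) < 0\<close>, and one multiplier,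
  say \<open>\<lambda>\<^sub>1\<close>, is negative.

  If \<open>u > 0\<close>, then testing with \<open>\<phi>\<^sup>2 / u\<close> (Picone) gives \<open>c \<integral> \<phi>\<^sup>2 \<le> \<integral> |\<nabla>\<phi>|\<^sup>2 + K\<close> for all
  \<open>|\<phi>| \<le> 1\<close>, where \<open>K\<close> accounts for the sets on which the solution is large. A cutoff at
  radius \<open>R\<close> makes the left-hand side of order \<open>R\<^sup>4\<close> and the right-hand side of order \<open>R\<^sup>2\<close>.

  If \<open>u\<close> and \<open>v\<close> are radial, then in the variable \<open>s = |x|\<^sup>2\<close> the function \<open>w = s u\<close> solves
  \<open>w'' = - (q - \<lambda>\<^sub>1) w / (4 s)\<close>. The radial decay \<open>w\<^sup>2 = O(\<surd>s)\<close> makes \<open>q / \<surd>s\<close> integrable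
  at infinity exactly when \<open>p > 8/3\<close>, so a suitable energy of \<open>w\<close> would converge to a positive
  limit, against \<open>\<integral> w\<^sup>2 / s < \<infinity>\<close>. Hence \<open>w\<close> vanishes near infinity, and everywhere by
  uniqueness for the linear equation.
\<close>

section \<open>Partial derivatives and test functions\<close>

text \<open>The obstacle is regularity: a solution is only an \<open>H^1\<close> function, so
  neither \<open>x\<close> times its gradient, nor \<open>1 / u\<close>, nor a differential equation
  in the radius is available at the outset. Second weak derivatives are never constructed. The
  linear part of the equation commutes with mollification, so the tensor identity holds exactly for
  smooth functions and survives the limit as soon as the right-hand side is in \<open>L^2\<close>;
  this is why one bootstrap step, from \<open>L^4\<close> to \<open>L^8\<close>, suffices. In the
  radial case an equation in one variable can simply be integrated twice. Only the component with
  the negative multiplier is examined; the other one acts as a coefficient in its equation, whatever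
  its own multiplier. The exponent 8/3 arises as follows: \<open>w^2 = O(sqrt s)\<close> means
  \<open>u = O(s^(-3/4))\<close>, so the power term of \<open>q / sqrt s\<close> is of order
  \<open>s^(-3(p-2)/4 - 1/2)\<close>, and this exponent is below -1 exactly when
  \<open>p > 8/3\<close>. The cubic terms only contribute \<open>s^(-2)\<close>. The sign of the
  multiplier identity comes from \<open>p < 4\<close> together with negative \<alpha>.\<close>

definition pd :: "'a::euclidean_space \<Rightarrow> ('a \<Rightarrow> real) \<Rightarrow> 'a \<Rightarrow> real" where
  "pd b f x = frechet_derivative f (at x) b"

abbreviation smooth :: "('a::euclidean_space \<Rightarrow> real) \<Rightarrow> bool" where
  "smooth f \<equiv> \<forall>k. C_k k f"

lemma C_k_Suc_iff:
  "C_k (Suc k) f \<longleftrightarrow> (\<forall>x. f differentiable (at x)) \<and> (\<forall>b\<in>Basis. C_k k (pd b f))"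
proof -
  have "pd b f = (\<lambda>x. frechet_derivative f (at x) b)" for b by (auto simp: pd_def)
  then show ?thesis by (simp add: differentiable_on_def)
qed

lemma pd_eq: "(f has_derivative f') (at x) \<Longrightarrow> pd b f x = f' b"
  unfolding pd_def using frechet_derivative_at by fastforce

lemma C_k_SucI:
  assumes "\<And>x. (f has_derivative f' x) (at x)" "\<And>b. b \<in> Basis \<Longrightarrow> C_k k (\<lambda>x. f' x b)"
  shows "C_k (Suc k) f"
proof -
  have "pd b f = (\<lambda>x. f' x b)" for b using pd_eq[OF assms(1)] by auto
  then show ?thesis unfolding C_k_Suc_iff using assms by (auto simp: differentiable_def)
qed

lemma C_k_SucD:
  assumes "C_k (Suc k) f"
  shows "(f has_derivative (\<lambda>h. frechet_derivative f (at x) h)) (at x)"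
    "b \<in> Basis \<Longrightarrow> C_k k (pd b f)"
  using assms unfolding C_k_Suc_iff by (auto simp: frechet_derivative_works[symmetric])

lemma C_k_pred: "C_k (Suc k) f \<Longrightarrow> C_k k f"
proof (induction k arbitrary: f)
  case 0 then show ?case by (auto intro: differentiable_imp_continuous_on)
next
  case (Suc k) then show ?case by (metis C_k_Suc_iff)
qed

lemma C_k_mono: "C_k m f \<Longrightarrow> n \<le> m \<Longrightarrow> C_k n f"
  by (induction m) (auto simp: le_Suc_eq simp del: C_k.simps intro: C_k_pred)

lemma C_k_cont: "C_k k f \<Longrightarrow> continuous_on S f"
  using C_k_mono[of k f 0] by (auto intro: continuous_on_subset)

lemma C_k_const: "C_k k (\<lambda>x. c)"
proof (induction k arbitrary: c)
  case (Suc k)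
  show ?case by (rule C_k_SucI[where f'="\<lambda>x h. 0"]) (use Suc in auto)
qed auto

lemma C_k_add: "C_k k f \<Longrightarrow> C_k k g \<Longrightarrow> C_k k (\<lambda>x. f x + g x)"
proof (induction k arbitrary: f g)
  case 0 then show ?case by (auto intro: continuous_intros)
next
  case (Suc k)
  show ?case
    by (rule C_k_SucI[OF has_derivative_add[OF C_k_SucD(1)[OF Suc.prems(1)] C_k_SucD(1)[OF Suc.prems(2)]]])
       (use Suc.IH[OF C_k_SucD(2)[OF Suc.prems(1)] C_k_SucD(2)[OF Suc.prems(2)]] in \<open>simp add: pd_def\<close>)
qed

lemma C_k_mult: "C_k k f \<Longrightarrow> C_k k g \<Longrightarrow> C_k k (\<lambda>x. f x * g x)"
proof (induction k arbitrary: f g)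
  case 0 then show ?case by (auto intro: continuous_intros)
next
  case (Suc k)
  show ?case
  proof (rule C_k_SucI[OF has_derivative_mult[OF C_k_SucD(1)[OF Suc.prems(1)] C_k_SucD(1)[OF Suc.prems(2)]]])
    fix b :: 'a assume b: "b \<in> Basis"
    show "C_k k (\<lambda>x. f x * frechet_derivative g (at x) b + frechet_derivative f (at x) b * g x)"
      using C_k_add[OF Suc.IH[OF C_k_pred[OF Suc.prems(1)] C_k_SucD(2)[OF Suc.prems(2) b]]
        Suc.IH[OF C_k_SucD(2)[OF Suc.prems(1) b] C_k_pred[OF Suc.prems(2)]]]
      by (simp add: pd_def)
  qed
qed

lemma C_k_cmult: "C_k k f \<Longrightarrow> C_k k (\<lambda>x. c * f x)"
  by (intro C_k_mult C_k_const)

lemma C_k_uminus: "C_k k f \<Longrightarrow> C_k k (\<lambda>x. - f x)"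
  using C_k_cmult[of k f "-1"] by simp

lemma C_k_diff: "C_k k f \<Longrightarrow> C_k k g \<Longrightarrow> C_k k (\<lambda>x. f x - g x)"
  using C_k_add[OF _ C_k_uminus, of k f g] by simp

lemma C_k_sum: "finite I \<Longrightarrow> (\<And>i. i \<in> I \<Longrightarrow> C_k k (f i)) \<Longrightarrow> C_k k (\<lambda>x. \<Sum>i\<in>I. f i x)"
  by (induction I rule: finite_induct) (auto intro: C_k_add C_k_const simp del: C_k.simps)

lemma C_k_inner: "C_k k (\<lambda>x. x \<bullet> a)"
proof (cases k)
  case (Suc m)
  show ?thesis unfolding Suc
    by (rule C_k_SucI[where f'="\<lambda>x h. h \<bullet> a"]) (auto intro!: derivative_eq_intros C_k_const simp del: C_k.simps)
qed (auto intro: continuous_intros)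

lemma C_k_norm_sq: "C_k k (\<lambda>x. (norm x)\<^sup>2)"
proof -
  have "(\<lambda>x::'a. (norm x)\<^sup>2) = (\<lambda>x. \<Sum>b\<in>Basis. (x \<bullet> b) * (x \<bullet> b))"
    by (auto simp: power2_norm_eq_inner euclidean_inner[of x x for x])
  then show ?thesis by (auto intro!: C_k_sum C_k_mult C_k_inner simp del: C_k.simps)
qed

lemma real_frechet_scale:
  fixes f :: "real \<Rightarrow> real"
  assumes "f differentiable (at y)"
  shows "frechet_derivative f (at y) h = h * pd 1 f y"
proof -
  have "linear (frechet_derivative f (at y))" by (rule linear_frechet_derivative[OF assms])
  from linear_scale[OF this, of h 1] show ?thesis by (simp add: pd_def)
qed

lemma C_k_compose:
  fixes f :: "real \<Rightarrow> real" and q :: "'a::euclidean_space \<Rightarrow> real"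
  shows "C_k k f \<Longrightarrow> C_k k q \<Longrightarrow> C_k k (\<lambda>x. f (q x))"
proof (induction k arbitrary: f q)
  case 0 then show ?case by (auto intro!: continuous_on_compose2[of UNIV f UNIV q])
next
  case (Suc k)
  show ?case
  proof (rule C_k_SucI[OF has_derivative_compose[OF C_k_SucD(1)[OF Suc.prems(2)] C_k_SucD(1)[OF Suc.prems(1)]]])
    fix b :: 'a assume b: "b \<in> Basis"
    have "C_k k (pd 1 f)" using C_k_SucD(2)[OF Suc.prems(1)] by simp
    note C_k_mult[OF C_k_SucD(2)[OF Suc.prems(2) b] Suc.IH[OF this C_k_pred[OF Suc.prems(2)]]]
    moreover have "frechet_derivative f (at (q x)) (frechet_derivative q (at x) b) = pd b q x * pd 1 f (q x)" for x
      using Suc.prems(1) unfolding C_k_Suc_iff by (subst real_frechet_scale) (auto simp: pd_def)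
    ultimately show "C_k k (\<lambda>x. frechet_derivative f (at (q x)) (frechet_derivative q (at x) b))" by simp
  qed
qed

lemma pd_affine:
  fixes f :: "'a::euclidean_space \<Rightarrow> real"
  assumes "f differentiable (at (a + c *\<^sub>R x))"
  shows "((\<lambda>x. f (a + c *\<^sub>R x)) has_derivative (\<lambda>h. c * frechet_derivative f (at (a + c *\<^sub>R x)) h)) (at x)"
proof -
  have l: "linear (frechet_derivative f (at (a + c *\<^sub>R x)))" by (rule linear_frechet_derivative[OF assms])
  have 1: "((\<lambda>x. a + c *\<^sub>R x) has_derivative (\<lambda>h. c *\<^sub>R h)) (at x)" by (auto intro!: derivative_eq_intros)
  have "(f has_derivative frechet_derivative f (at (a + c *\<^sub>R x))) (at (a + c *\<^sub>R x))"
    using assms frechet_derivative_works by blast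
  from has_derivative_compose[OF 1 this] show ?thesis by (simp add: linear_scale[OF l])
qed

lemma C_k_affine: "C_k k f \<Longrightarrow> C_k k (\<lambda>x. f (a + c *\<^sub>R x))"
proof (induction k arbitrary: f)
  case 0 then show ?case by (auto intro!: continuous_on_compose2[of UNIV f UNIV "\<lambda>x. a + c *\<^sub>R x"] continuous_intros)
next
  case (Suc k)
  show ?case
  proof (rule C_k_SucI[OF pd_affine])
    show "f differentiable at (a + c *\<^sub>R x)" for x using Suc.prems unfolding C_k_Suc_iff by auto
    fix b :: 'a assume b: "b \<in> Basis"
    from Suc.IH[OF C_k_SucD(2)[OF Suc.prems b]]
    show "C_k k (\<lambda>x. c * frechet_derivative f (at (a + c *\<^sub>R x)) b)" by (intro C_k_cmult) (simp add: pd_def)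
  qed
qed

section \<open>The flat function \<open>exp (-1/t)\<close> and smooth bump functions\<close>

definition pexp :: "real poly \<Rightarrow> real \<Rightarrow> real" where
  "pexp q t = (if t > 0 then poly q (1/t) * exp (-1/t) else 0)"

lemma pexp_tendsto_0: "((\<lambda>t. pexp q t) \<longlongrightarrow> 0) (at_right 0)"
proof -
  have "((\<lambda>s. poly q s * exp (-s)) \<longlongrightarrow> 0) at_top"
  proof (induction q)
    case (pCons a q)
    have "((\<lambda>s. a * exp (-s) + s * (poly q s * exp (-s))) \<longlongrightarrow> 0) at_top"
    proof -
      have A: "((\<lambda>s. s^n / exp s) \<longlongrightarrow> (0::real)) at_top" for n by (rule tendsto_power_div_exp_0)
      have "poly (pCons 0 q) s * exp (-s) = (\<Sum>i\<le>degree (pCons 0 q). coeff (pCons 0 q) i * (s^i / exp s))" for s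
        unfolding poly_altdef sum_distrib_right exp_minus divide_inverse mult.assoc ..
      moreover have "((\<lambda>s. \<Sum>i\<le>degree (pCons 0 q). coeff (pCons 0 q) i * (s^i / exp s)) \<longlongrightarrow> (\<Sum>i\<le>degree (pCons 0 q). coeff (pCons 0 q) i * 0)) at_top"
        by (intro tendsto_sum tendsto_mult tendsto_const A)
      ultimately have 1: "((\<lambda>s. s * (poly q s * exp (-s))) \<longlongrightarrow> 0) at_top" by (simp add: mult.assoc)
      have "((\<lambda>s. a * (s^0 / exp s)) \<longlongrightarrow> a * 0) at_top" by (intro tendsto_mult tendsto_const A)
      then have 2: "((\<lambda>s. a * exp (-s)) \<longlongrightarrow> 0) at_top" by (simp add: exp_minus inverse_eq_divide)
      show ?thesis using tendsto_add[OF 2 1] by simp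
    qed
    then show ?case by (simp add: algebra_simps)
  qed simp
  from filterlim_compose[OF this filterlim_inverse_at_top_right]
  have "((\<lambda>t. poly q (inverse t) * exp (- inverse t)) \<longlongrightarrow> 0) (at_right 0)" .
  then show ?thesis
    by (rule Lim_transform_eventually)
       (auto simp: eventually_at_right_less pexp_def inverse_eq_divide eventually_at_filter)
qed

text \<open>For \<open>t > 0\<close> differentiation turns \<open>q (1/t)\<close> into
  \<open>(q - q') (1/t) / t^2\<close>, and \<open>[:0,0,1:]\<close> is the factor
  \<open>1/t^2\<close>. The family \<open>pexp\<close> is thus closed under differentiation, so
  smoothness of \<open>exp (-1/t)\<close> becomes an induction on the order with \<open>q\<close>
  arbitrary.\<close>

lemma pexp_deriv: "(pexp q has_real_derivative pexp ((q - pderiv q) * [:0,0,1:]) t) (at t)"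
proof -
  consider "t > 0" | "t < 0" | "t = 0" by linarith
  then show ?thesis
  proof cases
    case 1
    have "((\<lambda>t. poly q (1/t) * exp (-1/t)) has_real_derivative pexp ((q - pderiv q) * [:0,0,1:]) t) (at t)"
      using 1 unfolding pexp_def
      by (auto intro!: derivative_eq_intros poly_DERIV[THEN DERIV_chain2] simp: field_simps power2_eq_square)
    then show ?thesis
      by (rule has_field_derivative_transform_within_open[where S="{0<..}"]) (use 1 in \<open>auto simp: pexp_def\<close>)
  next
    case 2
    have "((\<lambda>t. 0) has_real_derivative pexp ((q - pderiv q) * [:0,0,1:]) t) (at t)"
      using 2 by (auto simp: pexp_def)
    then show ?thesis
      by (rule has_field_derivative_transform_within_open[where S="{..<0}"]) (use 2 in \<open>auto simp: pexp_def\<close>)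
  next
    case 3
    \<comment> \<open>To the right of the origin the difference quotient is again in the family,
      with \<open>q\<close> multiplied by the variable, so it tends to 0.\<close>
    have r: "((\<lambda>h. pexp q h / h) \<longlongrightarrow> 0) (at_right 0)"
    proof (rule Lim_transform_eventually[OF pexp_tendsto_0[of "q * [:0,1:]"]])
      show "\<forall>\<^sub>F t in at_right 0. pexp (q * [:0,1:]) t = pexp q t / t"
        by (auto simp: eventually_at_filter pexp_def)
    qed
    have l: "((\<lambda>h. pexp q h / h) \<longlongrightarrow> 0) (at_left 0)"
      by (rule Lim_transform_eventually[OF tendsto_const]) (auto simp: eventually_at_filter pexp_def)
    have "((\<lambda>h. pexp q h / h) \<longlongrightarrow> 0) (at 0)"
      using filterlim_split_at[OF l r] .
    then show ?thesis using 3 by (simp add: DERIV_def pexp_def)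
  qed
qed

lemma C_k_pexp: "C_k k (pexp q)"
proof (induction k arbitrary: q)
  case 0
  then show ?case
    using DERIV_continuous_on[OF has_field_derivative_at_within[OF pexp_deriv]] by (simp add: C_k.simps)
next
  case (Suc k)
  show ?case
    by (rule C_k_SucI[OF pexp_deriv[unfolded has_field_derivative_def]]) (use Suc in auto)
qed

definition bump :: "real \<Rightarrow> 'a::euclidean_space \<Rightarrow> real" where
  "bump e x = pexp 1 (e\<^sup>2 - (norm x)\<^sup>2)"

lemma smooth_bump: "C_k k (bump e)"
  unfolding bump_def by (intro C_k_compose[OF C_k_pexp] C_k_diff C_k_const C_k_norm_sq)

lemma bump_nonneg: "0 \<le> bump e x"
  by (auto simp: bump_def pexp_def)

lemma bump_pos_iff: "e > 0 \<Longrightarrow> bump e x > 0 \<longleftrightarrow> norm x < e"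
  by (auto simp: bump_def pexp_def power2_less_imp_less intro!: power_strict_mono)

lemma bump_0: "e > 0 \<Longrightarrow> e \<le> norm x \<Longrightarrow> bump e x = 0"
  using bump_pos_iff[of e x] bump_nonneg[of e x] by auto

text \<open>Bounded support stated without a closure; by \<open>test_iff\<close> this is the
  compactness condition of \<open>test_function\<close>.\<close>

definition bsupp :: "('a::real_normed_vector \<Rightarrow> real) \<Rightarrow> bool" where
  "bsupp f \<longleftrightarrow> (\<exists>r. \<forall>x. norm x \<ge> r \<longrightarrow> f x = 0)"

lemma bsuppE:
  assumes "bsupp f" obtains r where "r > 0" "\<And>x. norm x \<ge> r \<Longrightarrow> f x = 0"
proof -
  obtain r where "\<forall>x. norm x \<ge> r \<longrightarrow> f x = 0" using assms unfolding bsupp_def by blast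
  then show ?thesis using that[of "max r 1"] by auto
qed

lemma has_real_derivativeI: "(f has_derivative (\<lambda>h. h * D)) F \<Longrightarrow> (f has_real_derivative D) F"
  unfolding has_field_derivative_def mult_commute_abs .

lemma test_iff: "test_function \<phi> \<longleftrightarrow> smooth \<phi> \<and> bsupp \<phi>"
proof -
  have "compact (closure {x. \<phi> x \<noteq> 0}) \<longleftrightarrow> bsupp \<phi>"
  proof
    assume "compact (closure {x. \<phi> x \<noteq> 0})"
    then obtain r where r: "\<And>x. \<phi> x \<noteq> 0 \<Longrightarrow> norm x \<le> r"
      unfolding compact_closure bounded_iff by auto
    have "\<phi> x = 0" if "norm x \<ge> r + 1" for x using r[of x] that by fastforce
    then show "bsupp \<phi>" unfolding bsupp_def by blast
  next
    assume "bsupp \<phi>"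
    then obtain r where r: "\<And>x. norm x \<ge> r \<Longrightarrow> \<phi> x = 0" unfolding bsupp_def by blast
    have "norm x \<le> r" if "\<phi> x \<noteq> 0" for x using r[of x] that by fastforce
    then show "compact (closure {x. \<phi> x \<noteq> 0})" unfolding compact_closure bounded_iff by blast
  qed
  then show ?thesis unfolding test_function_def by simp
qed

lemma bsupp_mult: "bsupp f \<Longrightarrow> bsupp (\<lambda>x. f x * g x)" "bsupp f \<Longrightarrow> bsupp (\<lambda>x. g x * f x)"
  unfolding bsupp_def by fastforce+

lemma bsupp_compose0: "bsupp f \<Longrightarrow> G 0 = 0 \<Longrightarrow> bsupp (\<lambda>x. G (f x))"
  unfolding bsupp_def by fastforce

lemma bsupp_shift: "bsupp f \<Longrightarrow> bsupp (\<lambda>x. f (a + x))"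
proof (elim bsuppE)
  fix r assume r: "0 < r" "\<And>x. r \<le> norm x \<Longrightarrow> f x = 0"
  have "f (a + x) = 0" if "norm x \<ge> r + norm a" for x
    using r(2)[of "a+x"] norm_triangle_ineq2[of x "-a"] that by (simp add: add.commute)
  then show ?thesis unfolding bsupp_def by blast
qed

lemma bsupp_reflect: "bsupp f \<Longrightarrow> bsupp (\<lambda>x. f (a - x))"
proof (elim bsuppE)
  fix r assume r: "0 < r" "\<And>x. r \<le> norm x \<Longrightarrow> f x = 0"
  have "f (a - x) = 0" if "norm x \<ge> r + norm a" for x
    using r(2)[of "a-x"] norm_triangle_ineq2[of x "a"] that by (simp add: norm_minus_commute)
  then show ?thesis unfolding bsupp_def by blast
qed

definition C1c :: "('a::euclidean_space \<Rightarrow> real) \<Rightarrow> bool" where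
  "C1c f \<longleftrightarrow> C_k 1 f \<and> bsupp f"

lemma test_C1c: "test_function \<phi> \<Longrightarrow> C1c \<phi>" by (auto simp: test_iff C1c_def simp del: C_k.simps)

lemma C_k1_deriv: "C_k (Suc k) f \<Longrightarrow> (f has_derivative (\<lambda>h. \<Sum>b\<in>Basis. (h \<bullet> b) * pd b f x)) (at x)"
proof -
  assume f: "C_k (Suc k) f"
  let ?D = "frechet_derivative f (at x)"
  have d: "f differentiable (at x)" using f unfolding C_k_Suc_iff by auto
  have l: "linear ?D" by (rule linear_frechet_derivative[OF d])
  have "?D h = (\<Sum>b\<in>Basis. (h \<bullet> b) * pd b f x)" for h
  proof -
    have "?D h = ?D (\<Sum>b\<in>Basis. (h \<bullet> b) *\<^sub>R b)" by (simp add: euclidean_representation)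
    also have "\<dots> = (\<Sum>b\<in>Basis. (h \<bullet> b) * pd b f x)"
      by (simp add: linear_sum[OF l] linear_scale[OF l] pd_def)
    finally show ?thesis .
  qed
  then have "?D = (\<lambda>h. \<Sum>b\<in>Basis. (h \<bullet> b) * pd b f x)" by auto
  with C_k_SucD(1)[OF f] show ?thesis by metis
qed

lemma C_k1_pd_cont: "C_k (Suc k) f \<Longrightarrow> b \<in> Basis \<Longrightarrow> continuous_on S (pd b f)"
  using C_k_SucD(2) C_k_cont by blast

lemma bsupp_pd: "bsupp f \<Longrightarrow> bsupp (pd b f)"
proof (elim bsuppE)
  fix r assume r: "0 < r" "\<And>x. r \<le> norm x \<Longrightarrow> f x = 0"
  have "pd b f x = 0" if "norm x \<ge> r + 1" for x
  proof -
    have "((\<lambda>x. 0) has_derivative (\<lambda>h. 0::real)) (at x)" by simp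
    then have "(f has_derivative (\<lambda>h. 0)) (at x)"
    proof (rule has_derivative_transform_within_open[of _ _ _ _ "- cball 0 r"])
      show "x \<in> - cball 0 r" using that by simp
    qed (use r in \<open>auto simp: not_le\<close>)
    from pd_eq[OF this] show ?thesis .
  qed
  then show ?thesis unfolding bsupp_def by blast
qed

lemma test_pd: "test_function \<phi> \<Longrightarrow> b \<in> Basis \<Longrightarrow> test_function (pd b \<phi>)"
  unfolding test_iff using C_k_SucD(2) bsupp_pd by blast

lemma test_mult: "test_function \<phi> \<Longrightarrow> smooth \<psi> \<Longrightarrow> test_function (\<lambda>x. \<phi> x * \<psi> x)"
  unfolding test_iff by (auto intro: C_k_mult bsupp_mult simp del: C_k.simps)

lemma test_cmult: "test_function \<phi> \<Longrightarrow> test_function (\<lambda>x. c * \<phi> x)"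
  unfolding test_iff by (auto intro: C_k_cmult bsupp_mult simp del: C_k.simps)

lemma test_reflect: "test_function \<phi> \<Longrightarrow> test_function (\<lambda>y. \<phi> (x - y))"
proof -
  assume *: "test_function \<phi>"
  have "C_k k (\<lambda>y. \<phi> (x - y))" for k
    using C_k_affine[of k \<phi> x "-1"] * unfolding test_iff by simp
  with * show ?thesis unfolding test_iff using bsupp_reflect by blast
qed

lemma grad_inner: "b \<in> Basis \<Longrightarrow> grad \<phi> x \<bullet> b = pd b \<phi> x"
  unfolding grad_def pd_def[symmetric] by (simp add: inner_sum_left inner_Basis if_distrib cong: if_cong)

lemma pd_mult:
  assumes "C_k (Suc k) f" "C_k (Suc m) g"
  shows "pd b (\<lambda>x. f x * g x) x = f x * pd b g x + pd b f x * g x"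
  by (rule trans[OF pd_eq[OF has_derivative_mult[OF C_k_SucD(1)[OF assms(1)] C_k_SucD(1)[OF assms(2)]]]])
     (simp add: pd_def)

lemma pd_cmult:
  assumes "C_k (Suc k) f"
  shows "pd b (\<lambda>x. c * f x) x = c * pd b f x"
  by (rule trans[OF pd_eq[OF has_derivative_mult_right[OF C_k_SucD(1)[OF assms(1)]]]])
     (simp add: pd_def)

lemma pd_diff:
  assumes "C_k (Suc k) f" "C_k (Suc m) g"
  shows "pd b (\<lambda>x. f x - g x) x = pd b f x - pd b g x"
  by (rule trans[OF pd_eq[OF has_derivative_diff[OF C_k_SucD(1)[OF assms(1)] C_k_SucD(1)[OF assms(2)]]]])
     (simp add: pd_def)

lemma pd_compose:
  fixes f :: "real \<Rightarrow> real"
  assumes "C_k (Suc k) q" "(f has_real_derivative D) (at (q x))"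
  shows "pd b (\<lambda>x. f (q x)) x = D * pd b q x"
  by (rule trans[OF pd_eq[OF has_derivative_compose[OF C_k_SucD(1)[OF assms(1)] assms(2)[unfolded has_field_derivative_def]]]])
     (simp add: pd_def)

lemma pd_reflect:
  assumes "C_k (Suc k) f"
  shows "pd b (\<lambda>y. f (x - y)) y = - pd b f (x - y)"
  using pd_eq[OF pd_affine[of f x "-1" y], of b] assms unfolding C_k_Suc_iff by (simp add: pd_def)

lemma test_pd_reflect:
  "test_function \<phi> \<Longrightarrow> pd b (\<lambda>y. \<phi> (x - y)) y = - pd b \<phi> (x - y)"
  using pd_reflect[of 0 \<phi>] unfolding test_iff by blast

lemma real_pd_eq: "(f has_real_derivative D) (at x) \<Longrightarrow> pd 1 f x = D"
  using pd_eq[of f "\<lambda>h. D * h" x 1] by (simp add: has_field_derivative_def)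

lemma C_k_real_deriv: "C_k (Suc k) f \<Longrightarrow> (f has_real_derivative pd 1 f x) (at x)"
  using C_k1_deriv[of k f x] by (intro has_real_derivativeI) (simp del: C_k.simps)

section \<open>Integration by parts for compactly supported functions\<close>

lemma cc_bounded:
  fixes f :: "'a::euclidean_space \<Rightarrow> real"
  assumes "continuous_on UNIV f" "bsupp f"
  obtains M where "M > 0" "\<And>x. \<bar>f x\<bar> \<le> M"
proof -
  obtain r where r: "r > 0" "\<And>x. norm x \<ge> r \<Longrightarrow> f x = 0" using assms(2) by (rule bsuppE) blast
  have "compact (f ` cball 0 r)"
    using assms(1) by (intro compact_continuous_image continuous_on_subset[OF assms(1)]) auto
  then obtain M where M: "\<And>x. x \<in> cball 0 r \<Longrightarrow> \<bar>f x\<bar> \<le> M"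
    by (metis bounded_iff compact_imp_bounded image_eqI real_norm_def)
  have "\<bar>f x\<bar> \<le> max M 1" for x
    using M[of x] r(2)[of x] by (cases "norm x \<le> r") auto
  then show ?thesis using that[of "max M 1"] by auto
qed

lemma cc_integrable:
  fixes f :: "'a::euclidean_space \<Rightarrow> real"
  assumes "continuous_on UNIV f" "bsupp f"
  shows "integrable lborel f"
proof -
  obtain r where r: "r > 0" "\<And>x. norm x \<ge> r \<Longrightarrow> f x = 0" using assms(2) by (rule bsuppE) blast
  have "integrable lborel (\<lambda>x. indicator (cball 0 r) x *\<^sub>R f x)"
    by (rule borel_integrable_compact) (auto intro: continuous_on_subset[OF assms(1)])
  moreover have "(\<lambda>x. indicator (cball 0 r) x *\<^sub>R f x) = f"
    using r(2) by (auto simp: indicator_def fun_eq_iff)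
  ultimately show ?thesis by simp
qed

lemma C1c_cont: "C1c f \<Longrightarrow> continuous_on S f" "C1c f \<Longrightarrow> b \<in> Basis \<Longrightarrow> continuous_on S (pd b f)"
  unfolding C1c_def One_nat_def by (auto intro: C_k_cont C_k1_pd_cont simp del: C_k.simps)

lemma C1c_bsupp: "C1c f \<Longrightarrow> bsupp f" "C1c f \<Longrightarrow> bsupp (pd b f)"
  unfolding C1c_def by (auto intro: bsupp_pd)

lemma cont_borel [measurable_dest]: "continuous_on UNIV f \<Longrightarrow> f \<in> borel_measurable borel"
  by (rule borel_measurable_continuous_onI)

lemma C1c_borel: "C1c f \<Longrightarrow> f \<in> borel_measurable borel" "C1c f \<Longrightarrow> b \<in> Basis \<Longrightarrow> pd b f \<in> borel_measurable borel"
  by (auto intro: borel_measurable_continuous_onI C1c_cont)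

lemma C1c_pd_bounded:
  fixes f :: "'a::euclidean_space \<Rightarrow> real"
  assumes "C1c f"
  obtains M where "M > 0" "\<And>x b. b \<in> Basis \<Longrightarrow> \<bar>pd b f x\<bar> \<le> M"
proof -
  have "\<exists>M>0. \<forall>x. \<bar>pd b f x\<bar> \<le> M" if "b \<in> Basis" for b
    using cc_bounded[OF C1c_cont(2)[OF assms that] C1c_bsupp(2)[OF assms]] by metis
  then obtain M where M: "\<And>b. b \<in> Basis \<Longrightarrow> M b > 0 \<and> (\<forall>x. \<bar>pd b f x\<bar> \<le> M b)" by metis
  have "\<bar>pd b f x\<bar> \<le> sum M Basis" if "b \<in> Basis" for b x
    using M that member_le_sum[of b Basis M] by (meson finite_Basis less_eq_real_def order_trans DiffD1)
  moreover have "sum M Basis > 0" using M by (intro sum_pos) auto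
  ultimately show ?thesis using that by blast
qed

lemma C1_mvt:
  fixes f :: "'a::euclidean_space \<Rightarrow> real"
  assumes "C_k (Suc 0) f"
  obtains t where "0 < t" "t < 1" "f (x + h) - f x = (\<Sum>b\<in>Basis. (h \<bullet> b) * pd b f (x + t *\<^sub>R h))"
proof -
  have d: "((\<lambda>t. f (x + t *\<^sub>R h)) has_real_derivative (\<Sum>b\<in>Basis. (h \<bullet> b) * pd b f (x + t *\<^sub>R h))) (at t)" for t
  proof -
    have 1: "((\<lambda>t. x + t *\<^sub>R h) has_derivative (\<lambda>s. s *\<^sub>R h)) (at t)" by (auto intro!: derivative_eq_intros)
    from has_derivative_compose[OF 1 C_k1_deriv[OF assms]]
    show ?thesis by (intro has_real_derivativeI) (simp add: sum_distrib_left mult.assoc)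
  qed
  obtain t where "0 < t" "t < 1" "f (x + 1 *\<^sub>R h) - f (x + 0 *\<^sub>R h) = (1 - 0) * (\<Sum>b\<in>Basis. (h \<bullet> b) * pd b f (x + t *\<^sub>R h))"
    using MVT2[of 0 1 "\<lambda>t. f (x + t *\<^sub>R h)", OF _ d] by auto
  with that show ?thesis by auto
qed

lemma C1c_lipschitz:
  fixes f :: "'a::euclidean_space \<Rightarrow> real"
  assumes "C1c f"
  obtains L where "L > 0" "\<And>x h. \<bar>f (x + h) - f x\<bar> \<le> L * norm h"
proof -
  obtain M where M: "M > 0" "\<And>x b. b \<in> Basis \<Longrightarrow> \<bar>pd b f x\<bar> \<le> M" using C1c_pd_bounded[OF assms] by blast
  have "\<bar>f (x + h) - f x\<bar> \<le> (M * DIM('a)) * norm h" for x h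
  proof -
    obtain t where t: "f (x + h) - f x = (\<Sum>b\<in>Basis. (h \<bullet> b) * pd b f (x + t *\<^sub>R h))"
      using C1_mvt[of f x h] assms unfolding C1c_def One_nat_def by metis
    have "\<bar>f (x + h) - f x\<bar> \<le> (\<Sum>b\<in>(Basis::'a set). norm h * M)"
      unfolding t
      by (rule order_trans[OF sum_abs], intro sum_mono, unfold abs_mult, intro mult_mono)
         (auto simp: Basis_le_norm M less_imp_le)
    then show ?thesis by (simp add: mult_ac)
  qed
  moreover have "M * DIM('a) > 0" using M by simp
  ultimately show ?thesis using that by blast
qed

lemma lborel_integral_shift:
  fixes f :: "'a::euclidean_space \<Rightarrow> real"
  assumes "f \<in> borel_measurable borel"
  shows "(LINT x|lborel. f (a + x)) = (LINT x|lborel. f x)"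
  by (subst (2) lborel_distr_plus[of a, symmetric], subst integral_distr) (use assms in auto)

text \<open>By translation invariance of Lebesgue measure every difference quotient of
  \<open>f\<close> has integral 0. The quotients are bounded by a Lipschitz constant on a fixed
  ball, so dominated convergence carries this over to the partial derivative without any use of
  Fubini.\<close>

lemma integral_pd_0:
  fixes f :: "'a::euclidean_space \<Rightarrow> real"
  assumes f: "C1c f" and b: "b \<in> Basis"
  shows "(LINT x|lborel. pd b f x) = 0"
proof -
  obtain L where L: "L > 0" "\<And>x h. \<bar>f (x + h) - f x\<bar> \<le> L * norm h" using C1c_lipschitz[OF f] by blast
  obtain r where r: "r > 0" "\<And>x. norm x \<ge> r \<Longrightarrow> f x = 0" using C1c_bsupp(1)[OF f] by (rule bsuppE) blast
  \<comment> \<open>Steps of length at most 1 keep every difference quotient supported in the ball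
    of radius \<open>r + 1\<close>.\<close>
  define t where "t n = 1 / real (Suc n)" for n
  have t: "t n > 0" "t n \<le> 1" for n by (auto simp: t_def)
  have t0: "t \<longlonglongrightarrow> 0" unfolding t_def by (rule LIMSEQ_Suc[OF lim_1_over_n])
  define D where "D n x = (f (t n *\<^sub>R b + x) - f x) / t n" for n x
  have fm[measurable]: "f \<in> borel_measurable borel" by (rule C1c_borel[OF f])
  have fi: "integrable lborel f" by (intro cc_integrable C1c_cont[OF f] C1c_bsupp[OF f])
  have fi2: "integrable lborel (\<lambda>x. f (a + x))" for a
    by (intro cc_integrable bsupp_shift C1c_bsupp[OF f] continuous_on_compose2[OF C1c_cont(1)[OF f, of UNIV]] continuous_intros) auto
  have "(\<lambda>n. LINT x|lborel. D n x) \<longlonglongrightarrow> (LINT x|lborel. pd b f x)"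
  proof (rule integral_dominated_convergence[where w="\<lambda>x. indicator (ball 0 (r+1)) x * L"])
    show "integrable lborel (\<lambda>x. indicator (ball 0 (r+1)) x * L)"
      by (intro integrable_mult_left integrable_real_indicator emeasure_bounded_finite) auto
    show "AE x in lborel. (\<lambda>n. D n x) \<longlonglongrightarrow> pd b f x"
    proof (rule AE_I2)
      fix x
      have 1: "((\<lambda>s. x + s *\<^sub>R b) has_derivative (\<lambda>s. s *\<^sub>R b)) (at 0)" by (auto intro!: derivative_eq_intros)
      have "((\<lambda>s. f (x + s *\<^sub>R b)) has_real_derivative pd b f x) (at 0)"
      proof (intro has_real_derivativeI)
        have *: "(\<Sum>c\<in>Basis. ((s *\<^sub>R b) \<bullet> c) * pd c f (x + 0 *\<^sub>R b)) = s * pd b f x" for s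
        proof -
          have "(\<Sum>c\<in>Basis. ((s *\<^sub>R b) \<bullet> c) * pd c f (x + 0 *\<^sub>R b)) = (\<Sum>c\<in>Basis. if c = b then s * pd b f x else 0)"
            by (rule sum.cong) (use b in \<open>auto simp: inner_Basis\<close>)
          then show ?thesis using b by simp
        qed
        show "((\<lambda>s. f (x + s *\<^sub>R b)) has_derivative (\<lambda>s. s * pd b f x)) (at 0)"
          using has_derivative_compose[OF 1 C_k1_deriv[of 0 f]] f
          unfolding C1c_def One_nat_def * by blast
      qed
      then have "((\<lambda>s. (f (x + s *\<^sub>R b) - f x) / s) \<longlongrightarrow> pd b f x) (at 0)"
        by (simp add: DERIV_def)
      then have "(\<lambda>n. (f (x + t n *\<^sub>R b) - f x) / t n) \<longlonglongrightarrow> pd b f x"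
        by (rule filterlim_compose) (use t t0 in \<open>auto simp: filterlim_at intro!: always_eventually less_imp_neq[THEN not_sym]\<close>)
      then show "(\<lambda>n. D n x) \<longlonglongrightarrow> pd b f x" by (simp add: D_def add.commute)
    qed
    show "AE x in lborel. norm (D n x) \<le> indicator (ball 0 (r+1)) x * L" for n
    proof (rule AE_I2)
      fix x
      have nb: "norm (t n *\<^sub>R b) = t n" using b t(1)[of n] by simp
      show "norm (D n x) \<le> indicator (ball 0 (r+1)) x * L"
      proof (cases "norm x < r + 1")
        case True
        have "\<bar>D n x\<bar> \<le> L"
          using L(2)[of x "t n *\<^sub>R b"] t(1)[of n] unfolding D_def nb
          by (simp add: divide_le_eq add.commute abs_divide)
        then show ?thesis using True by simp
      next
        case False
        have "norm x \<le> norm (t n *\<^sub>R b + x) + norm (t n *\<^sub>R b)"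
          by (metis add.commute add_diff_cancel_left' norm_triangle_ineq4 )
        then have "norm (t n *\<^sub>R b + x) \<ge> r" using False nb t(2)[of n] by linarith
        then show ?thesis using False r by (simp add: D_def)
      qed
    qed
  qed (use C1c_borel(2)[OF f b] in \<open>simp_all add: D_def\<close>)
  moreover have "(LINT x|lborel. D n x) = 0" for n
    unfolding D_def using lborel_integral_shift[OF fm, of "t n *\<^sub>R b"] fi fi2 by simp
  ultimately show ?thesis by (simp add: LIMSEQ_const_iff)
qed

lemma integral_by_parts:
  fixes f \<phi> :: "'a::euclidean_space \<Rightarrow> real"
  assumes f: "C_k (Suc k) f" and \<phi>: "C1c \<phi>" and b: "b \<in> Basis"
  shows "(LINT x|lborel. f x * pd b \<phi> x) = - (LINT x|lborel. pd b f x * \<phi> x)"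
proof -
  have f1: "C_k (Suc 0) f" by (rule C_k_mono[OF f]) simp
  have \<phi>1: "C_k (Suc 0) \<phi>" using \<phi> unfolding C1c_def by (simp del: C_k.simps)
  have "C1c (\<lambda>x. f x * \<phi> x)" using C_k_mult[OF f1 \<phi>1] \<phi> unfolding C1c_def One_nat_def by (auto intro: bsupp_mult simp del: C_k.simps)
  from integral_pd_0[OF this b] have "(LINT x|lborel. f x * pd b \<phi> x + pd b f x * \<phi> x) = 0"
    unfolding pd_mult[OF f1 \<phi>1] .
  moreover have "integrable lborel (\<lambda>x. f x * pd b \<phi> x)" "integrable lborel (\<lambda>x. pd b f x * \<phi> x)"
    using C_k_cont[OF f] C1c_cont[OF \<phi>] C_k1_pd_cont[OF f b] b
    by (intro cc_integrable continuous_intros bsupp_mult C1c_bsupp[OF \<phi>]; simp)+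
  ultimately show ?thesis by simp
qed

section \<open>Square integrable functions and mollification\<close>

definition loc :: "('a::euclidean_space \<Rightarrow> real) \<Rightarrow> bool" where
  "loc f \<longleftrightarrow> f \<in> borel_measurable borel \<and> (\<forall>r. integrable lborel (\<lambda>y. indicator (ball 0 r) y * f y))"

lemma loc_integrable:
  assumes f: "loc f" and \<phi>: "continuous_on UNIV \<phi>" "bsupp \<phi>"
  shows "integrable lborel (\<lambda>x. f x * \<phi> x)"
proof -
  obtain r where r: "r > 0" "\<And>x. norm x \<ge> r \<Longrightarrow> \<phi> x = 0" using \<phi>(2) by (rule bsuppE) blast
  obtain M where M: "M > 0" "\<And>x. \<bar>\<phi> x\<bar> \<le> M" using cc_bounded[OF \<phi>] by blast
  have [measurable]: "f \<in> borel_measurable borel" "\<phi> \<in> borel_measurable borel"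
    using f \<phi>(1) by (auto simp: loc_def intro: borel_measurable_continuous_onI)
  have "integrable lborel (\<lambda>x. M * (indicator (ball 0 r) x * f x))"
    using f unfolding loc_def by (intro integrable_mult_right) auto
  then show ?thesis
  proof (rule Bochner_Integration.integrable_bound)
    show "AE x in lborel. norm (f x * \<phi> x) \<le> norm (M * (indicator (ball 0 r) x * f x))"
    proof (rule AE_I2)
      fix x show "norm (f x * \<phi> x) \<le> norm (M * (indicator (ball 0 r) x * f x))"
        using M r(2)[of x] by (cases "norm x < r") (auto simp: abs_mult mult.commute intro!: mult_right_mono)
    qed
  qed simp
qed

text \<open>The working version of \<open>L2\<close>: Borel functions and \<open>lborel\<close>
  instead of \<open>lebesgue\<close>. The exchange of representatives happens once, at the end of
  the development.\<close>

definition sq :: "('a::euclidean_space \<Rightarrow> real) \<Rightarrow> bool" where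
  "sq f \<longleftrightarrow> f \<in> borel_measurable borel \<and> integrable lborel (\<lambda>x. (f x)\<^sup>2)"

text \<open>The square of the \<open>L^2\<close> norm, so that the triangle inequality appears below
  as \<open>n2_add_le\<close>, with factors 2.\<close>

definition n2 :: "('a::euclidean_space \<Rightarrow> real) \<Rightarrow> real" where
  "n2 f = (LINT x|lborel. (f x)\<^sup>2)"

lemma sq_borel[measurable_dest]: "sq f \<Longrightarrow> f \<in> borel_measurable borel" by (simp add: sq_def)

lemma n2_nonneg: "0 \<le> n2 f" by (simp add: n2_def)

lemma sq_le:
  assumes "sq w" "f \<in> borel_measurable borel" "AE x in lborel. \<bar>f x\<bar> \<le> \<bar>w x\<bar>"
  shows "sq f"
  unfolding sq_def
proof
  have [measurable]: "f \<in> borel_measurable borel" by fact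
  show "integrable lborel (\<lambda>x. (f x)\<^sup>2)"
    by (rule Bochner_Integration.integrable_bound[of _ "\<lambda>x. (w x)\<^sup>2"])
       (use assms(1,3) in \<open>simp_all add: sq_def abs_le_square_iff\<close>)
qed fact

lemma sq_mult_integrable:
  assumes "sq f" "sq g" shows "integrable lborel (\<lambda>x. f x * g x)"
proof (rule Bochner_Integration.integrable_bound[of _ "\<lambda>x. (f x)\<^sup>2 + (g x)\<^sup>2"])
  have "\<bar>a * b\<bar> \<le> a\<^sup>2 + b\<^sup>2" for a b :: real
  proof -
    have "2 * (\<bar>a\<bar> * \<bar>b\<bar>) \<le> a\<^sup>2 + b\<^sup>2" using sum_squares_bound[of "\<bar>a\<bar>" "\<bar>b\<bar>"] by (simp add: mult.assoc)
    moreover have "0 \<le> \<bar>a\<bar> * \<bar>b\<bar>" by simp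
    ultimately show ?thesis unfolding abs_mult by linarith
  qed
  then show "AE x in lborel. norm (f x * g x) \<le> norm ((f x)\<^sup>2 + (g x)\<^sup>2)" by simp
qed (use assms in \<open>auto simp: sq_def\<close>)

lemma sq_cmult: "sq f \<Longrightarrow> sq (\<lambda>x. c * f x)"
  by (auto simp: sq_def power_mult_distrib)

lemma sq_add: "sq f \<Longrightarrow> sq g \<Longrightarrow> sq (\<lambda>x. f x + g x)"
  using sq_mult_integrable[of f g] by (auto simp: sq_def power2_sum mult.assoc)

lemma sq_diff: "sq f \<Longrightarrow> sq g \<Longrightarrow> sq (\<lambda>x. f x - g x)"
  using sq_add[OF _ sq_cmult[of g "-1"], of f] by simp

lemma sq_abs: "sq f \<Longrightarrow> sq (\<lambda>x. \<bar>f x\<bar>)" by (auto simp: sq_def)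

lemma sq_bdd_mult:
  assumes "sq f" "m \<in> borel_measurable borel" "\<And>x. \<bar>m x\<bar> \<le> M"
  shows "sq (\<lambda>x. m x * f x)"
proof (rule sq_le[OF sq_cmult[OF assms(1), of M]])
  have [measurable]: "f \<in> borel_measurable borel" "m \<in> borel_measurable borel" using assms by (auto simp: sq_def)
  show "(\<lambda>x. m x * f x) \<in> borel_measurable borel" by simp
  show "AE x in lborel. \<bar>m x * f x\<bar> \<le> \<bar>M * f x\<bar>"
  proof (rule AE_I2)
    fix x have "\<bar>m x\<bar> \<le> \<bar>M\<bar>" using assms(3)[of x] by linarith
    then show "\<bar>m x * f x\<bar> \<le> \<bar>M * f x\<bar>" by (auto simp: abs_mult intro: mult_right_mono)
  qed
qed

lemma sq_cc: "continuous_on UNIV f \<Longrightarrow> bsupp f \<Longrightarrow> sq f"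
  unfolding sq_def
  by (intro conjI borel_measurable_continuous_onI cc_integrable continuous_intros bsupp_compose0[where G="\<lambda>x. x\<^sup>2"]) auto

lemma sq_loc: "sq f \<Longrightarrow> loc f"
  unfolding loc_def
proof (intro conjI allI)
  fix r assume f: "sq f"
  show "integrable lborel (\<lambda>y. indicator (ball 0 r) y * f y)"
  proof (rule sq_mult_integrable[OF _ f])
    show "sq (indicator (ball 0 r))"
      unfolding sq_def by (auto simp: power2_eq_square indicator_inter_arith[symmetric] intro!: integrable_real_indicator emeasure_bounded_finite borel_measurable_indicator)
  qed
qed (simp add: sq_def)

lemma n2_add_le:
  assumes "sq f" "sq g" shows "n2 (\<lambda>x. f x + g x) \<le> 2 * n2 f + 2 * n2 g"
proof -
  have "n2 (\<lambda>x. f x + g x) \<le> (LINT x|lborel. 2 * (f x)\<^sup>2 + 2 * (g x)\<^sup>2)"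
    unfolding n2_def
  proof (rule integral_mono)
    show "(f x + g x)\<^sup>2 \<le> 2 * (f x)\<^sup>2 + 2 * (g x)\<^sup>2" for x
      using zero_le_power2[of "f x - g x"] by (simp add: power2_sum power2_diff)
  qed (use assms sq_add[OF assms] in \<open>auto simp: sq_def\<close>)
  also have "\<dots> = 2 * n2 f + 2 * n2 g" using assms by (simp add: n2_def sq_def)
  finally show ?thesis .
qed

lemma n2_cmult: "n2 (\<lambda>x. c * f x) = c\<^sup>2 * n2 f"
  by (simp add: n2_def power_mult_distrib)

lemma n2_mono:
  assumes "sq w" "f \<in> borel_measurable borel" "AE x in lborel. \<bar>f x\<bar> \<le> \<bar>w x\<bar>"
  shows "n2 f \<le> n2 w"
  unfolding n2_def
proof (rule integral_mono_AE)
  show "AE x in lborel. (f x)\<^sup>2 \<le> (w x)\<^sup>2" using assms(3) by (simp add: abs_le_square_iff)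
qed (use sq_le[OF assms] assms(1) in \<open>auto simp: sq_def\<close>)

text \<open>The quadratic polynomial \<open>t \<mapsto> n2 (t f + g)\<close> is nonnegative, hence
  its discriminant is not positive.\<close>

lemma sq_CS:
  assumes "sq f" "sq g"
  shows "\<bar>LINT x|lborel. f x * g x\<bar> \<le> sqrt (n2 f) * sqrt (n2 g)"
proof -
  define A B I where "A = n2 f" "B = n2 g" "I = (LINT x|lborel. f x * g x)"
  have q: "0 \<le> t\<^sup>2 * A + 2 * t * I + B" for t
  proof -
    have "n2 (\<lambda>x. t * f x + g x) = (LINT x|lborel. t\<^sup>2 * (f x)\<^sup>2 + 2 * t * (f x * g x) + (g x)\<^sup>2)"
      unfolding n2_def by (simp add: power2_sum power_mult_distrib ac_simps)
    also have "\<dots> = t\<^sup>2 * A + 2 * t * I + B"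
      using assms sq_mult_integrable[OF assms] by (simp add: A_B_I_def n2_def sq_def)
    finally show ?thesis using n2_nonneg by metis
  qed
  have "I\<^sup>2 \<le> A * B"
  proof (cases "A = 0")
    case True
    have "I = 0"
    proof (rule ccontr)
      assume "I \<noteq> 0"
      \<comment> \<open>With \<open>A = 0\<close> the polynomial is linear in \<open>t\<close>, and
        this \<open>t\<close> gives it the value -1.\<close>
      then show False using q[of "- (B + 1) / (2 * I)"] True by (simp add: field_simps)
    qed
    then show ?thesis using True by simp
  next
    case False
    then have "A > 0" using n2_nonneg[of f] by (simp add: A_B_I_def)
    then show ?thesis using q[of "- I / A"] by (simp add: field_simps power2_eq_square)
  qed
  then have "sqrt (I\<^sup>2) \<le> sqrt (A * B)" by (rule real_sqrt_le_mono)
  then show ?thesis by (simp add: real_sqrt_mult A_B_I_def)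
qed

section \<open>Convergence in \<open>L^2\<close>\<close>

definition l2lim :: "(nat \<Rightarrow> 'a::euclidean_space \<Rightarrow> real) \<Rightarrow> ('a \<Rightarrow> real) \<Rightarrow> bool" where
  "l2lim f g \<longleftrightarrow> (\<forall>n. sq (f n)) \<and> sq g \<and> (\<lambda>n. n2 (\<lambda>x. f n x - g x)) \<longlonglongrightarrow> 0"

lemma l2lim_sq: "l2lim f g \<Longrightarrow> sq (f n)" "l2lim f g \<Longrightarrow> sq g" by (auto simp: l2lim_def)

lemma l2limI:
  assumes "\<And>n. sq (f n)" "sq g" "\<And>n. n2 (\<lambda>x. f n x - g x) \<le> e n" "e \<longlonglongrightarrow> 0"
  shows "l2lim f g"
  unfolding l2lim_def using assms(1,2)
  by (auto intro: tendsto_sandwich[OF _ _ tendsto_const assms(4)] simp: n2_nonneg assms(3))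

lemma l2lim_add:
  assumes "l2lim f g" "l2lim f' g'"
  shows "l2lim (\<lambda>n x. f n x + f' n x) (\<lambda>x. g x + g' x)"
proof (rule l2limI)
  show "n2 (\<lambda>x. f n x + f' n x - (g x + g' x)) \<le> 2 * n2 (\<lambda>x. f n x - g x) + 2 * n2 (\<lambda>x. f' n x - g' x)" for n
    using n2_add_le[OF sq_diff sq_diff, of "f n" g "f' n" g'] l2lim_sq[OF assms(1)] l2lim_sq[OF assms(2)]
    by (simp add: algebra_simps)
  show "(\<lambda>n. 2 * n2 (\<lambda>x. f n x - g x) + 2 * n2 (\<lambda>x. f' n x - g' x)) \<longlonglongrightarrow> 0"
    using assms unfolding l2lim_def by (auto intro!: tendsto_eq_intros)
qed (use l2lim_sq[OF assms(1)] l2lim_sq[OF assms(2)] in \<open>auto intro: sq_add\<close>)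

lemma l2lim_bdd_mult:
  assumes "l2lim f g" and m: "m \<in> borel_measurable borel" "\<And>x. \<bar>m x\<bar> \<le> M"
  shows "l2lim (\<lambda>n x. m x * f n x) (\<lambda>x. m x * g x)"
proof (rule l2limI)
  note s = l2lim_sq[OF assms(1)]
  have [measurable]: "f n \<in> borel_measurable borel" "g \<in> borel_measurable borel" for n using s by (auto simp: sq_def)
  note [measurable] = m(1)
  show "n2 (\<lambda>x. m x * f n x - m x * g x) \<le> M\<^sup>2 * n2 (\<lambda>x. f n x - g x)" for n
    unfolding n2_cmult[symmetric]
  proof (rule n2_mono)
    show "AE x in lborel. \<bar>m x * f n x - m x * g x\<bar> \<le> \<bar>M * (f n x - g x)\<bar>"
    proof (rule AE_I2)
      fix x have "\<bar>m x\<bar> \<le> \<bar>M\<bar>" using m(2)[of x] by linarith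
      then have "\<bar>m x * (f n x - g x)\<bar> \<le> \<bar>M * (f n x - g x)\<bar>" unfolding abs_mult by (rule mult_right_mono) simp
      then show "\<bar>m x * f n x - m x * g x\<bar> \<le> \<bar>M * (f n x - g x)\<bar>" by (simp add: right_diff_distrib)
    qed
  qed (use sq_cmult[OF sq_diff[OF s]] in simp_all)
  show "(\<lambda>n. M\<^sup>2 * n2 (\<lambda>x. f n x - g x)) \<longlonglongrightarrow> 0"
    using assms unfolding l2lim_def by (auto intro!: tendsto_eq_intros)
qed (use l2lim_sq[OF assms(1)] m in \<open>auto intro: sq_bdd_mult\<close>)

lemma l2lim_const: "sq g \<Longrightarrow> l2lim (\<lambda>n. g) g" by (simp add: l2lim_def n2_def)

lemma l2lim_dct:
  assumes f: "\<And>n. f n \<in> borel_measurable borel" "g \<in> borel_measurable borel" and w: "sq w"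
    and b: "\<And>n. AE x in lborel. \<bar>f n x\<bar> \<le> w x" and l: "AE x in lborel. (\<lambda>n. f n x) \<longlonglongrightarrow> g x"
  shows "l2lim f g"
proof -
  note [measurable] = f sq_borel[OF w]
  have ab: "AE x in lborel. \<forall>n. \<bar>f n x\<bar> \<le> w x" using b by (simp add: AE_all_countable)
  have gb: "AE x in lborel. \<bar>g x\<bar> \<le> w x"
    using ab l by eventually_elim (auto intro: tendsto_upperbound[OF tendsto_rabs])
  have s: "sq (f n)" for n
    using b[of n] by (intro sq_le[OF w f(1)]) (auto elim!: eventually_mono intro: order_trans)
  have s': "sq g"
    using gb by (intro sq_le[OF w f(2)]) (auto elim!: eventually_mono intro: order_trans)
  have "(\<lambda>n. LINT x|lborel. (f n x - g x)\<^sup>2) \<longlonglongrightarrow> (LINT x|(lborel::'a measure). 0)"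
  proof (rule integral_dominated_convergence[where w="\<lambda>x. (2 * w x)\<^sup>2"])
    show "integrable lborel (\<lambda>x. (2 * w x)\<^sup>2)" using sq_cmult[OF w, of 2] by (simp add: sq_def)
    show "AE x in lborel. (\<lambda>n. (f n x - g x)\<^sup>2) \<longlonglongrightarrow> 0"
      using l by eventually_elim (auto intro!: tendsto_eq_intros)
    show "AE x in lborel. norm ((f n x - g x)\<^sup>2) \<le> (2 * w x)\<^sup>2" for n
      using ab gb
    proof eventually_elim
      case (elim x)
      then have "\<bar>f n x\<bar> \<le> w x" by blast
      then have "\<bar>f n x - g x\<bar> \<le> \<bar>2 * w x\<bar>" using elim by linarith
      then show ?case using abs_le_square_iff[of "f n x - g x" "2 * w x"] by simp
    qed
  qed auto
  then show ?thesis unfolding l2lim_def n2_def using s s' by simp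
qed

lemma l2lim_subseq: "l2lim f g \<Longrightarrow> strict_mono r \<Longrightarrow> l2lim (\<lambda>n. f (r n)) g"
  unfolding l2lim_def using LIMSEQ_subseq_LIMSEQ[of "\<lambda>n. n2 (\<lambda>x. f n x - g x)" 0 r] by (simp add: o_def)

lemma l2lim_AE:
  assumes "l2lim f g"
  obtains r :: "nat \<Rightarrow> nat" where "strict_mono r" "AE x in lborel. (\<lambda>n. f (r n) x) \<longlonglongrightarrow> g x"
proof -
  have "\<exists>r::nat\<Rightarrow>nat. strict_mono r \<and> (AE x in lborel. (\<lambda>n. (f (r n) x - g x)\<^sup>2) \<longlonglongrightarrow> 0)"
  proof (rule tendsto_L1_AE_subseq)
    show "integrable lborel (\<lambda>x. (f n x - g x)\<^sup>2)" for n
      using sq_diff[OF l2lim_sq[OF assms]] by (simp add: sq_def)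
    show "(\<lambda>n. LINT x|lborel. norm ((f n x - g x)\<^sup>2)) \<longlonglongrightarrow> 0"
      using assms unfolding l2lim_def n2_def by simp
  qed
  then obtain r :: "nat \<Rightarrow> nat" where r: "strict_mono r" "AE x in lborel. (\<lambda>n. (f (r n) x - g x)\<^sup>2) \<longlonglongrightarrow> 0" by blast
  have "AE x in lborel. (\<lambda>n. f (r n) x) \<longlonglongrightarrow> g x"
    using r(2)
  proof eventually_elim
    case (elim x)
    have "(\<lambda>n. sqrt ((f (r n) x - g x)\<^sup>2)) \<longlonglongrightarrow> sqrt 0" by (intro tendsto_real_sqrt elim)
    then have "(\<lambda>n. f (r n) x - g x) \<longlonglongrightarrow> 0" by (simp add: tendsto_rabs_zero_iff)
    then show ?case by (rule LIM_zero_cancel)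
  qed
  with r(1) that show ?thesis by blast
qed

text \<open>Write \<open>m_n f_n - m' g\<close> as \<open>m_n (f_n - g) + (m_n - m') g\<close>: the
  first part is small by the uniform bound on the multipliers, the second by dominated convergence.
  This is the limit passage behind the density theorem, the chain rule and Pohozaev's
  identity.\<close>

lemma l2lim_bdd_seq:
  assumes "l2lim f g" and m: "\<And>n. m n \<in> borel_measurable borel" "\<And>n x. \<bar>m n x\<bar> \<le> M" "m' \<in> borel_measurable borel"
    and l: "AE x in lborel. (\<lambda>n. m n x) \<longlonglongrightarrow> m' x"
  shows "l2lim (\<lambda>n x. m n x * f n x) (\<lambda>x. m' x * g x)"
proof -
  note s = l2lim_sq[OF assms(1)]
  note [measurable] = m(1,3) sq_borel[OF s(1)] sq_borel[OF s(2)]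
  have 1: "l2lim (\<lambda>n x. m n x * g x) (\<lambda>x. m' x * g x)"
  proof (rule l2lim_dct[where w="\<lambda>x. M * \<bar>g x\<bar>"])
    show "sq (\<lambda>x. M * \<bar>g x\<bar>)" by (intro sq_cmult sq_abs s)
    show "AE x in lborel. \<bar>m n x * g x\<bar> \<le> M * \<bar>g x\<bar>" for n
      using m(2) by (auto simp: abs_mult intro!: mult_right_mono)
    show "AE x in lborel. (\<lambda>n. m n x * g x) \<longlonglongrightarrow> m' x * g x"
      using l by eventually_elim (auto intro!: tendsto_intros)
  qed auto
  have 2: "l2lim (\<lambda>n x. m n x * (f n x - g x)) (\<lambda>x. 0)"
  proof (rule l2limI)
    show "sq (\<lambda>x. m n x * (f n x - g x))" for n by (intro sq_bdd_mult[of _ _ M] sq_diff s m)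
    show "n2 (\<lambda>x. m n x * (f n x - g x) - 0) \<le> M\<^sup>2 * n2 (\<lambda>x. f n x - g x)" for n
      unfolding n2_cmult[symmetric]
    proof (rule n2_mono)
      show "AE x in lborel. \<bar>m n x * (f n x - g x) - 0\<bar> \<le> \<bar>M * (f n x - g x)\<bar>"
      proof (rule AE_I2)
        fix x have "\<bar>m n x\<bar> \<le> \<bar>M\<bar>" using m(2)[of n x] by linarith
        then have "\<bar>m n x * (f n x - g x)\<bar> \<le> \<bar>M * (f n x - g x)\<bar>" unfolding abs_mult by (rule mult_right_mono) simp
        then show "\<bar>m n x * (f n x - g x) - 0\<bar> \<le> \<bar>M * (f n x - g x)\<bar>" by simp
      qed
    qed (use sq_cmult[OF sq_diff[OF s]] in simp_all)
    show "(\<lambda>n. M\<^sup>2 * n2 (\<lambda>x. f n x - g x)) \<longlonglongrightarrow> 0"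
      using assms unfolding l2lim_def by (auto intro!: tendsto_eq_intros)
  qed (simp add: sq_def)
  from l2lim_add[OF 2 1] show ?thesis by (simp add: algebra_simps)
qed

text \<open>The product is expanded around the limits into three terms, each of which Cauchy-Schwarz
  bounds by a quantity tending to 0.\<close>

lemma l2lim_integral:
  assumes f: "l2lim f g" and f': "l2lim f' g'"
  shows "(\<lambda>n. LINT x|lborel. f n x * f' n x) \<longlonglongrightarrow> (LINT x|lborel. g x * g' x)"
proof -
  note s = l2lim_sq[OF f] l2lim_sq[OF f']
  define a b where "a n = n2 (\<lambda>x. f n x - g x)" "b n = n2 (\<lambda>x. f' n x - g' x)" for n
  have a: "a \<longlonglongrightarrow> 0" "b \<longlonglongrightarrow> 0" using f f' unfolding l2lim_def a_b_def by auto
  have "norm ((LINT x|lborel. f n x * f' n x) - (LINT x|lborel. g x * g' x)) \<le>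
      sqrt (a n) * sqrt (b n) + sqrt (a n) * sqrt (n2 g') + sqrt (n2 g) * sqrt (b n)" for n
  proof -
    have 1: "f n x * f' n x - g x * g' x = (f n x - g x) * (f' n x - g' x) + (f n x - g x) * g' x + g x * (f' n x - g' x)" for x
      by (simp add: algebra_simps)
    have "(LINT x|lborel. f n x * f' n x) - (LINT x|lborel. g x * g' x)
       = (LINT x|lborel. f n x * f' n x - g x * g' x)"
      by (intro Bochner_Integration.integral_diff[symmetric] sq_mult_integrable s)
    also have "\<dots> = (LINT x|lborel. (f n x - g x) * (f' n x - g' x)) + (LINT x|lborel. (f n x - g x) * g' x)
        + (LINT x|lborel. g x * (f' n x - g' x))"
    proof -
      have "integrable lborel (\<lambda>x. (f n x - g x) * (f' n x - g' x))" "integrable lborel (\<lambda>x. (f n x - g x) * g' x)"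
        "integrable lborel (\<lambda>x. g x * (f' n x - g' x))"
        by (intro sq_mult_integrable s sq_diff)+
      then show ?thesis unfolding 1 by simp
    qed
    finally show ?thesis
      using sq_CS[OF sq_diff[OF s(1,2)] sq_diff[OF s(3,4)], of n n]
        sq_CS[OF sq_diff[OF s(1,2)] s(4), of n] sq_CS[OF s(2) sq_diff[OF s(3,4)], of n]
      unfolding a_b_def real_norm_def by linarith
  qed
  moreover have "(\<lambda>n. sqrt (a n) * sqrt (b n) + sqrt (a n) * sqrt (n2 g') + sqrt (n2 g) * sqrt (b n)) \<longlonglongrightarrow> 0"
    by (rule tendsto_eq_intros refl a tendsto_real_sqrt | simp)+
  ultimately have "(\<lambda>n. (LINT x|lborel. f n x * f' n x) - (LINT x|lborel. g x * g' x)) \<longlonglongrightarrow> 0"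
    by (rule Lim_null_comparison[OF always_eventually, OF allI])
  then show ?thesis by (rule LIM_zero_cancel)
qed

lemma l2lim_integral_l:
  "l2lim f g \<Longrightarrow> sq h \<Longrightarrow> (\<lambda>n. LINT x|lborel. f n x * h x) \<longlonglongrightarrow> (LINT x|lborel. g x * h x)"
  using l2lim_integral[OF _ l2lim_const] .

lemma l2lim_n2: "l2lim f g \<Longrightarrow> (\<lambda>n. n2 (f n)) \<longlonglongrightarrow> n2 g"
  using l2lim_integral[of f g f g] by (simp add: n2_def power2_eq_square)

text \<open>Lebesgue measurability supplies continuous functions converging almost everywhere, but
  with no domination. Clipping the values at height \<open>k\<close> and cutting off at a radius of
  about \<open>k\<close> provides it, and both operations preserve continuity.\<close>

lemma sq_dense_cc:
  assumes f: "sq f" and e: "e > 0"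
  obtains c where "continuous_on UNIV c" "bsupp c" "n2 (\<lambda>x. f x - c x) < e"
proof -
  have [measurable]: "f \<in> borel_measurable borel" using f by (simp add: sq_def)
  define clip where "clip k t = max (- real k) (min (real k) t)" for k t
  define cut where "cut k x = max 0 (min 1 (real k + 1 - norm x))" for k and x :: 'a
  have clb: "\<bar>clip k t\<bar> \<le> real k" "\<bar>clip k t\<bar> \<le> \<bar>t\<bar>" for k t by (auto simp: clip_def)
  have clc: "continuous_on UNIV (clip k)" for k unfolding clip_def by (intro continuous_intros)
  have clm[measurable]: "clip k \<in> borel_measurable borel" for k by (rule borel_measurable_continuous_onI[OF clc])
  have cub: "0 \<le> cut k x" "cut k x \<le> 1" for k x by (auto simp: cut_def)
  have cuc: "continuous_on UNIV (cut k)" for k unfolding cut_def by (intro continuous_intros)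
  have cum[measurable]: "cut k \<in> borel_measurable borel" for k by (rule borel_measurable_continuous_onI[OF cuc])
  have cus: "bsupp (cut k)" for k unfolding bsupp_def cut_def by (intro exI[of _ "real k + 1"]) auto
  have "f \<in> borel_measurable lebesgue" by (intro measurable_completion) simp
  then have "f measurable_on UNIV" by (simp add: measurable_on_UNIV lebesgue_measurable_imp_measurable_on)
  then obtain N g where N: "negligible N" and gc: "\<And>n. continuous_on UNIV (g n)"
    and gl: "\<And>x. x \<notin> N \<Longrightarrow> (\<lambda>n. g n x) \<longlonglongrightarrow> f x"
    unfolding measurable_on_def by auto
  have AEN: "AE x in lborel. x \<notin> N"
    using AE_not_in[OF N[unfolded negligible_iff_null_sets]] unfolding AE_completion_iff .
  have gm[measurable]: "g n \<in> borel_measurable borel" for n by (rule borel_measurable_continuous_onI[OF gc])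
  have 1: "l2lim (\<lambda>k x. clip k (f x) * cut k x) f"
  proof (rule l2lim_dct[where w="\<lambda>x. \<bar>f x\<bar>"])
    show "AE x in lborel. \<bar>clip n (f x) * cut n x\<bar> \<le> \<bar>f x\<bar>" for n
    proof (rule AE_I2)
      fix x show "\<bar>clip n (f x) * cut n x\<bar> \<le> \<bar>f x\<bar>"
        using mult_mono[OF clb(2)[of n "f x"] cub(2)[of n x]] cub(1)[of n x] by (simp add: abs_mult)
    qed
    show "AE x in lborel. (\<lambda>n. clip n (f x) * cut n x) \<longlonglongrightarrow> f x"
    proof (rule AE_I2, rule tendsto_eventually)
      fix x
      obtain m where m: "real m \<ge> norm x + \<bar>f x\<bar>" using real_arch_simple by blast
      have "clip n (f x) * cut n x = f x" if "n \<ge> m" for n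
      proof -
        have "real n \<ge> norm x + \<bar>f x\<bar>" using m that by linarith
        then have "\<bar>f x\<bar> \<le> real n" "norm x \<le> real n" using norm_ge_zero[of x] abs_ge_zero[of "f x"] by linarith+
        then have "clip n (f x) = f x" "cut n x = 1"
          unfolding clip_def cut_def by (auto simp: min_def max_def)
        then show ?thesis by simp
      qed
      then show "\<forall>\<^sub>F n in sequentially. clip n (f x) * cut n x = f x"
        unfolding eventually_sequentially by blast
    qed
  qed (use f in \<open>auto intro: sq_abs\<close>)
  \<comment> \<open>Each of the two errors is doubled by \<open>n2_add_le\<close>, hence the quarter
    of \<open>e\<close>.\<close>
  then have "\<forall>\<^sub>F k in sequentially. n2 (\<lambda>x. clip k (f x) * cut k x - f x) < e / 4"
    unfolding l2lim_def using e by (intro order_tendstoD(2)[of _ 0]) auto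
  then obtain k where k: "n2 (\<lambda>x. clip k (f x) * cut k x - f x) < e / 4"
    unfolding eventually_sequentially by blast
  have cc: "continuous_on UNIV (\<lambda>x. clip k (g n x) * cut k x)" "bsupp (\<lambda>x. clip k (g n x) * cut k x)" for n
    by (auto intro!: continuous_intros continuous_on_compose2[OF clc[of k] gc[of n]] cuc bsupp_mult cus)
  have 2: "l2lim (\<lambda>n x. clip k (g n x) * cut k x) (\<lambda>x. clip k (f x) * cut k x)"
  proof (rule l2lim_dct[where w="\<lambda>x. real k * cut k x"])
    show "sq (\<lambda>x. real k * cut k x)" by (intro sq_cmult sq_cc cuc cus)
    show "AE x in lborel. \<bar>clip k (g n x) * cut k x\<bar> \<le> real k * cut k x" for n
      by (rule AE_I2) (use cub clb in \<open>auto simp: abs_mult intro!: mult_right_mono\<close>)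
    show "AE x in lborel. (\<lambda>n. clip k (g n x) * cut k x) \<longlonglongrightarrow> clip k (f x) * cut k x"
      using AEN by eventually_elim
       (auto intro!: tendsto_mult tendsto_const continuous_on_tendsto_compose[OF clc[of k]] gl)
  qed auto
  then have "\<forall>\<^sub>F n in sequentially. n2 (\<lambda>x. clip k (g n x) * cut k x - clip k (f x) * cut k x) < e / 4"
    unfolding l2lim_def using e by (intro order_tendstoD(2)[of _ 0]) auto
  then obtain n where n: "n2 (\<lambda>x. clip k (g n x) * cut k x - clip k (f x) * cut k x) < e / 4"
    unfolding eventually_sequentially by blast
  have "n2 (\<lambda>x. - (clip k (g n x) * cut k x - clip k (f x) * cut k x) + - (clip k (f x) * cut k x - f x))
     \<le> 2 * n2 (\<lambda>x. - (clip k (g n x) * cut k x - clip k (f x) * cut k x)) + 2 * n2 (\<lambda>x. - (clip k (f x) * cut k x - f x))"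
    using sq_cmult[OF sq_diff[OF l2lim_sq[OF 1]], of "-1" k] sq_cmult[OF sq_diff[OF l2lim_sq[OF 2]], of "-1" n]
    by (intro n2_add_le) auto
  also have "\<dots> < e" using n k n2_cmult[of "-1" "\<lambda>x. clip k (g n x) * cut k x - clip k (f x) * cut k x"]
       n2_cmult[of "-1" "\<lambda>x. clip k (f x) * cut k x - f x"] by simp
  finally have "n2 (\<lambda>x. f x - clip k (g n x) * cut k x) < e" by (simp add: algebra_simps)
  then show ?thesis using that cc by blast
qed

section \<open>Convolution and mollification\<close>

definition conv :: "('a::euclidean_space \<Rightarrow> real) \<Rightarrow> ('a \<Rightarrow> real) \<Rightarrow> 'a \<Rightarrow> real" where
  "conv \<rho> f x = (LINT y|lborel. f y * \<rho> (x - y))"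

lemma test_cont: "test_function \<phi> \<Longrightarrow> continuous_on S \<phi>"
  using test_C1c C1c_cont by blast

lemma test_bsupp: "test_function \<phi> \<Longrightarrow> bsupp \<phi>"
  by (simp add: test_iff)

lemma test_borel: "test_function \<phi> \<Longrightarrow> \<phi> \<in> borel_measurable borel"
  by (rule borel_measurable_continuous_onI[OF test_cont])

lemma test_Ck: "test_function \<phi> \<Longrightarrow> C_k k \<phi>"
  by (simp add: test_iff del: C_k.simps)

lemma test_loc_integrable: "loc f \<Longrightarrow> test_function \<phi> \<Longrightarrow> integrable lborel (\<lambda>x. f x * \<phi> x)"
  by (intro loc_integrable test_cont test_bsupp)

lemma conv_integrable: "loc f \<Longrightarrow> test_function \<rho> \<Longrightarrow> integrable lborel (\<lambda>y. f y * \<rho> (x - y))"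
  by (rule test_loc_integrable[OF _ test_reflect])

lemma test_taylor2:
  fixes \<rho> :: "'a::euclidean_space \<Rightarrow> real"
  assumes \<rho>: "test_function \<rho>"
  obtains C where "C > 0" "\<And>z h. \<bar>\<rho> (z + h) - \<rho> z - (\<Sum>b\<in>Basis. (h \<bullet> b) * pd b \<rho> z)\<bar> \<le> C * (norm h)\<^sup>2"
proof -
  have "\<exists>L>0. \<forall>x h. \<bar>pd b \<rho> (x + h) - pd b \<rho> x\<bar> \<le> L * norm h" if "b \<in> Basis" for b
    using C1c_lipschitz[OF test_C1c[OF test_pd[OF \<rho> that]]] by metis
  then obtain L where L: "\<And>b. b \<in> Basis \<Longrightarrow> L b > 0 \<and> (\<forall>x h. \<bar>pd b \<rho> (x + h) - pd b \<rho> x\<bar> \<le> L b * norm h)"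
    by metis
  have "\<bar>\<rho> (z + h) - \<rho> z - (\<Sum>b\<in>Basis. (h \<bullet> b) * pd b \<rho> z)\<bar> \<le> sum L Basis * (norm h)\<^sup>2" for z h
  proof -
    obtain t where t: "0 < t" "t < 1" "\<rho> (z + h) - \<rho> z = (\<Sum>b\<in>Basis. (h \<bullet> b) * pd b \<rho> (z + t *\<^sub>R h))"
      using C1_mvt[OF test_Ck[OF \<rho>]] by metis
    have "\<rho> (z + h) - \<rho> z - (\<Sum>b\<in>Basis. (h \<bullet> b) * pd b \<rho> z)
       = (\<Sum>b\<in>Basis. (h \<bullet> b) * (pd b \<rho> (z + t *\<^sub>R h) - pd b \<rho> z))"
      unfolding t by (simp add: sum_subtractf[symmetric] right_diff_distrib)
    also have "\<bar>\<dots>\<bar> \<le> (\<Sum>b\<in>Basis. norm h * (L b * norm h))"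
    proof (rule order_trans[OF sum_abs], rule sum_mono)
      fix b :: 'a assume b: "b \<in> Basis"
      have "\<bar>pd b \<rho> (z + t *\<^sub>R h) - pd b \<rho> z\<bar> \<le> L b * norm (t *\<^sub>R h)" using L[OF b] by blast
      also have "\<dots> \<le> L b * norm h"
        using t L[OF b] by (intro mult_left_mono) (auto simp: mult_left_le_one_le)
      finally show "\<bar>(h \<bullet> b) * (pd b \<rho> (z + t *\<^sub>R h) - pd b \<rho> z)\<bar> \<le> norm h * (L b * norm h)"
        unfolding abs_mult by (intro mult_mono) (auto simp: Basis_le_norm b)
    qed
    finally show ?thesis by (simp add: sum_distrib_left sum_distrib_right power2_eq_square mult_ac)
  qed
  moreover have "sum L Basis > 0" using L by (intro sum_pos) auto
  ultimately show ?thesis using that by blast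
qed

text \<open>The kernel is uniformly within \<open>C |h|^2\<close> of its linearisation, and for
  \<open>|h| \<le> 1\<close> the error lives on a ball of fixed radius, where \<open>f\<close> is
  integrable. The remainder of the convolution is therefore at most
  \<open>C K |h|^2\<close>.\<close>

lemma conv_deriv:
  fixes \<rho> f :: "'a::euclidean_space \<Rightarrow> real"
  assumes f: "loc f" and \<rho>: "test_function \<rho>"
  shows "(conv \<rho> f has_derivative (\<lambda>h. \<Sum>b\<in>Basis. (h \<bullet> b) * conv (pd b \<rho>) f x)) (at x)"
proof -
  obtain C where C: "C > 0" "\<And>z h. \<bar>\<rho> (z + h) - \<rho> z - (\<Sum>b\<in>Basis. (h \<bullet> b) * pd b \<rho> z)\<bar> \<le> C * (norm h)\<^sup>2"
    using test_taylor2[OF \<rho>] by blast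
  obtain r where r: "r > 0" "\<And>x. norm x \<ge> r \<Longrightarrow> \<rho> x = 0" using test_bsupp[OF \<rho>] by (rule bsuppE) blast
  \<comment> \<open>Outside this ball \<open>x - z\<close> has norm at least \<open>r + 2\<close>:
    the derivatives of the kernel vanish at this point, and the kernel vanishes even after a shift
    of length at most 1.\<close>
  define R where "R = norm x + r + 2"
  define K where "K = (LINT y|lborel. \<bar>indicator (ball 0 R) y * f y\<bar>)"
  have fi: "integrable lborel (\<lambda>y. indicator (ball 0 R) y * f y)" using f unfolding loc_def by blast
  have [measurable]: "f \<in> borel_measurable borel" using f by (simp add: loc_def)
  let ?D = "\<lambda>h. \<Sum>b\<in>Basis. (h \<bullet> b) * conv (pd b \<rho>) f x"
  have key: "\<bar>conv \<rho> f y - conv \<rho> f x - ?D (y - x)\<bar> \<le> C * (norm (y - x))\<^sup>2 * K" if y: "norm (y - x) \<le> 1" for y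
  proof -
    define h where "h = y - x"
    have yx: "y = x + h" by (simp add: h_def)
    define G where "G z = \<rho> (x - z + h) - \<rho> (x - z) - (\<Sum>b\<in>Basis. (h \<bullet> b) * pd b \<rho> (x - z))" for z
    have i: "integrable lborel (\<lambda>z. f z * \<rho> (x + h - z))"
      by (rule conv_integrable[OF f \<rho>])
    have ib: "integrable lborel (\<lambda>z. (h \<bullet> b) * (f z * pd b \<rho> (x - z)))" if "b \<in> Basis" for b
      by (intro integrable_mult_right conv_integrable f test_pd[OF \<rho> that])
    have e: "f z * G z = f z * \<rho> (x + h - z) - f z * \<rho> (x - z) - (\<Sum>b\<in>Basis. (h \<bullet> b) * (f z * pd b \<rho> (x - z)))" for z
      by (simp add: G_def algebra_simps sum_distrib_left)
    have "(LINT z|lborel. f z * G z) = conv \<rho> f y - conv \<rho> f x - ?D h"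
      unfolding e conv_def yx using i ib conv_integrable[OF f \<rho>, of x] by simp
    moreover have "norm (LINT z|lborel. f z * G z) \<le> (LINT z|lborel. C * (norm h)\<^sup>2 * \<bar>indicator (ball 0 R) z * f z\<bar>)"
    proof (rule Bochner_Integration.integral_norm_bound_integral)
      show "integrable lborel (\<lambda>z. f z * G z)" unfolding e
        by (intro Bochner_Integration.integrable_diff i ib Bochner_Integration.integrable_sum conv_integrable f \<rho>)
      show "integrable lborel (\<lambda>z. C * (norm h)\<^sup>2 * \<bar>indicator (ball 0 R) z * f z\<bar>)"
        using fi by (intro integrable_mult_right integrable_abs)
      fix z
      show "norm (f z * G z) \<le> C * (norm h)\<^sup>2 * \<bar>indicator (ball 0 R) z * f z\<bar>"
      proof (cases "norm z < R")
        case True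
        then show ?thesis using C(2)[of "x - z" h]
          by (simp add: G_def abs_mult mult.commute[of "\<bar>f z\<bar>"] mult_right_mono)
      next
        case False
        have 1: "norm (x - z) \<ge> r + 2" using False norm_triangle_ineq2[of z x] by (simp add: R_def norm_minus_commute)
        have nh: "norm h \<le> 1" using y by (simp add: h_def)
        have 2: "norm (x - z + h) \<ge> r" using 1 nh norm_triangle_ineq2[of "x - z" "-h"] by simp
        have "pd b \<rho> (x - z) = 0" for b
        proof -
          have "((\<lambda>x. 0) has_derivative (\<lambda>h. 0::real)) (at (x - z))" by simp
          then have "(\<rho> has_derivative (\<lambda>h. 0)) (at (x - z))"
          proof (rule has_derivative_transform_within_open[of _ _ _ _ "- cball 0 r"])
            show "x - z \<in> - cball 0 r" using 1 by simp
          qed (use r in \<open>auto simp: not_le\<close>)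
          from pd_eq[OF this] show ?thesis .
        qed
        then have "G z = 0" using 1 2 r(2) by (simp add: G_def)
        then show ?thesis using False by simp
      qed
    qed
    ultimately show ?thesis using fi by (simp add: h_def K_def)
  qed
  have "K \<ge> 0" by (simp add: K_def)
  show ?thesis
  proof (rule has_derivativeI_sandwich[of 1 _ _ _ _ "\<lambda>y. C * K * norm (y - x)"])
    show "bounded_linear ?D"
      by (intro bounded_linear_sum bounded_linear_mult_left[THEN bounded_linear_compose] bounded_linear_inner_left)
    show "((\<lambda>y. C * K * norm (y - x)) \<longlongrightarrow> 0) (at x)"
      by (auto intro!: tendsto_eq_intros)
    fix y assume "y \<noteq> x" "dist y x < 1"
    then have "norm (y - x) > 0" "norm (y - x) \<le> 1" by (auto simp: dist_norm)
    with key[OF this(2)] show "norm (conv \<rho> f y - conv \<rho> f x - ?D (y - x)) / norm (y - x) \<le> C * K * norm (y - x)"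
      by (simp add: divide_le_eq power2_eq_square mult_ac)
  qed simp
qed

lemma conv_Ck: "loc f \<Longrightarrow> test_function \<rho> \<Longrightarrow> C_k k (conv \<rho> f)"
proof (induction k arbitrary: \<rho>)
  case 0
  then show ?case
    using differentiableI[OF conv_deriv[OF 0]]
    by (auto intro!: differentiable_imp_continuous_on differentiable_at_imp_differentiable_on)
next
  case (Suc k)
  show ?case
  proof (rule C_k_SucI[OF conv_deriv[OF Suc.prems]])
    fix b :: 'a assume b: "b \<in> Basis"
    have "(\<Sum>c\<in>Basis. (b \<bullet> c) * conv (pd c \<rho>) f x) = (\<Sum>c\<in>Basis. if c = b then conv (pd b \<rho>) f x else 0)" for x
      by (rule sum.cong) (use b in \<open>auto simp: inner_Basis\<close>)
    then have "(\<Sum>c\<in>Basis. (b \<bullet> c) * conv (pd c \<rho>) f x) = conv (pd b \<rho>) f x" for x using b by simp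
    then show "C_k k (\<lambda>x. \<Sum>c\<in>Basis. (b \<bullet> c) * conv (pd c \<rho>) f x)"
      using Suc.IH[OF Suc.prems(1) test_pd[OF Suc.prems(2) b]] by simp
  qed
qed

lemma pd_conv:
  assumes "loc f" "test_function \<rho>" "b \<in> Basis"
  shows "pd b (conv \<rho> f) x = conv (pd b \<rho>) f x"
proof -
  have "(\<Sum>c\<in>Basis. (b \<bullet> c) * conv (pd c \<rho>) f x) = (\<Sum>c\<in>Basis. if c = b then conv (pd b \<rho>) f x else 0)"
    by (rule sum.cong) (use assms in \<open>auto simp: inner_Basis\<close>)
  then show ?thesis using pd_eq[OF conv_deriv[OF assms(1,2)], of b x] assms(3) by simp
qed

section \<open>Weak derivatives\<close>

text \<open>One direction at a time and without any integrability, which \<open>loc\<close> or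
  \<open>sq\<close> supply where it is needed.\<close>

definition wd :: "'a::euclidean_space \<Rightarrow> ('a \<Rightarrow> real) \<Rightarrow> ('a \<Rightarrow> real) \<Rightarrow> bool" where
  "wd b u g \<longleftrightarrow> (\<forall>\<phi>. test_function \<phi> \<longrightarrow> (LINT x|lborel. u x * pd b \<phi> x) = - (LINT x|lborel. g x * \<phi> x))"

lemma wdD: "wd b u g \<Longrightarrow> test_function \<phi> \<Longrightarrow> (LINT x|lborel. u x * pd b \<phi> x) = - (LINT x|lborel. g x * \<phi> x)"
  by (simp add: wd_def)

text \<open>The reflected kernel \<open>\<lambda>y. \<rho> (x - y)\<close> is itself a test
  function, and the reflection supplies the sign that the weak derivative costs.\<close>

lemma wd_conv:
  assumes "loc u" "wd b u g" "test_function \<rho>" "b \<in> Basis"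
  shows "pd b (conv \<rho> u) x = conv \<rho> g x"
proof -
  have "conv (pd b \<rho>) u x = - (LINT y|lborel. u y * pd b (\<lambda>y. \<rho> (x - y)) y)"
    unfolding conv_def test_pd_reflect[OF assms(3)] by simp
  also have "\<dots> = conv \<rho> g x" unfolding wdD[OF assms(2) test_reflect[OF assms(3)]] conv_def by simp
  finally show ?thesis using pd_conv[OF assms(1,3,4)] by simp
qed

lemma lborel_integral_reflect:
  fixes f :: "'a::euclidean_space \<Rightarrow> real"
  assumes [measurable]: "f \<in> borel_measurable borel"
  shows "(LINT y|lborel. f (x - y)) = (LINT y|lborel. f y)"
proof -
  have "lborel = distr lborel borel (\<lambda>y. x - y)"
    using lborel_affine[of "-1" x] by (simp add: density_1)
  then have "(LINT y|lborel. f y) = (LINT y|distr lborel borel (\<lambda>y. x - y). f y)" by simp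
  also have "\<dots> = (LINT y|lborel. f (x - y))" by (subst integral_distr) auto
  finally show ?thesis by simp
qed

definition mollifier :: "('a::euclidean_space \<Rightarrow> real) \<Rightarrow> bool" where
  "mollifier \<rho> \<longleftrightarrow> test_function \<rho> \<and> (\<forall>x. 0 \<le> \<rho> x) \<and> (LINT x|lborel. \<rho> x) = 1"

text \<open>Since the kernel is a probability density, Cauchy-Schwarz with weight
  \<open>\<rho> (x - y)\<close> gives \<open>(conv \<rho> f x)^2 \<le> conv \<rho> (f^2) x\<close>,
  and integrating in \<open>x\<close> by Fubini removes the kernel.\<close>

lemma conv_young:
  assumes f: "sq f" and \<rho>: "mollifier \<rho>"
  shows "sq (conv \<rho> f)" "n2 (conv \<rho> f) \<le> n2 f"
proof -
  have t: "test_function \<rho>" and p: "\<And>x. 0 \<le> \<rho> x" and one: "(LINT x|lborel. \<rho> x) = 1"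
    using \<rho> by (auto simp: mollifier_def)
  have [measurable]: "f \<in> borel_measurable borel" "\<rho> \<in> borel_measurable borel"
    using f test_borel[OF t] by (auto simp: sq_def)
  have cm[measurable]: "conv \<rho> f \<in> borel_measurable borel"
    by (rule borel_measurable_continuous_onI[OF C_k_cont[OF conv_Ck[OF sq_loc[OF f] t]]])
  have loc2: "loc (\<lambda>y. (f y)\<^sup>2)" unfolding loc_def
    using f integrable_mult_indicator[of "ball 0 r" lborel "\<lambda>y. (f y)\<^sup>2" for r] unfolding sq_def by auto
  have r1: "integrable lborel (\<lambda>y. \<rho> (x - y))" for x
    using test_reflect[OF t] by (intro cc_integrable test_cont test_bsupp)
  have one': "(LINT y|lborel. \<rho> (x - y)) = 1" for x using one by (simp add: lborel_integral_reflect)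
  have pt: "(conv \<rho> f x)\<^sup>2 \<le> (LINT y|lborel. (f y)\<^sup>2 * \<rho> (x - y))" for x
  proof -
    have s1: "sq (\<lambda>y. f y * sqrt (\<rho> (x - y)))"
      unfolding sq_def using conv_integrable[OF loc2 t] p by (simp add: power_mult_distrib)
    have s2: "sq (\<lambda>y. sqrt (\<rho> (x - y)))" unfolding sq_def using r1 p by simp
    have e: "conv \<rho> f x = (LINT y|lborel. (f y * sqrt (\<rho> (x - y))) * sqrt (\<rho> (x - y)))"
      unfolding conv_def by (simp add: mult.assoc p)
    have "\<bar>conv \<rho> f x\<bar> \<le> sqrt (n2 (\<lambda>y. f y * sqrt (\<rho> (x - y)))) * sqrt (n2 (\<lambda>y. sqrt (\<rho> (x - y))))"
      unfolding e by (rule sq_CS[OF s1 s2])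
    also have "n2 (\<lambda>y. sqrt (\<rho> (x - y))) = 1" unfolding n2_def using one' p by simp
    finally have "\<bar>conv \<rho> f x\<bar>\<^sup>2 \<le> (sqrt (n2 (\<lambda>y. f y * sqrt (\<rho> (x - y)))))\<^sup>2" by (intro power_mono) auto
    then show ?thesis using n2_nonneg by (simp add: n2_def power_mult_distrib p)
  qed
  have "(\<integral>\<^sup>+x. ennreal ((conv \<rho> f x)\<^sup>2) \<partial>lborel) \<le> (\<integral>\<^sup>+x. \<integral>\<^sup>+y. ennreal ((f y)\<^sup>2 * \<rho> (x - y)) \<partial>lborel \<partial>lborel)"
  proof (rule nn_integral_mono)
    fix x
    have "(\<integral>\<^sup>+y. ennreal ((f y)\<^sup>2 * \<rho> (x - y)) \<partial>lborel) = ennreal (LINT y|lborel. (f y)\<^sup>2 * \<rho> (x - y))"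
      by (rule nn_integral_eq_integral[OF conv_integrable[OF loc2 t]]) (simp add: p)
    then show "ennreal ((conv \<rho> f x)\<^sup>2) \<le> (\<integral>\<^sup>+y. ennreal ((f y)\<^sup>2 * \<rho> (x - y)) \<partial>lborel)"
      using pt by (simp add: ennreal_leI)
  qed
  also have "\<dots> = (\<integral>\<^sup>+y. \<integral>\<^sup>+x. ennreal ((f y)\<^sup>2 * \<rho> (x - y)) \<partial>lborel \<partial>lborel)"
    by (rule lborel_pair.Fubini'[symmetric]) measurable
  also have "\<dots> = (\<integral>\<^sup>+y. ennreal ((f y)\<^sup>2) \<partial>lborel)"
  proof (rule nn_integral_cong)
    fix y
    have i: "integrable lborel (\<lambda>x. \<rho> (x - y))"
      using C_k_cont[OF C_k_affine[OF test_Ck[OF t], of _ "-y" 1]] bsupp_shift[OF test_bsupp[OF t], of "-y"]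
      by (intro cc_integrable) simp_all
    have "(LINT x|lborel. \<rho> (x - y)) = 1" using one lborel_integral_shift[of \<rho> "-y"] by simp
    then have "(\<integral>\<^sup>+x. ennreal (\<rho> (x - y)) \<partial>lborel) = 1"
      using nn_integral_eq_integral[OF i] p by simp
    then show "(\<integral>\<^sup>+x. ennreal ((f y)\<^sup>2 * \<rho> (x - y)) \<partial>lborel) = ennreal ((f y)\<^sup>2)"
      using p by (simp add: ennreal_mult nn_integral_cmult)
  qed
  also have "\<dots> = ennreal (n2 f)" unfolding n2_def using f by (intro nn_integral_eq_integral) (auto simp: sq_def)
  finally have *: "(\<integral>\<^sup>+x. ennreal ((conv \<rho> f x)\<^sup>2) \<partial>lborel) \<le> ennreal (n2 f)" .
  have i: "integrable lborel (\<lambda>x. (conv \<rho> f x)\<^sup>2)"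
    by (rule integrableI_bounded) (use * in \<open>auto intro: le_less_trans\<close>)
  then show "sq (conv \<rho> f)" by (simp add: sq_def)
  have "ennreal (n2 (conv \<rho> f)) \<le> ennreal (n2 f)"
    using * nn_integral_eq_integral[OF i] by (simp add: n2_def)
  then show "n2 (conv \<rho> f) \<le> n2 f" using n2_nonneg[of f] by (simp add: ennreal_le_iff)
qed

text \<open>The kernel has radius \<open>1 / Suc n\<close>, so never more than 1; the kernel with
  index 0 also serves to build the smooth step.\<close>

definition moll :: "nat \<Rightarrow> 'a::euclidean_space \<Rightarrow> real" where
  "moll n x = bump (1 / real (Suc n)) x / (LINT x|(lborel::'a measure). bump (1 / real (Suc n)) x)"

lemma test_bump: "e > 0 \<Longrightarrow> test_function (bump e)"
  unfolding test_iff using smooth_bump bump_0 bsupp_def by blast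

lemma integral_bump_pos:
  assumes e: "e > 0" shows "(LINT x|(lborel::'a::euclidean_space measure). bump e x) > 0"
proof (rule ccontr)
  have i: "integrable lborel (bump e :: 'a \<Rightarrow> real)" by (intro cc_integrable test_cont test_bsupp test_bump e)
  assume "\<not> ?thesis"
  then have "(LINT x|(lborel::'a measure). bump e x) = 0"
    using Bochner_Integration.integral_nonneg[of "lborel :: 'a measure" "bump e", OF bump_nonneg] by (simp add: not_less)
  then have "AE x in (lborel::'a measure). bump e x = 0"
    using integral_nonneg_eq_0_iff_AE[OF i] bump_nonneg by auto
  then have "AE x in (lborel::'a measure). x \<notin> ball 0 e"
  proof eventually_elim
    case (elim x) then show ?case using bump_pos_iff[OF e, of x] by simp
  qed
  then have "emeasure lborel (ball (0::'a) e) = 0"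
    using AE_iff_measurable[of "ball 0 e" lborel "\<lambda>x::'a. x \<notin> ball 0 e"] by (auto simp: set_eq_iff)
  then have "measure lborel (ball (0::'a) e) = 0" by (simp add: measure_def)
  moreover have "measure lborel (ball (0::'a) e) > 0" using content_ball_pos[OF e, of "0::'a"] by simp
  ultimately show False by simp
qed

lemma moll_mollifier: "mollifier (moll n)"
  unfolding mollifier_def
proof (intro conjI allI)
  have p: "1 / real (Suc n) > 0" by simp
  show "test_function (moll n :: 'a \<Rightarrow> real)"
    using test_cmult[OF test_bump[OF p], of "inverse (LINT x|(lborel::'a measure). bump (1 / real (Suc n)) x)"]
    unfolding moll_def by (simp add: divide_inverse mult.commute)
  show "0 \<le> moll n x" for x :: 'a
    unfolding moll_def by (intro divide_nonneg_nonneg bump_nonneg Bochner_Integration.integral_nonneg)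
  show "(LINT x|(lborel::'a measure). moll n x) = 1"
    unfolding moll_def using integral_bump_pos[OF p, where 'a='a] by simp
qed

lemma moll_0: "1 / real (Suc n) \<le> norm x \<Longrightarrow> moll n x = 0"
  unfolding moll_def by (subst bump_0) auto

lemma conv_diff: "loc f \<Longrightarrow> loc g \<Longrightarrow> test_function \<rho> \<Longrightarrow> conv \<rho> (\<lambda>x. f x - g x) x = conv \<rho> f x - conv \<rho> g x"
  unfolding conv_def left_diff_distrib by (intro Bochner_Integration.integral_diff conv_integrable)

lemma conv_cc_tendsto:
  fixes c :: "'a::euclidean_space \<Rightarrow> real"
  assumes c: "loc c" "isCont c x"
  shows "(\<lambda>n. conv (moll n) c x) \<longlonglongrightarrow> c x"
proof (rule LIMSEQ_I)
  fix e :: real assume e: "e > 0"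
  obtain d where d: "d > 0" "\<And>y. norm (y - x) < d \<Longrightarrow> \<bar>c y - c x\<bar> < e / 2"
    using c(2) e unfolding continuous_at_eps_delta dist_norm real_norm_def by (metis half_gt_zero)
  obtain N where N: "1 / real (Suc N) < d" using d(1) nat_approx_posE by blast
  have "norm (conv (moll n) c x - c x) < e" if n: "n \<ge> N" for n
  proof -
    have nd: "1 / real (Suc n) < d" using N n by (smt (verit) frac_le of_nat_0_less_iff of_nat_mono Suc_le_mono zero_less_Suc)
    have t: "test_function (moll n :: 'a \<Rightarrow> real)" and p: "\<And>x. 0 \<le> moll n (x::'a)" and one: "(LINT x|lborel. moll n (x::'a)) = 1"
      using moll_mollifier[of n, where 'a='a] by (auto simp: mollifier_def)
    have tr: "integrable lborel (\<lambda>y. k * moll n (x - y))" for k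
      using test_reflect[OF t] by (intro integrable_mult_right cc_integrable test_cont test_bsupp)
    have one': "(LINT y|lborel. moll n (x - y)) = 1" using one test_borel[OF t] by (simp add: lborel_integral_reflect)
    have "conv (moll n) c x - c x = (LINT y|lborel. c y * moll n (x - y) - c x * moll n (x - y))"
      using conv_integrable[OF c(1) t] tr one' by (simp add: conv_def)
    also have "norm \<dots> \<le> (LINT y|lborel. e / 2 * moll n (x - y))"
    proof (rule Bochner_Integration.integral_norm_bound_integral)
      fix y
      show "norm (c y * moll n (x - y) - c x * moll n (x - y)) \<le> e / 2 * moll n (x - y)"
      proof (cases "norm (y - x) < d")
        case True
        then have "\<bar>c y - c x\<bar> * moll n (x - y) \<le> e / 2 * moll n (x - y)"
          using d(2)[OF True] p[of "x - y"] by (intro mult_right_mono) auto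
        then show ?thesis using p[of "x - y"] unfolding left_diff_distrib[symmetric]
          by (simp add: abs_mult)
      next
        case False
        then have "moll n (x - y) = 0" using nd by (intro moll_0) (simp add: norm_minus_commute)
        then show ?thesis by simp
      qed
    qed (use conv_integrable[OF c(1) t] tr in auto)
    also have "\<dots> = e / 2" using one' by simp
    finally show ?thesis using e by simp
  qed
  then show "\<exists>N. \<forall>n\<ge>N. norm (conv (moll n) c x - c x) < e" by blast
qed

lemma cc_loc:
  fixes c :: "'a::euclidean_space \<Rightarrow> real"
  shows "continuous_on UNIV c \<Longrightarrow> bsupp c \<Longrightarrow> loc c" by (intro sq_loc sq_cc)

lemma conv_cc_bound:
  assumes c: "loc c" "\<And>x. \<bar>c x\<bar> \<le> M" and \<rho>: "mollifier \<rho>"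
  shows "\<bar>conv \<rho> c x\<bar> \<le> M"
proof -
  have t: "test_function \<rho>" and p: "\<And>x. 0 \<le> \<rho> x" and one: "(LINT x|lborel. \<rho> x) = 1"
    using \<rho> by (auto simp: mollifier_def)
  have "norm (conv \<rho> c x) \<le> (LINT y|lborel. M * \<rho> (x - y))"
    unfolding conv_def
  proof (rule Bochner_Integration.integral_norm_bound_integral)
    show "integrable lborel (\<lambda>y. M * \<rho> (x - y))"
      using test_reflect[OF t] by (intro integrable_mult_right cc_integrable test_cont test_bsupp)
  qed (use conv_integrable[OF c(1) t] c(2) p in \<open>auto simp: abs_mult intro!: mult_right_mono\<close>)
  also have "\<dots> = M" using one test_borel[OF t] by (simp add: lborel_integral_reflect)
  finally show ?thesis by simp
qed

lemma l2lim_conv_cc: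
  fixes c :: "'a::euclidean_space \<Rightarrow> real"
  assumes c: "continuous_on UNIV c" "bsupp c"
  shows "l2lim (\<lambda>n. conv (moll n) c) c"
proof -
  obtain r where r: "r > 0" "\<And>x. norm x \<ge> r \<Longrightarrow> c x = 0" using c(2) by (rule bsuppE) blast
  obtain M where M: "M > 0" "\<And>x. \<bar>c x\<bar> \<le> M" using cc_bounded[OF c] by blast
  have t: "test_function (moll n :: 'a \<Rightarrow> real)" for n using moll_mollifier by (auto simp: mollifier_def)
  have lc: "loc c" by (rule cc_loc[OF c])
  show ?thesis
  proof (rule l2lim_dct[where w="\<lambda>x. M * indicator (ball 0 (r+1)) x"])
    show "conv (moll n) c \<in> borel_measurable borel" for n
      by (rule borel_measurable_continuous_onI[OF C_k_cont[OF conv_Ck[OF lc t]]])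
    show "c \<in> borel_measurable borel" using c by (intro borel_measurable_continuous_onI)
    show "sq (\<lambda>x. M * indicator (ball 0 (r + 1)) x)"
      by (rule sq_cmult, unfold sq_def) (auto simp: power2_eq_square indicator_inter_arith[symmetric]
          intro!: integrable_real_indicator emeasure_bounded_finite borel_measurable_indicator)
    show "AE x in lborel. \<bar>conv (moll n) c x\<bar> \<le> M * indicator (ball 0 (r + 1)) x" for n
    proof (rule AE_I2)
      fix x
      show "\<bar>conv (moll n) c x\<bar> \<le> M * indicator (ball 0 (r + 1)) x"
      proof (cases "norm x < r + 1")
        case True then show ?thesis using conv_cc_bound[OF lc M(2) moll_mollifier] by simp
      next
        case False
        have "c y * moll n (x - y) = 0" for y
        proof (cases "norm y \<ge> r")
          case False
          have "norm (x - y) \<ge> 1" using False \<open>\<not> norm x < r + 1\<close> norm_triangle_ineq2[of x y] by simp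
          then have "1 / real (Suc n) \<le> norm (x - y)" by (rule order_trans[rotated]) simp
          then show ?thesis by (simp add: moll_0)
        qed (simp add: r)
        then have "conv (moll n) c x = (LINT y|(lborel::'a measure). 0)"
          unfolding conv_def by (intro Bochner_Integration.integral_cong refl)
        then show ?thesis using False by simp
      qed
    qed
    show "AE x in lborel. (\<lambda>n. conv (moll n) c x) \<longlonglongrightarrow> c x"
      using c(1) by (intro AE_I2 conv_cc_tendsto lc) (simp add: continuous_on_eq_continuous_at)
  qed
qed

text \<open>Convergence is known for continuous functions of bounded support. It extends to all
  square integrable functions by density, because by \<open>conv_young\<close> mollification does
  not increase the norm of the error.\<close>

lemma l2lim_conv:
  fixes f :: "'a::euclidean_space \<Rightarrow> real"
  assumes f: "sq f"
  shows "l2lim (\<lambda>n. conv (moll n) f) f"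
  unfolding l2lim_def
proof (intro conjI allI)
  show "sq (conv (moll n) f)" for n by (rule conv_young[OF f moll_mollifier])
  show "(\<lambda>n. n2 (\<lambda>x. conv (moll n) f x - f x)) \<longlonglongrightarrow> 0"
  proof (rule LIMSEQ_I)
    fix e :: real assume e: "e > 0"
    \<comment> \<open>The three errors enter with weights 2, 4 and 4, and ten twelfths are less than
      one.\<close>
    obtain c where c: "continuous_on UNIV c" "bsupp c" "n2 (\<lambda>x. f x - c x) < e / 12"
      using sq_dense_cc[OF f, of "e/12"] e by auto
    have t: "test_function (moll n :: 'a \<Rightarrow> real)" for n using moll_mollifier by (auto simp: mollifier_def)
    have sc: "sq c" using c by (intro sq_cc)
    have lc: "l2lim (\<lambda>n. conv (moll n) c) c" by (rule l2lim_conv_cc[OF c(1,2)])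
    then obtain N where N: "\<And>n. n \<ge> N \<Longrightarrow> n2 (\<lambda>x. conv (moll n) c x - c x) < e / 12"
      using e order_tendstoD(2)[of "\<lambda>n. n2 (\<lambda>x. conv (moll n) c x - c x)" 0 sequentially "e/12"]
      unfolding l2lim_def eventually_sequentially by auto
    have "norm (n2 (\<lambda>x. conv (moll n) f x - f x) - 0) < e" if n: "n \<ge> N" for n
    proof -
      have e1: "(\<lambda>x. conv (moll n) f x - f x) = (\<lambda>x. conv (moll n) (\<lambda>x. f x - c x) x + ((conv (moll n) c x - c x) + -1 * (f x - c x)))"
        using conv_diff[OF sq_loc[OF f] sq_loc[OF sc] t] by auto
      have s1: "sq (conv (moll n) (\<lambda>x. f x - c x))" "n2 (conv (moll n) (\<lambda>x. f x - c x)) \<le> n2 (\<lambda>x. f x - c x)"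
        using conv_young[OF sq_diff[OF f sc] moll_mollifier] by auto
      have s2: "sq (\<lambda>x. conv (moll n) c x - c x)" by (intro sq_diff l2lim_sq[OF lc] sc)
      have s3: "sq (\<lambda>x. -1 * (f x - c x))" by (intro sq_cmult sq_diff f sc)
      have "n2 (\<lambda>x. conv (moll n) f x - f x) \<le> 2 * n2 (conv (moll n) (\<lambda>x. f x - c x))
          + 2 * n2 (\<lambda>x. (conv (moll n) c x - c x) + -1 * (f x - c x))"
        unfolding e1 by (rule n2_add_le[OF s1(1) sq_add[OF s2 s3]])
      also have "\<dots> \<le> 2 * n2 (conv (moll n) (\<lambda>x. f x - c x))
          + 2 * (2 * n2 (\<lambda>x. conv (moll n) c x - c x) + 2 * n2 (\<lambda>x. -1 * (f x - c x)))"
        by (intro add_left_mono mult_left_mono n2_add_le[OF s2 s3]) simp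
      also have "\<dots> < e"
      proof -
        have "n2 (\<lambda>x. -1 * (f x - c x)) = n2 (\<lambda>x. f x - c x)" using n2_cmult[of "-1" "\<lambda>x. f x - c x"] by simp
        moreover have "2 * x + 2 * (2 * y + 2 * z') < e" if "z' = z" "x \<le> z" "y < e / 12" "z < e / 12" for x y z z' :: real
          using that e by argo
        ultimately show ?thesis using s1(2) N[OF n] c(3) by blast
      qed
      finally show ?thesis using n2_nonneg[of "\<lambda>x. conv (moll n) f x - f x"] by simp
    qed
    then show "\<exists>N. \<forall>n\<ge>N. norm (n2 (\<lambda>x. conv (moll n) f x - f x) - 0) < e" by blast
  qed
qed (rule f)

section \<open>Smooth cutoff functions\<close>

lemma smooth_step_exists:
  obtains \<theta> :: "real \<Rightarrow> real" and C :: real where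
    "smooth \<theta>" "\<And>t. 0 \<le> \<theta> t" "\<And>t. \<theta> t \<le> 1" "\<And>t. t \<le> 1 \<Longrightarrow> \<theta> t = 1" "\<And>t. t \<ge> 4 \<Longrightarrow> \<theta> t = 0"
    "C > 0" "\<And>t. \<bar>pd 1 \<theta> t\<bar> \<le> C" "\<And>t. t < 1 \<Longrightarrow> pd 1 \<theta> t = 0" "\<And>t. t > 4 \<Longrightarrow> pd 1 \<theta> t = 0"
proof -
  \<comment> \<open>The midpoint 5/2 is farther than the kernel radius 1 from both thresholds 1 and
    4. These are the squares of 1 and 2: the step is applied to \<open>(norm x / R)^2\<close> and
    should drop from 1 to 0 between the radii \<open>R\<close> and \<open>2 * R\<close>.\<close>
  define i where "i = (indicator {..5/2} :: real \<Rightarrow> real)"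
  define \<theta> where "\<theta> = conv (moll 0) i"
  have t: "test_function (moll 0 :: real \<Rightarrow> real)" and p: "\<And>x::real. 0 \<le> moll 0 x" and one: "(LINT x|lborel. moll 0 (x::real)) = 1"
    using moll_mollifier[of 0, where 'a=real] by (auto simp: mollifier_def)
  have loc: "loc i" unfolding loc_def i_def
    by (auto simp: indicator_inter_arith[symmetric] intro!: integrable_real_indicator emeasure_bounded_finite borel_measurable_indicator)
  have s: "smooth \<theta>" unfolding \<theta>_def using conv_Ck[OF loc t] by blast
  have nn: "0 \<le> \<theta> x" for x unfolding \<theta>_def conv_def i_def by (intro Bochner_Integration.integral_nonneg) (simp add: p)
  have "\<bar>\<theta> x\<bar> \<le> 1" for x unfolding \<theta>_def by (rule conv_cc_bound[OF loc _ moll_mollifier]) (simp add: i_def indicator_def)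
  then have le1: "\<theta> x \<le> 1" for x by (simp add: abs_le_iff)
  have one': "\<theta> x = 1" if "x \<le> 1" for x
  proof -
    have "i y * moll 0 (x - y) = moll 0 (x - y)" for y
      using moll_0[of 0 "x - y"] that by (cases "y \<le> 5/2") (auto simp: i_def indicator_def)
    then have "\<theta> x = (LINT y|lborel. moll 0 (x - y))" unfolding \<theta>_def conv_def by (simp only:)
    then show ?thesis using one test_borel[OF t] by (simp add: lborel_integral_reflect)
  qed
  have zero: "\<theta> x = 0" if "x \<ge> 4" for x
  proof -
    have "i y * moll 0 (x - y) = 0" for y
      using moll_0[of 0 "x - y"] that by (cases "y \<le> 5/2") (auto simp: i_def indicator_def)
    then show ?thesis unfolding \<theta>_def conv_def by (subst Bochner_Integration.integral_cong[where g="\<lambda>_. 0"]) auto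
  qed
  have d1: "pd 1 \<theta> x = 0" if "x < 1" for x
  proof (rule real_pd_eq, rule has_field_derivative_transform_within_open[where S="{..<1}"])
    show "((\<lambda>_. 1) has_real_derivative 0) (at x)" by simp
  qed (use that one' in auto)
  have d4: "pd 1 \<theta> x = 0" if "x > 4" for x
  proof (rule real_pd_eq, rule has_field_derivative_transform_within_open[where S="{4<..}"])
    show "((\<lambda>_. 0) has_real_derivative 0) (at x)" by simp
  qed (use that zero in auto)
  have "continuous_on UNIV (pd 1 \<theta>)" using s C_k1_pd_cont[of 0 \<theta> 1] by simp
  moreover have "bsupp (pd 1 \<theta>)" unfolding bsupp_def
  proof (intro exI allI impI)
    fix x :: real assume "norm x \<ge> 5" then show "pd 1 \<theta> x = 0" using d1[of x] d4[of x] by (cases "x > 0") auto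
  qed
  ultimately obtain C where "C > 0" "\<And>x. \<bar>pd 1 \<theta> x\<bar> \<le> C" using cc_bounded by blast
  then show ?thesis using that[OF s nn le1 one' zero _ _ d1 d4] by blast
qed

lemma pd_norm_sq: "b \<in> Basis \<Longrightarrow> pd b (\<lambda>x. (norm x)\<^sup>2) x = 2 * (x \<bullet> b)"
  unfolding power2_norm_eq_inner
  by (rule trans[OF pd_eq[where f'="\<lambda>h. 2 * (x \<bullet> h)"]]) (auto intro!: derivative_eq_intros simp: inner_commute)

text \<open>Composing the step with \<open>|x|^2 / R^2\<close> avoids the singularity of the norm at
  the origin. On the ball of radius \<open>2 * R\<close> the chain rule gives derivatives of size at
  most \<open>C (2 * 2R) / R^2\<close>, which is where the factor 4 comes from.\<close>

lemma cutoff_exists: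
  obtains \<eta> :: "real \<Rightarrow> 'a::euclidean_space \<Rightarrow> real" and C :: real where
    "\<And>R. R > 0 \<Longrightarrow> test_function (\<eta> R)" "\<And>R x. 0 \<le> \<eta> R x" "\<And>R x. \<eta> R x \<le> 1"
    "\<And>R x. R > 0 \<Longrightarrow> norm x \<le> R \<Longrightarrow> \<eta> R x = 1" "\<And>R x. R > 0 \<Longrightarrow> norm x \<ge> 2 * R \<Longrightarrow> \<eta> R x = 0"
    "C > 0" "\<And>R x b. R > 0 \<Longrightarrow> b \<in> Basis \<Longrightarrow> \<bar>pd b (\<eta> R) x\<bar> \<le> C / R"
    "\<And>R x b. R > 0 \<Longrightarrow> b \<in> Basis \<Longrightarrow> norm x < R \<or> norm x > 2 * R \<Longrightarrow> pd b (\<eta> R) x = 0"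
proof -
  obtain \<theta> :: "real \<Rightarrow> real" and C where \<theta>:
    "smooth \<theta>" "\<And>t. 0 \<le> \<theta> t" "\<And>t. \<theta> t \<le> 1" "\<And>t. t \<le> 1 \<Longrightarrow> \<theta> t = 1" "\<And>t. t \<ge> 4 \<Longrightarrow> \<theta> t = 0"
    "C > 0" "\<And>t. \<bar>pd 1 \<theta> t\<bar> \<le> C" "\<And>t. t < 1 \<Longrightarrow> pd 1 \<theta> t = 0" "\<And>t. t > 4 \<Longrightarrow> pd 1 \<theta> t = 0"
    using smooth_step_exists by blast
  define \<eta> where "\<eta> R x = \<theta> (inverse (R\<^sup>2) * (norm (x::'a))\<^sup>2)" for R x
  have le: "inverse (R\<^sup>2) * (norm x)\<^sup>2 \<le> 1 \<longleftrightarrow> norm x \<le> R" "inverse (R\<^sup>2) * (norm x)\<^sup>2 < 1 \<longleftrightarrow> norm x < R"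
    "inverse (R\<^sup>2) * (norm x)\<^sup>2 \<ge> 4 \<longleftrightarrow> norm x \<ge> 2 * R" "inverse (R\<^sup>2) * (norm x)\<^sup>2 > 4 \<longleftrightarrow> norm x > 2 * R"
    if R: "R > 0" for R and x :: 'a
  proof -
    have *: "inverse (R\<^sup>2) * (norm x)\<^sup>2 = (norm x / R)\<^sup>2" by (simp add: power_mult_distrib power_inverse divide_inverse mult.commute)
    have **: "(4::real) = 2\<^sup>2" by simp
    have p: "norm x / R \<ge> 0" using R by simp
    show "inverse (R\<^sup>2) * (norm x)\<^sup>2 \<le> 1 \<longleftrightarrow> norm x \<le> R"
      unfolding * using abs_square_le_1[of "norm x / R"] p R by (simp add: divide_le_eq)
    show "inverse (R\<^sup>2) * (norm x)\<^sup>2 < 1 \<longleftrightarrow> norm x < R"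
      unfolding * using abs_square_less_1[of "norm x / R"] p R by (simp add: divide_less_eq)
    show "inverse (R\<^sup>2) * (norm x)\<^sup>2 \<ge> 4 \<longleftrightarrow> norm x \<ge> 2 * R"
    proof -
      have "(2::real)\<^sup>2 \<le> (norm x / R)\<^sup>2 \<longleftrightarrow> 2 \<le> norm x / R"
        using power_mono[of 2 "norm x / R" 2] power2_le_imp_le[OF _ p, of 2] by auto
      then show ?thesis unfolding * ** using R by (simp add: le_divide_eq)
    qed
    have "(2::real)\<^sup>2 < (norm x / R)\<^sup>2 \<longleftrightarrow> 2 < norm x / R"
      using power_strict_mono[of 2 "norm x / R" 2] power2_less_imp_less[OF _ p, of 2] by auto
    then show "inverse (R\<^sup>2) * (norm x)\<^sup>2 > 4 \<longleftrightarrow> norm x > 2 * R"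
      unfolding * ** using R by (simp add: less_divide_eq)
  qed
  have sm: "C_k k (\<lambda>x::'a. inverse (R\<^sup>2) * (norm x)\<^sup>2)" for k R by (intro C_k_cmult C_k_norm_sq)
  have se: "C_k k (\<eta> R)" for k R unfolding \<eta>_def by (rule C_k_compose[OF \<theta>(1)[rule_format] sm])
  have pdq: "pd b (\<eta> R) x = pd 1 \<theta> (inverse (R\<^sup>2) * (norm x)\<^sup>2) * (inverse (R\<^sup>2) * (2 * (x \<bullet> b)))" if "b \<in> Basis" for b x R
    unfolding \<eta>_def pd_compose[OF sm[of "Suc 0"] C_k_real_deriv[OF \<theta>(1)[rule_format, of "Suc 0"]]]
      pd_cmult[OF C_k_norm_sq[of "Suc 0"]] pd_norm_sq[OF that] ..
  show ?thesis
  proof (rule that[of \<eta> "4 * C"])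
    show "test_function (\<eta> R)" if "R > 0" for R
      unfolding test_iff bsupp_def using se le(3)[OF that]
      by (intro conjI exI[of _ "2 * R"]) (simp_all add: \<eta>_def \<theta>(5) del: C_k.simps)
    show "pd b (\<eta> R) x = 0" if "R > 0" "b \<in> Basis" "norm x < R \<or> norm x > 2 * R" for R x b
      unfolding pdq[OF that(2)] using that(3) le(2,4)[OF that(1), of x] \<theta>(8,9) by auto
    then show "\<bar>pd b (\<eta> R) x\<bar> \<le> 4 * C / R" if "R > 0" "b \<in> Basis" for R x b
    proof (cases "norm x > 2 * R")
      case False
      have "\<bar>x \<bullet> b\<bar> \<le> 2 * R" using Basis_le_norm[OF that(2), of x] False by linarith
      then have "\<bar>pd b (\<eta> R) x\<bar> \<le> C * (inverse (R\<^sup>2) * (2 * (2 * R)))"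
        unfolding pdq[OF that(2)] abs_mult using \<theta>(6,7) by (intro mult_mono) auto
      also have "\<dots> = 4 * C / R" using that(1) by (simp add: field_simps power2_eq_square)
      finally show ?thesis .
    qed (use that \<theta>(6) in simp)
  qed (use \<theta> le in \<open>auto simp: \<eta>_def\<close>)
qed

section \<open>The space \<open>H^1\<close>: approximation by test functions and chain rules\<close>

definition W :: "('a::euclidean_space \<Rightarrow> real) \<Rightarrow> ('a \<Rightarrow> 'a \<Rightarrow> real) \<Rightarrow> bool" where
  "W u g \<longleftrightarrow> sq u \<and> (\<forall>b\<in>Basis. sq (g b) \<and> wd b u (g b))"

lemma WD: "W u g \<Longrightarrow> sq u" "W u g \<Longrightarrow> b \<in> Basis \<Longrightarrow> sq (g b)" "W u g \<Longrightarrow> b \<in> Basis \<Longrightarrow> wd b u (g b)"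
  by (auto simp: W_def)

lemma test_sq: "test_function \<phi> \<Longrightarrow> sq \<phi>" by (intro sq_cc test_cont test_bsupp)

lemma C1c_sq: "C1c \<phi> \<Longrightarrow> sq \<phi>" "C1c \<phi> \<Longrightarrow> b \<in> Basis \<Longrightarrow> sq (pd b \<phi>)"
  by (auto intro: sq_cc C1c_cont C1c_bsupp)

lemma W_C1c: "C1c \<phi> \<Longrightarrow> W \<phi> (\<lambda>b. pd b \<phi>)"
  unfolding W_def wd_def using integral_by_parts[of 0 \<phi> _ _, OF _ test_C1c]
  by (auto intro: C1c_sq simp: C1c_def simp del: C_k.simps)

lemma W_test: "test_function \<phi> \<Longrightarrow> W \<phi> (\<lambda>b. pd b \<phi>)"
  by (intro W_C1c test_C1c)

lemma W_lincomb:
  assumes "W u g" "W v k"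
  shows "W (\<lambda>x. u x + c * v x) (\<lambda>b x. g b x + c * k b x)"
  unfolding W_def wd_def
proof (intro conjI ballI allI impI)
  show "sq (\<lambda>x. u x + c * v x)" by (intro sq_add sq_cmult WD(1)[OF assms(1)] WD(1)[OF assms(2)])
  fix b :: 'a assume b: "b \<in> Basis"
  show "sq (\<lambda>x. g b x + c * k b x)" by (intro sq_add sq_cmult WD(2)[OF assms(1) b] WD(2)[OF assms(2) b])
  fix \<phi> :: "'a \<Rightarrow> real" assume \<phi>: "test_function \<phi>"
  have i: "integrable lborel (\<lambda>x. f x * \<phi> x)" "integrable lborel (\<lambda>x. f x * pd b \<phi> x)" if "sq f" for f
    by (intro sq_mult_integrable that test_sq \<phi> test_pd b)+
  show "(LINT x|lborel. (u x + c * v x) * pd b \<phi> x) = - (LINT x|lborel. (g b x + c * k b x) * \<phi> x)"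
    using wdD[OF WD(3)[OF assms(1) b] \<phi>] wdD[OF WD(3)[OF assms(2) b] \<phi>] i WD(1)[OF assms(1)] WD(1)[OF assms(2)]
      WD(2)[OF assms(1) b] WD(2)[OF assms(2) b] by (simp add: distrib_right mult.assoc)
qed

lemma W_diff: "W u g \<Longrightarrow> W v k \<Longrightarrow> W (\<lambda>x. u x - v x) (\<lambda>b x. g b x - k b x)"
  using W_lincomb[of u g v k "-1"] by simp

text \<open>Mollification followed by a cutoff at radius \<open>R n\<close>. The derivative of the
  cutoff produces an additional term, which vanishes in the limit because this derivative is bounded
  and, at each point, eventually zero.\<close>

lemma W_dense:
  assumes W: "W u g"
  obtains \<phi> where "\<And>n. test_function (\<phi> n)" "l2lim \<phi> u" "\<And>b. b \<in> Basis \<Longrightarrow> l2lim (\<lambda>n. pd b (\<phi> n)) (g b)"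
proof -
  obtain \<eta> :: "real \<Rightarrow> 'a \<Rightarrow> real" and C where \<eta>:
    "\<And>R. R > 0 \<Longrightarrow> test_function (\<eta> R)" "\<And>R x. 0 \<le> \<eta> R x" "\<And>R x. \<eta> R x \<le> 1"
    "\<And>R x. R > 0 \<Longrightarrow> norm x \<le> R \<Longrightarrow> \<eta> R x = 1" "\<And>R x. R > 0 \<Longrightarrow> norm x \<ge> 2 * R \<Longrightarrow> \<eta> R x = 0"
    "C > 0" "\<And>R x b. R > 0 \<Longrightarrow> b \<in> Basis \<Longrightarrow> \<bar>pd b (\<eta> R) x\<bar> \<le> C / R"
    "\<And>R x b. R > 0 \<Longrightarrow> b \<in> Basis \<Longrightarrow> norm x < R \<or> norm x > 2 * R \<Longrightarrow> pd b (\<eta> R) x = 0"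
    using cutoff_exists by blast
  define R where "R n = real (Suc n)" for n
  have R: "R n > 0" for n by (simp add: R_def)
  have RI: "\<forall>\<^sub>F n in sequentially. norm x < R n" for x :: 'a
  proof -
    obtain m where "norm x < real m" using reals_Archimedean2 by blast
    then have "\<forall>n\<ge>m. norm x < R n" by (auto simp: R_def)
    then show ?thesis unfolding eventually_sequentially by blast
  qed
  have t: "test_function (moll n :: 'a \<Rightarrow> real)" for n using moll_mollifier by (auto simp: mollifier_def)
  have lu: "loc u" by (rule sq_loc[OF WD(1)[OF W]])
  define \<phi> where "\<phi> n x = \<eta> (R n) x * conv (moll n) u x" for n x
  have 1: "test_function (\<phi> n)" for n unfolding \<phi>_def by (intro test_mult \<eta> R allI conv_Ck lu t)
  have 2: "l2lim \<phi> u"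
  proof -
    have "l2lim (\<lambda>n x. \<eta> (R n) x * conv (moll n) u x) (\<lambda>x. 1 * u x)"
    proof (rule l2lim_bdd_seq[OF l2lim_conv[OF WD(1)[OF W]]])
      show "\<bar>\<eta> (R n) x\<bar> \<le> 1" for n x using \<eta>(2,3) by simp
      show "AE x in lborel. (\<lambda>n. \<eta> (R n) x) \<longlonglongrightarrow> 1"
      proof (rule AE_I2)
        fix x show "(\<lambda>n. \<eta> (R n) x) \<longlonglongrightarrow> 1"
          by (rule tendsto_eventually, rule eventually_mono[OF RI[of x]]) (simp add: \<eta>(4)[OF R])
      qed
    qed (auto intro: test_borel \<eta>(1) R)
    then show ?thesis by (simp add: \<phi>_def[abs_def])
  qed
  have 3: "l2lim (\<lambda>n. pd b (\<phi> n)) (g b)" if b: "b \<in> Basis" for b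
  proof -
    have p: "pd b (\<phi> n) = (\<lambda>x. \<eta> (R n) x * conv (moll n) (g b) x + pd b (\<eta> (R n)) x * conv (moll n) u x)" for n
      unfolding \<phi>_def using pd_mult[OF test_Ck[OF \<eta>(1)[OF R]] conv_Ck[OF lu t]] wd_conv[OF lu WD(3)[OF W b] t b] by auto
    have "l2lim (\<lambda>n x. \<eta> (R n) x * conv (moll n) (g b) x) (\<lambda>x. 1 * g b x)"
    proof (rule l2lim_bdd_seq[OF l2lim_conv[OF WD(2)[OF W b]]])
      show "\<bar>\<eta> (R n) x\<bar> \<le> 1" for n x using \<eta>(2,3) by simp
      show "AE x in lborel. (\<lambda>n. \<eta> (R n) x) \<longlonglongrightarrow> 1"
      proof (rule AE_I2)
        fix x show "(\<lambda>n. \<eta> (R n) x) \<longlonglongrightarrow> 1"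
          by (rule tendsto_eventually, rule eventually_mono[OF RI[of x]]) (simp add: \<eta>(4)[OF R])
      qed
    qed (auto intro: test_borel \<eta>(1) R)
    moreover have "l2lim (\<lambda>n x. pd b (\<eta> (R n)) x * conv (moll n) u x) (\<lambda>x. 0 * u x)"
    proof (rule l2lim_bdd_seq[OF l2lim_conv[OF WD(1)[OF W]]])
      show "\<bar>pd b (\<eta> (R n)) x\<bar> \<le> C" for n x
        by (rule order_trans[OF \<eta>(7)[OF R b]]) (use \<eta>(6) in \<open>simp add: R_def divide_le_eq\<close>)
      show "AE x in lborel. (\<lambda>n. pd b (\<eta> (R n)) x) \<longlonglongrightarrow> 0"
      proof (rule AE_I2)
        fix x show "(\<lambda>n. pd b (\<eta> (R n)) x) \<longlonglongrightarrow> 0"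
          by (rule tendsto_eventually, rule eventually_mono[OF RI[of x]]) (simp add: \<eta>(8)[OF R b])
      qed
    qed (auto intro: test_borel test_pd b \<eta>(1) R)
    ultimately show ?thesis using l2lim_add by (fastforce simp: p)
  qed
  show ?thesis using that[OF 1 2 3] .
qed

lemma wd_mult:
  fixes u g :: "'a::euclidean_space \<Rightarrow> real"
  assumes wd: "wd b u g" and l: "loc u" "loc g" and \<psi>: "smooth \<psi>" and b: "b \<in> Basis"
  shows "wd b (\<lambda>x. \<psi> x * u x) (\<lambda>x. \<psi> x * g x + pd b \<psi> x * u x)"
  unfolding wd_def
proof (intro allI impI)
  fix \<phi> :: "'a \<Rightarrow> real" assume \<phi>: "test_function \<phi>"
  have sp: "smooth (pd b \<psi>)" using C_k_SucD(2) \<psi> b by blast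
  have tp: "test_function (\<lambda>x. \<phi> x * \<psi> x)" by (rule test_mult[OF \<phi> \<psi>])
  have i1: "integrable lborel (\<lambda>x. u x * (\<phi> x * pd b \<psi> x))" by (intro test_loc_integrable l test_mult \<phi> sp)
  have i2: "integrable lborel (\<lambda>x. u x * (pd b \<phi> x * \<psi> x))" by (intro test_loc_integrable l test_mult \<phi> \<psi> test_pd b)
  have i3: "integrable lborel (\<lambda>x. g x * (\<phi> x * \<psi> x))" by (intro test_loc_integrable l tp)
  have "(LINT x|lborel. u x * (\<phi> x * pd b \<psi> x) + u x * (pd b \<phi> x * \<psi> x)) = - (LINT x|lborel. g x * (\<phi> x * \<psi> x))"
    using wdD[OF wd tp] pd_mult[OF test_Ck[OF \<phi>] \<psi>[rule_format], of b] by (simp add: distrib_left)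
  then have *: "(LINT x|lborel. u x * (pd b \<phi> x * \<psi> x)) = - (LINT x|lborel. g x * (\<phi> x * \<psi> x)) - (LINT x|lborel. u x * (\<phi> x * pd b \<psi> x))"
    using i1 i2 by simp
  have e: "(\<psi> x * g x + pd b \<psi> x * u x) * \<phi> x = g x * (\<phi> x * \<psi> x) + u x * (\<phi> x * pd b \<psi> x)"
    "\<psi> x * u x * pd b \<phi> x = u x * (pd b \<phi> x * \<psi> x)" for x by (simp_all add: algebra_simps)
  show "(LINT x|lborel. \<psi> x * u x * pd b \<phi> x) = - (LINT x|lborel. (\<psi> x * g x + pd b \<psi> x * u x) * \<phi> x)"
    unfolding e using * i1 i3 by simp
qed

lemma lip2:
  fixes P :: "real \<Rightarrow> real \<Rightarrow> real"
  assumes d: "\<And>s t. ((\<lambda>z. P (fst z) (snd z)) has_derivative (\<lambda>h. P1 s t * fst h + P2 s t * snd h)) (at (s, t))"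
    and M: "\<And>s t. \<bar>P1 s t\<bar> \<le> M" "\<And>s t. \<bar>P2 s t\<bar> \<le> M"
  shows "\<bar>P s t - P s' t'\<bar> \<le> M * \<bar>s - s'\<bar> + M * \<bar>t - t'\<bar>"
proof -
  have d1: "((\<lambda>s. P s t) has_real_derivative P1 s t) (at s)" for s t
  proof -
    have "((\<lambda>s. (s, t)) has_derivative (\<lambda>h. (h, 0))) (at s)" by (auto intro!: derivative_eq_intros)
    from has_derivative_compose[OF this d] show ?thesis by (intro has_real_derivativeI) (simp add: mult.commute)
  qed
  have d2: "((\<lambda>t. P s t) has_real_derivative P2 s t) (at t)" for s t
  proof -
    have "((\<lambda>t. (s, t)) has_derivative (\<lambda>h. (0, h))) (at t)" by (auto intro!: derivative_eq_intros)
    from has_derivative_compose[OF this d] show ?thesis by (intro has_real_derivativeI) (simp add: mult.commute)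
  qed
  have "norm (P s t - P s' t) \<le> M * norm (s - s')"
    by (rule field_differentiable_bound[of UNIV "\<lambda>s. P s t" "\<lambda>s. P1 s t"]) (use d1 M in auto)
  moreover have "norm (P s' t - P s' t') \<le> M * norm (t - t')"
    by (rule field_differentiable_bound[of UNIV "\<lambda>t. P s' t" "\<lambda>t. P2 s' t"]) (use d2 M in auto)
  ultimately show ?thesis by simp
qed

text \<open>Two functions at once, because the potential of the system couples \<open>u\<close> and
  \<open>v\<close>. The rule is classical for test functions, and bounded partial derivatives allow
  the passage to the limit along an approximating sequence. Since \<open>P 0 0\<close> may be
  nonzero, square integrability is claimed for \<open>P (u x) (v x) - P 0 0\<close>.\<close>

lemma wd_chain2:
  fixes P :: "real \<Rightarrow> real \<Rightarrow> real"
  assumes W: "W u g" "W v k"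
    and d: "\<And>s t. ((\<lambda>z. P (fst z) (snd z)) has_derivative (\<lambda>h. P1 s t * fst h + P2 s t * snd h)) (at (s, t))"
    and c: "continuous_on UNIV (\<lambda>z. P1 (fst z) (snd z))" "continuous_on UNIV (\<lambda>z. P2 (fst z) (snd z))"
    and M: "\<And>s t. \<bar>P1 s t\<bar> \<le> M" "\<And>s t. \<bar>P2 s t\<bar> \<le> M"
    and b: "b \<in> Basis"
  shows "wd b (\<lambda>x. P (u x) (v x)) (\<lambda>x. P1 (u x) (v x) * g b x + P2 (u x) (v x) * k b x)"
    "sq (\<lambda>x. P (u x) (v x) - P 0 0)" "sq (\<lambda>x. P1 (u x) (v x) * g b x + P2 (u x) (v x) * k b x)"
    "(\<lambda>x. P (u x) (v x)) \<in> borel_measurable borel"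
proof -
  note lip = lip2[OF d M]
  have M0: "M \<ge> 0" using M(1)[of 0 0] by linarith
  have cP: "continuous_on UNIV (\<lambda>z. P (fst z) (snd z))"
    using has_derivative_continuous[OF d] by (intro continuous_at_imp_continuous_on) auto
  have meas: "(\<lambda>x. Q (a x) (a' x)) \<in> borel_measurable borel"
    if "continuous_on UNIV (\<lambda>z. Q (fst z) (snd z))" "a \<in> borel_measurable borel" "a' \<in> borel_measurable borel"
    for Q :: "real \<Rightarrow> real \<Rightarrow> real" and a a' :: "'a \<Rightarrow> real"
  proof -
    have "(\<lambda>z. Q (fst z) (snd z)) \<in> borel_measurable (borel \<Otimes>\<^sub>M borel)"
      unfolding borel_prod by (rule borel_measurable_continuous_onI[OF that(1)])
    from measurable_compose[OF measurable_Pair[OF that(2,3)] this] show ?thesis by simp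
  qed
  note su = WD(1)[OF W(1)] and sv = WD(1)[OF W(2)]
  note [measurable] = sq_borel[OF su] sq_borel[OF sv]
  have bb: "\<bar>P (a x) (a' x) - P 0 0\<bar> \<le> \<bar>M * (\<bar>a x\<bar> + \<bar>a' x\<bar>)\<bar>" for a a' :: "'a \<Rightarrow> real" and x
    using lip[of "a x" "a' x" 0 0] M0 by (simp add: distrib_left)
  have sqP: "sq (\<lambda>x. P (a x) (a' x) - P 0 0)" if "sq a" "sq a'" for a a' :: "'a \<Rightarrow> real"
  proof (rule sq_le[where w="\<lambda>x. M * (\<bar>a x\<bar> + \<bar>a' x\<bar>)"])
    show "sq (\<lambda>x. M * (\<bar>a x\<bar> + \<bar>a' x\<bar>))" by (intro sq_cmult sq_add sq_abs that)
    show "(\<lambda>x. P (a x) (a' x) - P 0 0) \<in> borel_measurable borel"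
      by (intro borel_measurable_diff borel_measurable_const meas[OF cP] that[THEN sq_borel])
    show "AE x in lborel. \<bar>P (a x) (a' x) - P 0 0\<bar> \<le> \<bar>M * (\<bar>a x\<bar> + \<bar>a' x\<bar>)\<bar>" using bb by (intro AE_I2)
  qed
  show "sq (\<lambda>x. P (u x) (v x) - P 0 0)" by (rule sqP[OF su sv])
  show "(\<lambda>x. P (u x) (v x)) \<in> borel_measurable borel" by (rule meas[OF cP sq_borel[OF su] sq_borel[OF sv]])
  show "sq (\<lambda>x. P1 (u x) (v x) * g b x + P2 (u x) (v x) * k b x)"
    by (intro sq_add sq_bdd_mult[OF WD(2)[OF W(1) b] meas[OF c(1) sq_borel[OF su] sq_borel[OF sv]] M(1)]
        sq_bdd_mult[OF WD(2)[OF W(2) b] meas[OF c(2) sq_borel[OF su] sq_borel[OF sv]] M(2)])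
  show "wd b (\<lambda>x. P (u x) (v x)) (\<lambda>x. P1 (u x) (v x) * g b x + P2 (u x) (v x) * k b x)"
    unfolding wd_def
  proof (intro allI impI)
    fix \<phi> :: "'a \<Rightarrow> real" assume \<phi>: "test_function \<phi>"
    obtain un where un: "\<And>n. test_function (un n)" "l2lim un u" "\<And>b. b \<in> Basis \<Longrightarrow> l2lim (\<lambda>n. pd b (un n)) (g b)"
      using W_dense[OF W(1)] by blast
    obtain vn where vn: "\<And>n. test_function (vn n)" "l2lim vn v" "\<And>b. b \<in> Basis \<Longrightarrow> l2lim (\<lambda>n. pd b (vn n)) (k b)"
      using W_dense[OF W(2)] by blast
    \<comment> \<open>A subsequence of a subsequence, so that both approximations converge almost
      everywhere along the same indices.\<close>
    obtain r1 where r1: "strict_mono r1" "AE x in lborel. (\<lambda>n. un (r1 n) x) \<longlonglongrightarrow> u x" using l2lim_AE[OF un(2)] by blast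
    obtain r2 where r2: "strict_mono r2" "AE x in lborel. (\<lambda>n. vn (r1 (r2 n)) x) \<longlonglongrightarrow> v x"
      using l2lim_AE[OF l2lim_subseq[OF vn(2) r1(1)]] by blast
    define r where "r n = r1 (r2 n)" for n
    have r: "strict_mono r" unfolding r_def using r1(1) r2(1) by (simp add: strict_mono_def)
    have ae: "AE x in lborel. (\<lambda>n. un (r n) x) \<longlonglongrightarrow> u x \<and> (\<lambda>n. vn (r n) x) \<longlonglongrightarrow> v x"
      using r1(2) r2(2) by eventually_elim (auto simp: r_def intro: LIMSEQ_subseq_LIMSEQ[OF _ r2(1), unfolded o_def])
    have tQ: "AE x in lborel. (\<lambda>n. Q (un (r n) x) (vn (r n) x)) \<longlonglongrightarrow> Q (u x) (v x)"
      if "continuous_on UNIV (\<lambda>z. Q (fst z) (snd z))" for Q :: "real \<Rightarrow> real \<Rightarrow> real"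
      using ae
    proof eventually_elim
      case (elim x)
      then have "(\<lambda>n. (un (r n) x, vn (r n) x)) \<longlonglongrightarrow> (u x, v x)" by (intro tendsto_Pair) auto
      from continuous_on_tendsto_compose[OF that this] show ?case by simp
    qed
    define f where "f n x = P (un (r n) x) (vn (r n) x)" for n x
    have fd: "(f n has_derivative (\<lambda>h. P1 (un (r n) x) (vn (r n) x) * frechet_derivative (un (r n)) (at x) h
        + P2 (un (r n) x) (vn (r n) x) * frechet_derivative (vn (r n)) (at x) h)) (at x)" for n x
      using has_derivative_compose[OF has_derivative_Pair[OF C_k_SucD(1)[OF test_Ck[OF un(1)]] C_k_SucD(1)[OF test_Ck[OF vn(1)]]] d]
      unfolding f_def by simp
    have cQ: "continuous_on UNIV (\<lambda>x. Q (un n x) (vn n x))"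
      if "continuous_on UNIV (\<lambda>z. Q (fst z) (snd z))" for Q :: "real \<Rightarrow> real \<Rightarrow> real" and n
      using continuous_on_compose2[OF that, of UNIV "\<lambda>x. (un n x, vn n x)"]
      by (simp add: continuous_on_Pair test_cont un(1) vn(1))
    have f1: "C_k (Suc 0) (f n)" for n
    proof (rule C_k_SucI[OF fd])
      fix b :: 'a assume b: "b \<in> Basis"
      show "C_k 0 (\<lambda>x. P1 (un (r n) x) (vn (r n) x) * frechet_derivative (un (r n)) (at x) b +
           P2 (un (r n) x) (vn (r n) x) * frechet_derivative (vn (r n)) (at x) b)"
        unfolding C_k.simps pd_def[symmetric]
        by (intro continuous_intros cQ c test_cont test_pd un vn b)
    qed
    have pf: "pd b (f n) x = P1 (un (r n) x) (vn (r n) x) * pd b (un (r n)) x + P2 (un (r n) x) (vn (r n) x) * pd b (vn (r n)) x" for n x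
      using pd_eq[OF fd] by (simp add: pd_def)
    \<comment> \<open>The constant may be subtracted because the partial derivative of a test
      function has integral 0.\<close>
    have byp: "(LINT x|lborel. (f n x - P 0 0) * pd b \<phi> x) = - (LINT x|lborel. pd b (f n) x * \<phi> x)" for n
    proof -
      have "(LINT x|lborel. (f n x - P 0 0) * pd b \<phi> x) = (LINT x|lborel. f n x * pd b \<phi> x) - P 0 0 * (LINT x|lborel. pd b \<phi> x)"
      proof -
        have "integrable lborel (\<lambda>x. f n x * pd b \<phi> x)"
          by (intro cc_integrable continuous_intros C_k_cont[OF f1] test_cont test_pd \<phi> b bsupp_mult test_bsupp)
        moreover have "integrable lborel (\<lambda>x. pd b \<phi> x)"
          by (intro cc_integrable test_cont test_pd \<phi> b test_bsupp)
        ultimately show ?thesis by (simp add: left_diff_distrib)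
      qed
      then show ?thesis using integral_by_parts[OF f1 test_C1c[OF \<phi>] b, of n] integral_pd_0[OF test_C1c[OF \<phi>] b] by simp
    qed
    have l1: "l2lim (\<lambda>n x. f n x - P 0 0) (\<lambda>x. P (u x) (v x) - P 0 0)"
    proof (rule l2limI)
      show "sq (\<lambda>x. f n x - P 0 0)" for n unfolding f_def by (intro sqP test_sq un vn)
      show "sq (\<lambda>x. P (u x) (v x) - P 0 0)" by (rule sqP[OF su sv])
      show "n2 (\<lambda>x. f n x - P 0 0 - (P (u x) (v x) - P 0 0)) \<le>
          2 * (M\<^sup>2 * n2 (\<lambda>x. un (r n) x - u x)) + 2 * (M\<^sup>2 * n2 (\<lambda>x. vn (r n) x - v x))" for n
      proof -
        have s: "sq (\<lambda>x. un (r n) x - u x)" "sq (\<lambda>x. vn (r n) x - v x)" by (intro sq_diff test_sq un vn su sv)+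
        have "n2 (\<lambda>x. f n x - P 0 0 - (P (u x) (v x) - P 0 0)) \<le> n2 (\<lambda>x. M * \<bar>un (r n) x - u x\<bar> + M * \<bar>vn (r n) x - v x\<bar>)"
        proof (rule n2_mono)
          show "sq (\<lambda>x. M * \<bar>un (r n) x - u x\<bar> + M * \<bar>vn (r n) x - v x\<bar>)" by (intro sq_add sq_cmult sq_abs s)
          show "(\<lambda>x. f n x - P 0 0 - (P (u x) (v x) - P 0 0)) \<in> borel_measurable borel"
            unfolding f_def by (intro borel_measurable_diff borel_measurable_const meas[OF cP] test_borel un vn sq_borel[OF su] sq_borel[OF sv])
          show "AE x in lborel. \<bar>f n x - P 0 0 - (P (u x) (v x) - P 0 0)\<bar> \<le> \<bar>M * \<bar>un (r n) x - u x\<bar> + M * \<bar>vn (r n) x - v x\<bar>\<bar>"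
            using lip M0 by (intro AE_I2) (simp add: f_def)
        qed
        also have "\<dots> \<le> 2 * n2 (\<lambda>x. M * \<bar>un (r n) x - u x\<bar>) + 2 * n2 (\<lambda>x. M * \<bar>vn (r n) x - v x\<bar>)"
          by (intro n2_add_le sq_cmult sq_abs s)
        also have "\<dots> = 2 * (M\<^sup>2 * n2 (\<lambda>x. un (r n) x - u x)) + 2 * (M\<^sup>2 * n2 (\<lambda>x. vn (r n) x - v x))"
          unfolding n2_cmult by (simp add: n2_def)
        finally show ?thesis .
      qed
      show "(\<lambda>n. 2 * (M\<^sup>2 * n2 (\<lambda>x. un (r n) x - u x)) + 2 * (M\<^sup>2 * n2 (\<lambda>x. vn (r n) x - v x))) \<longlonglongrightarrow> 0"
        using l2lim_subseq[OF un(2) r] l2lim_subseq[OF vn(2) r] unfolding l2lim_def by (auto intro!: tendsto_eq_intros)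
    qed
    have l2: "l2lim (\<lambda>n. pd b (f n)) (\<lambda>x. P1 (u x) (v x) * g b x + P2 (u x) (v x) * k b x)"
    proof -
      have "l2lim (\<lambda>n x. P1 (un (r n) x) (vn (r n) x) * pd b (un (r n)) x) (\<lambda>x. P1 (u x) (v x) * g b x)"
        by (rule l2lim_bdd_seq[OF l2lim_subseq[OF un(3)[OF b] r] borel_measurable_continuous_onI[OF cQ[OF c(1)]] M(1)
            meas[OF c(1) sq_borel[OF su] sq_borel[OF sv]] tQ[OF c(1)]])
      moreover have "l2lim (\<lambda>n x. P2 (un (r n) x) (vn (r n) x) * pd b (vn (r n)) x) (\<lambda>x. P2 (u x) (v x) * k b x)"
        by (rule l2lim_bdd_seq[OF l2lim_subseq[OF vn(3)[OF b] r] borel_measurable_continuous_onI[OF cQ[OF c(2)]] M(2)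
            meas[OF c(2) sq_borel[OF su] sq_borel[OF sv]] tQ[OF c(2)]])
      moreover have "pd b (f n) = (\<lambda>x. P1 (un (r n) x) (vn (r n) x) * pd b (un (r n)) x + P2 (un (r n) x) (vn (r n) x) * pd b (vn (r n)) x)" for n
        using pf by auto
      ultimately show ?thesis using l2lim_add by simp
    qed
    have "(\<lambda>n. LINT x|lborel. (f n x - P 0 0) * pd b \<phi> x) \<longlonglongrightarrow> (LINT x|lborel. (P (u x) (v x) - P 0 0) * pd b \<phi> x)"
      by (rule l2lim_integral_l[OF l1 test_sq[OF test_pd[OF \<phi> b]]])
    moreover have "(\<lambda>n. - (LINT x|lborel. pd b (f n) x * \<phi> x)) \<longlonglongrightarrow> - (LINT x|lborel. (P1 (u x) (v x) * g b x + P2 (u x) (v x) * k b x) * \<phi> x)"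
      by (intro tendsto_minus l2lim_integral_l[OF l2 test_sq[OF \<phi>]])
    ultimately have e: "(LINT x|lborel. (P (u x) (v x) - P 0 0) * pd b \<phi> x) = - (LINT x|lborel. (P1 (u x) (v x) * g b x + P2 (u x) (v x) * k b x) * \<phi> x)"
      unfolding byp by (rule LIMSEQ_unique)
    have i1: "integrable lborel (\<lambda>x. (P (u x) (v x) - P 0 0) * pd b \<phi> x)"
      by (intro sq_mult_integrable sqP su sv test_sq test_pd \<phi> b)
    have i2: "integrable lborel (\<lambda>x. P 0 0 * pd b \<phi> x)"
      by (intro integrable_mult_right cc_integrable test_cont test_pd \<phi> b test_bsupp)
    have "(LINT x|lborel. P (u x) (v x) * pd b \<phi> x) = (LINT x|lborel. (P (u x) (v x) - P 0 0) * pd b \<phi> x + P 0 0 * pd b \<phi> x)"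
      by (simp add: algebra_simps)
    also have "\<dots> = (LINT x|lborel. (P (u x) (v x) - P 0 0) * pd b \<phi> x)"
      using i1 i2 integral_pd_0[OF test_C1c[OF \<phi>] b] by simp
    finally show "(LINT x|lborel. P (u x) (v x) * pd b \<phi> x) = - (LINT x|lborel. (P1 (u x) (v x) * g b x + P2 (u x) (v x) * k b x) * \<phi> x)"
      using e by simp
  qed
qed

text \<open>\<open>G 0\<close> may be nonzero, as for the function \<open>pcG\<close> below, so it
  is \<open>G (u x) - G 0\<close> that is claimed to be square integrable.\<close>

lemma wd_chain:
  fixes G :: "real \<Rightarrow> real"
  assumes W: "W u g" and d: "\<And>s. (G has_real_derivative G' s) (at s)" and c: "continuous_on UNIV G'"
    and M: "\<And>s. \<bar>G' s\<bar> \<le> M" and b: "b \<in> Basis"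
  shows "wd b (\<lambda>x. G (u x)) (\<lambda>x. G' (u x) * g b x)" "sq (\<lambda>x. G (u x) - G 0)" "sq (\<lambda>x. G' (u x) * g b x)"
proof -
  have M0: "M \<ge> 0" using M[of 0] by linarith
  have d': "((\<lambda>z::real\<times>real. G (fst z)) has_derivative (\<lambda>h. G' s * fst h + 0 * snd h)) (at (s, t))" for s t
    using has_derivative_compose[OF has_derivative_fst[OF has_derivative_ident[of "at (s, t)"]] d[unfolded has_field_derivative_def]] by simp
  note * = wd_chain2[OF W W, of "\<lambda>s t. G s" "\<lambda>s t. G' s" "\<lambda>s t. 0" M b, OF d']
  have c': "continuous_on UNIV (\<lambda>z::real\<times>real. G' (fst z))"
    by (intro continuous_on_compose2[OF c] continuous_intros) auto
  show "wd b (\<lambda>x. G (u x)) (\<lambda>x. G' (u x) * g b x)" "sq (\<lambda>x. G (u x) - G 0)" "sq (\<lambda>x. G' (u x) * g b x)"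
    using * c' M M0 b by auto
qed

lemma W_chain:
  fixes G :: "real \<Rightarrow> real"
  assumes W: "W u g" and d: "\<And>s. (G has_real_derivative G' s) (at s)" and c: "continuous_on UNIV G'"
    and M: "\<And>s. \<bar>G' s\<bar> \<le> M" and "G 0 = 0"
  shows "W (\<lambda>x. G (u x)) (\<lambda>b x. G' (u x) * g b x)"
proof -
  obtain b :: 'a where "b \<in> Basis" using nonempty_Basis by blast
  then show ?thesis unfolding W_def using wd_chain[OF W d c M] \<open>G 0 = 0\<close> by auto
qed

section \<open>The Sobolev inequality in dimension four\<close>

text \<open>\<open>enn2real\<close> sends \<open>top\<close> to 0, so \<open>top\<close> is treated
  separately. Working in \<open>ennreal\<close> lets the Loomis-Whitney argument handle iterated
  integrals without any finiteness condition.\<close>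

definition cbrt :: "ennreal \<Rightarrow> ennreal" where
  "cbrt x = (if x = top then top else ennreal (root 3 (enn2real x)))"

lemma cbrt_ennreal: "0 \<le> a \<Longrightarrow> cbrt (ennreal a) = ennreal (root 3 a)"
  by (simp add: cbrt_def)

lemma cbrt_mono: "x \<le> y \<Longrightarrow> cbrt x \<le> cbrt y"
  by (cases x; cases y) (auto simp: cbrt_def ennreal_leI top_unique)

lemma measurable_cbrt[measurable]: "cbrt \<in> borel_measurable borel"
  unfolding cbrt_def by measurable

text \<open>\<open>x^3 + y^3 + z^3 - 3xyz\<close> is \<open>x + y + z\<close> times half the sum of
  the squared differences.\<close>

lemma amgm3: "0 \<le> x \<Longrightarrow> 0 \<le> y \<Longrightarrow> 0 \<le> z \<Longrightarrow> x * y * z \<le> (x^3 + y^3 + z^3) / (3::real)"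
proof -
  assume "0 \<le> x" "0 \<le> y" "0 \<le> z"
  then have "0 \<le> (x + y + z) * ((x - y)\<^sup>2 + (y - z)\<^sup>2 + (z - x)\<^sup>2) / 2" by simp
  then show ?thesis by (simp add: power2_eq_square power3_eq_cube algebra_simps)
qed

text \<open>Holder's inequality with three exponents 3. In the main case the arithmetic-geometric
  mean inequality is applied to the cube roots of \<open>a / A\<close>, \<open>b / B\<close> and
  \<open>c / C\<close>, where each quotient has integral 1.\<close>

lemma nn_Holder3:
  assumes [measurable]: "a \<in> borel_measurable M" "b \<in> borel_measurable M" "c \<in> borel_measurable M"
  shows "(\<integral>\<^sup>+x. cbrt (a x) * cbrt (b x) * cbrt (c x) \<partial>M) \<le>
     cbrt (\<integral>\<^sup>+x. a x \<partial>M) * cbrt (\<integral>\<^sup>+x. b x \<partial>M) * cbrt (\<integral>\<^sup>+x. c x \<partial>M)"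
proof -
  define A B C where "A = (\<integral>\<^sup>+x. a x \<partial>M)" "B = (\<integral>\<^sup>+x. b x \<partial>M)" "C = (\<integral>\<^sup>+x. c x \<partial>M)"
  have c0: "cbrt 0 = 0" by (simp add: cbrt_def)
  have cpos: "cbrt x \<noteq> 0" if "x \<noteq> 0" for x
    using that by (cases x) (auto simp: cbrt_def ennreal_eq_0_iff)
  consider "A = 0 \<or> B = 0 \<or> C = 0" | "A \<noteq> 0" "B \<noteq> 0" "C \<noteq> 0" "A = top \<or> B = top \<or> C = top"
    | "A \<noteq> 0" "B \<noteq> 0" "C \<noteq> 0" "A \<noteq> top" "B \<noteq> top" "C \<noteq> top" by blast
  then show ?thesis
  proof cases
    case 1
    then have "(AE x in M. a x = 0) \<or> (AE x in M. b x = 0) \<or> (AE x in M. c x = 0)"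
      by (auto simp: A_B_C_def nn_integral_0_iff_AE)
    then have "AE x in M. cbrt (a x) * cbrt (b x) * cbrt (c x) = 0"
      by (elim disjE) (auto elim!: eventually_mono simp: c0)
    then have "(\<integral>\<^sup>+x. cbrt (a x) * cbrt (b x) * cbrt (c x) \<partial>M) = 0"
      by (simp add: nn_integral_0_iff_AE)
    then show ?thesis by simp
  next
    case 2
    have "cbrt A * cbrt B * cbrt C = top"
      using 2 cpos by (auto simp: ennreal_mult_eq_top_iff cbrt_def ennreal_eq_0_iff enn2real_eq_0_iff)
    then show ?thesis by (simp add: A_B_C_def)
  next
    case 3
    define \<alpha> \<beta> \<gamma> where "\<alpha> = root 3 (enn2real A)" "\<beta> = root 3 (enn2real B)" "\<gamma> = root 3 (enn2real C)"
    have pos: "\<alpha> > 0" "\<beta> > 0" "\<gamma> > 0"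
      unfolding \<alpha>_\<beta>_\<gamma>_def using 3 by (auto simp: enn2real_positive_iff top.not_eq_extremum zero_less_iff_neq_zero)
    have ABC: "A = ennreal (\<alpha>^3)" "B = ennreal (\<beta>^3)" "C = ennreal (\<gamma>^3)"
      unfolding \<alpha>_\<beta>_\<gamma>_def using 3 by (simp_all add: top.not_eq_extremum)
    \<comment> \<open>The weights of the normalised inequality after multiplication by
      \<open>\<alpha> * \<beta> * \<gamma>\<close>; with them the integrated right-hand side is
      again exactly this product.\<close>
    define k l m where "k = \<beta> * \<gamma> / (3 * \<alpha>\<^sup>2)" "l = \<alpha> * \<gamma> / (3 * \<beta>\<^sup>2)" "m = \<alpha> * \<beta> / (3 * \<gamma>\<^sup>2)"
    have kpos: "k > 0" "l > 0" "m > 0" using pos by (auto simp: k_l_m_def)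
    have pt: "cbrt x * cbrt y * cbrt z \<le> ennreal k * x + ennreal l * y + ennreal m * z" for x y z
    proof (cases "x = top \<or> y = top \<or> z = top")
      case True
      then have "ennreal k * x + ennreal l * y + ennreal m * z = top"
        using kpos by (auto simp: ennreal_mult_eq_top_iff)
      then show ?thesis using top_greatest by metis
    next
      case False
      then obtain p q r where pqr: "x = ennreal p" "y = ennreal q" "z = ennreal r" "p \<ge> 0" "q \<ge> 0" "r \<ge> 0"
        by (cases x; cases y; cases z) auto
      define p' q' r' where "p' = root 3 p" "q' = root 3 q" "r' = root 3 r"
      have p': "p = p'^3" "q = q'^3" "r = r'^3" "p' \<ge> 0" "q' \<ge> 0" "r' \<ge> 0" using pqr by (auto simp: p'_q'_r'_def)
      have "(p'/\<alpha>) * (q'/\<beta>) * (r'/\<gamma>) \<le> ((p'/\<alpha>)^3 + (q'/\<beta>)^3 + (r'/\<gamma>)^3) / 3"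
        using pos p' by (intro amgm3) auto
      then have "\<alpha> * \<beta> * \<gamma> * ((p'/\<alpha>) * (q'/\<beta>) * (r'/\<gamma>)) \<le> \<alpha> * \<beta> * \<gamma> * (((p'/\<alpha>)^3 + (q'/\<beta>)^3 + (r'/\<gamma>)^3) / 3)"
        using pos by (intro mult_left_mono) auto
      also have "\<alpha> * \<beta> * \<gamma> * ((p'/\<alpha>) * (q'/\<beta>) * (r'/\<gamma>)) = p' * q' * r'" using pos by simp
      also have "\<alpha> * \<beta> * \<gamma> * (((p'/\<alpha>)^3 + (q'/\<beta>)^3 + (r'/\<gamma>)^3) / 3) = k * p + l * q + m * r"
      proof -
        have "\<alpha> * \<beta> * \<gamma> * ((p'/\<alpha>)^3 / 3) = k * p" "\<alpha> * \<beta> * \<gamma> * ((q'/\<beta>)^3 / 3) = l * q" "\<alpha> * \<beta> * \<gamma> * ((r'/\<gamma>)^3 / 3) = m * r"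
          using pos unfolding p' k_l_m_def power_divide by (simp_all add: power2_eq_square power3_eq_cube)
        then show ?thesis unfolding add_divide_distrib distrib_left by simp
      qed
      finally have "p' * q' * r' \<le> k * p + l * q + m * r" .
      moreover have "cbrt x * cbrt y * cbrt z = ennreal (p' * q' * r')"
        using pqr(4-6) unfolding pqr(1-3) p'_q'_r'_def by (simp add: cbrt_ennreal ennreal_mult)
      moreover have "ennreal k * x + ennreal l * y + ennreal m * z = ennreal (k * p + l * q + m * r)"
        using pqr kpos by (simp add: ennreal_mult ennreal_plus)
      ultimately show ?thesis by (simp add: ennreal_leI)
    qed
    have "(\<integral>\<^sup>+x. cbrt (a x) * cbrt (b x) * cbrt (c x) \<partial>M) \<le> (\<integral>\<^sup>+x. ennreal k * a x + ennreal l * b x + ennreal m * c x \<partial>M)"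
      by (intro nn_integral_mono pt)
    also have "\<dots> = ennreal k * A + ennreal l * B + ennreal m * C"
      by (simp add: nn_integral_add nn_integral_cmult A_B_C_def)
    also have "\<dots> = ennreal (k * \<alpha>^3 + l * \<beta>^3 + m * \<gamma>^3)"
      unfolding ABC using pos kpos by (simp add: ennreal_mult ennreal_plus)
    also have "k * \<alpha>^3 + l * \<beta>^3 + m * \<gamma>^3 = \<alpha> * \<beta> * \<gamma>"
      using pos unfolding k_l_m_def by (simp add: field_simps power2_eq_square power3_eq_cube)
    also have "ennreal (\<alpha> * \<beta> * \<gamma>) = cbrt A * cbrt B * cbrt C"
      unfolding ABC using pos by (simp add: cbrt_ennreal real_root_power_cancel ennreal_mult)
    finally show ?thesis by (simp add: A_B_C_def)
  qed
qed

section \<open>The Loomis-Whitney inequality in four variables\<close>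

definition T4 :: "real \<Rightarrow> real \<Rightarrow> real \<Rightarrow> real \<Rightarrow> real^4" where
  "T4 x y z w = x *\<^sub>R axis 1 1 + y *\<^sub>R axis 2 1 + z *\<^sub>R axis 3 1 + w *\<^sub>R axis 4 1"

lemma T4_measurable[measurable (raw)]:
  assumes [measurable]: "a \<in> borel_measurable M" "b \<in> borel_measurable M" "c \<in> borel_measurable M" "d \<in> borel_measurable M"
  shows "(\<lambda>s. T4 (a s) (b s) (c s) (d s)) \<in> borel_measurable M"
  unfolding T4_def by measurable

lemma T4_nth: "T4 x y z w $ 1 = x" "T4 x y z w $ 2 = y" "T4 x y z w $ 3 = z" "T4 x y z w $ 4 = w"
  by (simp_all add: T4_def axis_def)

lemma box_Pair_eq: "box (a, b) (c, d) = box a c \<times> box b d"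
  by (auto simp: box_def Basis_prod_def ball_Un)

lemma emeasure_lborel_Times:
  "A \<in> sets borel \<Longrightarrow> B \<in> sets borel \<Longrightarrow>
    emeasure lborel (A \<times> B :: ('a::euclidean_space \<times> 'b::euclidean_space) set) = emeasure lborel A * emeasure lborel B"
  by (subst lborel_prod[symmetric], rule lborel.emeasure_pair_measure_Times) auto

lemma borel_Times [simp]:
  "A \<in> sets borel \<Longrightarrow> B \<in> sets borel \<Longrightarrow> (A \<times> B :: ('a::euclidean_space \<times> 'b::euclidean_space) set) \<in> sets borel"
  by (subst borel_prod[symmetric]) (rule pair_measureI)

text \<open>The tuple lists the coordinates in reverse, so that the first coordinate becomes the
  innermost variable of the iterated integrals in \<open>nn_integral_T4\<close>. It suffices to
  compare the volumes of boxes.\<close>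

lemma lborel_T4: "distr lborel borel (\<lambda>(w, z, y, x). T4 x y z w) = lborel"
proof (rule lborel_eqI[symmetric])
  fix l u :: "real^4" assume lu: "\<And>b. b \<in> Basis \<Longrightarrow> l \<bullet> b \<le> u \<bullet> b"
  have i: "l $ i \<le> u $ i" for i using lu[of "axis i 1"] by (simp add: axis_in_Basis_iff inner_axis)
  have pre: "(\<lambda>(w, z, y, x). T4 x y z w) -` box l u = box (l$4, l$3, l$2, l$1) (u$4, u$3, u$2, u$1)"
    by (auto simp: mem_box_cart forall_4 T4_nth box_Pair_eq mem_box)
  have "emeasure (distr lborel borel (\<lambda>(w, z, y, x). T4 x y z w)) (box l u) =
     emeasure lborel (box (l$4, l$3, l$2, l$1) (u$4, u$3, u$2, u$1))"
  proof -
    have "(\<lambda>(w, z, y, x). T4 x y z w) \<in> borel_measurable borel"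
      unfolding split_beta' borel_prod[symmetric] by measurable
    then show ?thesis by (subst emeasure_distr) (simp_all add: pre)
  qed
  also have "\<dots> = emeasure lborel (box (l$4) (u$4)) * (emeasure lborel (box (l$3) (u$3)) * (emeasure lborel (box (l$2) (u$2)) * emeasure lborel (box (l$1) (u$1))))"
    unfolding box_Pair_eq by (simp add: emeasure_lborel_Times)
  also have "\<dots> = ennreal (\<Prod>b\<in>Basis. (u - l) \<bullet> b)"
  proof -
    have "(\<Prod>b\<in>Basis. (u - l) \<bullet> b) = (\<Prod>i\<in>UNIV. (u - l) $ i)"
      unfolding Basis_vec_def by (simp add: prod.UNION_disjoint axis_eq_axis prod.reindex inj_on_def inner_axis)
    also have "\<dots> = (u$4 - l$4) * ((u$3 - l$3) * ((u$2 - l$2) * (u$1 - l$1)))"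
      unfolding UNIV_4 by simp
    finally show ?thesis using i by (simp add: ennreal_mult)
  qed
  finally show "emeasure (distr lborel borel (\<lambda>(w, z, y, x). T4 x y z w)) (box l u) = ennreal (\<Prod>b\<in>Basis. (u - l) \<bullet> b)" .
qed simp

lemma nn_integral_lborel_pair:
  fixes g :: "'a::euclidean_space \<times> 'b::euclidean_space \<Rightarrow> ennreal"
  assumes [measurable]: "g \<in> borel_measurable borel"
  shows "(\<integral>\<^sup>+p. g p \<partial>lborel) = (\<integral>\<^sup>+x. \<integral>\<^sup>+y. g (x, y) \<partial>lborel \<partial>lborel)"
  unfolding lborel_prod[symmetric] by (rule lborel.nn_integral_fst[symmetric]) (simp add: lborel_prod)

lemma nn_integral_T4:
  assumes [measurable]: "g \<in> borel_measurable borel"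
  shows "(\<integral>\<^sup>+p. g p \<partial>(lborel :: (real^4) measure)) = (\<integral>\<^sup>+w. \<integral>\<^sup>+z. \<integral>\<^sup>+y. \<integral>\<^sup>+x. g (T4 x y z w) \<partial>lborel \<partial>lborel \<partial>lborel \<partial>lborel)"
proof -
  have "(\<integral>\<^sup>+p. g p \<partial>(lborel :: (real^4) measure)) = (\<integral>\<^sup>+q. g (case q of (w, z, y, x) \<Rightarrow> T4 x y z w) \<partial>lborel)"
    by (subst lborel_T4[symmetric], subst nn_integral_distr) (auto simp: borel_prod[symmetric] split_beta')
  also have "\<dots> = (\<integral>\<^sup>+w. \<integral>\<^sup>+z. \<integral>\<^sup>+y. \<integral>\<^sup>+x. g (T4 x y z w) \<partial>lborel \<partial>lborel \<partial>lborel \<partial>lborel)"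
  proof -
    have 1: "(\<lambda>(w, z, y, x). g (T4 x y z w)) \<in> borel_measurable borel"
      unfolding split_beta' borel_prod[symmetric] by measurable
    have 2: "(\<lambda>(z, y, x). g (T4 x y z w)) \<in> borel_measurable borel" for w
      unfolding split_beta' borel_prod[symmetric] by measurable
    have 3: "(\<lambda>(y, x). g (T4 x y z w)) \<in> borel_measurable borel" for z w
      unfolding split_beta' borel_prod[symmetric] by measurable
    have "g (case q of (w, z, y, x) \<Rightarrow> T4 x y z w) = (case q of (w, z, y, x) \<Rightarrow> g (T4 x y z w))" for q
      by (simp add: split_beta')
    then show ?thesis
      by (simp only: nn_integral_lborel_pair[OF 1] nn_integral_lborel_pair[OF 2] nn_integral_lborel_pair[OF 3] prod.case)
  qed
  finally show ?thesis .
qed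

text \<open>The fundamental theorem of calculus, started from a point of the line where
  \<open>f\<close> already vanishes.\<close>

lemma line_bound:
  fixes f :: "'a::euclidean_space \<Rightarrow> real"
  assumes f: "C1c f" and b: "b \<in> Basis"
  shows "ennreal \<bar>f (a + t *\<^sub>R b)\<bar> \<le> (\<integral>\<^sup>+s. ennreal \<bar>pd b f (a + s *\<^sub>R b)\<bar> \<partial>lborel)"
proof -
  obtain r where r: "r > 0" "\<And>x. norm x \<ge> r \<Longrightarrow> f x = 0" using C1c_bsupp(1)[OF f] by (rule bsuppE) blast
  define h where "h s = f (a + s *\<^sub>R b)" for s
  define h' where "h' s = pd b f (a + s *\<^sub>R b)" for s
  have hd: "(h has_real_derivative h' s) (at s)" for s
  proof (rule has_real_derivativeI)
    have 1: "((\<lambda>s. a + s *\<^sub>R b) has_derivative (\<lambda>s. s *\<^sub>R b)) (at s)" by (auto intro!: derivative_eq_intros)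
    have *: "(\<Sum>c\<in>Basis. ((t *\<^sub>R b) \<bullet> c) * pd c f (a + s *\<^sub>R b)) = t * h' s" for t
    proof -
      have "(\<Sum>c\<in>Basis. ((t *\<^sub>R b) \<bullet> c) * pd c f (a + s *\<^sub>R b)) = (\<Sum>c\<in>Basis. if c = b then t * h' s else 0)"
        by (rule sum.cong) (use b in \<open>auto simp: inner_Basis h'_def\<close>)
      then show ?thesis using b by simp
    qed
    show "(h has_derivative (\<lambda>t. t * h' s)) (at s)"
      using has_derivative_compose[OF 1 C_k1_deriv[of 0 f]] f
      unfolding C1c_def One_nat_def * h_def by blast
  qed
  have h'c: "continuous_on UNIV h'"
    unfolding h'_def by (rule continuous_on_compose2[OF C1c_cont(2)[OF f b, of UNIV]]) (auto intro!: continuous_intros)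
  \<comment> \<open>At parameter \<open>- L\<close> the line is outside the ball of radius
    \<open>r\<close>, and \<open>- L\<close> lies to the left of \<open>t\<close>.\<close>
  define L where "L = \<bar>t\<bar> + norm a + r"
  have L0: "h (- L) = 0"
  proof -
    have "norm (a + (- L) *\<^sub>R b) \<ge> \<bar>L\<bar> - norm a" using norm_triangle_ineq2[of "L *\<^sub>R b" a] b by (simp add: norm_minus_commute)
    then have "norm (a + (- L) *\<^sub>R b) \<ge> r" by (simp add: L_def)
    then show ?thesis unfolding h_def by (rule r(2))
  qed
  have tL: "- L \<le> t" unfolding L_def using r(1) norm_ge_zero[of a] by linarith
  have "(LINT s|lborel. h' s * indicator {-L..t} s) = h t - h (-L)"
    by (rule integral_FTC_Icc_real[OF tL]) (use hd h'c in \<open>auto simp: continuous_on_eq_continuous_at\<close>)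
  then have ht: "h t = (LINT s|lborel. h' s * indicator {-L..t} s)" using L0 by simp
  have i: "integrable lborel (\<lambda>s. h' s * indicator {-L..t} s)"
    using borel_integrable_compact[of "{-L..t}" h'] continuous_on_subset[OF h'c] by (simp add: mult.commute)
  have "ennreal \<bar>h t\<bar> \<le> (\<integral>\<^sup>+s. ennreal (norm (h' s * indicator {-L..t} s)) \<partial>lborel)"
    unfolding ht using integral_norm_bound_ennreal[OF i] by simp
  also have "\<dots> \<le> (\<integral>\<^sup>+s. ennreal \<bar>h' s\<bar> \<partial>lborel)"
    by (intro nn_integral_mono ennreal_leI) (auto simp: indicator_def)
  finally show ?thesis by (simp add: h_def h'_def)
qed

text \<open>Joint measurability of a curried function, in the shape in which the
  \<open>measurable\<close> method can use it as a rule.\<close>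

lemma measurable_curried2:
  fixes F :: "real \<Rightarrow> real \<Rightarrow> ennreal"
  assumes "(\<lambda>(x,y). F x y) \<in> borel_measurable (borel \<Otimes>\<^sub>M borel)"
    and [measurable]: "f \<in> borel_measurable M" "g \<in> borel_measurable M"
  shows "(\<lambda>s. F (f s) (g s)) \<in> borel_measurable M"
proof -
  have "(\<lambda>s. (f s, g s)) \<in> M \<rightarrow>\<^sub>M borel \<Otimes>\<^sub>M borel" by measurable
  from measurable_compose[OF this assms(1)] show ?thesis by simp
qed

lemma measurable_curried3:
  fixes F :: "real \<Rightarrow> real \<Rightarrow> real \<Rightarrow> ennreal"
  assumes "(\<lambda>(x,y,z). F x y z) \<in> borel_measurable (borel \<Otimes>\<^sub>M borel \<Otimes>\<^sub>M borel)"
    and [measurable]: "f \<in> borel_measurable M" "g \<in> borel_measurable M" "h \<in> borel_measurable M"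
  shows "(\<lambda>s. F (f s) (g s) (h s)) \<in> borel_measurable M"
proof -
  have "(\<lambda>s. (f s, g s, h s)) \<in> M \<rightarrow>\<^sub>M borel \<Otimes>\<^sub>M borel \<Otimes>\<^sub>M borel" by measurable
  from measurable_compose[OF this assms(1)] show ?thesis by simp
qed

text \<open>Gagliardo's argument. Each \<open>F\<close> misses exactly one variable
  (\<open>F1\<close> misses \<open>x\<close>, and so on), so in each integration one factor is
  constant and moves out, while Holder's inequality with three factors handles the others. After
  four rounds each factor has been integrated over its own three variables. The exponent 1/3 is
  \<open>1 / (n - 1)\<close> for \<open>n = 4\<close>.\<close>

lemma loomis_whitney4:
  fixes F1 F2 F3 F4 :: "real \<Rightarrow> real \<Rightarrow> real \<Rightarrow> ennreal"
  assumes m: "(\<lambda>(x,y,z). F1 x y z) \<in> borel_measurable (borel \<Otimes>\<^sub>M borel \<Otimes>\<^sub>M borel)"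
    "(\<lambda>(x,y,z). F2 x y z) \<in> borel_measurable (borel \<Otimes>\<^sub>M borel \<Otimes>\<^sub>M borel)"
    "(\<lambda>(x,y,z). F3 x y z) \<in> borel_measurable (borel \<Otimes>\<^sub>M borel \<Otimes>\<^sub>M borel)"
    "(\<lambda>(x,y,z). F4 x y z) \<in> borel_measurable (borel \<Otimes>\<^sub>M borel \<Otimes>\<^sub>M borel)"
  shows "(\<integral>\<^sup>+w. \<integral>\<^sup>+z. \<integral>\<^sup>+y. \<integral>\<^sup>+x. cbrt (F1 y z w) * (cbrt (F2 x z w) * cbrt (F3 x y w) * cbrt (F4 x y z)) \<partial>lborel \<partial>lborel \<partial>lborel \<partial>lborel)
   \<le> cbrt (\<integral>\<^sup>+z. \<integral>\<^sup>+y. \<integral>\<^sup>+x. F4 x y z \<partial>lborel \<partial>lborel \<partial>lborel) *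
     (cbrt (\<integral>\<^sup>+w. \<integral>\<^sup>+y. \<integral>\<^sup>+x. F3 x y w \<partial>lborel \<partial>lborel \<partial>lborel) *
      cbrt (\<integral>\<^sup>+w. \<integral>\<^sup>+z. \<integral>\<^sup>+x. F2 x z w \<partial>lborel \<partial>lborel \<partial>lborel) *
      cbrt (\<integral>\<^sup>+w. \<integral>\<^sup>+z. \<integral>\<^sup>+y. F1 y z w \<partial>lborel \<partial>lborel \<partial>lborel))"
proof -
  note [measurable (raw)] = m[THEN measurable_curried3]
  \<comment> \<open>The letters \<open>A\<close>, \<open>B\<close>, \<open>C\<close> mark the state
    after integrating in \<open>x\<close>, \<open>y\<close> and \<open>z\<close>; the digit is that
    of the factor.\<close>
  define A2 where "A2 z w = (\<integral>\<^sup>+x. F2 x z w \<partial>lborel)" for z w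
  define A3 where "A3 y w = (\<integral>\<^sup>+x. F3 x y w \<partial>lborel)" for y w
  define A4 where "A4 y z = (\<integral>\<^sup>+x. F4 x y z \<partial>lborel)" for y z
  have mA: "(\<lambda>(z,w). A2 z w) \<in> borel_measurable (borel \<Otimes>\<^sub>M borel)"
    "(\<lambda>(z,w). A3 z w) \<in> borel_measurable (borel \<Otimes>\<^sub>M borel)" "(\<lambda>(z,w). A4 z w) \<in> borel_measurable (borel \<Otimes>\<^sub>M borel)"
    unfolding A2_def A3_def A4_def by measurable
  note [measurable (raw)] = mA[THEN measurable_curried2]
  define B1 where "B1 z w = (\<integral>\<^sup>+y. F1 y z w \<partial>lborel)" for z w
  define B3 where "B3 w = (\<integral>\<^sup>+y. A3 y w \<partial>lborel)" for w
  define B4 where "B4 z = (\<integral>\<^sup>+y. A4 y z \<partial>lborel)" for z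
  have mB: "(\<lambda>(z,w). B1 z w) \<in> borel_measurable (borel \<Otimes>\<^sub>M borel)" unfolding B1_def by measurable
  note [measurable (raw)] = mB[THEN measurable_curried2]
  have [measurable]: "B3 \<in> borel_measurable borel" "B4 \<in> borel_measurable borel"
    unfolding B3_def B4_def by measurable
  define C1 where "C1 w = (\<integral>\<^sup>+z. B1 z w \<partial>lborel)" for w
  define C2 where "C2 w = (\<integral>\<^sup>+z. A2 z w \<partial>lborel)" for w
  have mC[measurable]: "C1 \<in> borel_measurable borel" "C2 \<in> borel_measurable borel"
    unfolding C1_def C2_def by measurable
  have s1: "(\<integral>\<^sup>+x. cbrt (F1 y z w) * (cbrt (F2 x z w) * cbrt (F3 x y w) * cbrt (F4 x y z)) \<partial>lborel)
    \<le> cbrt (A2 z w) * (cbrt (F1 y z w) * cbrt (A3 y w) * cbrt (A4 y z))" for y z w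
  proof -
    have "(\<integral>\<^sup>+x. cbrt (F1 y z w) * (cbrt (F2 x z w) * cbrt (F3 x y w) * cbrt (F4 x y z)) \<partial>lborel)
      = cbrt (F1 y z w) * (\<integral>\<^sup>+x. cbrt (F2 x z w) * cbrt (F3 x y w) * cbrt (F4 x y z) \<partial>lborel)"
      by (rule nn_integral_cmult) measurable
    also have "\<dots> \<le> cbrt (F1 y z w) * (cbrt (A2 z w) * cbrt (A3 y w) * cbrt (A4 y z))"
      unfolding A2_def A3_def A4_def by (rule mult_left_mono[OF nn_Holder3 zero_le]) measurable
    finally show ?thesis by (simp add: mult_ac)
  qed
  have s2: "(\<integral>\<^sup>+y. cbrt (A2 z w) * (cbrt (F1 y z w) * cbrt (A3 y w) * cbrt (A4 y z)) \<partial>lborel)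
     \<le> cbrt (B3 w) * (cbrt (A2 z w) * cbrt (B1 z w) * cbrt (B4 z))" for z w
  proof -
    have "(\<integral>\<^sup>+y. cbrt (A2 z w) * (cbrt (F1 y z w) * cbrt (A3 y w) * cbrt (A4 y z)) \<partial>lborel)
      = cbrt (A2 z w) * (\<integral>\<^sup>+y. cbrt (F1 y z w) * cbrt (A3 y w) * cbrt (A4 y z) \<partial>lborel)"
      by (rule nn_integral_cmult) measurable
    also have "\<dots> \<le> cbrt (A2 z w) * (cbrt (B1 z w) * cbrt (B3 w) * cbrt (B4 z))"
      unfolding B1_def B3_def B4_def by (rule mult_left_mono[OF nn_Holder3 zero_le]) measurable
    finally show ?thesis by (simp add: mult_ac)
  qed
  have s3: "(\<integral>\<^sup>+z. cbrt (B3 w) * (cbrt (A2 z w) * cbrt (B1 z w) * cbrt (B4 z)) \<partial>lborel)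
     \<le> cbrt (\<integral>\<^sup>+z. B4 z \<partial>lborel) * (cbrt (B3 w) * cbrt (C2 w) * cbrt (C1 w))" for w
  proof -
    have "(\<integral>\<^sup>+z. cbrt (B3 w) * (cbrt (A2 z w) * cbrt (B1 z w) * cbrt (B4 z)) \<partial>lborel)
      = cbrt (B3 w) * (\<integral>\<^sup>+z. cbrt (A2 z w) * cbrt (B1 z w) * cbrt (B4 z) \<partial>lborel)"
      by (rule nn_integral_cmult) measurable
    also have "\<dots> \<le> cbrt (B3 w) * (cbrt (C2 w) * cbrt (C1 w) * cbrt (\<integral>\<^sup>+z. B4 z \<partial>lborel))"
      unfolding C1_def C2_def by (rule mult_left_mono[OF nn_Holder3 zero_le]) measurable
    finally show ?thesis by (simp add: mult_ac)
  qed
  have "(\<integral>\<^sup>+w. \<integral>\<^sup>+z. \<integral>\<^sup>+y. \<integral>\<^sup>+x. cbrt (F1 y z w) * (cbrt (F2 x z w) * cbrt (F3 x y w) * cbrt (F4 x y z)) \<partial>lborel \<partial>lborel \<partial>lborel \<partial>lborel)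
    \<le> (\<integral>\<^sup>+w. \<integral>\<^sup>+z. \<integral>\<^sup>+y. cbrt (A2 z w) * (cbrt (F1 y z w) * cbrt (A3 y w) * cbrt (A4 y z)) \<partial>lborel \<partial>lborel \<partial>lborel)"
    by (intro nn_integral_mono s1)
  also have "\<dots> \<le> (\<integral>\<^sup>+w. \<integral>\<^sup>+z. cbrt (B3 w) * (cbrt (A2 z w) * cbrt (B1 z w) * cbrt (B4 z)) \<partial>lborel \<partial>lborel)"
    by (intro nn_integral_mono s2)
  also have "\<dots> \<le> (\<integral>\<^sup>+w. cbrt (\<integral>\<^sup>+z. B4 z \<partial>lborel) * (cbrt (B3 w) * cbrt (C2 w) * cbrt (C1 w)) \<partial>lborel)"
    by (intro nn_integral_mono s3)
  also have "\<dots> = cbrt (\<integral>\<^sup>+z. B4 z \<partial>lborel) * (\<integral>\<^sup>+w. cbrt (B3 w) * cbrt (C2 w) * cbrt (C1 w) \<partial>lborel)"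
    by (rule nn_integral_cmult) measurable
  also have "\<dots> \<le> cbrt (\<integral>\<^sup>+z. B4 z \<partial>lborel) * (cbrt (\<integral>\<^sup>+w. B3 w \<partial>lborel) * cbrt (\<integral>\<^sup>+w. C2 w \<partial>lborel) * cbrt (\<integral>\<^sup>+w. C1 w \<partial>lborel))"
    by (rule mult_left_mono[OF nn_Holder3 zero_le]) measurable
  finally show ?thesis unfolding C1_def C2_def B1_def B3_def B4_def A2_def A3_def A4_def .
qed

text \<open>Bounding \<open>h\<close> once along each axis turns \<open>h ^ 4\<close> into a product
  of four functions, each independent of one coordinate. The remaining work is Fubini: the variable
  of the line integral must move to the place of its coordinate.\<close>

lemma loomis_whitney_T4:
  fixes G1 G2 G3 G4 h :: "real^4 \<Rightarrow> ennreal"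
  assumes [measurable]: "G1 \<in> borel_measurable borel" "G2 \<in> borel_measurable borel"
      "G3 \<in> borel_measurable borel" "G4 \<in> borel_measurable borel" "h \<in> borel_measurable borel"
    and h: "\<And>x y z w. h (T4 x y z w) \<le> cbrt (\<integral>\<^sup>+s. G1 (T4 s y z w) \<partial>lborel)"
      "\<And>x y z w. h (T4 x y z w) \<le> cbrt (\<integral>\<^sup>+s. G2 (T4 x s z w) \<partial>lborel)"
      "\<And>x y z w. h (T4 x y z w) \<le> cbrt (\<integral>\<^sup>+s. G3 (T4 x y s w) \<partial>lborel)"
      "\<And>x y z w. h (T4 x y z w) \<le> cbrt (\<integral>\<^sup>+s. G4 (T4 x y z s) \<partial>lborel)"
  shows "(\<integral>\<^sup>+p. h p ^ 4 \<partial>lborel) \<le> cbrt (\<integral>\<^sup>+p. G4 p \<partial>lborel) * (cbrt (\<integral>\<^sup>+p. G3 p \<partial>lborel) * cbrt (\<integral>\<^sup>+p. G2 p \<partial>lborel) * cbrt (\<integral>\<^sup>+p. G1 p \<partial>lborel))"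
proof -
  have e4: "a ^ 4 = a * (a * a * a)" for a :: ennreal by (simp add: eval_nat_numeral mult_ac)
  have "(\<integral>\<^sup>+p. h p ^ 4 \<partial>lborel) = (\<integral>\<^sup>+w. \<integral>\<^sup>+z. \<integral>\<^sup>+y. \<integral>\<^sup>+x. h (T4 x y z w) ^ 4 \<partial>lborel \<partial>lborel \<partial>lborel \<partial>lborel)"
    by (rule nn_integral_T4) measurable
  also have "\<dots> \<le> (\<integral>\<^sup>+w. \<integral>\<^sup>+z. \<integral>\<^sup>+y. \<integral>\<^sup>+x. cbrt (\<integral>\<^sup>+s. G1 (T4 s y z w) \<partial>lborel) *
      (cbrt (\<integral>\<^sup>+s. G2 (T4 x s z w) \<partial>lborel) * cbrt (\<integral>\<^sup>+s. G3 (T4 x y s w) \<partial>lborel) * cbrt (\<integral>\<^sup>+s. G4 (T4 x y z s) \<partial>lborel)) \<partial>lborel \<partial>lborel \<partial>lborel \<partial>lborel)"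
    unfolding e4 by (intro nn_integral_mono mult_mono h) auto
  also have "\<dots> \<le> cbrt (\<integral>\<^sup>+z. \<integral>\<^sup>+y. \<integral>\<^sup>+x. \<integral>\<^sup>+s. G4 (T4 x y z s) \<partial>lborel \<partial>lborel \<partial>lborel \<partial>lborel) *
     (cbrt (\<integral>\<^sup>+w. \<integral>\<^sup>+y. \<integral>\<^sup>+x. \<integral>\<^sup>+s. G3 (T4 x y s w) \<partial>lborel \<partial>lborel \<partial>lborel \<partial>lborel) *
      cbrt (\<integral>\<^sup>+w. \<integral>\<^sup>+z. \<integral>\<^sup>+x. \<integral>\<^sup>+s. G2 (T4 x s z w) \<partial>lborel \<partial>lborel \<partial>lborel \<partial>lborel) *
      cbrt (\<integral>\<^sup>+w. \<integral>\<^sup>+z. \<integral>\<^sup>+y. \<integral>\<^sup>+s. G1 (T4 s y z w) \<partial>lborel \<partial>lborel \<partial>lborel \<partial>lborel))"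
    by (rule loomis_whitney4) measurable
  also have "(\<integral>\<^sup>+w. \<integral>\<^sup>+z. \<integral>\<^sup>+y. \<integral>\<^sup>+s. G1 (T4 s y z w) \<partial>lborel \<partial>lborel \<partial>lborel \<partial>lborel) = (\<integral>\<^sup>+p. G1 p \<partial>lborel)"
    by (rule nn_integral_T4[symmetric]) measurable
  also have "(\<integral>\<^sup>+w. \<integral>\<^sup>+z. \<integral>\<^sup>+x. \<integral>\<^sup>+s. G2 (T4 x s z w) \<partial>lborel \<partial>lborel \<partial>lborel \<partial>lborel) = (\<integral>\<^sup>+p. G2 p \<partial>lborel)"
    unfolding nn_integral_T4[OF assms(2)]
    by (intro nn_integral_cong lborel_pair.Fubini') measurable
  also have "(\<integral>\<^sup>+w. \<integral>\<^sup>+y. \<integral>\<^sup>+x. \<integral>\<^sup>+s. G3 (T4 x y s w) \<partial>lborel \<partial>lborel \<partial>lborel \<partial>lborel) = (\<integral>\<^sup>+p. G3 p \<partial>lborel)"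
  proof -
    have "(\<integral>\<^sup>+w. \<integral>\<^sup>+y. \<integral>\<^sup>+x. \<integral>\<^sup>+s. G3 (T4 x y s w) \<partial>lborel \<partial>lborel \<partial>lborel \<partial>lborel)
       = (\<integral>\<^sup>+w. \<integral>\<^sup>+y. \<integral>\<^sup>+s. \<integral>\<^sup>+x. G3 (T4 x y s w) \<partial>lborel \<partial>lborel \<partial>lborel \<partial>lborel)"
      by (intro nn_integral_cong lborel_pair.Fubini') measurable
    also have "\<dots> = (\<integral>\<^sup>+w. \<integral>\<^sup>+s. \<integral>\<^sup>+y. \<integral>\<^sup>+x. G3 (T4 x y s w) \<partial>lborel \<partial>lborel \<partial>lborel \<partial>lborel)"
      by (intro nn_integral_cong lborel_pair.Fubini') measurable
    finally show ?thesis unfolding nn_integral_T4[OF assms(3)] .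
  qed
  also have "(\<integral>\<^sup>+z. \<integral>\<^sup>+y. \<integral>\<^sup>+x. \<integral>\<^sup>+s. G4 (T4 x y z s) \<partial>lborel \<partial>lborel \<partial>lborel \<partial>lborel) = (\<integral>\<^sup>+p. G4 p \<partial>lborel)"
  proof -
    have "(\<integral>\<^sup>+z. \<integral>\<^sup>+y. \<integral>\<^sup>+x. \<integral>\<^sup>+s. G4 (T4 x y z s) \<partial>lborel \<partial>lborel \<partial>lborel \<partial>lborel)
       = (\<integral>\<^sup>+z. \<integral>\<^sup>+y. \<integral>\<^sup>+s. \<integral>\<^sup>+x. G4 (T4 x y z s) \<partial>lborel \<partial>lborel \<partial>lborel \<partial>lborel)"
      by (intro nn_integral_cong lborel_pair.Fubini') measurable
    also have "\<dots> = (\<integral>\<^sup>+z. \<integral>\<^sup>+s. \<integral>\<^sup>+y. \<integral>\<^sup>+x. G4 (T4 x y z s) \<partial>lborel \<partial>lborel \<partial>lborel \<partial>lborel)"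
      by (intro nn_integral_cong lborel_pair.Fubini') measurable
    also have "\<dots> = (\<integral>\<^sup>+s. \<integral>\<^sup>+z. \<integral>\<^sup>+y. \<integral>\<^sup>+x. G4 (T4 x y z s) \<partial>lborel \<partial>lborel \<partial>lborel \<partial>lborel)"
      by (intro lborel_pair.Fubini') measurable
    finally show ?thesis unfolding nn_integral_T4[OF assms(4)] .
  qed
  finally show ?thesis .
qed

text \<open>The line bounds are applied to \<open>\<phi>^3\<close>, whose gradient is
  \<open>3 \<phi>^2\<close> times that of \<open>\<phi>\<close>. With \<open>A\<close> the integral
  of \<open>\<phi>^4\<close> and \<open>E\<close> the energy, Cauchy-Schwarz bounds each factor by
  the cube root of \<open>3 sqrt A sqrt E\<close>, hence \<open>A^3 \<le> 81 A^2 E^2\<close>.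
  Dividing by \<open>A^2\<close>, which is finite because \<phi> has bounded support, gives the
  constant \<open>81 = 3^4\<close>.\<close>

lemma sobolev_C1c:
  fixes \<phi> :: "real^4 \<Rightarrow> real"
  assumes \<phi>: "C1c \<phi>"
  shows "(LINT x|lborel. \<phi> x ^ 4) \<le> 81 * (\<Sum>b\<in>Basis. n2 (pd b \<phi>))\<^sup>2"
proof -
  define f where "f x = \<phi> x * (\<phi> x * \<phi> x)" for x
  have \<phi>1: "C_k (Suc 0) \<phi>" using \<phi> unfolding C1c_def One_nat_def by blast
  have f: "C1c f" unfolding C1c_def One_nat_def f_def
    by (intro conjI C_k_mult \<phi>1 bsupp_mult C1c_bsupp[OF \<phi>])
  have pf: "pd b f x = 3 * (\<phi> x)\<^sup>2 * pd b \<phi> x" for b x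
    unfolding f_def pd_mult[OF \<phi>1 C_k_mult[OF \<phi>1 \<phi>1]] pd_mult[OF \<phi>1 \<phi>1] by (simp add: power2_eq_square algebra_simps)
  define e where "e i = (axis i 1 :: real^4)" for i :: 4
  have eB: "e i \<in> Basis" for i by (simp add: e_def axis_in_Basis_iff)
  define G where "G i x = ennreal \<bar>pd (e i) f x\<bar>" for i x
  have Gm[measurable]: "G i \<in> borel_measurable borel" for i
    unfolding G_def using C1c_borel(2)[OF f eB[of i]] by measurable
  have \<phi>m[measurable]: "\<phi> \<in> borel_measurable borel" by (rule C1c_borel[OF \<phi>])
  define E where "E = (\<Sum>b\<in>Basis. n2 (pd b \<phi>))"
  define A where "A = (LINT x|lborel. \<phi> x ^ 4)"
  have c\<phi>: "continuous_on UNIV \<phi>" by (rule C1c_cont[OF \<phi>])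
  have Ai: "integrable lborel (\<lambda>x. \<phi> x ^ 4)"
    by (intro cc_integrable continuous_intros c\<phi> bsupp_compose0[where G="\<lambda>x. x^4"] C1c_bsupp[OF \<phi>]) simp
  have A0: "A \<ge> 0" unfolding A_def by (intro Bochner_Integration.integral_nonneg) (simp add: zero_le_even_power')
  have E0: "E \<ge> 0" unfolding E_def by (intro sum_nonneg n2_nonneg)
  have hc: "ennreal \<bar>\<phi> x\<bar> = cbrt (ennreal \<bar>f x\<bar>)" for x
  proof -
    have "\<bar>f x\<bar> = \<bar>\<phi> x\<bar> ^ 3" by (simp add: f_def abs_mult power3_eq_cube mult.assoc)
    then show ?thesis by (simp add: cbrt_ennreal real_root_power_cancel)
  qed
  have "(\<integral>\<^sup>+p. ennreal \<bar>\<phi> p\<bar> ^ 4 \<partial>lborel) \<le> cbrt (\<integral>\<^sup>+p. G 4 p \<partial>lborel) * (cbrt (\<integral>\<^sup>+p. G 3 p \<partial>lborel) * cbrt (\<integral>\<^sup>+p. G 2 p \<partial>lborel) * cbrt (\<integral>\<^sup>+p. G 1 p \<partial>lborel))"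
  proof (rule loomis_whitney_T4)
    fix x y z w
    show "ennreal \<bar>\<phi> (T4 x y z w)\<bar> \<le> cbrt (\<integral>\<^sup>+s. G 1 (T4 s y z w) \<partial>lborel)"
      unfolding hc G_def using line_bound[OF f eB[of 1], of "T4 0 y z w" x]
      by (intro cbrt_mono) (simp add: T4_def e_def add_ac)
    show "ennreal \<bar>\<phi> (T4 x y z w)\<bar> \<le> cbrt (\<integral>\<^sup>+s. G 2 (T4 x s z w) \<partial>lborel)"
      unfolding hc G_def using line_bound[OF f eB[of 2], of "T4 x 0 z w" y]
      by (intro cbrt_mono) (simp add: T4_def e_def add_ac)
    show "ennreal \<bar>\<phi> (T4 x y z w)\<bar> \<le> cbrt (\<integral>\<^sup>+s. G 3 (T4 x y s w) \<partial>lborel)"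
      unfolding hc G_def using line_bound[OF f eB[of 3], of "T4 x y 0 w" z]
      by (intro cbrt_mono) (simp add: T4_def e_def add_ac)
    show "ennreal \<bar>\<phi> (T4 x y z w)\<bar> \<le> cbrt (\<integral>\<^sup>+s. G 4 (T4 x y z s) \<partial>lborel)"
      unfolding hc G_def using line_bound[OF f eB[of 4], of "T4 x y z 0" w]
      by (intro cbrt_mono) (simp add: T4_def e_def add_ac)
  qed measurable
  also have "(\<integral>\<^sup>+p. ennreal \<bar>\<phi> p\<bar> ^ 4 \<partial>lborel) = ennreal A"
  proof -
    have "ennreal \<bar>\<phi> p\<bar> ^ 4 = ennreal (\<phi> p ^ 4)" for p by (simp add: ennreal_power)
    then show ?thesis unfolding A_def using nn_integral_eq_integral[OF Ai] by simp
  qed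
  finally have *: "ennreal A \<le> cbrt (\<integral>\<^sup>+p. G 4 p \<partial>lborel) * (cbrt (\<integral>\<^sup>+p. G 3 p \<partial>lborel) * cbrt (\<integral>\<^sup>+p. G 2 p \<partial>lborel) * cbrt (\<integral>\<^sup>+p. G 1 p \<partial>lborel))" .
  define B where "B = 3 * (sqrt A * sqrt E)"
  have B0: "B \<ge> 0" using A0 E0 by (simp add: B_def)
  have G: "cbrt (\<integral>\<^sup>+p. G i p \<partial>lborel) \<le> ennreal (root 3 B)" for i
  proof -
    have s1: "sq (\<lambda>x. (\<phi> x)\<^sup>2)" by (intro sq_cc continuous_intros c\<phi> bsupp_compose0[where G="\<lambda>x. x\<^sup>2"] C1c_bsupp[OF \<phi>]) simp
    have s2: "sq (\<lambda>x. \<bar>pd (e i) \<phi> x\<bar>)" by (intro sq_abs C1c_sq[OF \<phi>] eB)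
    have i: "integrable lborel (\<lambda>x. 3 * ((\<phi> x)\<^sup>2 * \<bar>pd (e i) \<phi> x\<bar>))" by (intro integrable_mult_right sq_mult_integrable s1 s2)
    have "(\<integral>\<^sup>+p. G i p \<partial>lborel) = (\<integral>\<^sup>+p. ennreal (3 * ((\<phi> p)\<^sup>2 * \<bar>pd (e i) \<phi> p\<bar>)) \<partial>lborel)"
      unfolding G_def pf by (simp add: abs_mult mult.assoc)
    also have "\<dots> = ennreal (LINT x|lborel. 3 * ((\<phi> x)\<^sup>2 * \<bar>pd (e i) \<phi> x\<bar>))"
      by (rule nn_integral_eq_integral[OF i]) simp
    also have "\<dots> \<le> ennreal B"
    proof (rule ennreal_leI)
      have "(LINT x|lborel. (\<phi> x)\<^sup>2 * \<bar>pd (e i) \<phi> x\<bar>) \<le> sqrt (n2 (\<lambda>x. (\<phi> x)\<^sup>2)) * sqrt (n2 (\<lambda>x. \<bar>pd (e i) \<phi> x\<bar>))"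
        using sq_CS[OF s1 s2] by linarith
      also have "n2 (\<lambda>x. (\<phi> x)\<^sup>2) = A" by (simp add: n2_def A_def)
      also have "n2 (\<lambda>x. \<bar>pd (e i) \<phi> x\<bar>) = n2 (pd (e i) \<phi>)" by (simp add: n2_def)
      also have "sqrt A * sqrt (n2 (pd (e i) \<phi>)) \<le> sqrt A * sqrt E"
        unfolding E_def using eB A0 by (intro mult_left_mono real_sqrt_le_mono member_le_sum n2_nonneg) auto
      finally show "(LINT x|lborel. 3 * ((\<phi> x)\<^sup>2 * \<bar>pd (e i) \<phi> x\<bar>)) \<le> B" by (simp add: B_def)
    qed
    finally show ?thesis using cbrt_mono cbrt_ennreal[OF B0] by metis
  qed
  have "ennreal A \<le> ennreal (root 3 B) * (ennreal (root 3 B) * ennreal (root 3 B) * ennreal (root 3 B))"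
    by (rule order_trans[OF *]) (intro mult_mono G; simp)
  also have "\<dots> = ennreal (root 3 B ^ 4)" using B0 by (simp add: ennreal_mult[symmetric] eval_nat_numeral mult_ac)
  finally have "A \<le> root 3 B ^ 4" using B0 by (simp add: ennreal_le_iff)
  then have "A ^ 3 \<le> (root 3 B ^ 4) ^ 3" using A0 by (intro power_mono)
  also have "\<dots> = (root 3 B ^ 3) ^ 4" by (simp add: power_mult[symmetric])
  also have "\<dots> = B ^ 4" using B0 by simp
  also have "\<dots> = 81 * (sqrt A ^ 4) * (sqrt E ^ 4)" by (simp add: B_def power_mult_distrib)
  also have "sqrt A ^ 4 = A\<^sup>2" using A0 by (metis real_sqrt_pow2 power_even_eq numeral_Bit0 mult_2 power_mult)
  also have "sqrt E ^ 4 = E\<^sup>2" using E0 by (metis real_sqrt_pow2 power_even_eq numeral_Bit0 mult_2 power_mult)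
  finally have 1: "A ^ 3 \<le> 81 * A\<^sup>2 * E\<^sup>2" .
  have "A \<le> 81 * E\<^sup>2"
  proof (cases "A = 0")
    case False
    then have "A\<^sup>2 > 0" by simp
    have "A\<^sup>2 * A \<le> A\<^sup>2 * (81 * E\<^sup>2)" using 1 by (simp add: power3_eq_cube power2_eq_square mult_ac)
    then show ?thesis using \<open>A\<^sup>2 > 0\<close> by (simp only: mult_le_cancel_left_pos)
  qed simp
  then show ?thesis by (simp add: A_def E_def)
qed

text \<open>Fatou's lemma along an almost everywhere convergent subsequence of test functions whose
  energies converge.\<close>

lemma sobolev:
  fixes u :: "real^4 \<Rightarrow> real"
  assumes W: "W u g"
  shows "integrable lborel (\<lambda>x. u x ^ 4)" "(LINT x|lborel. u x ^ 4) \<le> 81 * (\<Sum>b\<in>Basis. n2 (g b))\<^sup>2"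
proof -
  obtain \<phi> where \<phi>: "\<And>n. test_function (\<phi> n)" "l2lim \<phi> u" "\<And>b. b \<in> Basis \<Longrightarrow> l2lim (\<lambda>n. pd b (\<phi> n)) (g b)"
    using W_dense[OF W] by blast
  obtain r where r: "strict_mono r" "AE x in lborel. (\<lambda>n. \<phi> (r n) x) \<longlonglongrightarrow> u x" using l2lim_AE[OF \<phi>(2)] by blast
  have um[measurable]: "u \<in> borel_measurable borel" by (rule sq_borel[OF WD(1)[OF W]])
  have \<phi>m[measurable]: "\<phi> n \<in> borel_measurable borel" for n by (rule test_borel[OF \<phi>(1)])
  define E where "E n = (\<Sum>b\<in>Basis. n2 (pd b (\<phi> (r n))))" for n
  have E: "E \<longlonglongrightarrow> (\<Sum>b\<in>Basis. n2 (g b))"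
    unfolding E_def by (intro tendsto_sum l2lim_n2[OF l2lim_subseq[OF \<phi>(3) r(1)]])
  have "(\<integral>\<^sup>+x. ennreal (u x ^ 4) \<partial>lborel) = (\<integral>\<^sup>+x. liminf (\<lambda>n. ennreal (\<phi> (r n) x ^ 4)) \<partial>lborel)"
  proof (rule nn_integral_cong_AE)
    show "AE x in lborel. ennreal (u x ^ 4) = liminf (\<lambda>n. ennreal (\<phi> (r n) x ^ 4))"
      using r(2) by eventually_elim (intro lim_imp_Liminf[symmetric] trivial_limit_sequentially tendsto_ennrealI tendsto_power)
  qed
  also have "\<dots> \<le> liminf (\<lambda>n. \<integral>\<^sup>+x. ennreal (\<phi> (r n) x ^ 4) \<partial>lborel)"
    by (rule nn_integral_liminf) measurable
  also have "\<dots> \<le> liminf (\<lambda>n. ennreal (81 * (E n)\<^sup>2))"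
  proof (intro Liminf_mono always_eventually allI)
    fix n
    have i: "integrable lborel (\<lambda>x. \<phi> (r n) x ^ 4)"
      by (intro cc_integrable continuous_intros test_cont \<phi> bsupp_compose0[where G="\<lambda>x. x^4"] test_bsupp) simp
    have "(\<integral>\<^sup>+x. ennreal (\<phi> (r n) x ^ 4) \<partial>lborel) = ennreal (LINT x|lborel. \<phi> (r n) x ^ 4)"
      by (rule nn_integral_eq_integral[OF i]) (simp add: zero_le_even_power')
    also have "\<dots> \<le> ennreal (81 * (E n)\<^sup>2)"
      unfolding E_def by (intro ennreal_leI sobolev_C1c test_C1c \<phi>)
    finally show "(\<integral>\<^sup>+x. ennreal (\<phi> (r n) x ^ 4) \<partial>lborel) \<le> ennreal (81 * (E n)\<^sup>2)" .
  qed
  also have "\<dots> = ennreal (81 * (\<Sum>b\<in>Basis. n2 (g b))\<^sup>2)"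
    by (intro lim_imp_Liminf trivial_limit_sequentially tendsto_ennrealI tendsto_mult tendsto_const tendsto_power E)
  finally have *: "(\<integral>\<^sup>+x. ennreal (u x ^ 4) \<partial>lborel) \<le> ennreal (81 * (\<Sum>b\<in>Basis. n2 (g b))\<^sup>2)" .
  show i: "integrable lborel (\<lambda>x. u x ^ 4)"
    by (rule integrableI_bounded) (use * in \<open>auto simp: zero_le_even_power' intro: le_less_trans\<close>)
  have "ennreal (LINT x|lborel. u x ^ 4) \<le> ennreal (81 * (\<Sum>b\<in>Basis. n2 (g b))\<^sup>2)"
    using * nn_integral_eq_integral[OF i] by (simp add: zero_le_even_power')
  then show "(LINT x|lborel. u x ^ 4) \<le> 81 * (\<Sum>b\<in>Basis. n2 (g b))\<^sup>2"
    by (subst (asm) ennreal_le_iff) auto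
qed

section \<open>Weak solutions and the Brezis--Kato bootstrap\<close>

definition nonlin :: "real \<Rightarrow> real \<Rightarrow> real \<Rightarrow> real \<Rightarrow> real \<Rightarrow> real \<Rightarrow> real" where
  "nonlin \<mu> \<alpha> \<beta> p a b = \<mu> * a ^ 3 + \<alpha> * (\<bar>a\<bar> powr (p - 2) * a) + \<beta> * b\<^sup>2 * a"

definition weq :: "real \<Rightarrow> ('a::euclidean_space \<Rightarrow> real) \<Rightarrow> ('a \<Rightarrow> 'a \<Rightarrow> real) \<Rightarrow> ('a \<Rightarrow> real) \<Rightarrow> bool" where
  "weq l u g F \<longleftrightarrow> W u g \<and> (\<forall>\<phi>. test_function \<phi> \<longrightarrow>
     (\<Sum>b\<in>Basis. LINT x|lborel. g b x * pd b \<phi> x) + l * (LINT x|lborel. u x * \<phi> x) = (LINT x|lborel. F x * \<phi> x))"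

lemma powr_le_1_sq:
  fixes a :: real assumes "2 < p" "p < 4"
  shows "\<bar>a\<bar> powr (p - 2) \<le> 1 + a\<^sup>2"
proof (cases "\<bar>a\<bar> \<le> 1")
  case True
  then have "\<bar>a\<bar> powr (p - 2) \<le> 1 powr (p - 2)" using assms by (intro powr_mono2) auto
  then show ?thesis by (simp add: add_increasing2)
next
  case False
  then have "\<bar>a\<bar> powr (p - 2) \<le> \<bar>a\<bar> powr 2" using assms by (intro powr_mono) auto
  then show ?thesis using False by simp
qed

text \<open>The right-hand side is square integrable once \<open>u ^ 4\<close> and
  \<open>v ^ 4\<close> are. The arithmetic-geometric mean inequality turns \<open>a^3\<close> into
  \<open>a^2 + a^4\<close> and \<open>b^2 a\<close> into \<open>a^2 + b^4\<close>; the linear term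
  controls the power nonlinearity where \<open>x\<close> is small.\<close>

lemma nonlin_bound:
  fixes \<mu> \<alpha> \<beta> p x y :: real
  assumes \<mu>: "\<mu> \<ge> 0" and \<beta>: "\<beta> \<ge> 0" and p: "2 < p" "p < 4"
  shows "\<bar>nonlin \<mu> \<alpha> \<beta> p x y\<bar> \<le> \<bar>\<alpha>\<bar> * \<bar>x\<bar> + (\<mu> + \<bar>\<alpha>\<bar> + \<beta>) * (x\<^sup>2 + x ^ 4 + y ^ 4)"
proof -
  define a b where "a = \<bar>x\<bar>" "b = \<bar>y\<bar>"
  have a: "a \<ge> 0" "b \<ge> 0" by (auto simp: a_b_def)
  define h where "h = a\<^sup>2 + a ^ 4 + b ^ 4"
  have pa: "0 \<le> a\<^sup>2" "0 \<le> a^4" "0 \<le> b^4" using a by auto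
  have a3: "a ^ 3 \<le> h"
  proof -
    have "0 \<le> (a - a\<^sup>2)\<^sup>2" by simp
    then have "2 * a ^ 3 \<le> a\<^sup>2 + a ^ 4" by (simp add: power2_eq_square power3_eq_cube eval_nat_numeral algebra_simps)
    then show ?thesis unfolding h_def using pa by linarith
  qed
  have ab: "b\<^sup>2 * a \<le> h"
  proof -
    have "0 \<le> (a - b\<^sup>2)\<^sup>2" by simp
    then have "2 * (b\<^sup>2 * a) \<le> a\<^sup>2 + b ^ 4" by (simp add: power2_eq_square eval_nat_numeral algebra_simps)
    moreover have "0 \<le> b\<^sup>2 * a" using a by simp
    ultimately show ?thesis unfolding h_def using pa by linarith
  qed
  have ap: "a powr (p - 2) * a \<le> a + h"
  proof -
    have "a powr (p - 2) \<le> 1 + a\<^sup>2" using powr_le_1_sq[OF p, of x] by (simp add: a_b_def)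
    then have "a powr (p - 2) * a \<le> (1 + a\<^sup>2) * a" using a by (intro mult_right_mono)
    also have "\<dots> = a + a ^ 3" by (simp add: power2_eq_square power3_eq_cube algebra_simps)
    finally show ?thesis using a3 by linarith
  qed
  have "\<bar>nonlin \<mu> \<alpha> \<beta> p x y\<bar> \<le> \<bar>\<mu> * x ^ 3\<bar> + \<bar>\<alpha> * (\<bar>x\<bar> powr (p - 2) * x)\<bar> + \<bar>\<beta> * y\<^sup>2 * x\<bar>"
    unfolding nonlin_def by linarith
  also have "\<dots> = \<mu> * a ^ 3 + \<bar>\<alpha>\<bar> * (a powr (p - 2) * a) + \<beta> * (b\<^sup>2 * a)"
    using \<mu> \<beta> by (simp add: abs_mult power_abs a_b_def mult.assoc)
  also have "\<dots> \<le> \<mu> * h + \<bar>\<alpha>\<bar> * (a + h) + \<beta> * h"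
    using \<mu> \<beta> a3 ab ap by (intro add_mono mult_left_mono) auto
  also have "\<dots> = \<bar>\<alpha>\<bar> * \<bar>x\<bar> + (\<mu> + \<bar>\<alpha>\<bar> + \<beta>) * (x\<^sup>2 + x ^ 4 + y ^ 4)"
    by (simp add: h_def a_b_def algebra_simps)
  finally show ?thesis .
qed

lemma sq_mult_L4:
  assumes "sq (\<lambda>x. (u x)\<^sup>2)" "sq (\<lambda>x. (w x)\<^sup>2)" "u \<in> borel_measurable borel" "w \<in> borel_measurable borel"
  shows "sq (\<lambda>x. u x * w x)"
proof (rule sq_le[OF sq_add[OF assms(1,2)]])
  note [measurable] = assms(3,4)
  show "(\<lambda>x. u x * w x) \<in> borel_measurable borel" by measurable
  have "\<bar>a * b\<bar> \<le> \<bar>a\<^sup>2 + b\<^sup>2\<bar>" for a b :: real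
  proof -
    have "2 * (\<bar>a\<bar> * \<bar>b\<bar>) \<le> a\<^sup>2 + b\<^sup>2" using sum_squares_bound[of "\<bar>a\<bar>" "\<bar>b\<bar>"] by (simp add: mult.assoc)
    moreover have "0 \<le> \<bar>a\<bar> * \<bar>b\<bar>" by simp
    ultimately show ?thesis unfolding abs_mult by linarith
  qed
  then show "AE x in lborel. \<bar>u x * w x\<bar> \<le> \<bar>(u x)\<^sup>2 + (w x)\<^sup>2\<bar>" by simp
qed

lemma W_L4:
  fixes u :: "real^4 \<Rightarrow> real"
  assumes "W u g" shows "sq (\<lambda>x. (u x)\<^sup>2)" "n2 (\<lambda>x. (u x)\<^sup>2) \<le> 81 * (\<Sum>b\<in>Basis. n2 (g b))\<^sup>2"
  using sobolev[OF assms] sq_borel[OF WD(1)[OF assms]] by (auto simp: sq_def n2_def)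

text \<open>With \<open>u\<close> merely in \<open>L^4\<close>, convergence of
  \<open>\<phi> n\<close> in \<open>L^4\<close> is needed. It follows from convergence of the
  gradients by the Sobolev inequality for \<open>\<phi> n - w\<close>, whose constant 81 enters as
  \<open>9 = sqrt 81\<close>.\<close>

lemma l2lim_mult_L4:
  fixes u :: "real^4 \<Rightarrow> real"
  assumes u: "sq (\<lambda>x. (u x)\<^sup>2)" "u \<in> borel_measurable borel" and W: "W w k"
    and \<phi>: "\<And>n. test_function (\<phi> n)" "\<And>b. b \<in> Basis \<Longrightarrow> l2lim (\<lambda>n. pd b (\<phi> n)) (k b)"
  shows "l2lim (\<lambda>n x. u x * \<phi> n x) (\<lambda>x. u x * w x)"
proof (rule l2limI)
  have wb: "w \<in> borel_measurable borel" by (rule sq_borel[OF WD(1)[OF W]])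
  have Wn: "W (\<lambda>x. \<phi> n x - w x) (\<lambda>b x. pd b (\<phi> n) x - k b x)" for n by (intro W_diff W_test \<phi> W)
  show "sq (\<lambda>x. u x * \<phi> n x)" for n by (intro sq_mult_L4 u W_L4[OF W_test] \<phi> test_borel)
  show "sq (\<lambda>x. u x * w x)" by (intro sq_mult_L4 u W_L4[OF W] wb)
  show "n2 (\<lambda>x. u x * \<phi> n x - u x * w x) \<le> sqrt (n2 (\<lambda>x. (u x)\<^sup>2)) * (9 * (\<Sum>b\<in>Basis. n2 (\<lambda>x. pd b (\<phi> n) x - k b x)))" for n
  proof -
    define E where "E = (\<Sum>b\<in>Basis. n2 (\<lambda>x. pd b (\<phi> n) x - k b x))"
    have E0: "E \<ge> 0" unfolding E_def by (intro sum_nonneg n2_nonneg)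
    have "n2 (\<lambda>x. u x * \<phi> n x - u x * w x) = (LINT x|lborel. (u x)\<^sup>2 * (\<phi> n x - w x)\<^sup>2)"
      unfolding n2_def by (simp add: right_diff_distrib[symmetric] power_mult_distrib)
    also have "\<dots> \<le> sqrt (n2 (\<lambda>x. (u x)\<^sup>2)) * sqrt (n2 (\<lambda>x. (\<phi> n x - w x)\<^sup>2))"
      using sq_CS[OF u(1) W_L4(1)[OF Wn]] by (rule order_trans[OF abs_ge_self])
    also have "\<dots> \<le> sqrt (n2 (\<lambda>x. (u x)\<^sup>2)) * (9 * E)"
    proof (intro mult_left_mono)
      have "n2 (\<lambda>x. (\<phi> n x - w x)\<^sup>2) \<le> (9 * E)\<^sup>2" using W_L4(2)[OF Wn, of n] unfolding E_def power_mult_distrib by simp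
      then show "sqrt (n2 (\<lambda>x. (\<phi> n x - w x)\<^sup>2)) \<le> 9 * E" using E0 by (intro real_le_lsqrt) (auto simp: n2_nonneg)
    qed (simp add: n2_nonneg)
    finally show ?thesis by (simp add: E_def)
  qed
  have "(\<lambda>n. \<Sum>b\<in>Basis. n2 (\<lambda>x. pd b (\<phi> n) x - k b x)) \<longlonglongrightarrow> (\<Sum>b\<in>(Basis::(real^4) set). 0)"
    by (intro tendsto_sum) (use \<phi>(2) in \<open>auto simp: l2lim_def\<close>)
  then have "(\<lambda>n. sqrt (n2 (\<lambda>x. (u x)\<^sup>2)) * (9 * (\<Sum>b\<in>Basis. n2 (\<lambda>x. pd b (\<phi> n) x - k b x)))) \<longlonglongrightarrow> sqrt (n2 (\<lambda>x. (u x)\<^sup>2)) * (9 * 0)"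
    by (intro tendsto_mult tendsto_const) simp
  then show "(\<lambda>n. sqrt (n2 (\<lambda>x. (u x)\<^sup>2)) * (9 * (\<Sum>b\<in>Basis. n2 (\<lambda>x. pd b (\<phi> n) x - k b x)))) \<longlonglongrightarrow> 0" by simp
qed

text \<open>A single equation in which \<open>v\<close> is only a given \<open>H^1\<close>
  coefficient. The system is two copies with the roles exchanged, so the bootstrap and the
  positivity argument are proved once.\<close>

locale eqn =
  fixes \<mu> \<alpha> \<beta> p l :: real and u v :: "real^4 \<Rightarrow> real" and g k :: "real^4 \<Rightarrow> real^4 \<Rightarrow> real"
  assumes \<mu>: "\<mu> \<ge> 0" and \<alpha>: "\<alpha> \<le> 0" and \<beta>: "\<beta> \<ge> 0" and p: "2 < p" "p < 4"
    and eq: "weq l u g (\<lambda>x. nonlin \<mu> \<alpha> \<beta> p (u x) (v x))" and Wv: "W v k"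
begin

lemma Wu: "W u g" using eq by (simp add: weq_def)

lemma ub[measurable]: "u \<in> borel_measurable borel" and vb[measurable]: "v \<in> borel_measurable borel"
  using sq_borel[OF WD(1)[OF Wu]] sq_borel[OF WD(1)[OF Wv]] .

abbreviation F where "F x \<equiv> nonlin \<mu> \<alpha> \<beta> p (u x) (v x)"

lemma Fb[measurable]: "(\<lambda>x. F x) \<in> borel_measurable borel" unfolding nonlin_def by measurable

text \<open>The bounded part \<open>q1\<close> is split off because \<open>|u|\<close> to the power \<open>p - 2\<close> need not be square
  integrable where \<open>u\<close> is small.\<close>

definition q0 where "q0 x = \<mu> * (u x)\<^sup>2 + \<alpha> * (\<bar>u x\<bar> powr (p - 2) - min 1 (\<bar>u x\<bar> powr (p - 2))) + \<beta> * (v x)\<^sup>2"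
definition q1 where "q1 x = \<alpha> * min 1 (\<bar>u x\<bar> powr (p - 2))"

lemma qb[measurable]: "q0 \<in> borel_measurable borel" "q1 \<in> borel_measurable borel"
  unfolding q0_def q1_def by measurable

text \<open>For \<open>w\<close> in \<open>H^1\<close> each of \<open>q0\<close>,
  \<open>u w\<close>, \<open>q1 u\<close> and \<open>w\<close> is square integrable, so this
  splitting gives the integrability of \<open>F w\<close> and its convergence when \<open>w\<close>
  is approximated.\<close>

lemma F_split: "F x * w = q0 x * (u x * w) + (q1 x * u x) * w"
  unfolding nonlin_def q0_def q1_def by (simp add: algebra_simps power2_eq_square power3_eq_cube)

lemma sq_q0: "sq q0"
proof (rule sq_le)
  show "sq (\<lambda>x. (\<mu> + \<bar>\<alpha>\<bar>) * (u x)\<^sup>2 + \<beta> * (v x)\<^sup>2)" by (intro sq_add sq_cmult W_L4[OF Wu] W_L4[OF Wv])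
  show "AE x in lborel. \<bar>q0 x\<bar> \<le> \<bar>(\<mu> + \<bar>\<alpha>\<bar>) * (u x)\<^sup>2 + \<beta> * (v x)\<^sup>2\<bar>"
  proof (rule AE_I2)
    fix x
    define m where "m = \<bar>u x\<bar> powr (p - 2) - min 1 (\<bar>u x\<bar> powr (p - 2))"
    have m: "0 \<le> m" "m \<le> (u x)\<^sup>2" unfolding m_def using powr_le_1_sq[OF p, of "u x"] by (auto simp: min_def)
    have 1: "0 \<le> \<bar>\<alpha>\<bar> * m" "\<bar>\<alpha>\<bar> * m \<le> \<bar>\<alpha>\<bar> * (u x)\<^sup>2" using m by (auto intro: mult_left_mono)
    have 2: "0 \<le> \<mu> * (u x)\<^sup>2" "0 \<le> \<beta> * (v x)\<^sup>2" using \<mu> \<beta> by auto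
    have "\<alpha> * m = - (\<bar>\<alpha>\<bar> * m)" using \<alpha> by simp
    then show "\<bar>q0 x\<bar> \<le> \<bar>(\<mu> + \<bar>\<alpha>\<bar>) * (u x)\<^sup>2 + \<beta> * (v x)\<^sup>2\<bar>"
      unfolding q0_def m_def[symmetric] distrib_right using 1 2 by linarith
  qed
qed measurable

lemma sq_q1u: "sq (\<lambda>x. q1 x * u x)"
proof (rule sq_bdd_mult[OF WD(1)[OF Wu] qb(2), of "\<bar>\<alpha>\<bar>"])
  fix x
  have "\<bar>min 1 (\<bar>u x\<bar> powr (p - 2))\<bar> \<le> 1" by auto
  then show "\<bar>q1 x\<bar> \<le> \<bar>\<alpha>\<bar>" unfolding q1_def abs_mult using mult_left_mono[of _ 1 "\<bar>\<alpha>\<bar>"] by fastforce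
qed

lemma F_integrable: "W w h \<Longrightarrow> integrable lborel (\<lambda>x. F x * w x)"
  unfolding F_split
  by (intro Bochner_Integration.integrable_add sq_mult_integrable sq_q0 sq_q1u sq_mult_L4 W_L4[OF Wu] W_L4 ub WD(1)
      sq_borel[OF WD(1)]) auto

text \<open>By density the equation may be tested with arbitrary \<open>H^1\<close> functions, in
  particular with nonlinear functions of the solution. In the critical part \<open>q0 u w\<close>
  the limit is taken by means of \<open>l2lim_mult_L4\<close>, that is, through the Sobolev
  inequality.\<close>

lemma weq_ext:
  assumes W: "W w h"
  shows "(\<Sum>b\<in>Basis. LINT x|lborel. g b x * h b x) + l * (LINT x|lborel. u x * w x) = (LINT x|lborel. F x * w x)"
proof -
  obtain \<phi> where \<phi>: "\<And>n. test_function (\<phi> n)" "l2lim \<phi> w" "\<And>b. b \<in> Basis \<Longrightarrow> l2lim (\<lambda>n. pd b (\<phi> n)) (h b)"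
    using W_dense[OF W] by blast
  have wb: "w \<in> borel_measurable borel" by (rule sq_borel[OF WD(1)[OF W]])
  have *: "(\<Sum>b\<in>Basis. LINT x|lborel. g b x * pd b (\<phi> n) x) + l * (LINT x|lborel. u x * \<phi> n x) = (LINT x|lborel. F x * \<phi> n x)" for n
    using eq \<phi>(1) by (simp add: weq_def)
  have "(\<lambda>n. (\<Sum>b\<in>Basis. LINT x|lborel. g b x * pd b (\<phi> n) x) + l * (LINT x|lborel. u x * \<phi> n x)) \<longlonglongrightarrow>
     (\<Sum>b\<in>Basis. LINT x|lborel. g b x * h b x) + l * (LINT x|lborel. u x * w x)"
    by (intro tendsto_add tendsto_sum tendsto_mult tendsto_const l2lim_integral[OF l2lim_const] \<phi> WD(1)[OF Wu] WD(2)[OF Wu])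
  moreover have "(\<lambda>n. LINT x|lborel. F x * \<phi> n x) \<longlonglongrightarrow> (LINT x|lborel. F x * w x)"
  proof -
    have l: "l2lim (\<lambda>n x. u x * \<phi> n x) (\<lambda>x. u x * w x)"
      by (rule l2lim_mult_L4[OF W_L4(1)[OF Wu] ub W \<phi>(1,3)])
    have "(\<lambda>n. (LINT x|lborel. q0 x * (u x * \<phi> n x)) + (LINT x|lborel. (q1 x * u x) * \<phi> n x)) \<longlonglongrightarrow>
       (LINT x|lborel. q0 x * (u x * w x)) + (LINT x|lborel. (q1 x * u x) * w x)"
      by (intro tendsto_add l2lim_integral[OF l2lim_const[OF sq_q0] l] l2lim_integral[OF l2lim_const[OF sq_q1u] \<phi>(2)])
    moreover have "(LINT x|lborel. F x * \<phi> n x) = (LINT x|lborel. q0 x * (u x * \<phi> n x)) + (LINT x|lborel. (q1 x * u x) * \<phi> n x)" for n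
      unfolding F_split
      by (intro Bochner_Integration.integral_add sq_mult_integrable[OF sq_q0 l2lim_sq(1)[OF l]] sq_mult_integrable[OF sq_q1u l2lim_sq(1)[OF \<phi>(2)]])
    moreover have "(LINT x|lborel. F x * w x) = (LINT x|lborel. q0 x * (u x * w x)) + (LINT x|lborel. (q1 x * u x) * w x)"
      unfolding F_split
      by (intro Bochner_Integration.integral_add sq_mult_integrable[OF sq_q0 l2lim_sq(2)[OF l]] sq_mult_integrable[OF sq_q1u l2lim_sq(2)[OF \<phi>(2)]])
    ultimately show ?thesis by simp
  qed
  ultimately show ?thesis unfolding * by (rule LIMSEQ_unique)
qed

end

text \<open>\<open>bkG d\<close> truncates \<open>s\<^sup>3\<close> to a function with bounded derivative. Testing with \<open>bkG d u\<close>
  bounds the gradient of \<open>bkP d u\<close>, a truncation of \<open>u\<^sup>2\<close>, since \<open>(bkP' d)\<^sup>2 \<le> 2 bkG' d\<close>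
  and \<open>s bkG d s = (bkP d s)\<^sup>2\<close>.\<close>

definition bkG :: "real \<Rightarrow> real \<Rightarrow> real" where "bkG d s = s ^ 3 / (1 + d * s\<^sup>2)"
definition bkG' :: "real \<Rightarrow> real \<Rightarrow> real" where "bkG' d s = s\<^sup>2 * (3 + d * s\<^sup>2) / (1 + d * s\<^sup>2)\<^sup>2"
definition bkP :: "real \<Rightarrow> real \<Rightarrow> real" where "bkP d s = s\<^sup>2 / sqrt (1 + d * s\<^sup>2)"
definition bkP' :: "real \<Rightarrow> real \<Rightarrow> real" where "bkP' d s = s * (2 + d * s\<^sup>2) / ((1 + d * s\<^sup>2) * sqrt (1 + d * s\<^sup>2))"

lemma bk_pos: "d > 0 \<Longrightarrow> 1 + d * s\<^sup>2 > (0::real)"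
  by (smt (verit) mult_nonneg_nonneg zero_le_power2)

lemma bkG_deriv: "d > 0 \<Longrightarrow> (bkG d has_real_derivative bkG' d s) (at s)"
  unfolding bkG_def[abs_def] bkG'_def using bk_pos[of d s]
  by (auto intro!: derivative_eq_intros simp: power2_eq_square power3_eq_cube field_simps)

lemma bkP_deriv:
  assumes d: "d > 0" shows "(bkP d has_real_derivative bkP' d s) (at s)"
proof -
  define r where "r = sqrt (1 + d * s\<^sup>2)"
  have r: "r > 0" "1 + d * s\<^sup>2 = r * r" using bk_pos[OF d, of s] by (auto simp: r_def)
  have "((\<lambda>s. s\<^sup>2 / sqrt (1 + d * s\<^sup>2)) has_real_derivative (2 * s * r - s\<^sup>2 * (d * (2 * s) * (inverse r / 2))) / (r * r)) (at s)"
    using bk_pos[OF d, of s] r(1) unfolding r_def by (auto intro!: derivative_eq_intros simp: power2_eq_square)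
  also have "(2 * s * r - s\<^sup>2 * (d * (2 * s) * (inverse r / 2))) / (r * r) = bkP' d s"
  proof -
    have "(2 * s * r - s\<^sup>2 * (d * (2 * s) * (inverse r / 2))) / (r * r) = s * (2 * (r * r) - d * s\<^sup>2) / ((r * r) * r)"
      using r(1) by (simp add: field_simps power2_eq_square)
    also have "2 * (r * r) - d * s\<^sup>2 = 2 + d * s\<^sup>2" using r(2) by simp
    finally show ?thesis unfolding bkP'_def r(2) using r(1) by simp
  qed
  finally show ?thesis unfolding bkP_def[abs_def] .
qed

lemma bk_cont: "d > 0 \<Longrightarrow> continuous_on UNIV (bkG' d)" "d > 0 \<Longrightarrow> continuous_on UNIV (bkP' d)"
  unfolding bkG'_def[abs_def] bkP'_def[abs_def] using bk_pos[of d]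
  by (auto intro!: continuous_intros simp: less_imp_neq[THEN not_sym])

lemma bkG_bound:
  assumes d: "d > 0" shows "\<bar>bkG' d s\<bar> \<le> 3 / d" "bkG' d s \<ge> 0"
proof -
  have t: "1 + d * s\<^sup>2 > 0" using bk_pos[OF d] .
  have t0: "d * s\<^sup>2 \<ge> 0" using d by simp
  show 0: "bkG' d s \<ge> 0" unfolding bkG'_def using d t0 by (intro divide_nonneg_nonneg mult_nonneg_nonneg) auto
  have "d * (s\<^sup>2 * (3 + d * s\<^sup>2)) \<le> 3 * (1 + d * s\<^sup>2)\<^sup>2"
  proof -
    have "d * (s\<^sup>2 * (3 + d * s\<^sup>2)) = 3 * (d * s\<^sup>2) + (d * s\<^sup>2)\<^sup>2" by (simp add: power2_eq_square algebra_simps)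
    also have "\<dots> \<le> 3 + 6 * (d * s\<^sup>2) + 3 * (d * s\<^sup>2)\<^sup>2" using t0 zero_le_power2[of "d * s\<^sup>2"] by linarith
    also have "\<dots> = 3 * (1 + d * s\<^sup>2)\<^sup>2" by (simp add: power2_eq_square algebra_simps)
    finally show ?thesis .
  qed
  then have "bkG' d s \<le> 3 / d" unfolding bkG'_def using t d by (simp add: divide_le_eq le_divide_eq mult.commute)
  then show "\<bar>bkG' d s\<bar> \<le> 3 / d" using 0 by simp
qed

text \<open>With \<open>t = d s^2\<close> this reduces to
  \<open>(2 + t)^2 \<le> 2 (3 + t) (1 + t)\<close>, where the difference of the two sides is
  \<open>2 + 4 t + t^2\<close>.\<close>

lemma bkP'_sq:
  assumes d: "d > 0" shows "(bkP' d s)\<^sup>2 \<le> 2 * bkG' d s"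
proof -
  define t where "t = d * s\<^sup>2"
  have t0: "t \<ge> 0" using d by (simp add: t_def)
  have "(bkP' d s)\<^sup>2 = s\<^sup>2 * (2 + t)\<^sup>2 / ((1 + t)\<^sup>2 * (1 + t))"
    unfolding bkP'_def t_def[symmetric] using t0 by (simp add: power_mult_distrib power_divide)
  also have "\<dots> \<le> 2 * (s\<^sup>2 * (3 + t) / (1 + t)\<^sup>2)"
  proof -
    have "(2 + t)\<^sup>2 \<le> 2 * ((3 + t) * (1 + t))" using t0 zero_le_power2[of t] by (simp add: power2_eq_square algebra_simps)
    then have "s\<^sup>2 * (2 + t)\<^sup>2 \<le> s\<^sup>2 * (2 * ((3 + t) * (1 + t)))" by (intro mult_left_mono) auto
    then have "s\<^sup>2 * (2 + t)\<^sup>2 / ((1 + t)\<^sup>2 * (1 + t)) \<le> s\<^sup>2 * (2 * ((3 + t) * (1 + t))) / ((1 + t)\<^sup>2 * (1 + t))"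
      using t0 by (intro divide_right_mono) auto
    also have "\<dots> = 2 * (s\<^sup>2 * (3 + t) / (1 + t)\<^sup>2)"
    proof -
      have "x * (2 * (y * c)) / (c\<^sup>2 * c) = 2 * (x * y / c\<^sup>2)" if "c > 0" for x y c :: real
        using that by (simp add: power2_eq_square)
      then show ?thesis using t0 by simp
    qed
    finally show ?thesis .
  qed
  also have "\<dots> = 2 * bkG' d s" by (simp add: bkG'_def t_def)
  finally show ?thesis .
qed

lemma bkP'_bound: assumes d: "d > 0" shows "\<bar>bkP' d s\<bar> \<le> sqrt (6 / d)"
proof -
  have "(bkP' d s)\<^sup>2 \<le> 6 / d" using bkP'_sq[OF d, of s] bkG_bound(1)[OF d, of s] by simp
  then show ?thesis using real_sqrt_le_mono by fastforce
qed

lemma bk_sG: "d > 0 \<Longrightarrow> s * bkG d s = (bkP d s)\<^sup>2"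
  using bk_pos[of d s] by (simp add: bkG_def bkP_def power_divide power2_eq_square power3_eq_cube)

lemma bkP_le: assumes d: "d > 0" shows "0 \<le> bkP d s" "bkP d s \<le> s\<^sup>2"
proof -
  have "sqrt (1 + d * s\<^sup>2) \<ge> 1" using d by simp
  then show "0 \<le> bkP d s" "bkP d s \<le> s\<^sup>2"
    unfolding bkP_def by (auto simp: divide_le_eq mult_le_cancel_left1 intro: divide_nonneg_nonneg)
qed

text \<open>The part of \<open>V\<close> above height \<open>n\<close> tends to 0 in
  \<open>L^2\<close> by dominated convergence. This smallness is what the bootstrap absorbs.\<close>

lemma sq_tail:
  assumes V: "sq V" and e: "e > 0"
  obtains K where "K \<ge> 0" "n2 (\<lambda>x. max 0 (V x - K)) < e"
proof -
  note [measurable] = sq_borel[OF V]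
  have "l2lim (\<lambda>n x. max 0 (V x - real n)) (\<lambda>x. 0)"
  proof (rule l2lim_dct[where w="\<lambda>x. \<bar>V x\<bar>"])
    show "AE x in lborel. (\<lambda>n. max 0 (V x - real n)) \<longlonglongrightarrow> 0"
    proof (rule AE_I2, rule tendsto_eventually)
      fix x
      obtain m where "V x \<le> real m" using real_arch_simple by blast
      then have "\<forall>n\<ge>m. max 0 (V x - real n) = 0" by (auto simp: max_def)
      then show "\<forall>\<^sub>F n in sequentially. max 0 (V x - real n) = 0" unfolding eventually_sequentially by blast
    qed
  qed (use V in \<open>auto intro: sq_abs\<close>)
  then have "(\<lambda>n. n2 (\<lambda>x. max 0 (V x - real n))) \<longlonglongrightarrow> 0" by (simp add: l2lim_def)
  from order_tendstoD(2)[OF this e] obtain n where "n2 (\<lambda>x. max 0 (V x - real n)) < e"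
    unfolding eventually_sequentially by blast
  with that[of "real n"] show ?thesis by simp
qed

context eqn
begin

text \<open>The coefficient \<open>V\<close> is merely in \<open>L^2\<close>, which is critical for
  the Sobolev inequality. Above a height \<open>K\<close> its norm is so small that its contribution
  is absorbed by the gradient term; below \<open>K\<close> it acts as a bounded coefficient. The
  resulting bound does not depend on \<open>d\<close>, and Fatou's lemma removes the
  truncation.\<close>

lemma L8: "sq (\<lambda>x. u x ^ 4)"
proof -
  define V where "V x = \<mu> * (u x)\<^sup>2 + \<beta> * (v x)\<^sup>2" for x
  have sV: "sq V" unfolding V_def by (intro sq_add sq_cmult W_L4[OF Wu] W_L4[OF Wv])
  \<comment> \<open>Sobolev gives \<open>sqrt (n2 ((bkP d u)^2)) \<le> 9 * E\<close>, and 9/36 is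
    1/4; with the factor 2 in front, half of \<open>E\<close> is absorbed.\<close>
  obtain K where K: "K \<ge> 0" "n2 (\<lambda>x. max 0 (V x - K)) < (1/36)\<^sup>2"
    using sq_tail[OF sV, of "(1/36)\<^sup>2"] by auto
  define A where "A = n2 (\<lambda>x. (u x)\<^sup>2)"
  have main: "n2 (\<lambda>x. (bkP d (u x))\<^sup>2) \<le> 81 * (4 * (K + \<bar>l\<bar>) * A)\<^sup>2" if d: "d > 0" for d
  proof -
    have WG: "W (\<lambda>x. bkG d (u x)) (\<lambda>b x. bkG' d (u x) * g b x)"
      by (rule W_chain[OF Wu bkG_deriv[OF d] bk_cont(1)[OF d] bkG_bound(1)[OF d]]) (simp add: bkG_def)
    have WP: "W (\<lambda>x. bkP d (u x)) (\<lambda>b x. bkP' d (u x) * g b x)"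
      by (rule W_chain[OF Wu bkP_deriv[OF d] bk_cont(2)[OF d] bkP'_bound[OF d]]) (simp add: bkP_def)
    define E where "E = (\<Sum>b\<in>Basis. n2 (\<lambda>x. bkP' d (u x) * g b x))"
    have E0: "E \<ge> 0" unfolding E_def by (intro sum_nonneg n2_nonneg)
    have sP: "sq (\<lambda>x. bkP d (u x))" by (rule WD(1)[OF WP])
    have sP2: "sq (\<lambda>x. (bkP d (u x))\<^sup>2)" by (rule W_L4(1)[OF WP])
    have uG: "integrable lborel (\<lambda>x. u x * bkG d (u x))" by (intro sq_mult_integrable WD(1)[OF Wu] WD(1)[OF WG])
    have P_A: "n2 (\<lambda>x. bkP d (u x)) \<le> A"
      unfolding A_def using bkP_le[OF d] sq_borel[OF sP] W_L4(1)[OF Wu] by (intro n2_mono) auto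
    have "E \<le> 2 * (\<Sum>b\<in>Basis. LINT x|lborel. g b x * (bkG' d (u x) * g b x))"
      unfolding E_def sum_distrib_left
    proof (rule sum_mono)
      fix b :: "real^4" assume b: "b \<in> Basis"
      have i: "integrable lborel (\<lambda>x. g b x * (bkG' d (u x) * g b x))" by (intro sq_mult_integrable WD(2)[OF Wu b] WD(2)[OF WG b])
      have "n2 (\<lambda>x. bkP' d (u x) * g b x) \<le> (LINT x|lborel. 2 * (g b x * (bkG' d (u x) * g b x)))"
        unfolding n2_def
      proof (rule integral_mono)
        show "integrable lborel (\<lambda>x. (bkP' d (u x) * g b x)\<^sup>2)" using WD(2)[OF WP b] by (simp add: sq_def)
        show "integrable lborel (\<lambda>x. 2 * (g b x * (bkG' d (u x) * g b x)))" using i by simp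
        fix x
        show "(bkP' d (u x) * g b x)\<^sup>2 \<le> 2 * (g b x * (bkG' d (u x) * g b x))"
          using mult_right_mono[OF bkP'_sq[OF d, of "u x"], of "(g b x)\<^sup>2"] by (simp add: power_mult_distrib power2_eq_square mult_ac)
      qed
      then show "n2 (\<lambda>x. bkP' d (u x) * g b x) \<le> 2 * (LINT x|lborel. g b x * (bkG' d (u x) * g b x))" by simp
    qed
    also have "(\<Sum>b\<in>Basis. LINT x|lborel. g b x * (bkG' d (u x) * g b x)) =
        (LINT x|lborel. F x * bkG d (u x)) - l * (LINT x|lborel. u x * bkG d (u x))"
      using weq_ext[OF WG] by simp
    also have "(LINT x|lborel. u x * bkG d (u x)) = n2 (\<lambda>x. bkP d (u x))"
      unfolding n2_def bk_sG[OF d] ..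
    also have "(LINT x|lborel. F x * bkG d (u x)) \<le> K * n2 (\<lambda>x. bkP d (u x)) + E / 4"
    proof -
      have m: "sq (\<lambda>x. max 0 (V x - K))"
        using sq_borel[OF sV] K(1) by (intro sq_le[OF sV]) (auto simp: max_def V_def \<mu> \<beta>)
      have "(LINT x|lborel. F x * bkG d (u x)) \<le> (LINT x|lborel. K * (bkP d (u x))\<^sup>2 + max 0 (V x - K) * (bkP d (u x))\<^sup>2)"
      proof (rule integral_mono[OF F_integrable[OF WG]])
        show "integrable lborel (\<lambda>x. K * (bkP d (u x))\<^sup>2 + max 0 (V x - K) * (bkP d (u x))\<^sup>2)"
          using sP by (intro Bochner_Integration.integrable_add integrable_mult_right sq_mult_integrable m sP2) (simp add: sq_def)
        fix x
        have "F x = (V x + \<alpha> * \<bar>u x\<bar> powr (p - 2)) * u x"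
          unfolding nonlin_def V_def by (simp add: algebra_simps power2_eq_square power3_eq_cube)
        then have "F x * bkG d (u x) = (V x + \<alpha> * \<bar>u x\<bar> powr (p - 2)) * (bkP d (u x))\<^sup>2"
          using bk_sG[OF d, of "u x"] by (simp add: mult.assoc)
        \<comment> \<open>The power term has the good sign here, since \<alpha> is not positive, and
          is dropped.\<close>
        also have "\<dots> \<le> V x * (bkP d (u x))\<^sup>2"
          using \<alpha> by (intro mult_right_mono) (auto simp: mult_nonpos_nonneg)
        also have "\<dots> \<le> (K + max 0 (V x - K)) * (bkP d (u x))\<^sup>2" by (intro mult_right_mono) auto
        finally show "F x * bkG d (u x) \<le> K * (bkP d (u x))\<^sup>2 + max 0 (V x - K) * (bkP d (u x))\<^sup>2"
          by (simp add: distrib_right)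
      qed
      also have "\<dots> = K * n2 (\<lambda>x. bkP d (u x)) + (LINT x|lborel. max 0 (V x - K) * (bkP d (u x))\<^sup>2)"
        using sP sq_mult_integrable[OF m sP2] by (simp add: n2_def sq_def)
      also have "(LINT x|lborel. max 0 (V x - K) * (bkP d (u x))\<^sup>2) \<le> E / 4"
      proof -
        have "(LINT x|lborel. max 0 (V x - K) * (bkP d (u x))\<^sup>2) \<le> sqrt (n2 (\<lambda>x. max 0 (V x - K))) * sqrt (n2 (\<lambda>x. (bkP d (u x))\<^sup>2))"
          using sq_CS[OF m sP2] by (rule order_trans[OF abs_ge_self])
        also have "\<dots> \<le> (1/36) * (9 * E)"
        proof (intro mult_mono)
          show "sqrt (n2 (\<lambda>x. max 0 (V x - K))) \<le> 1/36"
            using K(2) by (intro real_le_lsqrt) (auto simp: n2_nonneg)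
          have "n2 (\<lambda>x. (bkP d (u x))\<^sup>2) \<le> (9 * E)\<^sup>2" using W_L4(2)[OF WP] unfolding E_def power_mult_distrib by simp
          then show "sqrt (n2 (\<lambda>x. (bkP d (u x))\<^sup>2)) \<le> 9 * E" using E0 by (intro real_le_lsqrt) (auto simp: n2_nonneg)
        qed (auto simp: n2_nonneg)
        finally show ?thesis by simp
      qed
      finally show ?thesis by simp
    qed
    finally have 1: "E \<le> 2 * (K * n2 (\<lambda>x. bkP d (u x)) + E / 4 - l * n2 (\<lambda>x. bkP d (u x)))" by simp
    have "- l * n2 (\<lambda>x. bkP d (u x)) \<le> \<bar>l\<bar> * n2 (\<lambda>x. bkP d (u x))" by (intro mult_right_mono n2_nonneg) auto
    with 1 have "E \<le> 4 * (K + \<bar>l\<bar>) * n2 (\<lambda>x. bkP d (u x))" by (simp add: algebra_simps)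
    also have "\<dots> \<le> 4 * (K + \<bar>l\<bar>) * A" using K(1) by (intro mult_left_mono P_A) auto
    finally have EA: "E \<le> 4 * (K + \<bar>l\<bar>) * A" .
    have "n2 (\<lambda>x. (bkP d (u x))\<^sup>2) \<le> 81 * E\<^sup>2" using W_L4(2)[OF WP] by (simp add: E_def)
    also have "\<dots> \<le> 81 * (4 * (K + \<bar>l\<bar>) * A)\<^sup>2" using EA E0 by (intro mult_left_mono power_mono) auto
    finally show ?thesis .
  qed
  define M where "M = 81 * (4 * (K + \<bar>l\<bar>) * A)\<^sup>2"
  define d where "d n = 1 / real (Suc n)" for n
  have d: "d n > 0" for n by (simp add: d_def)
  have d0: "d \<longlonglongrightarrow> 0" unfolding d_def by (rule LIMSEQ_Suc[OF lim_1_over_n])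
  have Pm[measurable]: "(\<lambda>x. bkP (d n) (u x)) \<in> borel_measurable borel" for n unfolding bkP_def by measurable
  have "(\<integral>\<^sup>+x. ennreal ((u x ^ 4)\<^sup>2) \<partial>lborel) = (\<integral>\<^sup>+x. liminf (\<lambda>n. ennreal (((bkP (d n) (u x))\<^sup>2)\<^sup>2)) \<partial>lborel)"
  proof (rule nn_integral_cong)
    fix x
    have "(\<lambda>n. ((bkP (d n) (u x))\<^sup>2)\<^sup>2) \<longlonglongrightarrow> (((u x)\<^sup>2 / sqrt (1 + 0 * (u x)\<^sup>2))\<^sup>2)\<^sup>2"
      unfolding bkP_def by (intro tendsto_intros d0) simp
    then have "(\<lambda>n. ((bkP (d n) (u x))\<^sup>2)\<^sup>2) \<longlonglongrightarrow> (u x ^ 4)\<^sup>2" by (simp add: power_mult[symmetric])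
    then show "ennreal ((u x ^ 4)\<^sup>2) = liminf (\<lambda>n. ennreal (((bkP (d n) (u x))\<^sup>2)\<^sup>2))"
      by (intro lim_imp_Liminf[symmetric] trivial_limit_sequentially tendsto_ennrealI)
  qed
  also have "\<dots> \<le> liminf (\<lambda>n. \<integral>\<^sup>+x. ennreal (((bkP (d n) (u x))\<^sup>2)\<^sup>2) \<partial>lborel)"
    by (rule nn_integral_liminf) measurable
  also have "\<dots> \<le> liminf (\<lambda>n. ennreal M)"
  proof (intro Liminf_mono always_eventually allI)
    fix n
    have "W (\<lambda>x. bkP (d n) (u x)) (\<lambda>b x. bkP' (d n) (u x) * g b x)"
      by (rule W_chain[OF Wu bkP_deriv[OF d] bk_cont(2)[OF d] bkP'_bound[OF d]]) (simp add: bkP_def)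
    then have "sq (\<lambda>x. (bkP (d n) (u x))\<^sup>2)" by (rule W_L4)
    then have "(\<integral>\<^sup>+x. ennreal (((bkP (d n) (u x))\<^sup>2)\<^sup>2) \<partial>lborel) = ennreal (n2 (\<lambda>x. (bkP (d n) (u x))\<^sup>2))"
      unfolding n2_def sq_def by (intro nn_integral_eq_integral) auto
    also have "\<dots> \<le> ennreal M" using main[OF d] by (intro ennreal_leI) (simp add: M_def)
    finally show "(\<integral>\<^sup>+x. ennreal (((bkP (d n) (u x))\<^sup>2)\<^sup>2) \<partial>lborel) \<le> ennreal M" .
  qed
  also have "\<dots> = ennreal M" by (simp add: Liminf_const)
  finally have "(\<integral>\<^sup>+x. ennreal ((u x ^ 4)\<^sup>2) \<partial>lborel) \<le> ennreal M" .
  then have "integrable lborel (\<lambda>x. (u x ^ 4)\<^sup>2)"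
    by (intro integrableI_bounded) (auto intro: le_less_trans)
  then show ?thesis by (simp add: sq_def)
qed

lemma sq_F:
  assumes v8: "sq (\<lambda>x. v x ^ 4)"
  shows "sq (\<lambda>x. F x)"
proof (rule sq_le)
  show "sq (\<lambda>x. \<bar>\<alpha>\<bar> * \<bar>u x\<bar> + (\<mu> + \<bar>\<alpha>\<bar> + \<beta>) * ((u x)\<^sup>2 + u x ^ 4 + v x ^ 4))"
    by (intro sq_add sq_cmult sq_abs WD(1)[OF Wu] W_L4[OF Wu] L8 v8)
  show "AE x in lborel. \<bar>F x\<bar> \<le> \<bar>\<bar>\<alpha>\<bar> * \<bar>u x\<bar> + (\<mu> + \<bar>\<alpha>\<bar> + \<beta>) * ((u x)\<^sup>2 + u x ^ 4 + v x ^ 4)\<bar>"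
    by (intro AE_I2 order_trans[OF nonlin_bound[OF \<mu> \<beta> p] abs_ge_self])
qed measurable

end

text \<open>Symmetry of second derivatives is used for mollified functions, where both derivatives
  fall on the kernel; for this radial kernel it can be read off from an explicit formula.\<close>

lemma bump_symmetric:
  fixes x :: "'a::euclidean_space"
  assumes i: "i \<in> Basis" and j: "j \<in> Basis"
  shows "pd j (pd i (bump e)) x = pd i (pd j (bump e)) x"
proof -
  define q where "q = (\<lambda>x::'a. e\<^sup>2 - (norm x)\<^sup>2)"
  have qk: "C_k k q" for k unfolding q_def by (intro C_k_diff C_k_const C_k_norm_sq)
  have pq: "pd b q x = - 2 * (x \<bullet> b)" if "b \<in> Basis" for b x
  proof -
    have "pd b (\<lambda>x::'a. e\<^sup>2) x = 0" using pd_eq[of "\<lambda>x. e\<^sup>2" "\<lambda>_. 0" x b] by simp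
    then show ?thesis unfolding q_def pd_diff[OF C_k_const[of "Suc 0"] C_k_norm_sq[of "Suc 0"]] pd_norm_sq[OF that] by simp
  qed
  obtain q1 q2 where q1: "\<And>t. (pexp 1 has_real_derivative pexp q1 t) (at t)" "\<And>t. (pexp q1 has_real_derivative pexp q2 t) (at t)"
    using pexp_deriv by blast
  have b: "bump e = (\<lambda>x. pexp 1 (q x))" by (auto simp: bump_def q_def)
  have p1: "pd b (bump e) = (\<lambda>x. pexp q1 (q x) * (- 2 * (x \<bullet> b)))" if "b \<in> Basis" for b
    unfolding b using pd_compose[OF qk[of "Suc 0"] q1(1)] pq[OF that] by auto
  have l: "C_k k (\<lambda>x. - 2 * (x \<bullet> b))" for k and b :: 'a by (intro C_k_cmult C_k_inner)
  have pl: "pd c (\<lambda>x. - 2 * (x \<bullet> b)) x = - 2 * (c \<bullet> b)" for b c x :: 'a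
    by (rule trans[OF pd_eq[where f'="\<lambda>h. - 2 * (h \<bullet> b)"]]) (auto intro!: derivative_eq_intros)
  have ck: "C_k k (\<lambda>x. pexp q1 (q x))" for k by (rule C_k_compose[OF C_k_pexp qk])
  have "pd c (pd b (bump e)) x = pexp q1 (q x) * (- 2 * (c \<bullet> b)) + pexp q2 (q x) * (- 2 * (x \<bullet> c)) * (- 2 * (x \<bullet> b))"
    if "b \<in> Basis" "c \<in> Basis" for b c
    unfolding p1[OF that(1)] pd_mult[OF ck[of "Suc 0"] l[of "Suc 0"]] pl pd_compose[OF qk[of "Suc 0"] q1(2)] pq[OF that(2)] ..
  from this[OF i j] this[OF j i] show ?thesis by (simp add: inner_commute mult_ac)
qed

lemma moll_symmetric:
  fixes x :: "'a::euclidean_space"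
  assumes i: "i \<in> Basis" and j: "j \<in> Basis"
  shows "pd j (pd i (moll n)) x = pd i (pd j (moll n)) x"
proof -
  define e c where "e = 1 / real (Suc n)" "c = inverse (LINT x|(lborel::'a measure). bump (1 / real (Suc n)) x)"
  have m: "moll n = (\<lambda>x::'a. c * bump e x)" unfolding moll_def e_c_def by (auto simp: divide_inverse mult.commute)
  have s: "C_k k (bump e)" for k by (rule smooth_bump)
  have p: "pd b (moll n) = (\<lambda>x::'a. c * pd b (bump e) x)" for b
    unfolding m using pd_cmult[OF s[of "Suc 0"]] by auto
  show ?thesis unfolding p pd_cmult[OF C_k_SucD(2)[OF s[of "Suc (Suc 0)"] i]] pd_cmult[OF C_k_SucD(2)[OF s[of "Suc (Suc 0)"] j]]
    bump_symmetric[OF i j] ..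
qed

text \<open>The divergence-free energy-momentum tensor, obtained by testing the mollified equation
  with \<open>\<phi> \<partial>\<^sub>b u\<close>.\<close>

lemma stress_identity:
  fixes u f \<phi> :: "'a::euclidean_space \<Rightarrow> real"
  assumes W: "W u g" and f: "sq f" and \<phi>: "test_function \<phi>" and b: "b \<in> Basis"
    and eq: "\<And>\<psi>. test_function \<psi> \<Longrightarrow> (\<Sum>i\<in>Basis. LINT x|lborel. g i x * pd i \<psi> x) = (LINT x|lborel. f x * \<psi> x)"
  shows "(LINT x|lborel. f x * (\<phi> x * g b x)) =
    (\<Sum>i\<in>Basis. LINT x|lborel. g i x * (pd i \<phi> x * g b x)) - (\<Sum>i\<in>Basis. LINT x|lborel. g i x * (pd b \<phi> x * g i x)) / 2"
proof -
  define \<rho> where "\<rho> n = (moll n :: 'a \<Rightarrow> real)" for n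
  have t: "test_function (\<rho> n)" for n using moll_mollifier by (auto simp: mollifier_def \<rho>_def)
  define G where "G n i = conv (\<rho> n) (g i)" for n i
  define h where "h n = conv (\<rho> n) f" for n
  have lu: "loc u" by (rule sq_loc[OF WD(1)[OF W]])
  have lg: "loc (g i)" if "i \<in> Basis" for i by (rule sq_loc[OF WD(2)[OF W that]])
  have lf: "loc f" by (rule sq_loc[OF f])
  have Gk: "C_k k (G n i)" if "i \<in> Basis" for n i k unfolding G_def by (rule conv_Ck[OF lg[OF that] t])
  have hk: "C_k k (h n)" for n k unfolding h_def by (rule conv_Ck[OF lf t])
  \<comment> \<open>The mollified weak gradient is curl free: both indices can be moved to the
    kernel, where they commute.\<close>
  have sym: "pd i (G n j) x = pd j (G n i) x" if i: "i \<in> Basis" and j: "j \<in> Basis" for i j n x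
  proof -
    have *: "pd i (G n j) x = conv (pd j (pd i (\<rho> n))) u x" if i: "i \<in> Basis" and j: "j \<in> Basis" for i j
    proof -
      have "pd i (G n j) x = conv (pd i (\<rho> n)) (g j) x" unfolding G_def by (rule pd_conv[OF lg[OF j] t i])
      also have "\<dots> = pd j (conv (pd i (\<rho> n)) u) x"
        by (rule wd_conv[OF lu WD(3)[OF W j] test_pd[OF t i] j, symmetric])
      also have "\<dots> = conv (pd j (pd i (\<rho> n))) u x" by (rule pd_conv[OF lu test_pd[OF t i] j])
      finally show ?thesis .
    qed
    have "pd j (pd i (\<rho> n)) = pd i (pd j (\<rho> n))" unfolding \<rho>_def using moll_symmetric[OF i j] by auto
    then show ?thesis unfolding *[OF i j] *[OF j i] by simp
  qed
  \<comment> \<open>The equation tested with the reflected kernel: mollification turns it into a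
    pointwise identity.\<close>
  have div: "(\<Sum>i\<in>Basis. pd i (G n i) x) = - h n x" for n x
  proof -
    have "(\<Sum>i\<in>Basis. pd i (G n i) x) = - (\<Sum>i\<in>Basis. LINT y|lborel. g i y * pd i (\<lambda>y. \<rho> n (x - y)) y)"
      unfolding sum_negf[symmetric]
    proof (rule sum.cong[OF refl])
      fix i :: 'a assume i: "i \<in> Basis"
      have "pd i (G n i) x = conv (pd i (\<rho> n)) (g i) x" unfolding G_def by (rule pd_conv[OF lg[OF i] t i])
      then show "pd i (G n i) x = - (LINT y|lborel. g i y * pd i (\<lambda>y. \<rho> n (x - y)) y)"
        unfolding conv_def test_pd_reflect[OF t] by simp
    qed
    also have "\<dots> = - (LINT y|lborel. f y * \<rho> n (x - y))" unfolding eq[OF test_reflect[OF t]] ..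
    finally show ?thesis by (simp add: h_def conv_def)
  qed
  have \<phi>k: "C_k k \<phi>" for k using test_Ck[OF \<phi>] .
  have int: "integrable lborel (\<lambda>x. A x * (B x * C x))"
    if "continuous_on UNIV A" "continuous_on UNIV C" "test_function B" for A B C
    by (intro cc_integrable continuous_intros that test_cont[OF that(3)] bsupp_mult test_bsupp)
  have Gc: "continuous_on UNIV (G n i)" if "i \<in> Basis" for n i by (rule C_k_cont[OF Gk[OF that]])
  have hc: "continuous_on UNIV (h n)" for n by (rule C_k_cont[OF hk])
  have idn: "(LINT x|lborel. h n x * (\<phi> x * G n b x)) =
    (\<Sum>i\<in>Basis. LINT x|lborel. G n i x * (pd i \<phi> x * G n b x)) - (\<Sum>i\<in>Basis. LINT x|lborel. G n i x * (pd b \<phi> x * G n i x)) / 2" for n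
  proof -
    have c1: "C1c (\<lambda>x. \<phi> x * (G n i x * G n j x))" if "i \<in> Basis" "j \<in> Basis" for i j
      using that unfolding C1c_def
      by (intro conjI bsupp_mult(1)[OF test_bsupp[OF \<phi>]] C_k_mult \<phi>k Gk)
    note z = integral_pd_0[OF c1]
    have i12: "integrable lborel (pd i (\<lambda>x. \<phi> x * (G n j x * G n k x)))" if "i \<in> Basis" "j \<in> Basis" "k \<in> Basis" for i j k
      by (intro cc_integrable C1c_cont C1c_bsupp c1 that)
    \<comment> \<open>The divergence of
      \<open>\<phi> G_i G_b - \<delta>_{ib} \<phi> |G|^2 / 2\<close>. The terms with derivatives of
      \<open>G\<close> cancel by \<open>sym\<close>, except for the divergence of \<open>G\<close>,
      which \<open>div\<close> replaces by \<open>- h\<close>.\<close>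
    have e: "(\<Sum>i\<in>Basis. pd i (\<lambda>x. \<phi> x * (G n i x * G n b x)) x) - (\<Sum>i\<in>Basis. pd b (\<lambda>x. \<phi> x * (G n i x * G n i x)) x) / 2 =
       - (h n x * (\<phi> x * G n b x)) + (\<Sum>i\<in>Basis. G n i x * (pd i \<phi> x * G n b x)) - (\<Sum>i\<in>Basis. G n i x * (pd b \<phi> x * G n i x)) / 2" for x
    proof -
      have a1: "pd i (\<lambda>x. \<phi> x * (G n i x * G n b x)) x = pd i (G n i) x * (\<phi> x * G n b x) + \<phi> x * (G n i x * pd b (G n i) x) + G n i x * (pd i \<phi> x * G n b x)"
        if i: "i \<in> Basis" for i
        unfolding pd_mult[OF \<phi>k[of "Suc 0"] C_k_mult[OF Gk[OF i, of "Suc 0"] Gk[OF b, of "Suc 0"]]] pd_mult[OF Gk[OF i, of "Suc 0"] Gk[OF b, of "Suc 0"]] sym[OF i b]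
        by (simp add: algebra_simps)
      have a2: "pd b (\<lambda>x. \<phi> x * (G n i x * G n i x)) x = 2 * (\<phi> x * (G n i x * pd b (G n i) x)) + G n i x * (pd b \<phi> x * G n i x)"
        if i: "i \<in> Basis" for i
        unfolding pd_mult[OF \<phi>k[of "Suc 0"] C_k_mult[OF Gk[OF i, of "Suc 0"] Gk[OF i, of "Suc 0"]]] pd_mult[OF Gk[OF i, of "Suc 0"] Gk[OF i, of "Suc 0"]]
        by (simp add: algebra_simps)
      have "(\<Sum>i\<in>Basis. pd i (\<lambda>x. \<phi> x * (G n i x * G n b x)) x) = (\<Sum>i\<in>Basis. pd i (G n i) x) * (\<phi> x * G n b x)
          + (\<Sum>i\<in>Basis. \<phi> x * (G n i x * pd b (G n i) x)) + (\<Sum>i\<in>Basis. G n i x * (pd i \<phi> x * G n b x))"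
        by (simp add: a1 sum.distrib sum_distrib_right)
      moreover have "(\<Sum>i\<in>Basis. pd b (\<lambda>x. \<phi> x * (G n i x * G n i x)) x) = 2 * (\<Sum>i\<in>Basis. \<phi> x * (G n i x * pd b (G n i) x))
          + (\<Sum>i\<in>Basis. G n i x * (pd b \<phi> x * G n i x))"
        by (simp add: a2 sum.distrib sum_distrib_left)
      ultimately show ?thesis unfolding div by (simp add: add_divide_distrib)
    qed
    have "0 = (LINT x|lborel. (\<Sum>i\<in>Basis. pd i (\<lambda>x. \<phi> x * (G n i x * G n b x)) x) - (\<Sum>i\<in>Basis. pd b (\<lambda>x. \<phi> x * (G n i x * G n i x)) x) / 2)"
      using z i12 b by (simp add: Bochner_Integration.integral_sum)
    also have "\<dots> = - (LINT x|lborel. h n x * (\<phi> x * G n b x)) + (\<Sum>i\<in>Basis. LINT x|lborel. G n i x * (pd i \<phi> x * G n b x))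
       - (\<Sum>i\<in>Basis. LINT x|lborel. G n i x * (pd b \<phi> x * G n i x)) / 2"
      unfolding e using int[OF hc Gc[OF b] \<phi>] int[OF Gc Gc[OF b] test_pd[OF \<phi>]] int[OF Gc Gc test_pd[OF \<phi> b]]
      by (simp add: Bochner_Integration.integral_sum Bochner_Integration.integrable_sum)
    finally show ?thesis by simp
  qed
  have lG: "l2lim (\<lambda>n. G n i) (g i)" if "i \<in> Basis" for i unfolding G_def \<rho>_def by (rule l2lim_conv[OF WD(2)[OF W that]])
  have lh: "l2lim h f" unfolding h_def[abs_def] \<rho>_def by (rule l2lim_conv[OF f])
  have lm: "l2lim (\<lambda>n x. B x * G n i x) (\<lambda>x. B x * g i x)" if i: "i \<in> Basis" and B: "test_function B" for i B
  proof -
    obtain M where "\<And>x. \<bar>B x\<bar> \<le> M" using cc_bounded[OF test_cont[OF B] test_bsupp[OF B]] by blast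
    then show ?thesis by (rule l2lim_bdd_mult[OF lG[OF i] test_borel[OF B]])
  qed
  have "(\<lambda>n. LINT x|lborel. h n x * (\<phi> x * G n b x)) \<longlonglongrightarrow> (LINT x|lborel. f x * (\<phi> x * g b x))"
    by (rule l2lim_integral[OF lh lm[OF b \<phi>]])
  moreover have "(\<lambda>n. (\<Sum>i\<in>Basis. LINT x|lborel. G n i x * (pd i \<phi> x * G n b x)) - (\<Sum>i\<in>Basis. LINT x|lborel. G n i x * (pd b \<phi> x * G n i x)) / 2)
    \<longlonglongrightarrow> (\<Sum>i\<in>Basis. LINT x|lborel. g i x * (pd i \<phi> x * g b x)) - (\<Sum>i\<in>Basis. LINT x|lborel. g i x * (pd b \<phi> x * g i x)) / 2"
    by (intro tendsto_diff tendsto_sum tendsto_divide tendsto_const l2lim_integral lG lm test_pd \<phi> b) simp_all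
  ultimately show ?thesis unfolding idn by (rule LIMSEQ_unique)
qed

section \<open>The Pohozaev identity and the sign of the multipliers\<close>

text \<open>Its partial derivatives are the two right-hand sides, with the linear terms included;
  such a function exists because both equations have the same coupling constant \<beta>.\<close>

definition potential :: "real \<Rightarrow> real \<Rightarrow> real \<Rightarrow> real \<Rightarrow> real \<Rightarrow> real \<Rightarrow> real \<Rightarrow> real \<Rightarrow> real \<Rightarrow> real \<Rightarrow> real" where
  "potential \<mu>1 \<mu>2 \<alpha>1 \<alpha>2 \<beta> p l1 l2 s t = \<mu>1 * s ^ 4 / 4 + \<mu>2 * t ^ 4 / 4 + \<beta> * s\<^sup>2 * t\<^sup>2 / 2
     + \<alpha>1 * (\<bar>s\<bar> powr p / p) + \<alpha>2 * (\<bar>t\<bar> powr p / p) - l1 * s\<^sup>2 / 2 - l2 * t\<^sup>2 / 2"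

lemma abs_powr_deriv:
  fixes p s :: real assumes p: "2 < p"
  shows "((\<lambda>s. \<bar>s\<bar> powr p / p) has_real_derivative \<bar>s\<bar> powr (p - 2) * s) (at s)"
proof -
  consider "s > 0" | "s < 0" | "s = 0" by linarith
  then show ?thesis
  proof cases
    case 1
    have "((\<lambda>s. s powr p / p) has_real_derivative \<bar>s\<bar> powr (p - 2) * s) (at s)"
      using 1 p powr_add[of s "p - 2" 1] by (auto intro!: derivative_eq_intros)
    then show ?thesis
      by (rule has_field_derivative_transform_within_open[where S="{0<..}"]) (use 1 in auto)
  next
    case 2
    have "((\<lambda>s. (- s) powr p / p) has_real_derivative \<bar>s\<bar> powr (p - 2) * s) (at s)"
      using 2 p powr_add[of "- s" "p - 2" 1] by (auto intro!: derivative_eq_intros)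
    then show ?thesis
      by (rule has_field_derivative_transform_within_open[where S="{..<0}"]) (use 2 in auto)
  next
    case 3
    have "((\<lambda>h. \<bar>h\<bar> powr (p - 1) / p) \<longlongrightarrow> \<bar>0\<bar> powr (p - 1) / p) (at 0)"
      using p by (intro tendsto_intros) (auto intro!: always_eventually)
    then have "((\<lambda>h. \<bar>\<bar>h\<bar> powr (p - 1) / p\<bar>) \<longlongrightarrow> 0) (at 0)" using p by (simp add: tendsto_rabs_zero)
    moreover have "\<bar>\<bar>h\<bar> powr (p - 1) / p\<bar> = \<bar>\<bar>h\<bar> powr p / p / h\<bar>" for h
      using p by (cases "h = 0") (auto simp: powr_diff abs_mult)
    ultimately have "((\<lambda>h. \<bar>h\<bar> powr p / p / h) \<longlongrightarrow> 0) (at 0)"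
      by (intro tendsto_rabs_zero_cancel[of "\<lambda>h. \<bar>h\<bar> powr p / p / h"]) (simp only:)
    then show ?thesis using 3 p by (simp add: DERIV_def)
  qed
qed

lemma potential_deriv:
  assumes p: "2 < p"
  shows "((\<lambda>z. potential \<mu>1 \<mu>2 \<alpha>1 \<alpha>2 \<beta> p l1 l2 (fst z) (snd z)) has_derivative
    (\<lambda>h. (nonlin \<mu>1 \<alpha>1 \<beta> p s t - l1 * s) * fst h + (nonlin \<mu>2 \<alpha>2 \<beta> p t s - l2 * t) * snd h)) (at (s, t))"
proof -
  have f: "((\<lambda>z::real\<times>real. \<bar>fst z\<bar> powr p / p) has_derivative (\<lambda>h. (\<bar>s\<bar> powr (p - 2) * s) * fst h)) (at (s, t))"
    using has_derivative_compose[OF has_derivative_fst[OF has_derivative_ident[of "at (s, t)"]] abs_powr_deriv[OF p, unfolded has_field_derivative_def]] by simp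
  have g: "((\<lambda>z::real\<times>real. \<bar>snd z\<bar> powr p / p) has_derivative (\<lambda>h. (\<bar>t\<bar> powr (p - 2) * t) * snd h)) (at (s, t))"
    using has_derivative_compose[OF has_derivative_snd[OF has_derivative_ident[of "at (s, t)"]] abs_powr_deriv[OF p, unfolded has_field_derivative_def]] by simp
  have a: "((\<lambda>z::real\<times>real. \<mu>1 * fst z ^ 4 / 4 + \<mu>2 * snd z ^ 4 / 4 + \<beta> * (fst z)\<^sup>2 * (snd z)\<^sup>2 / 2 - l1 * (fst z)\<^sup>2 / 2 - l2 * (snd z)\<^sup>2 / 2) has_derivative
    (\<lambda>h. (\<mu>1 * s ^ 3 + \<beta> * t\<^sup>2 * s - l1 * s) * fst h + (\<mu>2 * t ^ 3 + \<beta> * s\<^sup>2 * t - l2 * t) * snd h)) (at (s, t))"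
    by (auto intro!: derivative_eq_intros simp: fun_eq_iff algebra_simps power2_eq_square power3_eq_cube)
  have "((\<lambda>z::real\<times>real. (\<mu>1 * fst z ^ 4 / 4 + \<mu>2 * snd z ^ 4 / 4 + \<beta> * (fst z)\<^sup>2 * (snd z)\<^sup>2 / 2 - l1 * (fst z)\<^sup>2 / 2 - l2 * (snd z)\<^sup>2 / 2)
     + (\<alpha>1 * (\<bar>fst z\<bar> powr p / p) + \<alpha>2 * (\<bar>snd z\<bar> powr p / p))) has_derivative
    (\<lambda>h. ((\<mu>1 * s ^ 3 + \<beta> * t\<^sup>2 * s - l1 * s) * fst h + (\<mu>2 * t ^ 3 + \<beta> * s\<^sup>2 * t - l2 * t) * snd h) +
      (\<alpha>1 * ((\<bar>s\<bar> powr (p - 2) * s) * fst h) + \<alpha>2 * ((\<bar>t\<bar> powr (p - 2) * t) * snd h)))) (at (s, t))"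
    by (intro has_derivative_add a has_derivative_mult_right f g)
  then show ?thesis unfolding potential_def nonlin_def by (simp add: algebra_simps)
qed

text \<open>A bounded, 1-Lipschitz function that tends to the identity as \<open>d\<close> tends to
  0. The potential has unbounded derivatives, so the chain rule is applied to it after truncating
  both arguments.\<close>

definition trunc :: "real \<Rightarrow> real \<Rightarrow> real" where "trunc d s = s / sqrt (1 + d * s\<^sup>2)"
definition trunc' :: "real \<Rightarrow> real \<Rightarrow> real" where "trunc' d s = 1 / ((1 + d * s\<^sup>2) * sqrt (1 + d * s\<^sup>2))"

lemma trunc_deriv:
  assumes d: "d > 0" shows "(trunc d has_real_derivative trunc' d s) (at s)"
proof -
  define r where "r = sqrt (1 + d * s\<^sup>2)"
  have r: "r > 0" "1 + d * s\<^sup>2 = r * r" using bk_pos[OF d, of s] by (auto simp: r_def)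
  have "((\<lambda>s. s / sqrt (1 + d * s\<^sup>2)) has_real_derivative (1 * r - s * (d * (2 * s) * (inverse r / 2))) / (r * r)) (at s)"
    using bk_pos[OF d, of s] r(1) unfolding r_def by (auto intro!: derivative_eq_intros simp: power2_eq_square)
  also have "(1 * r - s * (d * (2 * s) * (inverse r / 2))) / (r * r) = trunc' d s"
  proof -
    have "(1 * r - s * (d * (2 * s) * (inverse r / 2))) / (r * r) = ((r * r) - d * s\<^sup>2) / ((r * r) * r)"
      using r(1) by (simp add: field_simps power2_eq_square)
    also have "(r * r) - d * s\<^sup>2 = 1" using r(2) by simp
    finally show ?thesis unfolding trunc'_def r(2) using r(1) by simp
  qed
  finally show ?thesis unfolding trunc_def[abs_def] .
qed

lemma trunc_cont: "d > 0 \<Longrightarrow> continuous_on UNIV (trunc d)" "d > 0 \<Longrightarrow> continuous_on UNIV (trunc' d)"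
  unfolding trunc_def[abs_def] trunc'_def[abs_def] using bk_pos[of d]
  by (auto intro!: continuous_intros simp: less_imp_neq[THEN not_sym])

lemma trunc_bound:
  assumes d: "d > 0"
  shows "\<bar>trunc d s\<bar> \<le> \<bar>s\<bar>" "\<bar>trunc d s\<bar> \<le> 1 / sqrt d" "0 \<le> trunc' d s" "trunc' d s \<le> 1"
proof -
  have r: "sqrt (1 + d * s\<^sup>2) \<ge> 1" "1 + d * s\<^sup>2 \<ge> 1" using d by auto
  show "\<bar>trunc d s\<bar> \<le> \<bar>s\<bar>" unfolding trunc_def abs_divide using r by (simp add: divide_le_eq mult_le_cancel_left1)
  show "0 \<le> trunc' d s" unfolding trunc'_def using r by (intro divide_nonneg_nonneg mult_nonneg_nonneg) auto
  have "1 * 1 \<le> (1 + d * s\<^sup>2) * sqrt (1 + d * s\<^sup>2)" using r by (intro mult_mono) auto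
  then show "trunc' d s \<le> 1" unfolding trunc'_def by (simp add: divide_le_eq)
  have "sqrt d * \<bar>s\<bar> = sqrt (d * s\<^sup>2)" using d by (simp add: real_sqrt_mult)
  also have "\<dots> \<le> sqrt (1 + d * s\<^sup>2)" by simp
  finally have "sqrt d * \<bar>s\<bar> \<le> sqrt (1 + d * s\<^sup>2)" .
  moreover have rp: "sqrt (1 + d * s\<^sup>2) > 0" using r(1) by linarith
  ultimately show "\<bar>trunc d s\<bar> \<le> 1 / sqrt d" unfolding trunc_def abs_divide abs_of_pos[OF rp]
    using d by (simp add: pos_divide_le_eq pos_le_divide_eq mult.commute)
qed

lemma nonlin_cont: "2 < p \<Longrightarrow> continuous_on UNIV (\<lambda>z. nonlin \<mu> \<alpha> \<beta> p (fst z) (snd z))"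
  "2 < p \<Longrightarrow> continuous_on UNIV (\<lambda>z. nonlin \<mu> \<alpha> \<beta> p (snd z) (fst z))"
  unfolding nonlin_def by (intro continuous_intros continuous_on_powr'; auto)+

lemma bounded_on_square:
  fixes Q :: "real \<times> real \<Rightarrow> real"
  assumes "continuous_on UNIV Q"
  obtains M where "\<And>s t. \<bar>s\<bar> \<le> r \<Longrightarrow> \<bar>t\<bar> \<le> r \<Longrightarrow> \<bar>Q (s, t)\<bar> \<le> M"
proof -
  have "compact (Q ` (cbox (-r, -r) (r, r)))"
    by (intro compact_continuous_image continuous_on_subset[OF assms]) auto
  then obtain M where "\<And>z. z \<in> cbox (-r, -r) (r, r) \<Longrightarrow> \<bar>Q z\<bar> \<le> M"
    by (metis bounded_iff compact_imp_bounded image_eqI real_norm_def)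
  then show ?thesis using that[of M] by (auto simp: cbox_Pair_eq abs_le_iff)
qed

lemma pow4_mono_abs: "\<bar>a\<bar> \<le> \<bar>b\<bar> \<Longrightarrow> a ^ 4 \<le> (b::real) ^ 4"
  using power_mono[of "\<bar>a\<bar>" "\<bar>b\<bar>" 4] by simp

lemma potential_bound:
  assumes p: "2 < p" "p < 4"
  shows "\<bar>potential \<mu>1 \<mu>2 \<alpha>1 \<alpha>2 \<beta> p l1 l2 s t\<bar> \<le>
    (\<bar>\<mu>1\<bar> + \<bar>\<mu>2\<bar> + \<bar>\<beta>\<bar> + \<bar>\<alpha>1\<bar> + \<bar>\<alpha>2\<bar> + \<bar>l1\<bar> + \<bar>l2\<bar>) * (s\<^sup>2 + t\<^sup>2 + s ^ 4 + t ^ 4)"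
proof -
  define H where "H = s\<^sup>2 + t\<^sup>2 + s ^ 4 + t ^ 4"
  have nn: "0 \<le> s\<^sup>2" "0 \<le> t\<^sup>2" "0 \<le> s ^ 4" "0 \<le> t ^ 4" by auto
  have pw: "\<bar>r\<bar> powr p / p \<le> r\<^sup>2 + r ^ 4" for r :: real
  proof -
    have "\<bar>r\<bar> powr p = \<bar>r\<bar> powr (p - 2) * r\<^sup>2" using p by (cases "r = 0") (auto simp: powr_diff)
    also have "\<dots> \<le> (1 + r\<^sup>2) * r\<^sup>2" by (intro mult_right_mono powr_le_1_sq p) auto
    finally have 1: "\<bar>r\<bar> powr p \<le> r\<^sup>2 + r ^ 4" by (simp add: power2_eq_square eval_nat_numeral algebra_simps)
    have "\<bar>r\<bar> powr p / p \<le> \<bar>r\<bar> powr p" using p by (simp add: divide_le_eq mult_le_cancel_left1)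
    then show ?thesis using 1 by linarith
  qed
  have m: "\<bar>c * x\<bar> \<le> \<bar>c\<bar> * H" if "0 \<le> x" "x \<le> H" for c x
    unfolding abs_mult using that by (intro mult_left_mono) auto
  have st: "s\<^sup>2 * t\<^sup>2 / 2 \<le> H"
  proof -
    have "0 \<le> (s\<^sup>2 - t\<^sup>2)\<^sup>2" by simp
    then have "2 * (s\<^sup>2 * t\<^sup>2) \<le> s ^ 4 + t ^ 4" by (simp add: power2_eq_square eval_nat_numeral algebra_simps)
    moreover have "0 \<le> s\<^sup>2 * t\<^sup>2" by simp
    ultimately show ?thesis unfolding H_def using nn by linarith
  qed
  have e: "potential \<mu>1 \<mu>2 \<alpha>1 \<alpha>2 \<beta> p l1 l2 s t = \<mu>1 * (s ^ 4 / 4) + \<mu>2 * (t ^ 4 / 4) + \<beta> * (s\<^sup>2 * t\<^sup>2 / 2)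
     + \<alpha>1 * (\<bar>s\<bar> powr p / p) + \<alpha>2 * (\<bar>t\<bar> powr p / p) - l1 * (s\<^sup>2 / 2) - l2 * (t\<^sup>2 / 2)"
    by (simp add: potential_def)
  have le: "s ^ 4 / 4 \<le> H" "t ^ 4 / 4 \<le> H" "\<bar>s\<bar> powr p / p \<le> H" "\<bar>t\<bar> powr p / p \<le> H" "s\<^sup>2 / 2 \<le> H" "t\<^sup>2 / 2 \<le> H"
    unfolding H_def using pw[of s] pw[of t] nn by linarith+
  have ge: "0 \<le> s ^ 4 / 4" "0 \<le> t ^ 4 / 4" "0 \<le> \<bar>s\<bar> powr p / p" "0 \<le> \<bar>t\<bar> powr p / p" "0 \<le> s\<^sup>2 / 2" "0 \<le> t\<^sup>2 / 2"
    "0 \<le> s\<^sup>2 * t\<^sup>2 / 2" using nn p by auto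
  have "\<bar>\<mu>1 * (s ^ 4 / 4)\<bar> \<le> \<bar>\<mu>1\<bar> * H" "\<bar>\<mu>2 * (t ^ 4 / 4)\<bar> \<le> \<bar>\<mu>2\<bar> * H" "\<bar>\<beta> * (s\<^sup>2 * t\<^sup>2 / 2)\<bar> \<le> \<bar>\<beta>\<bar> * H"
    "\<bar>\<alpha>1 * (\<bar>s\<bar> powr p / p)\<bar> \<le> \<bar>\<alpha>1\<bar> * H" "\<bar>\<alpha>2 * (\<bar>t\<bar> powr p / p)\<bar> \<le> \<bar>\<alpha>2\<bar> * H"
    "\<bar>l1 * (s\<^sup>2 / 2)\<bar> \<le> \<bar>l1\<bar> * H" "\<bar>l2 * (t\<^sup>2 / 2)\<bar> \<le> \<bar>l2\<bar> * H"
    by (rule m[OF ge(1) le(1)] m[OF ge(2) le(2)] m[OF ge(7) st] m[OF ge(3) le(3)] m[OF ge(4) le(4)] m[OF ge(5) le(5)] m[OF ge(6) le(6)])+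
  note B = this
  have ad: "\<bar>a + b\<bar> \<le> a' + b'" "\<bar>a - b\<bar> \<le> a' + b'" if "\<bar>a\<bar> \<le> a'" "\<bar>b\<bar> \<le> b'" for a b a' b' :: real
    using that by linarith+
  have "\<bar>potential \<mu>1 \<mu>2 \<alpha>1 \<alpha>2 \<beta> p l1 l2 s t\<bar> \<le> \<bar>\<mu>1\<bar> * H + \<bar>\<mu>2\<bar> * H + \<bar>\<beta>\<bar> * H + \<bar>\<alpha>1\<bar> * H + \<bar>\<alpha>2\<bar> * H + \<bar>l1\<bar> * H + \<bar>l2\<bar> * H"
    unfolding e by (intro ad B)
  then show ?thesis unfolding H_def by (simp add: distrib_right)
qed

lemma trunc_tendsto:
  assumes "d \<longlonglongrightarrow> 0"
  shows "(\<lambda>n. trunc (d n) s) \<longlonglongrightarrow> s" "(\<lambda>n. trunc' (d n) s) \<longlonglongrightarrow> 1"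
proof -
  have "(\<lambda>n. trunc (d n) s) \<longlonglongrightarrow> s / sqrt (1 + 0 * s\<^sup>2)" unfolding trunc_def by (intro tendsto_intros assms) simp
  then show "(\<lambda>n. trunc (d n) s) \<longlonglongrightarrow> s" by simp
  have "(\<lambda>n. trunc' (d n) s) \<longlonglongrightarrow> 1 / ((1 + 0 * s\<^sup>2) * sqrt (1 + 0 * s\<^sup>2))" unfolding trunc'_def by (intro tendsto_intros assms) simp
  then show "(\<lambda>n. trunc' (d n) s) \<longlonglongrightarrow> 1" by simp
qed

text \<open>The two copies have \<open>u\<close> and \<open>v\<close>, \<open>g\<close> and
  \<open>k\<close> and the constants exchanged. The locale is itself symmetric under this exchange,
  which the final argument uses so that either multiplier can be the negative one.\<close>

locale sys = U: eqn \<mu>1 \<alpha>1 \<beta> p l1 u v g k + V: eqn \<mu>2 \<alpha>2 \<beta> p l2 v u k g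
  for \<mu>1 \<mu>2 \<alpha>1 \<alpha>2 \<beta> p l1 l2 :: real and u v :: "real^4 \<Rightarrow> real" and g k :: "real^4 \<Rightarrow> real^4 \<Rightarrow> real"
begin

abbreviation fu where "fu x \<equiv> nonlin \<mu>1 \<alpha>1 \<beta> p (u x) (v x) - l1 * u x"
abbreviation fv where "fv x \<equiv> nonlin \<mu>2 \<alpha>2 \<beta> p (v x) (u x) - l2 * v x"
abbreviation \<Phi> where "\<Phi> x \<equiv> potential \<mu>1 \<mu>2 \<alpha>1 \<alpha>2 \<beta> p l1 l2 (u x) (v x)"

lemmas p = U.p
lemmas Wu = U.Wu
lemmas Wv = V.Wu

lemma sq_fu: "sq (\<lambda>x. fu x)" by (intro sq_diff U.sq_F V.L8 sq_cmult WD(1)[OF Wu])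
lemma sq_fv: "sq (\<lambda>x. fv x)" by (intro sq_diff V.sq_F U.L8 sq_cmult WD(1)[OF Wv])

lemma int_dom: "integrable lborel (\<lambda>x. (u x)\<^sup>2 + (v x)\<^sup>2 + u x ^ 4 + v x ^ 4)"
  using WD(1)[OF Wu] WD(1)[OF Wv] sobolev(1)[OF Wu] sobolev(1)[OF Wv]
  by (intro Bochner_Integration.integrable_add) (auto simp: sq_def)

lemma \<Phi>b: "(\<lambda>x. \<Phi> x) \<in> borel_measurable borel"
  using U.ub U.vb unfolding potential_def by measurable

lemma \<Phi>_integrable: "integrable lborel (\<lambda>x. \<Phi> x)"
proof (rule Bochner_Integration.integrable_bound)
  show "integrable lborel (\<lambda>x. (\<bar>\<mu>1\<bar> + \<bar>\<mu>2\<bar> + \<bar>\<beta>\<bar> + \<bar>\<alpha>1\<bar> + \<bar>\<alpha>2\<bar> + \<bar>l1\<bar> + \<bar>l2\<bar>) * ((u x)\<^sup>2 + (v x)\<^sup>2 + u x ^ 4 + v x ^ 4))"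
    by (intro integrable_mult_right int_dom)
  show "AE x in lborel. norm (\<Phi> x) \<le> norm ((\<bar>\<mu>1\<bar> + \<bar>\<mu>2\<bar> + \<bar>\<beta>\<bar> + \<bar>\<alpha>1\<bar> + \<bar>\<alpha>2\<bar> + \<bar>l1\<bar> + \<bar>l2\<bar>) * ((u x)\<^sup>2 + (v x)\<^sup>2 + u x ^ 4 + v x ^ 4))"
    unfolding real_norm_def by (intro AE_I2 order_trans[OF potential_bound[OF p] abs_ge_self])
qed (use \<Phi>b in simp)

text \<open>The weak form of \<open>\<partial>_b \<Phi> = fu g_b + fv k_b\<close>. It is exact for
  the truncated potential, and the integrability of the eighth powers of \<open>u\<close> and
  \<open>v\<close> dominates the truncated nonlinearities in \<open>L^2\<close>, uniformly in the
  truncation.\<close>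

lemma chain:
  assumes \<phi>: "test_function \<phi>" and b: "b \<in> Basis"
  shows "(LINT x|lborel. fu x * (\<phi> x * g b x)) + (LINT x|lborel. fv x * (\<phi> x * k b x)) = - (LINT x|lborel. \<Phi> x * pd b \<phi> x)"
proof -
  define d where "d n = 1 / real (Suc n)" for n
  have d: "d n > 0" for n by (simp add: d_def)
  have d0: "d \<longlonglongrightarrow> 0" unfolding d_def by (rule LIMSEQ_Suc[OF lim_1_over_n])
  note [measurable] = U.ub U.vb
  define N1 where "N1 s t = nonlin \<mu>1 \<alpha>1 \<beta> p s t - l1 * s" for s t
  define N2 where "N2 s t = nonlin \<mu>2 \<alpha>2 \<beta> p t s - l2 * t" for s t
  have Nc: "continuous_on UNIV (\<lambda>z. N1 (fst z) (snd z))" "continuous_on UNIV (\<lambda>z. N2 (fst z) (snd z))"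
    unfolding N1_def N2_def by (intro continuous_intros nonlin_cont p)+
  define P where "P n s t = potential \<mu>1 \<mu>2 \<alpha>1 \<alpha>2 \<beta> p l1 l2 (trunc (d n) s) (trunc (d n) t)" for n s t
  define P1 where "P1 n s t = N1 (trunc (d n) s) (trunc (d n) t) * trunc' (d n) s" for n s t
  define P2 where "P2 n s t = N2 (trunc (d n) s) (trunc (d n) t) * trunc' (d n) t" for n s t
  have Pd: "((\<lambda>z. P n (fst z) (snd z)) has_derivative (\<lambda>h. P1 n s t * fst h + P2 n s t * snd h)) (at (s, t))" for n s t
  proof -
    have f: "((\<lambda>z::real\<times>real. trunc (d n) (fst z)) has_derivative (\<lambda>h. trunc' (d n) s * fst h)) (at (s, t))"
      using has_derivative_compose[OF has_derivative_fst[OF has_derivative_ident[of "at (s, t)"]] trunc_deriv[OF d, unfolded has_field_derivative_def]] by simp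
    have g: "((\<lambda>z::real\<times>real. trunc (d n) (snd z)) has_derivative (\<lambda>h. trunc' (d n) t * snd h)) (at (s, t))"
      using has_derivative_compose[OF has_derivative_snd[OF has_derivative_ident[of "at (s, t)"]] trunc_deriv[OF d, unfolded has_field_derivative_def]] by simp
    have "((\<lambda>z::real\<times>real. (trunc (d n) (fst z), trunc (d n) (snd z))) has_derivative (\<lambda>h. (trunc' (d n) s * fst h, trunc' (d n) t * snd h))) (at (s, t))"
      by (intro has_derivative_Pair f g)
    moreover have "((\<lambda>z. potential \<mu>1 \<mu>2 \<alpha>1 \<alpha>2 \<beta> p l1 l2 (fst z) (snd z)) has_derivative
      (\<lambda>h. N1 (trunc (d n) s) (trunc (d n) t) * fst h + N2 (trunc (d n) s) (trunc (d n) t) * snd h))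
      (at (trunc (d n) (fst (s, t)), trunc (d n) (snd (s, t))))"
      unfolding N1_def N2_def fst_conv snd_conv by (rule potential_deriv[OF p(1)])
    ultimately show ?thesis unfolding P_def P1_def P2_def
      using has_derivative_compose by (fastforce simp: mult.assoc)
  qed
  have tc: "continuous_on UNIV (\<lambda>z::real\<times>real. (trunc (d n) (fst z), trunc (d n) (snd z)))" for n
    by (intro continuous_intros continuous_on_compose2[OF trunc_cont(1)[OF d, of n]]) auto
  have Pc: "continuous_on UNIV (\<lambda>z. P1 n (fst z) (snd z))" "continuous_on UNIV (\<lambda>z. P2 n (fst z) (snd z))" for n
  proof -
    have a: "continuous_on UNIV (\<lambda>z::real\<times>real. N1 (trunc (d n) (fst z)) (trunc (d n) (snd z)))"
      using continuous_on_compose2[OF Nc(1) tc] by simp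
    have b: "continuous_on UNIV (\<lambda>z::real\<times>real. N2 (trunc (d n) (fst z)) (trunc (d n) (snd z)))"
      using continuous_on_compose2[OF Nc(2) tc] by simp
    have c: "continuous_on UNIV (\<lambda>z::real\<times>real. trunc' (d n) (fst z))" "continuous_on UNIV (\<lambda>z::real\<times>real. trunc' (d n) (snd z))"
      by (intro continuous_intros continuous_on_compose2[OF trunc_cont(2)[OF d, of n]]; auto)+
    show "continuous_on UNIV (\<lambda>z. P1 n (fst z) (snd z))" "continuous_on UNIV (\<lambda>z. P2 n (fst z) (snd z))"
      unfolding P1_def P2_def by (intro continuous_on_mult a b c)+
  qed
  have PM: "\<exists>M. \<forall>s t. \<bar>P1 n s t\<bar> \<le> M \<and> \<bar>P2 n s t\<bar> \<le> M" for n
  proof -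
    obtain M1 where M1: "\<And>s t. \<bar>s\<bar> \<le> 1 / sqrt (d n) \<Longrightarrow> \<bar>t\<bar> \<le> 1 / sqrt (d n) \<Longrightarrow> \<bar>N1 s t\<bar> \<le> M1"
      using bounded_on_square[OF Nc(1)] by (metis fst_conv snd_conv)
    obtain M2 where M2: "\<And>s t. \<bar>s\<bar> \<le> 1 / sqrt (d n) \<Longrightarrow> \<bar>t\<bar> \<le> 1 / sqrt (d n) \<Longrightarrow> \<bar>N2 s t\<bar> \<le> M2"
      using bounded_on_square[OF Nc(2)] by (metis fst_conv snd_conv)
    have "\<bar>x * y\<bar> \<le> M" if "\<bar>x\<bar> \<le> M" "0 \<le> y" "y \<le> 1" for x y M :: real
    proof -
      have "\<bar>x\<bar> * y \<le> \<bar>x\<bar> * 1" using that by (intro mult_left_mono) auto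
      then show ?thesis using that by (simp add: abs_mult)
    qed
    then have "\<bar>P1 n s t\<bar> \<le> M1" "\<bar>P2 n s t\<bar> \<le> M2" for s t
      unfolding P1_def P2_def using M1 M2 trunc_bound[OF d] by auto
    then show ?thesis by (intro exI[of _ "max M1 M2"]) (auto simp: le_max_iff_disj)
  qed
  have Pm[measurable]: "(\<lambda>x. P1 n (u x) (v x)) \<in> borel_measurable borel" "(\<lambda>x. P2 n (u x) (v x)) \<in> borel_measurable borel"
    "(\<lambda>x. P n (u x) (v x)) \<in> borel_measurable borel" for n
    unfolding P_def P1_def P2_def N1_def N2_def nonlin_def trunc_def trunc'_def potential_def by measurable
  have id: "(LINT x|lborel. P n (u x) (v x) * pd b \<phi> x) =
      - ((LINT x|lborel. P1 n (u x) (v x) * (\<phi> x * g b x)) + (LINT x|lborel. P2 n (u x) (v x) * (\<phi> x * k b x)))" for n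
  proof -
    obtain M where M: "\<And>s t. \<bar>P1 n s t\<bar> \<le> M" "\<And>s t. \<bar>P2 n s t\<bar> \<le> M" using PM by blast
    have "(LINT x|lborel. P n (u x) (v x) * pd b \<phi> x) = - (LINT x|lborel. (P1 n (u x) (v x) * g b x + P2 n (u x) (v x) * k b x) * \<phi> x)"
      by (rule wdD[OF wd_chain2(1)[OF Wu Wv Pd Pc M b] \<phi>])
    also have "(\<lambda>x. (P1 n (u x) (v x) * g b x + P2 n (u x) (v x) * k b x) * \<phi> x) = (\<lambda>x. (P1 n (u x) (v x) * g b x) * \<phi> x + (P2 n (u x) (v x) * k b x) * \<phi> x)"
      by (simp add: distrib_right)
    also have "(LINT x|lborel. (P1 n (u x) (v x) * g b x) * \<phi> x + (P2 n (u x) (v x) * k b x) * \<phi> x) =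
      (LINT x|lborel. (P1 n (u x) (v x) * g b x) * \<phi> x) + (LINT x|lborel. (P2 n (u x) (v x) * k b x) * \<phi> x)"
      using sq_mult_integrable[OF sq_bdd_mult[OF WD(2)[OF Wu b] Pm(1) M(1)] test_sq[OF \<phi>]]
        sq_mult_integrable[OF sq_bdd_mult[OF WD(2)[OF Wv b] Pm(2) M(2)] test_sq[OF \<phi>]]
      by (rule Bochner_Integration.integral_add)
    finally show ?thesis by (simp add: mult_ac)
  qed
  have tl: "(\<lambda>n. Q (trunc (d n) s) (trunc (d n) t) * trunc' (d n) r) \<longlonglongrightarrow> Q s t"
    if "continuous_on UNIV (\<lambda>z. Q (fst z) (snd z))" for Q :: "real \<Rightarrow> real \<Rightarrow> real" and s t r
  proof -
    have "(\<lambda>n. (trunc (d n) s, trunc (d n) t)) \<longlonglongrightarrow> (s, t)" by (intro tendsto_Pair trunc_tendsto d0)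
    from continuous_on_tendsto_compose[OF that this] have "(\<lambda>n. Q (trunc (d n) s) (trunc (d n) t)) \<longlonglongrightarrow> Q s t" by simp
    from tendsto_mult[OF this trunc_tendsto(2)[OF d0]] show ?thesis by simp
  qed
  have tm: "(trunc (d n) s)\<^sup>2 \<le> s\<^sup>2" "trunc (d n) s ^ 4 \<le> s ^ 4" "\<bar>trunc (d n) s\<bar> \<le> \<bar>s\<bar>" for n s
    using trunc_bound(1)[OF d, of n s] by (auto simp: abs_le_square_iff[symmetric] intro: pow4_mono_abs)
  have dom: "\<bar>(nonlin \<mu> \<alpha> \<beta> p (trunc (d n) s) (trunc (d n) t) - l * trunc (d n) s) * trunc' (d n) s\<bar> \<le>
     (\<bar>\<alpha>\<bar> + \<bar>l\<bar>) * \<bar>s\<bar> + (\<mu> + \<bar>\<alpha>\<bar> + \<beta>) * (s\<^sup>2 + s ^ 4 + t ^ 4)" if "\<mu> \<ge> 0" for \<mu> \<alpha> l s t n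
  proof -
    have "\<bar>nonlin \<mu> \<alpha> \<beta> p (trunc (d n) s) (trunc (d n) t) - l * trunc (d n) s\<bar> \<le>
      (\<bar>\<alpha>\<bar> * \<bar>trunc (d n) s\<bar> + (\<mu> + \<bar>\<alpha>\<bar> + \<beta>) * ((trunc (d n) s)\<^sup>2 + trunc (d n) s ^ 4 + trunc (d n) t ^ 4)) + \<bar>l\<bar> * \<bar>trunc (d n) s\<bar>"
      using nonlin_bound[OF that U.\<beta> p, of \<alpha> "trunc (d n) s" "trunc (d n) t"] abs_triangle_ineq4 unfolding abs_mult[symmetric, of l]
      by (smt (verit))
    also have "\<dots> \<le> (\<bar>\<alpha>\<bar> * \<bar>s\<bar> + (\<mu> + \<bar>\<alpha>\<bar> + \<beta>) * (s\<^sup>2 + s ^ 4 + t ^ 4)) + \<bar>l\<bar> * \<bar>s\<bar>"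
      using that U.\<beta> by (intro add_mono mult_left_mono tm) auto
    also have "\<dots> = (\<bar>\<alpha>\<bar> + \<bar>l\<bar>) * \<bar>s\<bar> + (\<mu> + \<bar>\<alpha>\<bar> + \<beta>) * (s\<^sup>2 + s ^ 4 + t ^ 4)" by (simp add: distrib_right)
    finally have 1: "\<bar>nonlin \<mu> \<alpha> \<beta> p (trunc (d n) s) (trunc (d n) t) - l * trunc (d n) s\<bar> \<le> \<dots>" .
    have "\<bar>x * y\<bar> \<le> M" if "\<bar>x\<bar> \<le> M" "0 \<le> y" "y \<le> 1" for x y M :: real
    proof -
      have "\<bar>x\<bar> * y \<le> \<bar>x\<bar> * 1" using that by (intro mult_left_mono) auto
      then show ?thesis using that by (simp add: abs_mult)
    qed
    from this[OF 1 trunc_bound(3,4)[OF d]] show ?thesis .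
  qed
  have lu: "l2lim (\<lambda>n x. P1 n (u x) (v x)) (\<lambda>x. fu x)"
  proof (rule l2lim_dct)
    show "sq (\<lambda>x. (\<bar>\<alpha>1\<bar> + \<bar>l1\<bar>) * \<bar>u x\<bar> + (\<mu>1 + \<bar>\<alpha>1\<bar> + \<beta>) * ((u x)\<^sup>2 + u x ^ 4 + v x ^ 4))"
      by (intro sq_add sq_cmult sq_abs WD(1)[OF Wu] W_L4[OF Wu] U.L8 V.L8)
    show "AE x in lborel. \<bar>P1 n (u x) (v x)\<bar> \<le> (\<bar>\<alpha>1\<bar> + \<bar>l1\<bar>) * \<bar>u x\<bar> + (\<mu>1 + \<bar>\<alpha>1\<bar> + \<beta>) * ((u x)\<^sup>2 + u x ^ 4 + v x ^ 4)" for n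
      unfolding P1_def N1_def by (intro AE_I2 dom U.\<mu>)
    show "AE x in lborel. (\<lambda>n. P1 n (u x) (v x)) \<longlonglongrightarrow> fu x"
      using tl[OF Nc(1)] unfolding P1_def N1_def by (intro AE_I2)
  qed (use sq_borel[OF sq_fu] in auto)
  have lv: "l2lim (\<lambda>n x. P2 n (u x) (v x)) (\<lambda>x. fv x)"
  proof (rule l2lim_dct)
    show "sq (\<lambda>x. (\<bar>\<alpha>2\<bar> + \<bar>l2\<bar>) * \<bar>v x\<bar> + (\<mu>2 + \<bar>\<alpha>2\<bar> + \<beta>) * ((v x)\<^sup>2 + v x ^ 4 + u x ^ 4))"
      by (intro sq_add sq_cmult sq_abs WD(1)[OF Wv] W_L4[OF Wv] U.L8 V.L8)
    show "AE x in lborel. \<bar>P2 n (u x) (v x)\<bar> \<le> (\<bar>\<alpha>2\<bar> + \<bar>l2\<bar>) * \<bar>v x\<bar> + (\<mu>2 + \<bar>\<alpha>2\<bar> + \<beta>) * ((v x)\<^sup>2 + v x ^ 4 + u x ^ 4)" for n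
      unfolding P2_def N2_def by (intro AE_I2 dom V.\<mu>)
    show "AE x in lborel. (\<lambda>n. P2 n (u x) (v x)) \<longlonglongrightarrow> fv x"
      using tl[OF Nc(2)] unfolding P2_def N2_def by (intro AE_I2)
  qed (use sq_borel[OF sq_fv] in auto)
  have s\<phi>: "sq (\<lambda>x. \<phi> x * g b x)" "sq (\<lambda>x. \<phi> x * k b x)"
  proof -
    obtain M where "\<And>x. \<bar>\<phi> x\<bar> \<le> M" using cc_bounded[OF test_cont[OF \<phi>] test_bsupp[OF \<phi>]] by blast
    then show "sq (\<lambda>x. \<phi> x * g b x)" "sq (\<lambda>x. \<phi> x * k b x)"
      by (intro sq_bdd_mult WD(2)[OF Wu b] WD(2)[OF Wv b] test_borel[OF \<phi>]; assumption)+
  qed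
  have 1: "(\<lambda>n. - ((LINT x|lborel. P1 n (u x) (v x) * (\<phi> x * g b x)) + (LINT x|lborel. P2 n (u x) (v x) * (\<phi> x * k b x))))
     \<longlonglongrightarrow> - ((LINT x|lborel. fu x * (\<phi> x * g b x)) + (LINT x|lborel. fv x * (\<phi> x * k b x)))"
    by (intro tendsto_minus tendsto_add l2lim_integral_l lu lv s\<phi>)
  have 2: "(\<lambda>n. LINT x|lborel. P n (u x) (v x) * pd b \<phi> x) \<longlonglongrightarrow> (LINT x|lborel. \<Phi> x * pd b \<phi> x)"
  proof -
    obtain M where M: "M > 0" "\<And>x. \<bar>pd b \<phi> x\<bar> \<le> M" using cc_bounded[OF test_cont[OF test_pd[OF \<phi> b]] test_bsupp[OF test_pd[OF \<phi> b]]] by blast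
    define K where "K = \<bar>\<mu>1\<bar> + \<bar>\<mu>2\<bar> + \<bar>\<beta>\<bar> + \<bar>\<alpha>1\<bar> + \<bar>\<alpha>2\<bar> + \<bar>l1\<bar> + \<bar>l2\<bar>"
    have K: "K \<ge> 0" by (simp add: K_def)
    have [measurable]: "pd b \<phi> \<in> borel_measurable borel" by (rule test_borel[OF test_pd[OF \<phi> b]])
    show ?thesis
    proof (rule integral_dominated_convergence[where w="\<lambda>x. K * ((u x)\<^sup>2 + (v x)\<^sup>2 + u x ^ 4 + v x ^ 4) * M"])
      show "integrable lborel (\<lambda>x. K * ((u x)\<^sup>2 + (v x)\<^sup>2 + u x ^ 4 + v x ^ 4) * M)"
        by (intro integrable_mult_left integrable_mult_right int_dom)
      show "AE x in lborel. (\<lambda>n. P n (u x) (v x) * pd b \<phi> x) \<longlonglongrightarrow> \<Phi> x * pd b \<phi> x"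
      proof (rule AE_I2, intro tendsto_mult tendsto_const)
        fix x
        have "continuous_on UNIV (\<lambda>z. potential \<mu>1 \<mu>2 \<alpha>1 \<alpha>2 \<beta> p l1 l2 (fst z) (snd z))"
          using has_derivative_continuous[OF potential_deriv[OF p(1)]] by (intro continuous_at_imp_continuous_on) auto
        moreover have "(\<lambda>n. (trunc (d n) (u x), trunc (d n) (v x))) \<longlonglongrightarrow> (u x, v x)" by (intro tendsto_Pair trunc_tendsto d0)
        ultimately show "(\<lambda>n. P n (u x) (v x)) \<longlonglongrightarrow> \<Phi> x"
          using continuous_on_tendsto_compose by (fastforce simp: P_def)
      qed
      show "AE x in lborel. norm (P n (u x) (v x) * pd b \<phi> x) \<le> K * ((u x)\<^sup>2 + (v x)\<^sup>2 + u x ^ 4 + v x ^ 4) * M" for n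
      proof (rule AE_I2)
        fix x
        have "\<bar>P n (u x) (v x)\<bar> \<le> K * ((trunc (d n) (u x))\<^sup>2 + (trunc (d n) (v x))\<^sup>2 + trunc (d n) (u x) ^ 4 + trunc (d n) (v x) ^ 4)"
          unfolding P_def K_def by (rule potential_bound[OF p])
        also have "\<dots> \<le> K * ((u x)\<^sup>2 + (v x)\<^sup>2 + u x ^ 4 + v x ^ 4)" by (intro mult_left_mono add_mono tm K)
        finally show "norm (P n (u x) (v x) * pd b \<phi> x) \<le> K * ((u x)\<^sup>2 + (v x)\<^sup>2 + u x ^ 4 + v x ^ 4) * M"
          unfolding real_norm_def abs_mult by (intro mult_mono M) auto
      qed
    qed (use \<Phi>b in simp_all)
  qed
  show ?thesis using LIMSEQ_unique[OF 2[unfolded id] 1] by simp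
qed

lemma eq_u: "test_function \<psi> \<Longrightarrow> (\<Sum>i\<in>Basis. LINT x|lborel. g i x * pd i \<psi> x) = (LINT x|lborel. fu x * \<psi> x)"
proof -
  assume \<psi>: "test_function \<psi>"
  have "(LINT x|lborel. fu x * \<psi> x) = (LINT x|lborel. U.F x * \<psi> x) - l1 * (LINT x|lborel. u x * \<psi> x)"
    using U.F_integrable[OF W_test[OF \<psi>]] sq_mult_integrable[OF WD(1)[OF Wu] test_sq[OF \<psi>]]
    by (simp add: left_diff_distrib mult.assoc)
  then show ?thesis using U.weq_ext[OF W_test[OF \<psi>]] by simp
qed

lemma eq_v: "test_function \<psi> \<Longrightarrow> (\<Sum>i\<in>Basis. LINT x|lborel. k i x * pd i \<psi> x) = (LINT x|lborel. fv x * \<psi> x)"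
proof -
  assume \<psi>: "test_function \<psi>"
  have "(LINT x|lborel. fv x * \<psi> x) = (LINT x|lborel. V.F x * \<psi> x) - l2 * (LINT x|lborel. v x * \<psi> x)"
    using V.F_integrable[OF W_test[OF \<psi>]] sq_mult_integrable[OF WD(1)[OF Wv] test_sq[OF \<psi>]]
    by (simp add: left_diff_distrib mult.assoc)
  then show ?thesis using V.weq_ext[OF W_test[OF \<psi>]] by simp
qed

text \<open>The vector field \<open>x\<close> is used one coordinate at a time:
  \<open>\<phi> n b\<close> is the cutoff times \<open>x \<bullet> b\<close>. For each of the four
  directions the limit is \<open>n2 (g b)\<close> minus half the energy, plus the same for
  \<open>k\<close>, equal to minus the integral of \<Phi>. Summation gives the energy the factor
  \<open>1 - 4/2 = -1\<close>.\<close>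

lemma pohozaev: "(\<Sum>b\<in>Basis. n2 (g b)) + (\<Sum>b\<in>Basis. n2 (k b)) = 4 * (LINT x|lborel. \<Phi> x)"
proof -
  obtain \<eta> :: "real \<Rightarrow> real^4 \<Rightarrow> real" and C where \<eta>:
    "\<And>R. R > 0 \<Longrightarrow> test_function (\<eta> R)" "\<And>R x. 0 \<le> \<eta> R x" "\<And>R x. \<eta> R x \<le> 1"
    "\<And>R x. R > 0 \<Longrightarrow> norm x \<le> R \<Longrightarrow> \<eta> R x = 1" "\<And>R x. R > 0 \<Longrightarrow> norm x \<ge> 2 * R \<Longrightarrow> \<eta> R x = 0"
    "C > 0" "\<And>R x b. R > 0 \<Longrightarrow> b \<in> Basis \<Longrightarrow> \<bar>pd b (\<eta> R) x\<bar> \<le> C / R"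
    "\<And>R x b. R > 0 \<Longrightarrow> b \<in> Basis \<Longrightarrow> norm x < R \<or> norm x > 2 * R \<Longrightarrow> pd b (\<eta> R) x = 0"
    using cutoff_exists by blast
  define R where "R n = real (Suc n)" for n
  have R: "R n > 0" for n by (simp add: R_def)
  have RI: "\<forall>\<^sub>F n in sequentially. norm x < R n" for x :: "real^4"
  proof -
    obtain m where "norm x < real m" using reals_Archimedean2 by blast
    then have "\<forall>n\<ge>m. norm x < R n" by (auto simp: R_def)
    then show ?thesis unfolding eventually_sequentially by blast
  qed
  define \<phi> where "\<phi> n b x = \<eta> (R n) x * (x \<bullet> b)" for n b x
  have \<phi>t: "test_function (\<phi> n b)" for n b unfolding \<phi>_def by (intro test_mult \<eta> R allI C_k_inner)
  have pdl: "pd i (\<lambda>x. x \<bullet> b) x = i \<bullet> b" for i b x :: "real^4"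
    by (rule pd_eq) (auto intro!: derivative_eq_intros)
  have p\<phi>: "pd i (\<phi> n b) x = \<eta> (R n) x * (i \<bullet> b) + pd i (\<eta> (R n)) x * (x \<bullet> b)" for n i b x
    unfolding \<phi>_def pd_mult[OF test_Ck[OF \<eta>(1)[OF R], of "Suc 0"] C_k_inner[of "Suc 0"]] pdl ..
  \<comment> \<open>The derivative of the cutoff, at most \<open>C / R\<close>, meets
    \<open>|x \<bullet> b| \<le> 2 R\<close> on its support, so the product stays bounded as the
    radius grows.\<close>
  have bnd: "\<bar>pd i (\<phi> n b) x\<bar> \<le> 1 + 2 * C" if i: "i \<in> Basis" and b: "b \<in> Basis" for n i b x
  proof -
    have ib: "\<bar>i \<bullet> b\<bar> \<le> 1" using i b by (simp add: inner_Basis)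
    have 1: "\<bar>\<eta> (R n) x * (i \<bullet> b)\<bar> \<le> 1 * 1" unfolding abs_mult using \<eta>(2,3)[of "R n" x] ib by (intro mult_mono) auto
    have 2: "\<bar>pd i (\<eta> (R n)) x * (x \<bullet> b)\<bar> \<le> 2 * C"
    proof (cases "norm x > 2 * R n")
      case True then show ?thesis using \<eta>(8)[OF R i, of x n] \<eta>(6) by simp
    next
      case False
      have "\<bar>x \<bullet> b\<bar> \<le> 2 * R n" using Basis_le_norm[OF b, of x] False by linarith
      then have "\<bar>pd i (\<eta> (R n)) x * (x \<bullet> b)\<bar> \<le> C / R n * (2 * R n)"
        unfolding abs_mult using \<eta>(6) R[of n] by (intro mult_mono \<eta>(7) i R) auto
      then show ?thesis using R[of n] by simp
    qed
    show ?thesis unfolding p\<phi> using 1 2 by linarith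
  qed
  have lim: "(\<lambda>n. pd i (\<phi> n b) x) \<longlonglongrightarrow> i \<bullet> b" if i: "i \<in> Basis" for i b x
    by (rule tendsto_eventually, rule eventually_mono[OF RI[of x]]) (simp add: p\<phi> \<eta>(8)[OF R i] \<eta>(4)[OF R])
  have m: "pd i (\<phi> n b) \<in> borel_measurable borel" if "i \<in> Basis" for i n b by (rule test_borel[OF test_pd[OF \<phi>t that]])
  have ll: "l2lim (\<lambda>n x. pd i (\<phi> n b) x * w x) (\<lambda>x. (i \<bullet> b) * w x)" if "i \<in> Basis" "b \<in> Basis" "sq w" for i b w
    by (rule l2lim_bdd_seq[OF l2lim_const[OF that(3)] m[OF that(1)] bnd[OF that(1,2)]]) (use lim[OF that(1)] in auto)
  define S where "S G b n = (\<Sum>i\<in>Basis. LINT x|lborel. G i x * (pd i (\<phi> n b) x * G b x)) - (\<Sum>i\<in>Basis. LINT x|lborel. G i x * (pd b (\<phi> n b) x * G i x)) / 2"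
    for G :: "real^4 \<Rightarrow> real^4 \<Rightarrow> real" and b n
  have Sl: "(\<lambda>n. S G b n) \<longlonglongrightarrow> n2 (G b) - (\<Sum>i\<in>Basis. n2 (G i)) / 2" if G: "\<And>i. i \<in> Basis \<Longrightarrow> sq (G i)" and b: "b \<in> Basis" for G b
  proof -
    have "(\<lambda>n. S G b n) \<longlonglongrightarrow> (\<Sum>i\<in>Basis. LINT x|lborel. G i x * ((i \<bullet> b) * G b x)) - (\<Sum>i\<in>Basis. LINT x|lborel. G i x * ((b \<bullet> b) * G i x)) / 2"
      unfolding S_def by (intro tendsto_diff tendsto_sum tendsto_divide tendsto_const l2lim_integral l2lim_const G ll b) simp_all
    moreover have "(\<Sum>i\<in>Basis. LINT x|lborel. G i x * ((i \<bullet> b) * G b x)) = (\<Sum>i\<in>Basis. if i = b then n2 (G b) else 0)"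
      by (rule sum.cong) (use b in \<open>auto simp: inner_Basis n2_def power2_eq_square\<close>)
    moreover have "(\<Sum>i\<in>Basis. LINT x|lborel. G i x * ((b \<bullet> b) * G i x)) = (\<Sum>i\<in>Basis. n2 (G i))"
      using b by (simp add: n2_def power2_eq_square)
    ultimately show ?thesis using b by simp
  qed
  have id: "S g b n + S k b n = - (LINT x|lborel. \<Phi> x * pd b (\<phi> n b) x)" if b: "b \<in> Basis" for b n
  proof -
    have "S g b n = (LINT x|lborel. fu x * (\<phi> n b x * g b x))"
      unfolding S_def by (rule stress_identity[OF Wu sq_fu \<phi>t b, symmetric]) (rule eq_u)
    moreover have "S k b n = (LINT x|lborel. fv x * (\<phi> n b x * k b x))"
      unfolding S_def by (rule stress_identity[OF Wv sq_fv \<phi>t b, symmetric]) (rule eq_v)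
    ultimately show ?thesis using chain[OF \<phi>t b] by simp
  qed
  have key: "n2 (g b) - (\<Sum>i\<in>Basis. n2 (g i)) / 2 + (n2 (k b) - (\<Sum>i\<in>Basis. n2 (k i)) / 2) = - (LINT x|lborel. \<Phi> x)" if b: "b \<in> Basis" for b
  proof (rule LIMSEQ_unique)
    show "(\<lambda>n. S g b n + S k b n) \<longlonglongrightarrow> n2 (g b) - (\<Sum>i\<in>Basis. n2 (g i)) / 2 + (n2 (k b) - (\<Sum>i\<in>Basis. n2 (k i)) / 2)"
      by (intro tendsto_add Sl WD(2)[OF Wu] WD(2)[OF Wv] b)
    have "(\<lambda>n. LINT x|lborel. \<Phi> x * pd b (\<phi> n b) x) \<longlonglongrightarrow> (LINT x|lborel. \<Phi> x)"
    proof (rule integral_dominated_convergence[where w="\<lambda>x. \<bar>\<Phi> x\<bar> * (1 + 2 * C)"])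
      show "integrable lborel (\<lambda>x. \<bar>\<Phi> x\<bar> * (1 + 2 * C))" by (intro integrable_mult_left integrable_abs \<Phi>_integrable)
      show "AE x in lborel. (\<lambda>n. \<Phi> x * pd b (\<phi> n b) x) \<longlonglongrightarrow> \<Phi> x"
      proof (rule AE_I2)
        fix x
        have "(\<lambda>n. \<Phi> x * pd b (\<phi> n b) x) \<longlonglongrightarrow> \<Phi> x * (b \<bullet> b)" by (intro tendsto_mult tendsto_const lim b)
        then show "(\<lambda>n. \<Phi> x * pd b (\<phi> n b) x) \<longlonglongrightarrow> \<Phi> x" using b by simp
      qed
      show "AE x in lborel. norm (\<Phi> x * pd b (\<phi> n b) x) \<le> \<bar>\<Phi> x\<bar> * (1 + 2 * C)" for n
        unfolding real_norm_def abs_mult by (intro AE_I2 mult_left_mono bnd b) auto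
    qed (use \<Phi>b m[OF b] in simp_all)
    then show "(\<lambda>n. S g b n + S k b n) \<longlonglongrightarrow> - (LINT x|lborel. \<Phi> x)" unfolding id[OF b] by (rule tendsto_minus)
  qed
  have "(\<Sum>b\<in>(Basis::(real^4) set). n2 (g b) - (\<Sum>i\<in>Basis. n2 (g i)) / 2 + (n2 (k b) - (\<Sum>i\<in>Basis. n2 (k i)) / 2)) = (\<Sum>b\<in>(Basis::(real^4) set). - (LINT x|lborel. \<Phi> x))"
    by (rule sum.cong) (use key in auto)
  then show ?thesis by (simp add: sum.distrib sum_subtractf)
qed

lemma multiplier_identity:
  "l1 * n2 u + l2 * n2 v = (4 / p - 1) * (LINT x|lborel. \<alpha>1 * \<bar>u x\<bar> powr p + \<alpha>2 * \<bar>v x\<bar> powr p)"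
  "integrable lborel (\<lambda>x. \<alpha>1 * \<bar>u x\<bar> powr p + \<alpha>2 * \<bar>v x\<bar> powr p)"
proof -
  define D where "D x = \<alpha>1 * \<bar>u x\<bar> powr p + \<alpha>2 * \<bar>v x\<bar> powr p" for x
  have p0: "p > 0" using p by simp
  have pw: "\<bar>r\<bar> powr p = \<bar>r\<bar> powr (p - 2) * r * r" for r :: real
    using p by (cases "r = 0") (auto simp: powr_diff power2_eq_square)
  \<comment> \<open>All terms of degree four cancel pointwise. As \<open>1 - 4 / p\<close> is
    nonzero, the identity also shows that \<open>D\<close> is integrable.\<close>
  have pt: "U.F x * u x + V.F x * v x - 4 * \<Phi> x = (1 - 4 / p) * D x + 2 * l1 * (u x)\<^sup>2 + 2 * l2 * (v x)\<^sup>2" for x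
    unfolding nonlin_def potential_def D_def pw by (simp add: algebra_simps power2_eq_square eval_nat_numeral)
  have i1: "integrable lborel (\<lambda>x. (u x)\<^sup>2)" "integrable lborel (\<lambda>x. (v x)\<^sup>2)"
    using WD(1)[OF Wu] WD(1)[OF Wv] by (auto simp: sq_def)
  have iL: "integrable lborel (\<lambda>x. U.F x * u x + V.F x * v x - 4 * \<Phi> x)"
    by (intro Bochner_Integration.integrable_diff Bochner_Integration.integrable_add integrable_mult_right
        U.F_integrable[OF Wu] V.F_integrable[OF Wv] \<Phi>_integrable)
  have "integrable lborel (\<lambda>x. p / (p - 4) * ((U.F x * u x + V.F x * v x - 4 * \<Phi> x) - 2 * l1 * (u x)\<^sup>2 - 2 * l2 * (v x)\<^sup>2))"
    by (intro integrable_mult_right[of "p / (p - 4)"] Bochner_Integration.integrable_diff[OF Bochner_Integration.integrable_diff[OF iL]] integrable_mult_right i1)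
  moreover have "p / (p - 4) * ((U.F x * u x + V.F x * v x - 4 * \<Phi> x) - 2 * l1 * (u x)\<^sup>2 - 2 * l2 * (v x)\<^sup>2) = D x" for x
  proof -
    have "p / (p - 4) * (1 - 4 / p) = 1" using p by (simp add: field_simps)
    then have "p / (p - 4) * ((1 - 4 / p) * D x) = D x" by (simp only: mult.assoc[symmetric] mult_1)
    then show ?thesis unfolding pt by simp
  qed
  ultimately have iD: "integrable lborel D" by simp
  then show "integrable lborel (\<lambda>x. \<alpha>1 * \<bar>u x\<bar> powr p + \<alpha>2 * \<bar>v x\<bar> powr p)" unfolding D_def .
  have "(LINT x|lborel. U.F x * u x + V.F x * v x - 4 * \<Phi> x) = (1 - 4 / p) * (LINT x|lborel. D x) + 2 * l1 * n2 u + 2 * l2 * n2 v"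
    unfolding pt n2_def using iD i1 by simp
  moreover have "(LINT x|lborel. U.F x * u x + V.F x * v x - 4 * \<Phi> x) = (LINT x|lborel. U.F x * u x) + (LINT x|lborel. V.F x * v x) - 4 * (LINT x|lborel. \<Phi> x)"
    using U.F_integrable[OF Wu] V.F_integrable[OF Wv] \<Phi>_integrable by simp
  moreover have "(\<Sum>b\<in>Basis. n2 (g b)) + l1 * n2 u = (LINT x|lborel. U.F x * u x)"
    using U.weq_ext[OF Wu] by (simp add: n2_def power2_eq_square)
  moreover have "(\<Sum>b\<in>Basis. n2 (k b)) + l2 * n2 v = (LINT x|lborel. V.F x * v x)"
    using V.weq_ext[OF Wv] by (simp add: n2_def power2_eq_square)
  ultimately have "l1 * n2 u + l2 * n2 v = - ((1 - 4 / p) * (LINT x|lborel. D x))"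
    using pohozaev by linarith
  then show "l1 * n2 u + l2 * n2 v = (4 / p - 1) * (LINT x|lborel. \<alpha>1 * \<bar>u x\<bar> powr p + \<alpha>2 * \<bar>v x\<bar> powr p)"
    unfolding D_def by (simp add: algebra_simps)
qed

text \<open>Strictness: if the integral of the two nonpositive power terms were 0, then
  \<open>u\<close> would vanish almost everywhere, against \<open>n2 u > 0\<close>. The prefactor
  \<open>4 / p - 1\<close> is positive since \<open>p < 4\<close>.\<close>

lemma multiplier_neg:
  assumes "\<alpha>1 < 0" "n2 u > 0"
  shows "l1 * n2 u + l2 * n2 v < 0"
proof -
  let ?D = "\<lambda>x. \<alpha>1 * \<bar>u x\<bar> powr p + \<alpha>2 * \<bar>v x\<bar> powr p"
  have le: "?D x \<le> 0" for x using assms(1) V.\<alpha> by (intro add_nonpos_nonpos mult_nonpos_nonneg) auto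
  have "(LINT x|lborel. - ?D x) \<noteq> 0"
  proof
    assume "(LINT x|lborel. - ?D x) = 0"
    then have "AE x in lborel. - ?D x = 0"
      using le by (subst (asm) integral_nonneg_eq_0_iff_AE) (auto intro!: multiplier_identity(2) integrable_minus simp del: minus_add_distrib)
    then have "AE x in lborel. (u x)\<^sup>2 = 0"
    proof eventually_elim
      case (elim x)
      have "\<alpha>1 * \<bar>u x\<bar> powr p \<le> 0" "\<alpha>2 * \<bar>v x\<bar> powr p \<le> 0" using assms(1) V.\<alpha> by (auto intro: mult_nonpos_nonneg)
      then have "\<alpha>1 * \<bar>u x\<bar> powr p = 0" using elim by linarith
      then show ?case using assms(1) by simp
    qed
    then have "n2 u = (LINT x|(lborel::(real^4) measure). 0)" unfolding n2_def by (intro integral_cong_AE) auto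
    then show False using assms(2) by simp
  qed
  moreover have "(LINT x|lborel. - ?D x) \<ge> 0" using le by (intro Bochner_Integration.integral_nonneg) (simp del: minus_add_distrib)
  ultimately have "(LINT x|lborel. ?D x) < 0" by (simp del: minus_add_distrib)
  moreover have "4 / p - 1 > 0" using p by (simp add: field_simps)
  ultimately show ?thesis unfolding multiplier_identity(1) by (simp add: mult_pos_neg)
qed

end

section \<open>Positive solutions\<close>

text \<open>As \<open>d\<close> tends to 0, \<open>pcG d s\<close> tends to \<open>1 / (2 s)\<close> for \<open>s > 0\<close>: \<open>\<phi>\<^sup>2 pcG d u\<close> is the
  admissible version of the test function \<open>\<phi>\<^sup>2 / u\<close>.\<close>

definition pcG :: "real \<Rightarrow> real \<Rightarrow> real" where "pcG d s = (sqrt (s\<^sup>2 + d\<^sup>2) - s) / d\<^sup>2"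
definition pcG' :: "real \<Rightarrow> real \<Rightarrow> real" where "pcG' d s = (s / sqrt (s\<^sup>2 + d\<^sup>2) - 1) / d\<^sup>2"

lemma pcG_deriv:
  assumes "d > 0" shows "(pcG d has_real_derivative pcG' d s) (at s)"
proof -
  have "s\<^sup>2 + d\<^sup>2 > 0" using assms by (simp add: add_nonneg_pos)
  then show ?thesis unfolding pcG_def[abs_def] pcG'_def using assms
    by (auto intro!: derivative_eq_intros simp: field_simps)
qed

lemma pcG'_cont: "d > 0 \<Longrightarrow> continuous_on UNIV (pcG' d)"
  unfolding pcG'_def[abs_def]
  by (intro continuous_intros) (auto simp: add_nonneg_eq_0_iff)

lemma pcG'_bound: assumes "d > 0" shows "\<bar>pcG' d s\<bar> \<le> 2 / d\<^sup>2"
proof -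
  have "sqrt (s\<^sup>2) \<le> sqrt (s\<^sup>2 + d\<^sup>2)" by simp
  then have 1: "\<bar>s\<bar> \<le> sqrt (s\<^sup>2 + d\<^sup>2)" by simp
  moreover have r: "sqrt (s\<^sup>2 + d\<^sup>2) > 0" using assms by (simp add: add_nonneg_pos)
  ultimately have "\<bar>s / sqrt (s\<^sup>2 + d\<^sup>2)\<bar> \<le> 1" by (simp add: abs_divide divide_le_eq)
  then have "\<bar>s / sqrt (s\<^sup>2 + d\<^sup>2) - 1\<bar> \<le> 2" by linarith
  then show ?thesis unfolding pcG'_def abs_divide using assms by (simp add: divide_right_mono)
qed

text \<open>Rationalising the difference gives \<open>1 / (r + s)\<close> with \<open>r\<close> the
  square root, and the derivative \<open>- 1 / (r (r + s))\<close>. The inequality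
  \<open>G' \<le> - G^2\<close>, which \<open>1 / s\<close> satisfies with equality, is what lets
  Picone's argument complete a square; the regularisation preserves it because
  \<open>r \<le> r + s\<close>.\<close>

lemma pcG_pos:
  assumes d: "d > 0" and s: "s > 0"
  shows "pcG d s = 1 / (sqrt (s\<^sup>2 + d\<^sup>2) + s)" "pcG d s > 0" "pcG' d s \<le> - (pcG d s)\<^sup>2"
proof -
  define r where "r = sqrt (s\<^sup>2 + d\<^sup>2)"
  have r: "r > 0" "r\<^sup>2 = s\<^sup>2 + d\<^sup>2" using d by (auto simp: r_def add_nonneg_pos)
  have d2: "d\<^sup>2 = (r - s) * (r + s)" using r(2) by (simp add: power2_eq_square algebra_simps)
  have rs: "r + s > 0" using r s by simp
  have rs': "r - s > 0" using d2 d rs by (metis zero_less_mult_pos2 zero_less_power)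
  have "pcG d s = (r - s) / d\<^sup>2" by (simp add: pcG_def r_def)
  also have "\<dots> = 1 / (r + s)" unfolding d2 using rs rs' by simp
  finally have 1: "pcG d s = 1 / (r + s)" .
  then show "pcG d s = 1 / (sqrt (s\<^sup>2 + d\<^sup>2) + s)" by (simp add: r_def)
  show "pcG d s > 0" unfolding 1 using rs by simp
  have "pcG' d s = (s / r - 1) / d\<^sup>2" by (simp add: pcG'_def r_def)
  also have "s / r - 1 = - ((r - s) / r)" using r(1) by (simp add: field_simps)
  also have "- ((r - s) / r) / d\<^sup>2 = - (1 / (r * (r + s)))" unfolding d2 using rs rs' r(1) by simp
  finally have "pcG' d s = - (1 / (r * (r + s)))" .
  also have "- (1 / (r * (r + s))) \<le> - (1 / ((r + s) * (r + s)))"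
    using rs r(1) s by (intro le_imp_neg_le divide_left_mono mult_right_mono mult_pos_pos) auto
  also have "\<dots> = - (pcG d s)\<^sup>2" unfolding 1 by (simp add: power2_eq_square)
  finally show "pcG' d s \<le> - (pcG d s)\<^sup>2" .
qed

text \<open>\<open>s0\<close> is the point where \<open>s powr (p - 2)\<close> reaches \<theta>;
  beyond it \<open>s powr (p - 4)\<close> only decreases, as \<open>p < 4\<close>.\<close>

lemma powr_young:
  fixes p \<theta> :: real
  assumes p: "2 < p" "p < 4" and \<theta>: "\<theta> > 0"
  obtains C where "C \<ge> 0" "\<And>s. s > 0 \<Longrightarrow> s powr (p - 2) \<le> \<theta> + C * s\<^sup>2"
proof -
  define s0 where "s0 = \<theta> powr (1 / (p - 2))"
  have s0: "s0 > 0" "s0 powr (p - 2) = \<theta>" using \<theta> p by (auto simp: s0_def powr_powr)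
  have "s powr (p - 2) \<le> \<theta> + s0 powr (p - 4) * s\<^sup>2" if s: "s > 0" for s
  proof (cases "s \<le> s0")
    case True
    then have "s powr (p - 2) \<le> s0 powr (p - 2)" using s p by (intro powr_mono2) auto
    then show ?thesis using s0(2) by (simp add: add_increasing2)
  next
    case False
    have "s powr (p - 2) = s powr (p - 4) * s\<^sup>2" using s powr_add[of s "p - 4" 2] by simp
    also have "\<dots> \<le> s0 powr (p - 4) * s\<^sup>2" using False s0 p s by (intro mult_right_mono powr_mono2') auto
    finally show ?thesis using \<theta> by simp
  qed
  with that[of "s0 powr (p - 4)"] show ?thesis by simp
qed

lemma measure_ball4: "R \<ge> 0 \<Longrightarrow> measure lborel (ball (0::real^4) R) = unit_ball_vol 4 * R ^ 4"
  "R \<ge> 0 \<Longrightarrow> measure lborel (cball (0::real^4) R) = unit_ball_vol 4 * R ^ 4"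
  using content_ball[of R "0::real^4"] content_cball[of R "0::real^4"] by simp_all

context eqn
begin

text \<open>Tested with \<open>\<phi>^2 G\<close>, the gradient term is
  \<open>(\<phi> g)^2 G' + 2 \<phi> g G \<partial>\<phi>\<close>, and \<open>G' \<le> - G^2\<close>
  bounds it by \<open>(\<partial>\<phi>)^2\<close> minus a square. The unknown gradient of
  \<open>u\<close> thus disappears from the estimate.\<close>

lemma picone_step:
  assumes pos: "AE x in lborel. u x > 0" and \<phi>: "test_function \<phi>" and d: "d > 0"
  shows "(LINT x|lborel. (F x - l * u x) * (\<phi> x * \<phi> x * pcG d (u x))) \<le> (\<Sum>b\<in>Basis. n2 (pd b \<phi>))"
   "integrable lborel (\<lambda>x. (F x - l * u x) * (\<phi> x * \<phi> x * pcG d (u x)))"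
proof -
  define \<psi> where "\<psi> x = \<phi> x * \<phi> x" for x
  have \<psi>: "test_function \<psi>" unfolding \<psi>_def using \<phi> by (intro test_mult) (auto simp: test_iff)
  have p\<psi>: "pd b \<psi> x = 2 * (\<phi> x * pd b \<phi> x)" for b x
    unfolding \<psi>_def pd_mult[OF test_Ck[OF \<phi>, of "Suc 0"] test_Ck[OF \<phi>, of "Suc 0"]] by simp
  define G where "G x = pcG d (u x)" for x
  note ch = wd_chain[OF Wu pcG_deriv[OF d] pcG'_cont[OF d] pcG'_bound[OF d], folded G_def]
  obtain b0 :: "real^4" where b0: "b0 \<in> Basis" using nonempty_Basis by blast
  have Gm[measurable]: "G \<in> borel_measurable borel" "(\<lambda>x. pcG' d (u x)) \<in> borel_measurable borel"
    unfolding G_def pcG_def pcG'_def by measurable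
  have sG: "sq (\<lambda>x. \<zeta> x * G x)" if \<zeta>: "test_function \<zeta>" for \<zeta>
  proof -
    obtain M where M: "\<And>x. \<bar>\<zeta> x\<bar> \<le> M" using cc_bounded[OF test_cont[OF \<zeta>] test_bsupp[OF \<zeta>]] by blast
    \<comment> \<open>\<open>pcG d 0\<close> is \<open>1 / d\<close>, so this constant is split off
      before the square integrability of \<open>G x - pcG d 0\<close> is used.\<close>
    have "sq (\<lambda>x. \<zeta> x * (G x - pcG d 0) + pcG d 0 * \<zeta> x)"
      by (intro sq_add sq_cmult test_sq \<zeta> sq_bdd_mult[OF ch(2)[OF b0] test_borel[OF \<zeta>] M])
    then show ?thesis by (simp add: algebra_simps)
  qed
  have lG: "loc G"
  proof -
    have "loc (\<lambda>x. G x - pcG d 0)" by (rule sq_loc[OF ch(2)[OF b0]])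
    then have "integrable lborel (\<lambda>y. indicator (ball 0 r) y * (G y - pcG d 0) + indicator (ball 0 r) y * pcG d 0)" for r
      unfolding loc_def by (intro Bochner_Integration.integrable_add integrable_mult_left integrable_real_indicator emeasure_bounded_finite) auto
    then show ?thesis unfolding loc_def by (simp add: algebra_simps)
  qed
  define w where "w x = \<psi> x * G x" for x
  define h where "h b x = \<psi> x * (pcG' d (u x) * g b x) + pd b \<psi> x * G x" for b x
  have W: "W w h" unfolding W_def
  proof (intro conjI ballI)
    show "sq w" unfolding w_def by (rule sG[OF \<psi>])
    fix b :: "real^4" assume b: "b \<in> Basis"
    obtain M where M: "\<And>x. \<bar>\<psi> x\<bar> \<le> M" using cc_bounded[OF test_cont[OF \<psi>] test_bsupp[OF \<psi>]] by blast
    show "sq (h b)" unfolding h_def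
      by (intro sq_add sG test_pd \<psi> b sq_bdd_mult[OF ch(3)[OF b] test_borel[OF \<psi>] M])
    show "wd b w (h b)" unfolding w_def h_def
      by (rule wd_mult[OF ch(1)[OF b] lG sq_loc[OF ch(3)[OF b]] _ b]) (use \<psi> in \<open>simp add: test_iff\<close>)
  qed
  have iF: "integrable lborel (\<lambda>x. F x * w x)" by (rule F_integrable[OF W])
  have iu: "integrable lborel (\<lambda>x. u x * w x)" by (intro sq_mult_integrable WD(1)[OF Wu] WD(1)[OF W])
  have e: "(F x - l * u x) * (\<phi> x * \<phi> x * pcG d (u x)) = F x * w x - l * (u x * w x)" for x
    unfolding w_def \<psi>_def G_def by (simp add: algebra_simps)
  show "integrable lborel (\<lambda>x. (F x - l * u x) * (\<phi> x * \<phi> x * pcG d (u x)))" unfolding e using iF iu by simp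
  have "(LINT x|lborel. (F x - l * u x) * (\<phi> x * \<phi> x * pcG d (u x))) = (\<Sum>b\<in>Basis. LINT x|lborel. g b x * h b x)"
    unfolding e using iF iu weq_ext[OF W] by simp
  also have "\<dots> \<le> (\<Sum>b\<in>Basis. n2 (pd b \<phi>))"
  proof (rule sum_mono)
    fix b :: "real^4" assume b: "b \<in> Basis"
    show "(LINT x|lborel. g b x * h b x) \<le> n2 (pd b \<phi>)" unfolding n2_def
    proof (rule integral_mono_AE)
      show "integrable lborel (\<lambda>x. g b x * h b x)" by (intro sq_mult_integrable WD(2)[OF Wu b] WD(2)[OF W b])
      show "integrable lborel (\<lambda>x. (pd b \<phi> x)\<^sup>2)" using test_sq[OF test_pd[OF \<phi> b]] by (simp add: sq_def)
      show "AE x in lborel. g b x * h b x \<le> (pd b \<phi> x)\<^sup>2"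
        using pos
      proof eventually_elim
        case (elim x)
        have "g b x * h b x = (\<phi> x * g b x)\<^sup>2 * pcG' d (u x) + 2 * (\<phi> x * g b x * G x) * pd b \<phi> x"
          unfolding h_def \<psi>_def[symmetric] p\<psi> by (simp add: \<psi>_def power2_eq_square algebra_simps)
        also have "\<dots> \<le> (\<phi> x * g b x)\<^sup>2 * (- (G x)\<^sup>2) + 2 * (\<phi> x * g b x * G x) * pd b \<phi> x"
          unfolding G_def by (intro add_right_mono mult_left_mono pcG_pos(3)[OF d elim]) simp
        also have "\<dots> = (pd b \<phi> x)\<^sup>2 - (\<phi> x * g b x * G x - pd b \<phi> x)\<^sup>2"
          by (simp add: power2_eq_square algebra_simps)
        also have "\<dots> \<le> (pd b \<phi> x)\<^sup>2" by simp
        finally show ?case .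
      qed
    qed
  qed
  finally show "(LINT x|lborel. (F x - l * u x) * (\<phi> x * \<phi> x * pcG d (u x))) \<le> (\<Sum>b\<in>Basis. n2 (pd b \<phi>))" .
qed

text \<open>The coefficient of the equation is bounded below by
  \<open>- l / 2 - |\<alpha>| C u^2\<close>: the power term costs at most half of
  \<open>- l\<close>, and the excess is charged to \<open>u^2\<close>, whose integral gives
  \<open>K\<close>. The weight \<open>u pcG d u\<close> lies in \<open>[0, 1]\<close> and tends to
  1/2, which turns \<open>- l / 2\<close> into \<open>- l / 4\<close>.\<close>

lemma picone:
  assumes l: "l < 0" and pos: "AE x in lborel. u x > 0"
  shows "\<exists>c K. c > 0 \<and> (\<forall>\<phi>::real^4 \<Rightarrow> real. test_function \<phi> \<longrightarrow> (\<forall>x. \<bar>\<phi> x\<bar> \<le> 1) \<longrightarrow> c * n2 \<phi> \<le> (\<Sum>b\<in>Basis. n2 (pd b \<phi>)) + K)"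
proof -
  define \<theta> where "\<theta> = - l / (2 * (1 + \<bar>\<alpha>\<bar>))"
  have \<theta>: "\<theta> > 0" "\<bar>\<alpha>\<bar> * \<theta> \<le> - l / 2"
  proof -
    show "\<theta> > 0" unfolding \<theta>_def using l by (intro divide_pos_pos) auto
    have "\<bar>\<alpha>\<bar> * \<theta> = (- l / 2) * (\<bar>\<alpha>\<bar> / (1 + \<bar>\<alpha>\<bar>))" unfolding \<theta>_def by simp
    also have "\<dots> \<le> (- l / 2) * 1" using l by (intro mult_left_mono) auto
    finally show "\<bar>\<alpha>\<bar> * \<theta> \<le> - l / 2" by simp
  qed
  obtain C where C: "C \<ge> 0" "\<And>s. s > 0 \<Longrightarrow> s powr (p - 2) \<le> \<theta> + C * s\<^sup>2" using powr_young[OF p \<theta>(1)] by blast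
  define K where "K = \<bar>\<alpha>\<bar> * C * n2 u"
  show ?thesis
  proof (rule exI[of _ "- l / 4"], rule exI[of _ K], intro conjI allI impI)
    show "- l / 4 > 0" using l by simp
    fix \<phi> :: "real^4 \<Rightarrow> real" assume \<phi>: "test_function \<phi>" and \<phi>1: "\<forall>x. \<bar>\<phi> x\<bar> \<le> 1"
    define d where "d n = 1 / real (Suc n)" for n
    have d: "d n > 0" for n by (simp add: d_def)
    have d0: "d \<longlonglongrightarrow> 0" unfolding d_def by (rule LIMSEQ_Suc[OF lim_1_over_n])
    define m where "m n x = u x * pcG (d n) (u x)" for n x
    have [measurable]: "\<phi> \<in> borel_measurable borel" by (rule test_borel[OF \<phi>])
    have mm[measurable]: "m n \<in> borel_measurable borel" for n unfolding m_def pcG_def by measurable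
    have mb: "AE x in lborel. 0 \<le> m n x \<and> m n x \<le> 1" for n
      using pos
    proof eventually_elim
      case (elim x)
      have "sqrt ((u x)\<^sup>2 + (d n)\<^sup>2) \<ge> 0" by simp
      moreover have "0 \<le> u x * (1 / (r + u x)) \<and> u x * (1 / (r + u x)) \<le> 1" if "r \<ge> 0" for r
        using that elim by (simp add: divide_le_eq)
      ultimately show ?case unfolding m_def pcG_pos(1)[OF d elim] by blast
    qed
    have ml: "AE x in lborel. (\<lambda>n. m n x) \<longlonglongrightarrow> 1 / 2"
      using pos
    proof eventually_elim
      case (elim x)
      have "(\<lambda>n. u x * (1 / (sqrt ((u x)\<^sup>2 + (d n)\<^sup>2) + u x))) \<longlonglongrightarrow> u x * (1 / (sqrt ((u x)\<^sup>2 + 0\<^sup>2) + u x))"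
        using elim by (intro tendsto_intros d0) simp
      then show ?case unfolding m_def pcG_pos(1)[OF d elim] using elim by simp
    qed
    have i\<phi>: "integrable lborel (\<lambda>x. (\<phi> x)\<^sup>2)" using test_sq[OF \<phi>] by (simp add: sq_def)
    have iu: "integrable lborel (\<lambda>x. (u x)\<^sup>2)" using WD(1)[OF Wu] by (simp add: sq_def)
    have im: "integrable lborel (\<lambda>x. m n x * (\<phi> x)\<^sup>2)" for n
    proof (rule Bochner_Integration.integrable_bound[OF i\<phi>])
      show "AE x in lborel. norm (m n x * (\<phi> x)\<^sup>2) \<le> norm ((\<phi> x)\<^sup>2)"
        using mb[of n] by eventually_elim (simp add: abs_mult mult_left_le_one_le)
    qed measurable
    have st: "(- l / 2) * (LINT x|lborel. m n x * (\<phi> x)\<^sup>2) \<le> (\<Sum>b\<in>Basis. n2 (pd b \<phi>)) + K" for n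
    proof -
      have "(LINT x|lborel. (- l / 2) * (m n x * (\<phi> x)\<^sup>2) - \<bar>\<alpha>\<bar> * C * (u x)\<^sup>2) \<le> (LINT x|lborel. (F x - l * u x) * (\<phi> x * \<phi> x * pcG (d n) (u x)))"
      proof (rule integral_mono_AE)
        show "integrable lborel (\<lambda>x. (- l / 2) * (m n x * (\<phi> x)\<^sup>2) - \<bar>\<alpha>\<bar> * C * (u x)\<^sup>2)"
          by (intro Bochner_Integration.integrable_diff integrable_mult_right im iu)
        show "integrable lborel (\<lambda>x. (F x - l * u x) * (\<phi> x * \<phi> x * pcG (d n) (u x)))"
          by (rule picone_step(2)[OF pos \<phi> d])
        show "AE x in lborel. (- l / 2) * (m n x * (\<phi> x)\<^sup>2) - \<bar>\<alpha>\<bar> * C * (u x)\<^sup>2 \<le> (F x - l * u x) * (\<phi> x * \<phi> x * pcG (d n) (u x))"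
          using pos mb[of n]
        proof eventually_elim
          case (elim x)
          define y where "y = m n x * (\<phi> x)\<^sup>2"
          have p2: "(\<phi> x)\<^sup>2 \<le> 1" using \<phi>1 by (simp add: abs_square_le_1)
          have y: "0 \<le> y" "y \<le> 1" unfolding y_def using elim p2 mult_mono[of "m n x" 1 "(\<phi> x)\<^sup>2" 1] by auto
          define q where "q = \<mu> * (u x)\<^sup>2 + \<alpha> * u x powr (p - 2) + \<beta> * (v x)\<^sup>2"
          have "(F x - l * u x) * (\<phi> x * \<phi> x * pcG (d n) (u x)) = (q - l) * y"
            unfolding nonlin_def q_def y_def m_def using elim by (simp add: power2_eq_square power3_eq_cube algebra_simps)
          also have "\<dots> \<ge> (- l / 2 - \<bar>\<alpha>\<bar> * C * (u x)\<^sup>2) * y"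
          proof (rule mult_right_mono[OF _ y(1)])
            have "0 \<le> \<mu> * (u x)\<^sup>2" "0 \<le> \<beta> * (v x)\<^sup>2" using \<mu> \<beta> by auto
            moreover have "\<bar>\<alpha>\<bar> * u x powr (p - 2) \<le> \<bar>\<alpha>\<bar> * (\<theta> + C * (u x)\<^sup>2)" by (intro mult_left_mono C(2)) (use elim in auto)
            moreover have "\<alpha> * u x powr (p - 2) = - (\<bar>\<alpha>\<bar> * u x powr (p - 2))" using \<alpha> by simp
            ultimately show "- l / 2 - \<bar>\<alpha>\<bar> * C * (u x)\<^sup>2 \<le> q - l"
              unfolding q_def using \<theta>(2) by (simp add: distrib_left mult.assoc)
          qed
          moreover have "(\<bar>\<alpha>\<bar> * C * (u x)\<^sup>2) * y \<le> (\<bar>\<alpha>\<bar> * C * (u x)\<^sup>2) * 1"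
            using C(1) y by (intro mult_left_mono) auto
          ultimately show ?case unfolding y_def[symmetric] by (simp add: left_diff_distrib)
        qed
      qed
      also have "\<dots> \<le> (\<Sum>b\<in>Basis. n2 (pd b \<phi>))" by (rule picone_step(1)[OF pos \<phi> d])
      finally show ?thesis unfolding K_def n2_def[of u] using im iu by simp
    qed
    have "(\<lambda>n. LINT x|lborel. m n x * (\<phi> x)\<^sup>2) \<longlonglongrightarrow> (LINT x|lborel. (1/2) * (\<phi> x)\<^sup>2)"
    proof (rule integral_dominated_convergence[OF _ _ i\<phi>])
      show "AE x in lborel. (\<lambda>n. m n x * (\<phi> x)\<^sup>2) \<longlonglongrightarrow> (1/2) * (\<phi> x)\<^sup>2"
        using ml by eventually_elim (intro tendsto_mult tendsto_const)
      show "AE x in lborel. norm (m n x * (\<phi> x)\<^sup>2) \<le> (\<phi> x)\<^sup>2" for n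
        using mb[of n] by eventually_elim (simp add: abs_mult mult_left_le_one_le)
    qed measurable
    then have "(\<lambda>n. (- l / 2) * (LINT x|lborel. m n x * (\<phi> x)\<^sup>2)) \<longlonglongrightarrow> (- l / 2) * (LINT x|lborel. (1/2) * (\<phi> x)\<^sup>2)"
      by (intro tendsto_mult tendsto_const)
    then have "(- l / 2) * (LINT x|lborel. (1/2) * (\<phi> x)\<^sup>2) \<le> (\<Sum>b\<in>Basis. n2 (pd b \<phi>)) + K"
      by (rule LIMSEQ_le_const2) (use st in blast)
    then show "- l / 4 * n2 \<phi> \<le> (\<Sum>b\<in>Basis. n2 (pd b \<phi>)) + K" by (simp add: n2_def)
  qed
qed

lemma no_positive:
  assumes l: "l < 0" and pos: "AE x in lborel. u x > 0"
  shows False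
proof -
  obtain c K where c: "c > 0" "\<And>\<phi>::real^4 \<Rightarrow> real. test_function \<phi> \<Longrightarrow> (\<And>x. \<bar>\<phi> x\<bar> \<le> 1) \<Longrightarrow> c * n2 \<phi> \<le> (\<Sum>b\<in>Basis. n2 (pd b \<phi>)) + K"
    using picone[OF l pos] by blast
  obtain \<eta> :: "real \<Rightarrow> real^4 \<Rightarrow> real" and C where \<eta>:
    "\<And>R. R > 0 \<Longrightarrow> test_function (\<eta> R)" "\<And>R x. 0 \<le> \<eta> R x" "\<And>R x. \<eta> R x \<le> 1"
    "\<And>R x. R > 0 \<Longrightarrow> norm x \<le> R \<Longrightarrow> \<eta> R x = 1" "\<And>R x. R > 0 \<Longrightarrow> norm x \<ge> 2 * R \<Longrightarrow> \<eta> R x = 0"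
    "C > 0" "\<And>R x b. R > 0 \<Longrightarrow> b \<in> Basis \<Longrightarrow> \<bar>pd b (\<eta> R) x\<bar> \<le> C / R"
    "\<And>R x b. R > 0 \<Longrightarrow> b \<in> Basis \<Longrightarrow> norm x < R \<or> norm x > 2 * R \<Longrightarrow> pd b (\<eta> R) x = 0"
    using cutoff_exists by blast
  define \<omega> where "\<omega> = unit_ball_vol 4"
  have \<omega>: "\<omega> > 0" by (simp add: \<omega>_def)
  \<comment> \<open>The factor 64 is four directions times \<open>2 ^ 4\<close> from the volume of
    the ball of radius \<open>2 * R\<close>.\<close>
  have le: "c * (\<omega> * R ^ 4) \<le> 64 * C\<^sup>2 * \<omega> * R\<^sup>2 + K" if R: "R > 0" for R
  proof -
    have 1: "\<omega> * R ^ 4 \<le> n2 (\<eta> R)"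
    proof -
      have "\<omega> * R ^ 4 = (LINT x|lborel. indicator (ball (0::real^4) R) x)" using measure_ball4(1)[of R] R by (simp add: \<omega>_def)
      also have "\<dots> \<le> (LINT x|lborel. (\<eta> R x)\<^sup>2)"
      proof (rule integral_mono)
        show "integrable lborel (indicator (ball (0::real^4) R) :: _ \<Rightarrow> real)"
          by (intro integrable_real_indicator emeasure_bounded_finite) auto
        show "integrable lborel (\<lambda>x. (\<eta> R x)\<^sup>2)" using test_sq[OF \<eta>(1)[OF R]] by (simp add: sq_def)
        show "indicator (ball 0 R) x \<le> (\<eta> R x)\<^sup>2" for x using \<eta>(4)[OF R, of x] by (auto simp: indicator_def)
      qed
      finally show ?thesis by (simp add: n2_def)
    qed
    have 2: "n2 (pd b (\<eta> R)) \<le> 16 * C\<^sup>2 * \<omega> * R\<^sup>2" if b: "b \<in> Basis" for b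
    proof -
      have "n2 (pd b (\<eta> R)) \<le> (LINT x|lborel. (C / R)\<^sup>2 * indicator (cball (0::real^4) (2 * R)) x)" unfolding n2_def
      proof (rule integral_mono)
        show "integrable lborel (\<lambda>x. (C / R)\<^sup>2 * indicator (cball (0::real^4) (2 * R)) x :: real)"
          by (intro integrable_mult_right integrable_real_indicator emeasure_bounded_finite) auto
        show "integrable lborel (\<lambda>x. (pd b (\<eta> R) x)\<^sup>2)" using test_sq[OF test_pd[OF \<eta>(1)[OF R] b]] by (simp add: sq_def)
        show "(pd b (\<eta> R) x)\<^sup>2 \<le> (C / R)\<^sup>2 * indicator (cball 0 (2 * R)) x" for x
        proof (cases "norm x > 2 * R")
          case True then show ?thesis using \<eta>(8)[OF R b, of x] by simp
        next
          case False
          have "\<bar>pd b (\<eta> R) x\<bar>\<^sup>2 \<le> (C / R)\<^sup>2" by (intro power_mono \<eta>(7)[OF R b]) simp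
          then show ?thesis using False by simp
        qed
      qed
      also have "\<dots> = (C / R)\<^sup>2 * (\<omega> * (2 * R) ^ 4)" using measure_ball4(2)[of "2 * R"] R by (simp add: \<omega>_def)
      also have "\<dots> = 16 * C\<^sup>2 * \<omega> * R\<^sup>2" using R by (simp add: power_divide power_mult_distrib field_simps eval_nat_numeral)
      finally show ?thesis .
    qed
    have "c * (\<omega> * R ^ 4) \<le> c * n2 (\<eta> R)" using c(1) by (intro mult_left_mono 1) simp
    also have "\<dots> \<le> (\<Sum>b\<in>Basis. n2 (pd b (\<eta> R))) + K" by (rule c(2)[OF \<eta>(1)[OF R]]) (use \<eta>(2,3) in simp)
    also have "\<dots> \<le> (\<Sum>b\<in>(Basis::(real^4) set). 16 * C\<^sup>2 * \<omega> * R\<^sup>2) + K" by (intro add_right_mono sum_mono 2)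
    finally show ?thesis by simp
  qed
  define a b where "a = c * \<omega>" "b = 64 * C\<^sup>2 * \<omega>"
  have a: "a > 0" "b \<ge> 0" using c(1) \<omega> by (auto simp: a_b_def)
  \<comment> \<open>Large enough for \<open>a * R\<close> to exceed
    \<open>b + \<bar>K\<bar>\<close>, and at least 1, so that the powers of \<open>R\<close> are
    ordered.\<close>
  define R where "R = 1 + (b + \<bar>K\<bar>) / a"
  have R: "R \<ge> 1" using a by (simp add: R_def)
  have aR: "a * R = a + b + \<bar>K\<bar>" unfolding R_def distrib_left using a by simp
  have R2: "R\<^sup>2 \<ge> R" "R\<^sup>2 \<ge> 1"
    using mult_left_mono[OF R, of R] R one_le_power[OF R, of 2] by (simp_all add: power2_eq_square)
  have "a * R ^ 4 \<le> b * R\<^sup>2 + K" using le[of R] R by (simp add: a_b_def mult_ac)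
  also have "\<dots> \<le> (b + \<bar>K\<bar>) * R\<^sup>2"
  proof -
    have "K \<le> \<bar>K\<bar> * R\<^sup>2" using R2(2) mult_left_mono[of 1 "R\<^sup>2" "\<bar>K\<bar>"] by simp
    then show ?thesis by (simp add: distrib_right)
  qed
  also have "\<dots> < (a * R) * R\<^sup>2" using a R2 by (intro mult_strict_right_mono) (auto simp: aR)
  also have "\<dots> \<le> a * R\<^sup>2 * R\<^sup>2" using a R2 by (intro mult_right_mono mult_left_mono) auto
  also have "\<dots> = a * R ^ 4" by (simp add: eval_nat_numeral)
  finally show False by simp
qed

end

section \<open>The radial system as a system of ordinary differential equations\<close>

lemma deriv_mono:
  fixes f :: "real \<Rightarrow> real"
  assumes "\<And>t. t \<ge> c \<Longrightarrow> (f has_real_derivative f' t) (at t)" "\<And>t. t \<ge> c \<Longrightarrow> f' t \<ge> 0" "c \<le> s" "s \<le> t"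
  shows "f s \<le> f t"
  by (rule DERIV_nonneg_imp_nondecreasing[OF assms(4)]) (use assms in \<open>meson order_trans\<close>)

text \<open>With \<open>w = s u\<close>, \<open>z = s v\<close>, the radial equation for \<open>u\<close> becomes
  \<open>w'' = - ((\<kappa> + qf \<mu> \<alpha> \<beta> p w z s) w) / (4 s)\<close> with \<open>\<kappa> = - \<lambda>\<^sub>1\<close>.\<close>

definition qf :: "real \<Rightarrow> real \<Rightarrow> real \<Rightarrow> real \<Rightarrow> (real \<Rightarrow> real) \<Rightarrow> (real \<Rightarrow> real) \<Rightarrow> real \<Rightarrow> real" where
  "qf \<mu> \<alpha> \<beta> p w z t = \<mu> * (w t / t)\<^sup>2 + \<alpha> * \<bar>w t / t\<bar> powr (p - 2) + \<beta> * (z t / t)\<^sup>2"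

text \<open>In terms of \<open>y = w / t\<close> and \<open>x = z / t\<close> the bracket is
  \<open>t (y^2 + y^4 + x^2 + x^4)\<close>. Up to a constant this is the radial density of the
  integral of \<open>u^2 + u^4 + v^2 + v^4\<close>, so the bound is by a function whose primitive
  stays bounded.\<close>

lemma qf_bound:
  assumes t: "t > 0" and p: "2 < p" "p < 4"
  shows "\<bar>(\<kappa> + qf \<mu> \<alpha> \<beta> p w z t) * w t / (4 * t) * w t\<bar> \<le>
    (\<bar>\<kappa>\<bar> + \<bar>\<mu>\<bar> + \<bar>\<alpha>\<bar> + \<bar>\<beta>\<bar>) * ((w t)\<^sup>2 / t + w t ^ 4 / t ^ 3 + (z t)\<^sup>2 / t + z t ^ 4 / t ^ 3)"
proof -
  define y x where "y = w t / t" "x = z t / t"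
  have wy: "w t = t * y" "z t = t * x" using t by (simp_all add: y_x_def)
  have \<sigma>: "(w t)\<^sup>2 / t + w t ^ 4 / t ^ 3 + (z t)\<^sup>2 / t + z t ^ 4 / t ^ 3 = t * (y\<^sup>2 + y ^ 4 + x\<^sup>2 + x ^ 4)"
    using t unfolding wy by (simp add: power_mult_distrib power2_eq_square power3_eq_cube eval_nat_numeral field_simps)
  define H where "H = y\<^sup>2 + y ^ 4 + x\<^sup>2 + x ^ 4"
  have nn: "0 \<le> y\<^sup>2" "0 \<le> y ^ 4" "0 \<le> x\<^sup>2" "0 \<le> x ^ 4" by auto
  have 1: "\<bar>y\<bar> powr (p - 2) * y\<^sup>2 \<le> H"
  proof -
    have "\<bar>y\<bar> powr (p - 2) * y\<^sup>2 \<le> (1 + y\<^sup>2) * y\<^sup>2" by (intro mult_right_mono powr_le_1_sq p) auto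
    also have "\<dots> = y\<^sup>2 + y ^ 4" by (simp add: power2_eq_square eval_nat_numeral algebra_simps)
    finally show ?thesis unfolding H_def using nn by linarith
  qed
  have 2: "x\<^sup>2 * y\<^sup>2 \<le> H"
  proof -
    have "0 \<le> (x\<^sup>2 - y\<^sup>2)\<^sup>2" by simp
    then have "2 * (x\<^sup>2 * y\<^sup>2) \<le> x ^ 4 + y ^ 4" by (simp add: power2_eq_square eval_nat_numeral algebra_simps)
    moreover have "0 \<le> x\<^sup>2 * y\<^sup>2" by simp
    ultimately show ?thesis unfolding H_def using nn by linarith
  qed
  have e: "(\<kappa> + qf \<mu> \<alpha> \<beta> p w z t) * w t / (4 * t) * w t = t * ((\<kappa> * y\<^sup>2 + \<mu> * y ^ 4 + \<alpha> * (\<bar>y\<bar> powr (p - 2) * y\<^sup>2) + \<beta> * (x\<^sup>2 * y\<^sup>2)) / 4)"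
  proof -
    have "c * (t * y) / (4 * t) * (t * y) = t * (c * y\<^sup>2 / 4)" for c using t by (simp add: power2_eq_square)
    then have "(\<kappa> + qf \<mu> \<alpha> \<beta> p w z t) * w t / (4 * t) * w t = t * ((\<kappa> + qf \<mu> \<alpha> \<beta> p w z t) * y\<^sup>2 / 4)"
      unfolding wy(1) .
    then show ?thesis unfolding qf_def y_x_def[symmetric] by (simp add: power2_eq_square eval_nat_numeral algebra_simps)
  qed
  have m: "\<bar>c * r\<bar> \<le> \<bar>c\<bar> * H" if "0 \<le> r" "r \<le> H" for c r
    unfolding abs_mult using that by (intro mult_left_mono) auto
  have "y\<^sup>2 \<le> H" "y ^ 4 \<le> H" unfolding H_def using nn by linarith+
  then have "\<bar>\<kappa> * y\<^sup>2\<bar> \<le> \<bar>\<kappa>\<bar> * H" "\<bar>\<mu> * y ^ 4\<bar> \<le> \<bar>\<mu>\<bar> * H" "\<bar>\<alpha> * (\<bar>y\<bar> powr (p - 2) * y\<^sup>2)\<bar> \<le> \<bar>\<alpha>\<bar> * H" "\<bar>\<beta> * (x\<^sup>2 * y\<^sup>2)\<bar> \<le> \<bar>\<beta>\<bar> * H"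
    using 1 2 nn by (auto intro!: m simp del: abs_mult)
  moreover have "0 \<le> H" unfolding H_def using nn by linarith
  ultimately have "\<bar>(\<kappa> * y\<^sup>2 + \<mu> * y ^ 4 + \<alpha> * (\<bar>y\<bar> powr (p - 2) * y\<^sup>2) + \<beta> * (x\<^sup>2 * y\<^sup>2)) / 4\<bar> \<le> (\<bar>\<kappa>\<bar> + \<bar>\<mu>\<bar> + \<bar>\<alpha>\<bar> + \<bar>\<beta>\<bar>) * H"
  proof -
    assume B: "\<bar>\<kappa> * y\<^sup>2\<bar> \<le> \<bar>\<kappa>\<bar> * H" "\<bar>\<mu> * y ^ 4\<bar> \<le> \<bar>\<mu>\<bar> * H" "\<bar>\<alpha> * (\<bar>y\<bar> powr (p - 2) * y\<^sup>2)\<bar> \<le> \<bar>\<alpha>\<bar> * H" "\<bar>\<beta> * (x\<^sup>2 * y\<^sup>2)\<bar> \<le> \<bar>\<beta>\<bar> * H"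
    have ad: "\<bar>a + b\<bar> \<le> a' + b'" if "\<bar>a\<bar> \<le> a'" "\<bar>b\<bar> \<le> b'" for a b a' b' :: real using that by linarith
    have q: "\<bar>r / 4\<bar> \<le> c" if "\<bar>r\<bar> \<le> c" for r c :: real using that by (simp add: abs_divide)
    show ?thesis unfolding distrib_right by (intro q ad B)
  qed
  then have "t * \<bar>(\<kappa> * y\<^sup>2 + \<mu> * y ^ 4 + \<alpha> * (\<bar>y\<bar> powr (p - 2) * y\<^sup>2) + \<beta> * (x\<^sup>2 * y\<^sup>2)) / 4\<bar> \<le> t * ((\<bar>\<kappa>\<bar> + \<bar>\<mu>\<bar> + \<bar>\<alpha>\<bar> + \<bar>\<beta>\<bar>) * H)"
    using t by (intro mult_left_mono) auto
  then show ?thesis unfolding e \<sigma> H_def[symmetric] using t by (simp add: abs_mult mult_ac)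
qed

text \<open>\<open>w w'\<close> has derivative \<open>(w')^2 - h w\<close>, and adding
  \<open>c S\<close> makes it monotone with derivative at least \<open>(w')^2\<close>. Its
  boundedness expresses that \<open>(w')^2\<close> is integrable. From there
  \<open>w^2 / sqrt t\<close> can grow no faster than \<open>S + X\<close>, because
  \<open>2 w w' / sqrt t \<le> w^2 / t + (w')^2\<close>. \<open>X\<close> is returned as well, since
  it bounds the integral of \<open>(w')^2\<close> later.\<close>

lemma ode_decay:
  fixes w w' S \<sigma> :: "real \<Rightarrow> real"
  assumes a: "a \<ge> 1"
    and dw: "\<And>t. t \<ge> a \<Longrightarrow> (w has_real_derivative w' t) (at t)"
    and dw': "\<And>t. t \<ge> a \<Longrightarrow> (w' has_real_derivative - h t) (at t)"
    and h: "\<And>t. t \<ge> a \<Longrightarrow> \<bar>h t * w t\<bar> \<le> c * \<sigma> t"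
    and S: "\<And>t. t \<ge> a \<Longrightarrow> (S has_real_derivative \<sigma> t) (at t)" "\<And>t. t \<ge> a \<Longrightarrow> S t \<le> C"
    and \<sigma>: "\<And>t. t \<ge> a \<Longrightarrow> (w t)\<^sup>2 / t \<le> \<sigma> t" and c: "c \<ge> 0"
  obtains X X' K where "\<And>t. t \<ge> a \<Longrightarrow> (X has_real_derivative X' t) (at t)" "\<And>t. t \<ge> a \<Longrightarrow> (w' t)\<^sup>2 \<le> X' t"
     "\<And>t. t \<ge> a \<Longrightarrow> X t \<le> K" "\<And>t. t \<ge> a \<Longrightarrow> (w t)\<^sup>2 \<le> K * sqrt t" "K > 0"
proof -
  define X where "X t = w t * w' t + c * S t" for t
  define X' where "X' t = (w' t)\<^sup>2 - h t * w t + c * \<sigma> t" for t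
  have dX: "(X has_real_derivative X' t) (at t)" if "t \<ge> a" for t
    unfolding X_def[abs_def] X'_def
    by (auto intro!: derivative_eq_intros dw dw' S(1) that simp: power2_eq_square algebra_simps)
  have X': "(w' t)\<^sup>2 \<le> X' t" if "t \<ge> a" for t using h[OF that] unfolding X'_def by linarith
  have X'0: "X' t \<ge> 0" if "t \<ge> a" for t using X'[OF that] zero_le_power2 order_trans by blast
  \<comment> \<open>If \<open>X\<close> exceeded this bound, \<open>w w'\<close> would stay at least
    1, so \<open>w^2\<close> would grow at least like \<open>2 s\<close>; hence
    \<open>w^2 / s\<close> would be at least 1 from \<open>2 t\<close> on, and \<open>S\<close>
    could not be bounded.\<close>
  have XK: "X t \<le> c * C + 1" if t1: "t \<ge> a" for t
  proof (rule ccontr)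
    assume "\<not> X t \<le> c * C + 1"
    have ww: "w s * w' s \<ge> 1" if "s \<ge> t" for s
    proof -
      have "X t \<le> X s" by (rule deriv_mono[OF dX X'0 t1 that])
      moreover have "c * S s \<le> c * C" using S(2)[of s] t1 that c by (intro mult_left_mono) auto
      ultimately show ?thesis using \<open>\<not> X t \<le> c * C + 1\<close> unfolding X_def[of s] by linarith
    qed
    have w2: "(w s)\<^sup>2 \<ge> 2 * s - 2 * t" if "s \<ge> t" for s
    proof -
      have "(w t)\<^sup>2 - 2 * t \<le> (w s)\<^sup>2 - 2 * s"
      proof (rule deriv_mono[of t "\<lambda>s. (w s)\<^sup>2 - 2 * s" "\<lambda>s. 2 * (w s * w' s) - 2"])
        show "((\<lambda>s. (w s)\<^sup>2 - 2 * s) has_real_derivative 2 * (w s * w' s) - 2) (at s)" if "s \<ge> t" for s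
          using that t1 by (auto intro!: derivative_eq_intros dw)
        show "2 * (w s * w' s) - 2 \<ge> 0" if "s \<ge> t" for s using ww[OF that] by linarith
      qed (use that in auto)
      then show ?thesis using zero_le_power2[of "w t"] by linarith
    qed
    have \<sigma>1: "\<sigma> s \<ge> 1" if s: "s \<ge> 2 * t" for s
    proof -
      have s0: "s \<ge> t" "s > 0" using s t1 a by auto
      have "(w s)\<^sup>2 \<ge> s" using w2[OF s0(1)] s by linarith
      then have "1 \<le> (w s)\<^sup>2 / s" using s0 by simp
      then show ?thesis using \<sigma>[of s] s0 t1 by linarith
    qed
    \<comment> \<open>Far enough for the linear lower bound on \<open>S\<close> to pass
      \<open>C\<close>.\<close>
    define s where "s = 2 * t + \<bar>C\<bar> + \<bar>S (2 * t)\<bar> + 1"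
    have t2: "2 * t \<ge> a" using t1 a by linarith
    have "S (2 * t) - 2 * t \<le> S s - s"
    proof (rule deriv_mono[of "2 * t" "\<lambda>s. S s - s" "\<lambda>s. \<sigma> s - 1"])
      show "((\<lambda>s. S s - s) has_real_derivative \<sigma> s - 1) (at s)" if "s \<ge> 2 * t" for s
        using that t2 by (auto intro!: derivative_eq_intros S(1))
      show "\<sigma> s - 1 \<ge> 0" if "s \<ge> 2 * t" for s using \<sigma>1[OF that] by simp
    qed (auto simp: s_def)
    moreover have "S s \<le> C" using t2 by (intro S(2)) (simp add: s_def)
    ultimately show False unfolding s_def by linarith
  qed
  define Y where "Y t = (w t)\<^sup>2 / sqrt t - S t - X t" for t
  have Yd: "(Y has_real_derivative (2 * w t * w' t / sqrt t - (w t)\<^sup>2 / (2 * t * sqrt t) - \<sigma> t - X' t)) (at t)" if t: "t \<ge> a" for t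
  proof -
    define r where "r = sqrt t"
    have r: "r > 0" "t = r * r" using t a by (auto simp: r_def)
    have "((\<lambda>t. (w t)\<^sup>2 / sqrt t - S t - X t) has_real_derivative ((2 * w t * w' t * r - (w t)\<^sup>2 * (inverse r / 2)) / (r * r) - \<sigma> t - X' t)) (at t)"
      using t a unfolding r_def by (auto intro!: derivative_eq_intros dw S(1) dX)
    moreover have "(2 * w t * w' t * r - (w t)\<^sup>2 * (inverse r / 2)) / (r * r) = 2 * w t * w' t / r - (w t)\<^sup>2 / (2 * (r * r) * r)"
      using r(1) by (simp add: field_simps)
    ultimately show ?thesis unfolding Y_def[abs_def] r_def[symmetric] using r(2) by simp
  qed
  have Yb: "2 * w t * w' t / sqrt t - (w t)\<^sup>2 / (2 * t * sqrt t) - \<sigma> t - X' t \<le> 0" if t: "t \<ge> a" for t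
  proof -
    have t0: "t > 0" using t a by simp
    have "2 * (w t / sqrt t) * w' t \<le> (w t / sqrt t)\<^sup>2 + (w' t)\<^sup>2" by (rule sum_squares_bound)
    also have "(w t / sqrt t)\<^sup>2 = (w t)\<^sup>2 / t" using t0 by (simp add: power_divide)
    finally have "2 * w t * w' t / sqrt t \<le> \<sigma> t + X' t" using \<sigma>[OF t] X'[OF t] by simp
    moreover have "(w t)\<^sup>2 / (2 * t * sqrt t) \<ge> 0" using t0 by simp
    ultimately show ?thesis by linarith
  qed
  define K where "K = \<bar>Y a\<bar> + \<bar>C\<bar> + \<bar>c * C + 1\<bar> + 1"
  have K: "(w t)\<^sup>2 \<le> K * sqrt t" if t: "t \<ge> a" for t
  proof -
    have "- Y a \<le> - Y t"
    proof (rule deriv_mono[of a "\<lambda>t. - Y t" "\<lambda>t. - (2 * w t * w' t / sqrt t - (w t)\<^sup>2 / (2 * t * sqrt t) - \<sigma> t - X' t)"])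
      show "((\<lambda>t. - Y t) has_real_derivative - (2 * w s * w' s / sqrt s - (w s)\<^sup>2 / (2 * s * sqrt s) - \<sigma> s - X' s)) (at s)"
        if "s \<ge> a" for s by (rule DERIV_minus[OF Yd[OF that]])
      show "- (2 * w s * w' s / sqrt s - (w s)\<^sup>2 / (2 * s * sqrt s) - \<sigma> s - X' s) \<ge> 0" if "s \<ge> a" for s
        using Yb[OF that] by linarith
    qed (use t in auto)
    then have "(w t)\<^sup>2 / sqrt t \<le> Y a + S t + X t" unfolding Y_def[of t] by linarith
    also have "\<dots> \<le> K" unfolding K_def using S(2)[OF t] XK[OF t] by linarith
    finally show ?thesis using t a by (simp add: divide_le_eq)
  qed
  have "X t \<le> K" if "t \<ge> a" for t using XK[OF that] unfolding K_def by linarith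
  moreover have "K > 0" unfolding K_def by linarith
  ultimately show ?thesis using that[of X X' K] dX X' K by blast
qed

text \<open>\<open>z\<close> acts only through the coefficient of \<open>w\<close>: what is used of
  its own equation is the decay. With an integrating factor the energy \<open>E1\<close> is
  nondecreasing near infinity, so if it were positive anywhere there, \<open>E0\<close> would stay
  above some \<epsilon>. But \<open>E0 / sqrt t = (w')^2 + w^2 / t\<close> is integrable and
  \<open>\<epsilon> / sqrt t\<close> is not.\<close>

lemma ode_vanish:
  fixes w w' z z' S :: "real \<Rightarrow> real"
  assumes a: "a \<ge> 0" and \<kappa>: "\<kappa> > 0" and p: "8 / 3 < p" "p < 4"
    and dw: "\<And>t. t > a \<Longrightarrow> (w has_real_derivative w' t) (at t)"
    and dw': "\<And>t. t > a \<Longrightarrow> (w' has_real_derivative - ((\<kappa> + qf \<mu>1 \<alpha>1 \<beta> p w z t) * w t / (4 * t))) (at t)"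
    and dz: "\<And>t. t > a \<Longrightarrow> (z has_real_derivative z' t) (at t)"
    and dz': "\<And>t. t > a \<Longrightarrow> (z' has_real_derivative - ((\<kappa>2 + qf \<mu>2 \<alpha>2 \<beta> p z w t) * z t / (4 * t))) (at t)"
    and S: "\<And>t. t > a \<Longrightarrow> (S has_real_derivative (w t)\<^sup>2 / t + w t ^ 4 / t ^ 3 + (z t)\<^sup>2 / t + z t ^ 4 / t ^ 3) (at t)"
      "\<And>t. t > a \<Longrightarrow> S t \<le> C"
    and b: "b > a"
  shows "w b = 0"
proof -
  define \<sigma> where "\<sigma> t = (w t)\<^sup>2 / t + w t ^ 4 / t ^ 3 + (z t)\<^sup>2 / t + z t ^ 4 / t ^ 3" for t
  define a1 where "a1 = max (a + 1) 1"
  have a1: "a1 \<ge> 1" "a1 > a" by (auto simp: a1_def)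
  have p2: "2 < p" using p by simp
  have nn: "0 \<le> (w t)\<^sup>2 / t" "0 \<le> w t ^ 4 / t ^ 3" "0 \<le> (z t)\<^sup>2 / t" "0 \<le> z t ^ 4 / t ^ 3" if "t \<ge> a1" for t
    using that a1 by auto
  obtain X X' K where X: "\<And>t. t \<ge> a1 \<Longrightarrow> (X has_real_derivative X' t) (at t)" "\<And>t. t \<ge> a1 \<Longrightarrow> (w' t)\<^sup>2 \<le> X' t"
     "\<And>t. t \<ge> a1 \<Longrightarrow> X t \<le> K" "\<And>t. t \<ge> a1 \<Longrightarrow> (w t)\<^sup>2 \<le> K * sqrt t" "K > 0"
  proof (rule ode_decay[of a1 w w' "\<lambda>t. (\<kappa> + qf \<mu>1 \<alpha>1 \<beta> p w z t) * w t / (4 * t)" "\<bar>\<kappa>\<bar> + \<bar>\<mu>1\<bar> + \<bar>\<alpha>1\<bar> + \<bar>\<beta>\<bar>" \<sigma> S C])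
    show "\<bar>(\<kappa> + qf \<mu>1 \<alpha>1 \<beta> p w z t) * w t / (4 * t) * w t\<bar> \<le> (\<bar>\<kappa>\<bar> + \<bar>\<mu>1\<bar> + \<bar>\<alpha>1\<bar> + \<bar>\<beta>\<bar>) * \<sigma> t" if "t \<ge> a1" for t
      unfolding \<sigma>_def using that a1 by (intro qf_bound p2 p) auto
    show "(w t)\<^sup>2 / t \<le> \<sigma> t" if "t \<ge> a1" for t unfolding \<sigma>_def using nn[OF that] by linarith
  qed (use a1 dw dw' S in \<open>auto simp: \<sigma>_def\<close>)
  obtain X2 X2' K2 where X2: "\<And>t. t \<ge> a1 \<Longrightarrow> (z t)\<^sup>2 \<le> K2 * sqrt t" "K2 > 0"
  proof (rule ode_decay[of a1 z z' "\<lambda>t. (\<kappa>2 + qf \<mu>2 \<alpha>2 \<beta> p z w t) * z t / (4 * t)" "\<bar>\<kappa>2\<bar> + \<bar>\<mu>2\<bar> + \<bar>\<alpha>2\<bar> + \<bar>\<beta>\<bar>" \<sigma> S C])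
    show "\<bar>(\<kappa>2 + qf \<mu>2 \<alpha>2 \<beta> p z w t) * z t / (4 * t) * z t\<bar> \<le> (\<bar>\<kappa>2\<bar> + \<bar>\<mu>2\<bar> + \<bar>\<alpha>2\<bar> + \<bar>\<beta>\<bar>) * \<sigma> t" if t: "t \<ge> a1" for t
    proof -
      have e: "\<sigma> t = (z t)\<^sup>2 / t + z t ^ 4 / t ^ 3 + (w t)\<^sup>2 / t + w t ^ 4 / t ^ 3" by (simp add: \<sigma>_def)
      show ?thesis unfolding e using t a1 by (intro qf_bound p2 p) auto
    qed
    show "(z t)\<^sup>2 / t \<le> \<sigma> t" if "t \<ge> a1" for t unfolding \<sigma>_def using nn[OF that] by linarith
  qed (use a1 dz dz' S in \<open>auto simp: \<sigma>_def\<close>)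
  define q where "q t = qf \<mu>1 \<alpha>1 \<beta> p w z t" for t
  \<comment> \<open>The aim is \<open>q / sqrt t = O(t powr (- 1 - s0))\<close>. The power term of
    \<open>q\<close> has exponent \<open>- 3 * (p - 2) / 4\<close>, which is at most
    \<open>- 1/2 - s0\<close> for \<open>s0 \<le> (3 * p - 8) / 4\<close>; this bound is positive
    exactly for \<open>p > 8/3\<close>. The other bound 1/2 serves the term
    \<open>w w' / (t sqrt t)\<close> of \<open>D\<close>.\<close>
  define s0 where "s0 = min (1/2) ((3 * p - 8) / 4)"
  have s0: "s0 > 0" "s0 \<le> 1/2" "s0 \<le> (3 * p - 8) / 4" using p by (auto simp: s0_def min_def field_simps)
  define Cq where "Cq = \<bar>\<mu>1\<bar> * K + \<bar>\<alpha>1\<bar> * K powr ((p - 2) / 2) + \<bar>\<beta>\<bar> * K2"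
  have Cq: "Cq \<ge> 0" unfolding Cq_def using X(5) X2(2) by simp
  have qb: "\<bar>q t\<bar> \<le> Cq * (sqrt t * t powr (- 1 - s0))" if t: "t \<ge> a1" for t
  proof -
    have t1: "t \<ge> 1" "t > 0" using t a1 by auto
    have st: "sqrt t = t powr (1/2)" using t1 by (simp add: powr_half_sqrt)
    have B: "sqrt t * t powr (- 1 - s0) = t powr (- 1/2 - s0)" unfolding st powr_add[symmetric] by simp
    have sq: "x\<^sup>2 \<le> M * sqrt t \<Longrightarrow> (x / t)\<^sup>2 \<le> M * t powr (- 3/2)" for x M
    proof -
      assume "x\<^sup>2 \<le> M * sqrt t"
      then have "x\<^sup>2 / t\<^sup>2 \<le> M * (sqrt t / t\<^sup>2)" unfolding times_divide_eq_right by (intro divide_right_mono) auto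
      also have "sqrt t / t\<^sup>2 = t powr (- 3/2)"
      proof -
        have "t\<^sup>2 = t powr 2" using t1 by simp
        then show ?thesis unfolding st using powr_diff[of t "1/2" 2] by simp
      qed
      finally show ?thesis by (simp add: power_divide)
    qed
    have 1: "(w t / t)\<^sup>2 \<le> K * t powr (- 1/2 - s0)"
      by (rule order_trans[OF sq[OF X(4)[OF t]]]) (use X(5) t1 s0 in \<open>intro mult_left_mono powr_mono; simp\<close>)
    have 2: "(z t / t)\<^sup>2 \<le> K2 * t powr (- 1/2 - s0)"
      by (rule order_trans[OF sq[OF X2(1)[OF t]]]) (use X2(2) t1 s0 in \<open>intro mult_left_mono powr_mono; simp\<close>)
    have 3: "\<bar>w t / t\<bar> powr (p - 2) \<le> K powr ((p - 2) / 2) * t powr (- 1/2 - s0)"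
    proof -
      have "\<bar>w t / t\<bar> powr (p - 2) = ((w t / t)\<^sup>2) powr ((p - 2) / 2)"
      proof (cases "w t / t = 0")
        case False
        have "y\<^sup>2 = \<bar>y\<bar> powr 2" if "y \<noteq> 0" for y :: real using that by simp
        from this[OF False] have "(w t / t)\<^sup>2 = \<bar>w t / t\<bar> powr 2" .
        moreover have "2 * ((p - 2) / 2) = p - 2" by simp
        ultimately show ?thesis by (simp only: powr_powr)
      next
        case True then show ?thesis unfolding True using p by simp
      qed
      also have "\<dots> \<le> (K * t powr (- 3/2)) powr ((p - 2) / 2)"
        by (intro powr_mono2 sq X(4) t) (use p in auto)
      also have "\<dots> = K powr ((p - 2) / 2) * t powr ((- 3/2) * ((p - 2) / 2))"
        using X(5) by (simp add: powr_mult powr_powr)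
      also have "\<dots> \<le> K powr ((p - 2) / 2) * t powr (- 1/2 - s0)"
        using t1 s0 by (intro mult_left_mono powr_mono) (auto simp: field_simps)
      finally show ?thesis .
    qed
    define B' where "B' = t powr (- 1/2 - s0)"
    have "\<bar>\<mu>1 * (w t / t)\<^sup>2\<bar> \<le> \<bar>\<mu>1\<bar> * (K * B')" unfolding abs_mult B'_def using 1 by (intro mult_left_mono) auto
    moreover have "\<bar>\<alpha>1 * \<bar>w t / t\<bar> powr (p - 2)\<bar> \<le> \<bar>\<alpha>1\<bar> * (K powr ((p - 2) / 2) * B')" unfolding abs_mult B'_def using 3 by (intro mult_left_mono) auto
    moreover have "\<bar>\<beta> * (z t / t)\<^sup>2\<bar> \<le> \<bar>\<beta>\<bar> * (K2 * B')" unfolding abs_mult B'_def using 2 by (intro mult_left_mono) auto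
    ultimately have "\<bar>q t\<bar> \<le> \<bar>\<mu>1\<bar> * (K * B') + \<bar>\<alpha>1\<bar> * (K powr ((p - 2) / 2) * B') + \<bar>\<beta>\<bar> * (K2 * B')"
      unfolding q_def qf_def by linarith
    also have "\<dots> = Cq * B'" by (simp add: Cq_def distrib_right mult.assoc)
    finally show ?thesis unfolding B B'_def .
  qed
  \<comment> \<open>The cross term in \<open>E1\<close> cancels the derivatives of the weights in \<open>E0\<close> up to terms that are
    integrable multiples of \<open>E0\<close>.\<close>
  define E0 where "E0 t = sqrt t * (w' t)\<^sup>2 + (w t)\<^sup>2 / sqrt t" for t
  define E1 where "E1 t = sqrt t * (w' t)\<^sup>2 + \<kappa> / 4 * ((w t)\<^sup>2 / sqrt t) - w t * w' t / (2 * sqrt t)" for t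
  define D where "D t = - (q t * (w t * w' t) / (2 * sqrt t)) + q t * (w t)\<^sup>2 / (8 * (t * sqrt t)) + w t * w' t / (4 * (t * sqrt t))" for t
  have dE: "(E1 has_real_derivative D t) (at t)" if t: "t \<ge> a1" for t
  proof -
    define r i where "r = sqrt t" "i = inverse (sqrt t)"
    have r: "r > 0" "t = r * r" "r * i = 1" "i > 0" using t a1 by (auto simp: r_i_def)
    have ta: "t > a" "t > 0" using t a1 by auto
    define R J where "R t = sqrt t" "J t = inverse (sqrt t)" for t :: real
    have RJ: "R t = r" "J t = i" by (simp_all add: R_J_def r_i_def)
    have hR: "(R has_real_derivative i / 2) (at t)"
      unfolding R_J_def[abs_def] r_i_def using ta by (auto intro!: derivative_eq_intros)
    have hJ: "(J has_real_derivative - (i * i * i) / 2) (at t)"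
      unfolding R_J_def[abs_def] r_i_def using ta by (auto intro!: derivative_eq_intros simp: power2_eq_square)
    define y where "y = - ((\<kappa> + q t) * w t / (4 * t))"
    have hy: "(w' has_real_derivative y) (at t)" using dw'[OF ta(1)] by (simp add: y_def q_def)
    have y: "y = - ((\<kappa> + q t) * w t * (i * i) / 4)"
    proof -
      have "inverse t = i * i" using ta by (simp add: r_i_def inverse_mult_distrib[symmetric])
      then show ?thesis unfolding y_def divide_inverse inverse_mult_distrib by (simp add: mult_ac)
    qed
    have dE: "((\<lambda>t. R t * (w' t)\<^sup>2 + \<kappa> / 4 * ((w t)\<^sup>2 * J t) - w t * w' t * J t / 2) has_real_derivative
      (i / 2 * (w' t)\<^sup>2 + r * (2 * w' t * y) + \<kappa> / 4 * (2 * w t * w' t * i - (w t)\<^sup>2 * (i * i * i) / 2)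
       - (w' t * w' t + w t * y) * i / 2 + w t * w' t * (i * i * i) / 4)) (at t)"
      by (auto intro!: derivative_eq_intros hR hJ dw[OF ta(1)] hy simp: RJ algebra_simps add_divide_distrib diff_divide_distrib)
    have ry: "r * (2 * w' t * y) = - ((\<kappa> + q t) * (w t * w' t) * i / 2)"
    proof -
      have "r * (2 * w' t * y) = - ((\<kappa> + q t) * (w t * w' t) * ((r * i) * i) / 2)" unfolding y by (simp add: algebra_simps)
      then show ?thesis unfolding r(3) by simp
    qed
    have D: "D t = - (q t * (w t * w' t) * i / 2) + q t * (w t)\<^sup>2 * (i * i * i) / 8 + w t * w' t * (i * i * i) / 4"
    proof -
      have "inverse (sqrt t) = i" "inverse t = i * i" using ta by (simp_all add: r_i_def inverse_mult_distrib[symmetric])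
      then show ?thesis unfolding D_def divide_inverse inverse_mult_distrib by (simp add: mult_ac)
    qed
    have "i / 2 * (w' t)\<^sup>2 + r * (2 * w' t * y) + \<kappa> / 4 * (2 * w t * w' t * i - (w t)\<^sup>2 * (i * i * i) / 2)
       - (w' t * w' t + w t * y) * i / 2 + w t * w' t * (i * i * i) / 4 = D t"
    proof -
      have "i / 2 * b\<^sup>2 + - ((k + q) * (a * b) * i / 2) + k / 4 * (2 * a * b * i - a\<^sup>2 * (i * i * i) / 2)
        - (b * b + a * - ((k + q) * a * (i * i) / 4)) * i / 2 + a * b * (i * i * i) / 4 =
        - (q * (a * b) * i / 2) + q * a\<^sup>2 * (i * i * i) / 8 + a * b * (i * i * i) / 4" for a b k q i :: real
      proof -
        have e: "i / 2 * b\<^sup>2 = (i * b * b) / 2" "(k + q) * (a * b) * i / 2 = (k * (a * b * i) + q * (a * b * i)) / 2"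
          "k / 4 * (2 * a * b * i - a\<^sup>2 * (i * i * i) / 2) = k * (a * b * i) / 2 - k * (a * a * i * i * i) / 8"
          "(b * b + a * - ((k + q) * a * (i * i) / 4)) * i / 2 = (i * b * b) / 2 - (k * (a * a * i * i * i) + q * (a * a * i * i * i)) / 8"
          "q * (a * b) * i / 2 = q * (a * b * i) / 2" "q * a\<^sup>2 * (i * i * i) / 8 = q * (a * a * i * i * i) / 8"
          by (simp_all add: power2_eq_square algebra_simps add_divide_distrib diff_divide_distrib)
        show ?thesis unfolding e by (simp add: add_divide_distrib)
      qed
      from this[of i "w' t" \<kappa> "q t" "w t"] show ?thesis unfolding ry D unfolding y .
    qed
    moreover have "E1 = (\<lambda>t. R t * (w' t)\<^sup>2 + \<kappa> / 4 * ((w t)\<^sup>2 * J t) - w t * w' t * J t / 2)"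
      by (rule ext) (simp add: E1_def R_J_def field_simps)
    ultimately show ?thesis using dE by simp
  qed
  have ab: "2 * \<bar>w t * w' t\<bar> \<le> E0 t" if t: "t \<ge> a1" for t
  proof -
    \<comment> \<open>The fourth root of \<open>t\<close> distributes the weights
      \<open>sqrt t\<close> and \<open>1 / sqrt t\<close> over the two factors.\<close>
    define r where "r = sqrt (sqrt t)"
    have r: "r > 0" "r * r = sqrt t" using t a1 by (auto simp: r_def)
    have "2 * \<bar>w t / r\<bar> * \<bar>w' t * r\<bar> \<le> \<bar>w t / r\<bar>\<^sup>2 + \<bar>w' t * r\<bar>\<^sup>2" by (rule sum_squares_bound)
    also have "\<dots> = E0 t" unfolding E0_def r(2)[symmetric] using r(1) by (simp add: power_divide power_mult_distrib power2_eq_square mult_ac)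
    also have "2 * \<bar>w t / r\<bar> * \<bar>w' t * r\<bar> = 2 * \<bar>w t * w' t\<bar>" using r(1) by (simp add: abs_mult)
    finally show ?thesis .
  qed
  have E00: "E0 t \<ge> 0" if "t \<ge> a1" for t using that a1 unfolding E0_def by simp
  define C3 where "C3 = Cq + 1"
  have Db: "\<bar>D t\<bar> \<le> C3 * t powr (- 1 - s0) * E0 t" if t: "t \<ge> a1" for t
  proof -
    define r where "r = sqrt t"
    have r: "r \<ge> 1" "t = r * r" "r > 0" using t a1 by (auto simp: r_def)
    have rt: "r \<le> t" using r by (simp add: mult_le_cancel_right1)
    have w2: "(w t)\<^sup>2 \<le> r * E0 t"
    proof -
      have "r * E0 t = r * (r * (w' t)\<^sup>2) + (w t)\<^sup>2" unfolding E0_def r_def[symmetric] using r by (simp add: distrib_left)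
      then show ?thesis using r by simp
    qed
    have ww: "\<bar>w t * w' t\<bar> \<le> E0 t / 2" using ab[OF t] by simp
    define e where "e = E0 t"
    have e0: "e \<ge> 0" using E00[OF t] by (simp add: e_def)
    define T where "T = t powr (- 1 - s0)"
    have T0: "T > 0" using t a1 by (simp add: T_def)
    have q': "\<bar>q t\<bar> \<le> Cq * (r * T)" using qb[OF t] by (simp add: r_def T_def)
    have 1: "\<bar>q t * (w t * w' t) / (2 * r)\<bar> \<le> Cq * T * e / 4"
    proof -
      have "\<bar>q t * (w t * w' t) / (2 * r)\<bar> = \<bar>q t\<bar> * \<bar>w t * w' t\<bar> / (2 * r)" using r by (simp add: abs_mult)
      also have "\<dots> \<le> (Cq * (r * T)) * (e / 2) / (2 * r)"
        using q' ww r e0 Cq T0 by (intro divide_right_mono mult_mono) (auto simp: e_def)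
      also have "\<dots> = Cq * T * e / 4" using r by simp
      finally show ?thesis .
    qed
    have 2: "\<bar>q t * (w t)\<^sup>2 / (8 * (t * r))\<bar> \<le> Cq * T * e / 8"
    proof -
      have "\<bar>q t * (w t)\<^sup>2 / (8 * (t * r))\<bar> = \<bar>q t\<bar> * (w t)\<^sup>2 / (8 * (t * r))" using r by (simp add: abs_mult)
      also have "\<dots> \<le> (Cq * (r * T)) * (r * e) / (8 * (t * r))"
        using q' w2 r e0 Cq T0 by (intro divide_right_mono mult_mono) (auto simp: e_def)
      also have "\<dots> = Cq * T * e / (8 * r)" unfolding r(2) using r(3) by simp
      also have "\<dots> \<le> Cq * T * e / 8" using r e0 Cq T0 by (intro divide_left_mono) auto
      finally show ?thesis .
    qed
    have 3: "\<bar>w t * w' t / (4 * (t * r))\<bar> \<le> T * e / 8"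
    proof -
      have "t * r = t powr (3/2)" using t a1 powr_add[of t 1 "1/2"] by (simp add: r_def powr_half_sqrt)
      then have "1 / (t * r) = t powr (- (3/2))" by (simp only: powr_minus_divide)
      also have "\<dots> \<le> T" unfolding T_def using t a1 s0 by (intro powr_mono) auto
      finally have T1: "1 / (t * r) \<le> T" .
      have "\<bar>w t * w' t / (4 * (t * r))\<bar> = \<bar>w t * w' t\<bar> / 4 * (1 / (t * r))" using r by (simp add: abs_mult)
      also have "\<dots> \<le> (e / 2) / 4 * T" using ww T1 e0 r by (intro mult_mono divide_right_mono) (auto simp: e_def)
      finally show ?thesis by (simp add: mult_ac)
    qed
    have "\<bar>D t\<bar> \<le> \<bar>q t * (w t * w' t) / (2 * r)\<bar> + \<bar>q t * (w t)\<^sup>2 / (8 * (t * r))\<bar> + \<bar>w t * w' t / (4 * (t * r))\<bar>"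
      unfolding D_def r_def[symmetric] by linarith
    also have "\<dots> \<le> Cq * T * e / 4 + Cq * T * e / 8 + T * e / 8" using 1 2 3 by linarith
    also have "\<dots> \<le> Cq * T * e + T * e"
    proof -
      have "0 \<le> Cq * T * e" "0 \<le> T * e" using Cq T0 e0 by auto
      then show ?thesis by linarith
    qed
    also have "\<dots> = C3 * T * e" by (simp add: C3_def distrib_right)
    finally show ?thesis by (simp add: T_def e_def)
  qed
  define k1 where "k1 = min 1 (\<kappa> / 4)"
  have k1: "k1 > 0" "k1 \<le> 1" "k1 \<le> \<kappa> / 4" using \<kappa> by (auto simp: k1_def)
  \<comment> \<open>From \<open>t0\<close> on \<open>1 / sqrt t \<le> k1\<close>, so the cross term
    takes at most half of the lower bound \<open>k1 * E0 t\<close> for the two squares in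
    \<open>E1\<close>.\<close>
  define t0 where "t0 = max a1 (inverse (k1\<^sup>2))"
  have t0: "t0 \<ge> a1" by (simp add: t0_def)
  have E1l: "k1 / 2 * E0 t \<le> E1 t" if t: "t \<ge> t0" for t
  proof -
    have ta: "t \<ge> a1" using t t0 by simp
    define r where "r = sqrt t"
    have r: "r > 0" using ta a1 by (simp add: r_def)
    have "inverse (k1\<^sup>2) \<le> t" using t by (simp add: t0_def)
    then have "sqrt (inverse (k1\<^sup>2)) \<le> r" unfolding r_def by simp
    then have "inverse k1 \<le> r" using k1 by (simp add: real_sqrt_inverse)
    then have kr: "1 / r \<le> k1" using k1 r by (simp add: field_simps)
    have A: "k1 * E0 t \<le> sqrt t * (w' t)\<^sup>2 + \<kappa> / 4 * ((w t)\<^sup>2 / sqrt t)"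
      unfolding E0_def distrib_left using k1 r unfolding r_def[symmetric] by (intro add_mono mult_right_mono) (auto intro!: mult_left_le_one_le)
    have "\<bar>w t * w' t / (2 * r)\<bar> = \<bar>w t * w' t\<bar> / 2 * (1 / r)" using r by (simp add: abs_mult)
    also have "\<dots> \<le> (E0 t / 2) / 2 * k1" using ab[OF ta] kr r E00[OF ta] by (intro mult_mono divide_right_mono) auto
    also have "\<dots> \<le> k1 / 2 * E0 t" using E00[OF ta] k1 by simp
    finally show ?thesis using A unfolding E1_def r_def[symmetric] by linarith
  qed
  define c5 where "c5 = 1 + \<kappa> / 4 + 1"
  have E1u: "E1 t \<le> c5 * E0 t" if ta: "t \<ge> a1" for t
  proof -
    have r: "sqrt t \<ge> 1" using ta a1 by simp
    have n: "0 \<le> sqrt t * (w' t)\<^sup>2" "0 \<le> (w t)\<^sup>2 / sqrt t" using r by auto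
    have "\<bar>w t * w' t / (2 * sqrt t)\<bar> = \<bar>w t * w' t\<bar> / (2 * sqrt t)" using r by (simp add: abs_mult)
    also have "\<dots> \<le> \<bar>w t * w' t\<bar> / 1"
    proof (rule divide_left_mono)
      show "1 \<le> 2 * sqrt t" using r by linarith
    qed (use r in auto)
    also have "\<dots> \<le> E0 t" using ab[OF ta] E00[OF ta] by simp
    finally have 1: "\<bar>w t * w' t / (2 * sqrt t)\<bar> \<le> E0 t" .
    have "\<kappa> / 4 * ((w t)\<^sup>2 / sqrt t) \<le> \<kappa> / 4 * E0 t" using \<kappa> n unfolding E0_def by (intro mult_left_mono) auto
    moreover have "sqrt t * (w' t)\<^sup>2 \<le> E0 t" using n unfolding E0_def by simp
    ultimately show ?thesis using 1 unfolding E1_def c5_def distrib_right by linarith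
  qed
  define C4 where "C4 = C3 * (2 / k1)"
  have C4: "C4 \<ge> 0" unfolding C4_def C3_def using Cq k1 by simp
  have Db': "\<bar>D t\<bar> \<le> C4 * t powr (- 1 - s0) * E1 t" if t: "t \<ge> t0" for t
  proof -
    have ta: "t \<ge> a1" using t t0 by simp
    have "E0 t \<le> 2 / k1 * E1 t" using E1l[OF t] k1 by (simp add: field_simps)
    then have "C3 * t powr (- 1 - s0) * E0 t \<le> C3 * t powr (- 1 - s0) * (2 / k1 * E1 t)"
      using Cq by (intro mult_left_mono) (auto simp: C3_def)
    then show ?thesis using Db[OF ta] by (simp add: C4_def mult_ac)
  qed
  \<comment> \<open>The integrating factor for the error rate \<open>C4 * t powr (- 1 - s0)\<close>.
    The rate is integrable at infinity because \<open>s0 > 0\<close>, so its primitive can be taken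
    to vanish there.\<close>
  define M where "M t = exp (- (C4 / s0) * t powr (- s0))" for t
  have dM: "((\<lambda>t. E1 t * M t) has_real_derivative (D t + C4 * t powr (- 1 - s0) * E1 t) * M t) (at t)" if t: "t \<ge> t0" for t
  proof -
    have ta: "t \<ge> a1" "t > 0" using t t0 a1 by auto
    have "(M has_real_derivative M t * (- (C4 / s0) * (- s0 * t powr (- s0 - 1)))) (at t)"
      unfolding M_def[abs_def] using ta by (auto intro!: derivative_eq_intros)
    moreover have "- (C4 / s0) * (- s0 * t powr (- s0 - 1)) = C4 * t powr (- 1 - s0)"
    proof -
      have e: "- s0 - 1 = - 1 - s0" by simp
      show ?thesis unfolding e using s0(1) by simp
    qed
    ultimately have "(M has_real_derivative M t * (C4 * t powr (- 1 - s0))) (at t)" by simp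
    from DERIV_mult[OF dE[OF ta(1)] this] show ?thesis by (simp add: algebra_simps)
  qed
  have M1: "0 < M t" "M t \<le> 1" for t unfolding M_def using C4 s0 by (auto intro!: mult_nonneg_nonneg)
  have E10: "E1 t1 \<le> 0" if t1: "t1 \<ge> t0" for t1
  proof (rule ccontr)
    assume "\<not> E1 t1 \<le> 0"
    then have pos: "E1 t1 > 0" by simp
    define \<epsilon> where "\<epsilon> = E1 t1 * M t1 / c5"
    have c5: "c5 > 0" using \<kappa> by (simp add: c5_def)
    have \<epsilon>: "\<epsilon> > 0" unfolding \<epsilon>_def using pos M1 c5 by simp
    have lb: "\<epsilon> \<le> E0 t" if t: "t \<ge> t1" for t
    proof -
      have ta: "t \<ge> a1" "t \<ge> t0" using t t1 t0 by auto
      have "E1 t1 * M t1 \<le> E1 t * M t"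
      proof (rule deriv_mono[of t1 "\<lambda>t. E1 t * M t" "\<lambda>s. (D s + C4 * s powr (- 1 - s0) * E1 s) * M s"])
        show "((\<lambda>t. E1 t * M t) has_real_derivative (D s + C4 * s powr (- 1 - s0) * E1 s) * M s) (at s)" if "s \<ge> t1" for s
          using that t1 by (intro dM) simp
        show "(D s + C4 * s powr (- 1 - s0) * E1 s) * M s \<ge> 0" if "s \<ge> t1" for s
          using Db'[of s] that t1 M1(1)[of s] by (intro mult_nonneg_nonneg) auto
      qed (use t in auto)
      also have "E1 t * M t \<le> E1 t * 1"
      proof (rule mult_left_mono[OF M1(2)])
        show "0 \<le> E1 t" using E1l[OF ta(2)] k1 E00[OF ta(1)] by (meson divide_nonneg_nonneg less_imp_le mult_nonneg_nonneg order_trans zero_le_numeral)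
      qed
      also have "\<dots> \<le> c5 * E0 t" using E1u[OF ta(1)] by simp
      finally show ?thesis unfolding \<epsilon>_def using c5 by (simp add: divide_le_eq mult.commute)
    qed
    \<comment> \<open>Far enough for \<open>2 * \<epsilon> * sqrt s\<close>, a primitive of
      \<open>\<epsilon> / sqrt s\<close>, to exceed what the bounds on \<open>X\<close> and
      \<open>S\<close> allow.\<close>
    define s where "s = (sqrt t1 + (\<bar>K\<bar> + \<bar>C\<bar> + \<bar>X t1 + S t1\<bar> + 1) / (2 * \<epsilon>))\<^sup>2"
    have t1p: "t1 \<ge> a1" "t1 > 0" using t1 t0 a1 by auto
    have ss: "sqrt s = sqrt t1 + (\<bar>K\<bar> + \<bar>C\<bar> + \<bar>X t1 + S t1\<bar> + 1) / (2 * \<epsilon>)"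
      unfolding s_def using t1p \<epsilon> by simp
    have st: "t1 \<le> s"
    proof -
      have "sqrt t1 \<le> sqrt s" unfolding ss using \<epsilon> by simp
      then show ?thesis by simp
    qed
    have "X t1 + S t1 - 2 * \<epsilon> * sqrt t1 \<le> X s + S s - 2 * \<epsilon> * sqrt s"
    proof (rule deriv_mono[of t1 "\<lambda>t. X t + S t - 2 * \<epsilon> * sqrt t" "\<lambda>t. X' t + \<sigma> t - \<epsilon> / sqrt t"])
      fix t assume t: "t \<ge> t1"
      then have ta: "t \<ge> a1" "t > a" "t > 0" using t1p a1 by auto
      show "((\<lambda>t. X t + S t - 2 * \<epsilon> * sqrt t) has_real_derivative X' t + \<sigma> t - \<epsilon> / sqrt t) (at t)"
      proof (intro DERIV_diff DERIV_add X(1) ta)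
        show "(S has_real_derivative \<sigma> t) (at t)" unfolding \<sigma>_def by (rule S(1)[OF ta(2)])
        have "((\<lambda>t. 2 * \<epsilon> * sqrt t) has_real_derivative 2 * \<epsilon> * (inverse (sqrt t) / 2)) (at t)"
          by (intro DERIV_cmult DERIV_real_sqrt ta)
        then show "((\<lambda>t. 2 * \<epsilon> * sqrt t) has_real_derivative \<epsilon> / sqrt t) (at t)" by (simp add: inverse_eq_divide)
      qed
      have "\<epsilon> / sqrt t \<le> E0 t / sqrt t" using lb[OF t] ta by (intro divide_right_mono) auto
      also have "\<dots> = (w' t)\<^sup>2 + (w t)\<^sup>2 / t"
      proof -
        define r where "r = sqrt t"
        have r: "r > 0" "t = r * r" using ta by (auto simp: r_def)
        show ?thesis unfolding E0_def r_def[symmetric] unfolding r(2) using r(1) by (simp add: add_divide_distrib)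
      qed
      also have "\<dots> \<le> X' t + \<sigma> t" using X(2)[OF ta(1)] nn[OF ta(1)] unfolding \<sigma>_def by linarith
      finally show "X' t + \<sigma> t - \<epsilon> / sqrt t \<ge> 0" by simp
    qed (use st in auto)
    moreover have "X s \<le> K" "S s \<le> C" using st t1p a1 by (auto intro!: X(3) S(2))
    moreover have "2 * \<epsilon> * sqrt s = 2 * \<epsilon> * sqrt t1 + (\<bar>K\<bar> + \<bar>C\<bar> + \<bar>X t1 + S t1\<bar> + 1)"
      unfolding ss distrib_left using \<epsilon> by simp
    ultimately show False by linarith
  qed
  have wz: "w t = 0 \<and> w' t = 0" if t: "t \<ge> t0" for t
  proof -
    have ta: "t \<ge> a1" "t > 0" using t t0 a1 by auto
    have "k1 / 2 * E0 t \<le> 0" using E1l[OF t] E10[OF t] by linarith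
    then have "E0 t \<le> 0" using k1 by (simp add: mult_le_0_iff)
    then have "E0 t = 0" using E00[OF ta(1)] by simp
    moreover have "0 \<le> sqrt t * (w' t)\<^sup>2" "0 \<le> (w t)\<^sup>2 / sqrt t" using ta by auto
    ultimately have "sqrt t * (w' t)\<^sup>2 = 0" "(w t)\<^sup>2 / sqrt t = 0" unfolding E0_def by linarith+
    then show ?thesis using ta by auto
  qed
  show ?thesis
  proof (cases "b \<ge> t0")
    case True then show ?thesis using wz by blast
  next
    case False
    have bt: "b \<le> t0" using False by simp
    have cw: "continuous_on {b..t0} w" "continuous_on {b..t0} z"
      by (rule DERIV_continuous_on, rule has_field_derivative_at_within, rule dw dz, use b in simp)+
    have b0: "b > 0" using a b by simp
    have "continuous_on {b..t0} (\<lambda>t. (\<kappa> + q t) / (4 * t))"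
      unfolding q_def qf_def by (intro continuous_intros cw continuous_on_powr') (use b0 p in auto)
    then have "compact ((\<lambda>t. (\<kappa> + q t) / (4 * t)) ` {b..t0})" by (intro compact_continuous_image) auto
    then have "bounded ((\<lambda>t. (\<kappa> + q t) / (4 * t)) ` {b..t0})" by (rule compact_imp_bounded)
    then obtain L where "\<forall>y\<in>(\<lambda>t. (\<kappa> + q t) / (4 * t)) ` {b..t0}. norm y \<le> L" unfolding bounded_iff by blast
    then have L: "\<bar>(\<kappa> + q t) / (4 * t)\<bar> \<le> L" if "t \<in> {b..t0}" for t using that by (simp only: ball_simps real_norm_def)
    have L0: "L \<ge> 0" using order_trans[OF abs_ge_zero L[of b]] bt by simp
    \<comment> \<open>Uniqueness backwards from \<open>t0\<close>: with the bounded coefficient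
      \<open>A\<close>, Gronwall's argument makes \<open>e t * exp ((1 + L) * t)\<close>
      nondecreasing, and it vanishes at \<open>t0\<close>.\<close>
    define e where "e t = (w t)\<^sup>2 + (w' t)\<^sup>2" for t
    define A where "A t = (\<kappa> + q t) / (4 * t)" for t
    define e' where "e' t = 2 * (w t * w' t) - 2 * (A t * (w t * w' t))" for t
    have "e b * exp ((1 + L) * b) \<le> e t0 * exp ((1 + L) * t0)"
    proof (rule DERIV_nonneg_imp_nondecreasing[OF bt])
      fix t assume t: "b \<le> t" "t \<le> t0"
      have ta: "t > a" using t b by simp
      have de: "(e has_real_derivative e' t) (at t)"
      proof -
        have hy: "(w' has_real_derivative - (A t * w t)) (at t)" using dw'[OF ta] by (simp add: A_def q_def)
        from DERIV_add[OF DERIV_mult[OF dw[OF ta] dw[OF ta]] DERIV_mult[OF hy hy]]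
        show ?thesis unfolding e_def[abs_def] e'_def power2_eq_square by (simp add: mult_ac)
      qed
      have "((\<lambda>t. e t * exp ((1 + L) * t)) has_real_derivative (e' t + (1 + L) * e t) * exp ((1 + L) * t)) (at t)"
        by (auto intro!: derivative_eq_intros de simp: algebra_simps)
      moreover have "(e' t + (1 + L) * e t) * exp ((1 + L) * t) \<ge> 0"
      proof (intro mult_nonneg_nonneg)
        have ww: "2 * \<bar>w t * w' t\<bar> \<le> e t"
          using sum_squares_bound[of "\<bar>w t\<bar>" "\<bar>w' t\<bar>"] by (simp add: e_def abs_mult mult.assoc)
        have "\<bar>2 * (A t * (w t * w' t))\<bar> = \<bar>A t\<bar> * (2 * \<bar>w t * w' t\<bar>)" by (simp add: abs_mult)
        also have "\<dots> \<le> L * e t" using L[of t] t ww L0 by (intro mult_mono) (auto simp: A_def)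
        finally have "\<bar>2 * (A t * (w t * w' t))\<bar> \<le> L * e t" .
        then show "e' t + (1 + L) * e t \<ge> 0" unfolding e'_def distrib_right using ww by linarith
      qed simp
      ultimately show "\<exists>y. ((\<lambda>t. e t * exp ((1 + L) * t)) has_real_derivative y) (at t) \<and> 0 \<le> y" by blast
    qed
    moreover have "e t0 = 0" using wz[of t0] by (simp add: e_def)
    ultimately have "e b \<le> 0" by (simp add: mult_le_0_iff)
    then have "(w b)\<^sup>2 \<le> 0" unfolding e_def using zero_le_power2[of "w' b"] by linarith
    then show ?thesis by simp
  qed
qed

section \<open>Radial functions as functions of \<open>|x|^2\<close>\<close>

lemma sigma_compact_image_borel:
  fixes C :: "'a::euclidean_space set" and f :: "'a \<Rightarrow> real"
  assumes C: "fsigma C" and f: "continuous_on UNIV f"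
  shows "f ` C \<in> sets borel"
proof -
  \<comment> \<open>Continuous images of Borel sets can fail to be Borel, but closed sets are
    countable unions of compact ones, whose images are compact.\<close>
  obtain K where K: "\<And>n::nat. closed (K n)" "C = (\<Union>n. K n)" using C by (auto elim: fsigma.cases)
  have "f ` C = (\<Union>n. \<Union>m::nat. f ` (K n \<inter> cball 0 (real m)))"
  proof -
    have "x \<in> (\<Union>m::nat. cball 0 (real m))" for x :: 'a using real_arch_simple[of "norm x"] by auto
    then show ?thesis unfolding K(2) by fast
  qed
  moreover have "f ` (K n \<inter> cball 0 (real m)) \<in> sets borel" for n m
    by (intro borel_closed compact_imp_closed compact_continuous_image continuous_on_subset[OF f] closed_Int_compact K compact_cball) auto
  ultimately show ?thesis by (simp only:) (intro sets.countable_UN image_subsetI, auto)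
qed

text \<open>The profile \<open>\<rho>\<close> may be non-measurable. Superlevel sets of \<open>u\<close> are \<open>\<sigma>\<close>-compact up to null
  sets, and the images of these \<open>\<sigma>\<close>-compact sets under \<open>|x|\<^sup>2\<close> are superlevel sets of a Borel
  profile.\<close>

lemma radial_borel_representative:
  fixes u :: "'a::euclidean_space \<Rightarrow> real"
  assumes [measurable]: "u \<in> borel_measurable borel" and r: "AE x in lborel. u x = \<rho> (norm x)"
  obtains U :: "real \<Rightarrow> real" where "U \<in> borel_measurable borel" "AE x in lborel. u x = U ((norm x)\<^sup>2)"
proof -
  obtain N where N0: "\<And>x. x \<in> space lborel - N \<Longrightarrow> u x = \<rho> (norm x)" and N1: "N \<in> null_sets lborel"
    using AE_E3[OF r] by metis
  define E where "E c = {x. u x > real_of_rat c} - N" for c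
  have Eb: "E c \<in> sets borel" for c
  proof -
    have "{x. u x > real_of_rat c} \<in> sets borel" by measurable
    then show ?thesis using N1 unfolding E_def by auto
  qed
  have "\<exists>C T. fsigma C \<and> T \<in> null_sets lebesgue \<and> C \<union> T = E c" for c
  proof -
    have "E c \<in> sets lebesgue" using Eb[of c] by simp
    from lebesgue_set_almost_fsigma[OF this] show ?thesis by metis
  qed
  then obtain C T where CT: "\<And>c. fsigma (C c)" "\<And>c. T c \<in> null_sets lebesgue" "\<And>c. C c \<union> T c = E c" by metis
  define B where "B c = (\<lambda>x::'a. (norm x)\<^sup>2) ` C c" for c
  have B: "B c \<in> sets borel" for c unfolding B_def by (intro sigma_compact_image_borel CT continuous_intros)
  \<comment> \<open>The profile is rebuilt from its rational superlevel sets; the extended reals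
    provide \<open>- \<infinity>\<close> for the levels that do not count at
    \<open>s\<close>.\<close>
  define U where "U s = real_of_ereal (SUP c. if s \<in> B c then ereal (real_of_rat c) else - \<infinity>)" for s
  show ?thesis
  proof (rule that[of U])
    show "U \<in> borel_measurable borel" unfolding U_def[abs_def]
    proof (intro borel_measurable_real_of_ereal borel_measurable_SUP countableI_type)
      show "(\<lambda>s. if s \<in> B c then ereal (real_of_rat c) else - \<infinity>) \<in> borel_measurable borel" for c
        using B[of c] by (intro measurable_If_set) auto
    qed
    have "(\<Union>c. T c) \<in> null_sets lebesgue" by (intro null_sets_UN' CT) simp
    then have "AE x in lebesgue. x \<notin> (\<Union>c. T c)" by (rule AE_not_in)
    then have "AE x in lborel. x \<notin> (\<Union>c. T c)" by (simp add: AE_completion_iff)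
    then show "AE x in lborel. u x = U ((norm x)\<^sup>2)" using AE_not_in[OF N1]
    proof eventually_elim
      fix x assume x: "x \<notin> (\<Union>c. T c)" "x \<notin> N"
      \<comment> \<open>Membership of \<open>|x|^2\<close> in the image only produces a point
        \<open>y\<close> of the same norm; that \<open>u\<close> agrees at \<open>x\<close> and
        \<open>y\<close> is where radial symmetry off \<open>N\<close> is used.\<close>
      have iff: "(norm x)\<^sup>2 \<in> B c \<longleftrightarrow> real_of_rat c < u x" for c
      proof
        assume "(norm x)\<^sup>2 \<in> B c"
        then obtain y where y: "y \<in> C c" "(norm x)\<^sup>2 = (norm y)\<^sup>2" unfolding B_def by blast
        then have "y \<in> E c" "norm x = norm y" using CT(3)[of c] by auto
        then have y: "real_of_rat c < u y" "y \<notin> N" "norm x = norm y" unfolding E_def by auto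
        have "u y = \<rho> (norm y)" "u x = \<rho> (norm x)" using N0 x(2) y(2) by auto
        then show "real_of_rat c < u x" using y by simp
      next
        assume "real_of_rat c < u x"
        then have "x \<in> E c" using x by (simp add: E_def)
        then have "x \<in> C c" using CT(3)[of c] x by blast
        then show "(norm x)\<^sup>2 \<in> B c" unfolding B_def by blast
      qed
      have "(SUP c. if (norm x)\<^sup>2 \<in> B c then ereal (real_of_rat c) else - \<infinity>) = ereal (u x)"
      proof (rule SUP_eqI)
        show "(if (norm x)\<^sup>2 \<in> B c then ereal (real_of_rat c) else - \<infinity>) \<le> ereal (u x)" for c using iff[of c] by auto
        fix y assume y: "\<And>c. c \<in> UNIV \<Longrightarrow> (if (norm x)\<^sup>2 \<in> B c then ereal (real_of_rat c) else - \<infinity>) \<le> y"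
        show "ereal (u x) \<le> y"
        proof (rule dense_le)
          fix z assume "z < ereal (u x)"
          then obtain w where w: "z < ereal w" "w < u x"
            by (metis ereal_dense2 less_ereal.simps(1))
          obtain c where c: "w < real_of_rat c" "real_of_rat c < u x" using of_rat_dense[OF w(2)] by blast
          have "ereal (real_of_rat c) \<le> y" using y[of c] iff[of c] c by auto
          moreover have "ereal w < ereal (real_of_rat c)" using c by simp
          ultimately show "z \<le> y" using w(1) by order
        qed
      qed
      then show "u x = U ((norm x)\<^sup>2)" by (simp add: U_def)
    qed
  qed
qed

text \<open>The density of the image of Lebesgue measure under \<open>x \<mapsto> |x|\<^sup>2\<close>, which is
  \<open>2 unit_ball_vol 4 s\<close> on the positive half line.\<close>

definition jac :: "real \<Rightarrow> real" where "jac s = max 0 (2 * unit_ball_vol 4 * s)"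

lemma ub4: "unit_ball_vol 4 > (0::real)" by simp

lemma jac_borel[measurable]: "jac \<in> borel_measurable borel" unfolding jac_def[abs_def] by measurable
lemma jac_nonneg: "0 \<le> jac s" by (simp add: jac_def)

lemma jac_pos: "s > 0 \<Longrightarrow> jac s = 2 * unit_ball_vol 4 * s" "s > 0 \<Longrightarrow> jac s > 0"
  using ub4 by (simp_all add: jac_def)
lemma jac_neg: "s \<le> 0 \<Longrightarrow> jac s = 0"
  using ub4 mult_nonneg_nonpos[of "2 * unit_ball_vol 4" s] by (simp add: jac_def)

text \<open>Half-lines generate the Borel sets, and for \<open>s \<ge> 0\<close> both measures give
  \<open>{..s}\<close> the value \<open>unit_ball_vol 4 * s^2\<close>. This is the volume of the
  ball of radius \<open>sqrt s\<close>, and its derivative in \<open>s\<close> is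
  \<open>jac\<close>.\<close>

lemma distr_norm_sq: "distr lborel borel (\<lambda>x::real^4. (norm x)\<^sup>2) = density lborel (\<lambda>s. ennreal (jac s))"
proof -
  have v: "emeasure (distr lborel borel (\<lambda>x::real^4. (norm x)\<^sup>2)) {..s} = ennreal (if s < 0 then 0 else unit_ball_vol 4 * s\<^sup>2)" for s
  proof -
    have "emeasure (distr lborel borel (\<lambda>x::real^4. (norm x)\<^sup>2)) {..s} = emeasure lborel {x::real^4. (norm x)\<^sup>2 \<le> s}"
      by (subst emeasure_distr) (auto simp: vimage_def)
    also have "\<dots> = ennreal (if s < 0 then 0 else unit_ball_vol 4 * s\<^sup>2)"
    proof (cases "s < 0")
      case True
      then have "{x::real^4. (norm x)\<^sup>2 \<le> s} = {}" using zero_le_power2 by (force simp: not_le intro: less_le_trans)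
      then show ?thesis using True by simp
    next
      case False
      have "{x::real^4. (norm x)\<^sup>2 \<le> s} = cball 0 (sqrt s)" using False by (auto simp: real_le_rsqrt sqrt_le_D real_sqrt_ge_zero) (metis norm_ge_zero real_sqrt_le_iff real_sqrt_unique sqrt_le_D not_less)
      moreover have "emeasure lborel (cball (0::real^4) (sqrt s)) = ennreal (unit_ball_vol 4 * s\<^sup>2)"
      proof -
        have "emeasure lborel (cball (0::real^4) (sqrt s)) = ennreal (measure lborel (cball (0::real^4) (sqrt s)))"
          by (rule emeasure_eq_ennreal_measure) (use emeasure_lborel_cball_finite[of "0::real^4" "sqrt s"] in auto)
        also have "measure lborel (cball (0::real^4) (sqrt s)) = unit_ball_vol 4 * sqrt s ^ 4" using False by (intro measure_ball4) auto
        also have "sqrt s ^ 4 = s\<^sup>2" using False by (simp add: power4_eq_xxxx power2_eq_square mult.assoc)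
        finally show ?thesis .
      qed
      ultimately show ?thesis using False by simp
    qed
    finally show ?thesis .
  qed
  have vN: "emeasure (density lborel (\<lambda>s. ennreal (jac s))) {..s} = ennreal (if s < 0 then 0 else unit_ball_vol 4 * s\<^sup>2)" for s
  proof -
  have "emeasure (density lborel (\<lambda>s. ennreal (jac s))) {..s} = (\<integral>\<^sup>+x. ennreal (jac x) * indicator {..s} x \<partial>lborel)"
    by (subst emeasure_density) auto
  also have "\<dots> = ennreal (if s < 0 then 0 else unit_ball_vol 4 * s\<^sup>2)"
  proof (cases "s < 0")
    case True
    have "(\<integral>\<^sup>+x. ennreal (jac x) * indicator {..s} x \<partial>lborel) = (\<integral>\<^sup>+x. 0 \<partial>(lborel :: real measure))"
    proof (rule nn_integral_cong)
      fix x :: real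
      have "2 * unit_ball_vol 4 * x \<le> 0" if "x \<le> s" using that True ub4 by (intro mult_nonneg_nonpos) auto
      then show "ennreal (jac x) * indicator {..s} x = 0" by (auto simp: jac_def indicator_def)
    qed
    then show ?thesis using True by simp
  next
    case False
    have "(\<integral>\<^sup>+x. ennreal (jac x) * indicator {..s} x \<partial>lborel) = (\<integral>\<^sup>+x. ennreal (2 * unit_ball_vol 4 * x) * indicator {0..s} x \<partial>lborel)"
    proof (rule nn_integral_cong)
      fix x :: real
      have "2 * unit_ball_vol 4 * x \<le> 0" if "x < 0" using that ub4 by (intro mult_nonneg_nonpos) auto
      moreover have "2 * unit_ball_vol 4 * x \<ge> 0" if "x \<ge> 0" using that ub4 by (intro mult_nonneg_nonneg) auto
      ultimately show "ennreal (jac x) * indicator {..s} x = ennreal (2 * unit_ball_vol 4 * x) * indicator {0..s} x"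
        by (cases "x < 0") (auto simp: jac_def indicator_def max_def)
    qed
    also have "\<dots> = ennreal (unit_ball_vol 4 * s\<^sup>2 - unit_ball_vol 4 * 0\<^sup>2)"
    proof (rule nn_integral_FTC_Icc)
      show "((\<lambda>x. unit_ball_vol 4 * x\<^sup>2) has_real_derivative 2 * unit_ball_vol 4 * x) (at x)" for x
        by (auto intro!: derivative_eq_intros)
    qed (use False ub4 in auto)
    finally show ?thesis using False by simp
  qed
  finally show ?thesis .
  qed
  have A: "\<exists>n. x \<le> real n" for x :: real using real_arch_simple[of x] by blast
  show ?thesis
  proof (rule measure_eqI_generator_eq[of "range atMost" UNIV _ _ "\<lambda>i. {..real i}"])
    show "Int_stable (range (atMost :: real \<Rightarrow> _))" by (auto simp: Int_stable_def)
    show "emeasure (distr lborel borel (\<lambda>x::real^4. (norm x)\<^sup>2)) X = emeasure (density lborel (\<lambda>s. ennreal (jac s))) X"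
      if "X \<in> range atMost" for X using that v vN by auto
    show "sets (distr lborel borel (\<lambda>x::real^4. (norm x)\<^sup>2)) = sigma_sets UNIV (range atMost)"
      "sets (density lborel (\<lambda>s. ennreal (jac s))) = sigma_sets UNIV (range atMost)"
      by (simp_all add: borel_eq_atMost)
    show "(\<Union>i. {..real i}) = UNIV" using A by auto
    show "emeasure (distr lborel borel (\<lambda>x::real^4. (norm x)\<^sup>2)) {..real i} \<noteq> \<infinity>" for i unfolding v by simp
  qed auto
qed

lemma radial_integral:
  fixes h :: "real \<Rightarrow> real"
  assumes [measurable]: "h \<in> borel_measurable borel"
  shows "integrable lborel (\<lambda>x::real^4. h ((norm x)\<^sup>2)) \<longleftrightarrow> integrable lborel (\<lambda>s. jac s * h s)"
    "(LINT x|lborel. h ((norm (x::real^4))\<^sup>2)) = (LINT s|lborel. jac s * h s)"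
proof -
  have "integrable lborel (\<lambda>x::real^4. h ((norm x)\<^sup>2)) \<longleftrightarrow> integrable (distr lborel borel (\<lambda>x::real^4. (norm x)\<^sup>2)) h"
    by (subst integrable_distr_eq) auto
  then show "integrable lborel (\<lambda>x::real^4. h ((norm x)\<^sup>2)) \<longleftrightarrow> integrable lborel (\<lambda>s. jac s * h s)"
    unfolding distr_norm_sq by (subst (asm) integrable_density) (auto simp: jac_nonneg)
  have "(LINT x|lborel. h ((norm (x::real^4))\<^sup>2)) = (LINT s|distr lborel borel (\<lambda>x::real^4. (norm x)\<^sup>2). h s)"
    by (subst integral_distr) auto
  then show "(LINT x|lborel. h ((norm (x::real^4))\<^sup>2)) = (LINT s|lborel. jac s * h s)"
    unfolding distr_norm_sq by (subst (asm) integral_density) (auto simp: jac_nonneg)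
qed

lemma radial_AE:
  assumes [measurable]: "Measurable.pred borel P"
  shows "(AE x::real^4 in lborel. P ((norm x)\<^sup>2)) \<longleftrightarrow> (AE s in lborel. s > 0 \<longrightarrow> P s)"
proof -
  have "(AE x::real^4 in lborel. P ((norm x)\<^sup>2)) \<longleftrightarrow> (AE s in distr lborel borel (\<lambda>x::real^4. (norm x)\<^sup>2). P s)"
    by (subst AE_distr_iff) auto
  also have "\<dots> \<longleftrightarrow> (AE s in lborel. 0 < ennreal (jac s) \<longrightarrow> P s)" unfolding distr_norm_sq by (subst AE_density) auto
  also have "(\<lambda>s. 0 < ennreal (jac s)) = (\<lambda>s. s > 0)"
  proof
    show "0 < ennreal (jac s) \<longleftrightarrow> s > 0" for s using jac_pos(2)[of s] jac_neg[of s] by (cases "s > 0") auto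
  qed
  finally show ?thesis .
qed

section \<open>The radial equation on the half-line\<close>

lemma pd1_zero_below:
  fixes \<xi> :: "real \<Rightarrow> real"
  assumes "\<And>s. s < c \<Longrightarrow> \<xi> s = 0" "s < c"
  shows "pd 1 \<xi> s = 0"
proof (rule real_pd_eq)
  have "((\<lambda>_. 0) has_real_derivative 0) (at s)" by simp
  then show "(\<xi> has_real_derivative 0) (at s)"
    by (rule DERIV_cong_ev[THEN iffD1, rotated -1]) (use assms in \<open>auto simp: eventually_nhds intro!: exI[of _ "{..<c}"]\<close>)
qed

text \<open>Since \<xi> vanishes below \<open>c\<close>, the singularity at 0 is never met. The
  exponent \<open>m\<close> is arbitrary because each derivative raises it by one.\<close>

lemma C_k_div_power:
  assumes c: "c > 0"
  shows "smooth \<xi> \<Longrightarrow> (\<And>s. s < c \<Longrightarrow> \<xi> s = 0) \<Longrightarrow> C_k k (\<lambda>s::real. \<xi> s / s ^ m)"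
proof (induction k arbitrary: \<xi> m)
  have d: "((\<lambda>s. \<xi> s / s ^ m) has_real_derivative pd 1 \<xi> s / s ^ m - real m * (\<xi> s / s ^ Suc m)) (at s)"
    if \<xi>: "smooth \<xi>" "\<And>s. s < c \<Longrightarrow> \<xi> s = 0" for \<xi> :: "real \<Rightarrow> real" and m s
  proof (cases "s < c")
    case True
    have "((\<lambda>_. 0) has_real_derivative 0) (at s)" by simp
    then have "((\<lambda>s. \<xi> s / s ^ m) has_real_derivative 0) (at s)"
      by (rule DERIV_cong_ev[THEN iffD1, rotated -1]) (use True \<xi>(2) in \<open>auto simp: eventually_nhds intro!: exI[of _ "{..<c}"]\<close>)
    then show ?thesis using pd1_zero_below[OF \<xi>(2) True] \<xi>(2)[OF True] by simp
  next
    case False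
    then have s: "s > 0" using c by simp
    have "(\<xi> has_real_derivative pd 1 \<xi> s) (at s)" by (rule C_k_real_deriv[of 0]) (use \<xi> in blast)
    from DERIV_divide[OF this DERIV_pow[of m s]] s
    have "((\<lambda>s. \<xi> s / s ^ m) has_real_derivative (pd 1 \<xi> s * s ^ m - \<xi> s * (real m * s ^ (m - Suc 0))) / (s ^ m * s ^ m)) (at s)" by simp
    also have "(pd 1 \<xi> s * s ^ m - \<xi> s * (real m * s ^ (m - Suc 0))) / (s ^ m * s ^ m) = pd 1 \<xi> s / s ^ m - real m * (\<xi> s / s ^ Suc m)"
      using s by (cases m) (simp_all add: field_simps)
    finally show ?thesis .
  qed
  { case 0
    have "isCont (\<lambda>s. \<xi> s / s ^ m) s" for s using d[OF 0] DERIV_isCont by blast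
    then show ?case by (simp add: continuous_at_imp_continuous_on)
  next
    case (Suc k)
    have 1: "smooth (pd 1 \<xi>)" using Suc(2) C_k_SucD(2)[of _ \<xi> 1] by simp
    have "C_k k (\<lambda>s. pd 1 \<xi> s / s ^ m - real m * (\<xi> s / s ^ Suc m))"
      by (intro C_k_diff C_k_cmult Suc.IH 1 Suc.prems pd1_zero_below[of c]) auto
    moreover have "((\<lambda>s. \<xi> s / s ^ m) has_derivative (\<lambda>h. h * (pd 1 \<xi> s / s ^ m - real m * (\<xi> s / s ^ Suc m)))) (at s)" for s
      using d[OF Suc.prems, of m s] unfolding has_field_derivative_def mult_commute_abs .
    ultimately show ?case
      by (intro C_k_SucI[where f'="\<lambda>s h. h * (pd 1 \<xi> s / s ^ m - real m * (\<xi> s / s ^ Suc m))"]) (simp_all del: C_k.simps power_Suc)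
  }
qed

text \<open>With \<open>s = |x|^2\<close> the Laplacian of \<open>\<zeta> s\<close> in dimension
  \<open>n\<close> is \<open>4 s \<zeta>'' + 2 n \<zeta>'\<close>; here
  \<open>n = 4\<close>.\<close>

lemma laplacian_radial:
  fixes \<zeta> :: "real \<Rightarrow> real"
  assumes \<zeta>: "smooth \<zeta>"
  shows "(\<Sum>i\<in>Basis. pd i (pd i (\<lambda>x::real^4. \<zeta> ((norm x)\<^sup>2))) x) = 4 * (norm x)\<^sup>2 * pd 1 (pd 1 \<zeta>) ((norm x)\<^sup>2) + 8 * pd 1 \<zeta> ((norm x)\<^sup>2)"
proof -
  have \<zeta>1: "smooth (pd 1 \<zeta>)" using \<zeta> C_k_SucD(2)[of _ \<zeta> 1] by simp
  have c: "pd i (\<lambda>x::real^4. f ((norm x)\<^sup>2)) x = pd 1 f ((norm x)\<^sup>2) * (2 * (x \<bullet> i))" if "smooth f" "i \<in> Basis" for f i and x :: "real^4"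
  proof -
    have "pd i (\<lambda>x::real^4. f ((norm x)\<^sup>2)) x = pd 1 f ((norm x)\<^sup>2) * pd i (\<lambda>x. (norm x)\<^sup>2) x"
      using that by (intro pd_compose[of 0] C_k_norm_sq C_k_real_deriv[of 0]) blast
    then show ?thesis using pd_norm_sq[OF that(2)] by simp
  qed
  have "pd i (pd i (\<lambda>x::real^4. \<zeta> ((norm x)\<^sup>2))) x = 4 * (x \<bullet> i)\<^sup>2 * pd 1 (pd 1 \<zeta>) ((norm x)\<^sup>2) + 2 * pd 1 \<zeta> ((norm x)\<^sup>2)" if i: "i \<in> Basis" for i
  proof -
    have e: "pd i (\<lambda>x::real^4. \<zeta> ((norm x)\<^sup>2)) = (\<lambda>x. pd 1 \<zeta> ((norm x)\<^sup>2) * (2 * (x \<bullet> i)))" using c[OF \<zeta> i] by blast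
    have l: "pd i (\<lambda>x. 2 * (x \<bullet> i)) x = 2"
    proof -
      have "((\<lambda>x. 2 * (x \<bullet> i)) has_derivative (\<lambda>h. 2 * (h \<bullet> i))) (at x)" by (auto intro!: derivative_eq_intros)
      from pd_eq[OF this, of i] i show ?thesis by simp
    qed
    have "pd i (\<lambda>x. pd 1 \<zeta> ((norm x)\<^sup>2) * (2 * (x \<bullet> i))) x = pd 1 \<zeta> ((norm x)\<^sup>2) * pd i (\<lambda>x. 2 * (x \<bullet> i)) x + pd i (\<lambda>x. pd 1 \<zeta> ((norm x)\<^sup>2)) x * (2 * (x \<bullet> i))"
    proof (rule pd_mult)
      show "C_k (Suc 0) (\<lambda>x::real^4. pd 1 \<zeta> ((norm x)\<^sup>2))" by (rule C_k_compose[OF \<zeta>1[rule_format] C_k_norm_sq])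
      show "C_k (Suc 0) (\<lambda>x::real^4. 2 * (x \<bullet> i))" by (rule C_k_cmult[OF C_k_inner])
    qed
    then show ?thesis unfolding e l c[OF \<zeta>1 i] by (simp add: power2_eq_square)
  qed
  then have "(\<Sum>i\<in>Basis. pd i (pd i (\<lambda>x::real^4. \<zeta> ((norm x)\<^sup>2))) x) = (\<Sum>i\<in>Basis. 4 * (x \<bullet> i)\<^sup>2 * pd 1 (pd 1 \<zeta>) ((norm x)\<^sup>2) + 2 * pd 1 \<zeta> ((norm x)\<^sup>2))" by simp
  also have "\<dots> = 4 * (\<Sum>i\<in>Basis. (x \<bullet> i)\<^sup>2) * pd 1 (pd 1 \<zeta>) ((norm x)\<^sup>2) + 8 * pd 1 \<zeta> ((norm x)\<^sup>2)"
    by (simp add: sum.distrib sum_distrib_left sum_distrib_right)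
  also have "(\<Sum>i\<in>Basis. (x \<bullet> i)\<^sup>2) = (norm x)\<^sup>2"
    unfolding power2_norm_eq_inner euclidean_inner[of x x] by (simp add: power2_eq_square)
  finally show ?thesis .
qed

text \<open>For \<open>s = |x|\<^sup>2\<close> in dimension four, \<open>\<Delta>(U(s)) = 4 (s U)''\<close>: no first order term remains.\<close>

lemma radial_weak_equation:
  fixes u f :: "real^4 \<Rightarrow> real" and U F \<xi> :: "real \<Rightarrow> real"
  assumes W: "W u g" and f: "sq f"
    and eq: "\<And>\<psi>. test_function \<psi> \<Longrightarrow> (\<Sum>i\<in>Basis. LINT x|lborel. g i x * pd i \<psi> x) = (LINT x|lborel. f x * \<psi> x)"
    and [measurable]: "U \<in> borel_measurable borel" "F \<in> borel_measurable borel"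
    and U: "AE x in lborel. u x = U ((norm x)\<^sup>2)" and F: "AE x in lborel. f x = F ((norm x)\<^sup>2)"
    and \<xi>: "test_function \<xi>" and c: "c > 0" "\<And>s. s < c \<Longrightarrow> \<xi> s = 0"
  shows "4 * (LINT s|lborel. (s * U s) * pd 1 (pd 1 \<xi>) s) = - (LINT s|lborel. F s * \<xi> s)"
proof -
  have \<xi>s: "smooth \<xi>" using \<xi> unfolding test_iff by blast
  \<comment> \<open>Dividing by \<open>s\<close> makes \<open>4 s \<zeta>'' + 8 \<zeta>'\<close>
    equal to \<open>4 \<xi>''\<close>, and on the right-hand side the factor \<open>s\<close> of
    \<open>jac\<close> cancels against the quotient.\<close>
  define \<zeta> where "\<zeta> s = \<xi> s / s" for s
  have \<zeta>: "smooth \<zeta>" unfolding \<zeta>_def[abs_def] using C_k_div_power[OF c(1) \<xi>s c(2), of _ 1] by simp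
  have \<zeta>1: "smooth (pd 1 \<zeta>)" using \<zeta> C_k_SucD(2)[of _ \<zeta> 1] by simp
  have \<xi>\<zeta>: "\<xi> = (\<lambda>s. s * \<zeta> s)" using c by (auto simp: \<zeta>_def fun_eq_iff)
  have d\<zeta>: "(\<zeta> has_real_derivative pd 1 \<zeta> s) (at s)" "(pd 1 \<zeta> has_real_derivative pd 1 (pd 1 \<zeta>) s) (at s)" for s
    using \<zeta> \<zeta>1 by (blast intro: C_k_real_deriv[of 0])+
  have 1: "pd 1 \<xi> = (\<lambda>s. \<zeta> s + s * pd 1 \<zeta> s)"
    unfolding \<xi>\<zeta> by (rule ext, rule real_pd_eq) (auto intro!: derivative_eq_intros d\<zeta>)
  have 2: "pd 1 (pd 1 \<xi>) s = s * pd 1 (pd 1 \<zeta>) s + 2 * pd 1 \<zeta> s" for s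
    unfolding 1 by (rule real_pd_eq) (auto intro!: derivative_eq_intros d\<zeta>)
  define \<phi> where "\<phi> x = \<zeta> ((norm x)\<^sup>2)" for x :: "real^4"
  have \<phi>: "test_function \<phi>" unfolding test_iff
  proof
    show "smooth \<phi>" unfolding \<phi>_def[abs_def] using \<zeta> C_k_compose C_k_norm_sq by blast
    obtain r where r: "r > 0" "\<And>s. norm s \<ge> r \<Longrightarrow> \<xi> s = 0" using \<xi> bsuppE unfolding test_iff by blast
    have "\<phi> x = 0" if "norm x \<ge> r + 1" for x
    proof -
      have "r \<le> norm x * 1" using that by simp
      also have "\<dots> \<le> norm x * norm x" using that r by (intro mult_left_mono) auto
      finally have "\<xi> ((norm x)\<^sup>2) = 0" by (intro r) (simp add: power2_eq_square)
      then show ?thesis by (simp add: \<phi>_def \<zeta>_def)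
    qed
    then show "bsupp \<phi>" unfolding bsupp_def by blast
  qed
  have [measurable]: "\<zeta> \<in> borel_measurable borel" "pd 1 (pd 1 \<xi>) \<in> borel_measurable borel" "\<xi> \<in> borel_measurable borel"
    using \<zeta> test_borel[OF \<xi>] test_borel[OF test_pd[OF test_pd[OF \<xi>]]]
    by (auto intro!: borel_measurable_continuous_onI C_k_cont[of 0] simp del: C_k.simps)
  have lap: "(\<Sum>i\<in>Basis. pd i (pd i \<phi>) x) = 4 * pd 1 (pd 1 \<xi>) ((norm x)\<^sup>2)" for x
    unfolding \<phi>_def[abs_def] laplacian_radial[OF \<zeta>] 2 by simp
  have "(LINT x|lborel. f x * \<phi> x) = (\<Sum>i\<in>Basis. LINT x|lborel. g i x * pd i \<phi> x)" using eq[OF \<phi>] by simp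
  also have "\<dots> = (\<Sum>i\<in>Basis. - (LINT x|lborel. u x * pd i (pd i \<phi>) x))"
    using wdD[OF WD(3)[OF W] test_pd[OF \<phi>]] by (intro sum.cong) auto
  also have "\<dots> = - (LINT x|lborel. (\<Sum>i\<in>Basis. u x * pd i (pd i \<phi>) x))"
    by (subst Bochner_Integration.integral_sum) (auto simp: sum_negf intro!: sq_mult_integrable WD(1)[OF W] test_sq test_pd \<phi>)
  also have "(\<lambda>x. \<Sum>i\<in>Basis. u x * pd i (pd i \<phi>) x) = (\<lambda>x. u x * (4 * pd 1 (pd 1 \<xi>) ((norm x)\<^sup>2)))"
    unfolding sum_distrib_left[symmetric] lap ..
  also have "(LINT x|lborel. u x * (4 * pd 1 (pd 1 \<xi>) ((norm x)\<^sup>2))) = (LINT x::real^4|lborel. (\<lambda>s. U s * (4 * pd 1 (pd 1 \<xi>) s)) ((norm x)\<^sup>2))"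
    using sq_borel[OF WD(1)[OF W]] by (intro integral_cong_AE) (use U in auto)
  also have "\<dots> = (LINT s|lborel. jac s * (U s * (4 * pd 1 (pd 1 \<xi>) s)))" by (rule radial_integral) measurable
  also have "\<dots> = (LINT s|lborel. 2 * unit_ball_vol 4 * (4 * ((s * U s) * pd 1 (pd 1 \<xi>) s)))"
  proof (rule Bochner_Integration.integral_cong[OF refl])
    fix s :: real
    show "jac s * (U s * (4 * pd 1 (pd 1 \<xi>) s)) = 2 * unit_ball_vol 4 * (4 * ((s * U s) * pd 1 (pd 1 \<xi>) s))"
    proof (cases "s < c")
      case True
      have "pd 1 (pd 1 \<xi>) s = 0" by (intro pd1_zero_below[of c] c) (use True in auto)
      then show ?thesis by simp
    next
      case False
      then have "jac s = 2 * unit_ball_vol 4 * s" using c ub4 by (simp add: jac_def max_def)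
      then show ?thesis by simp
    qed
  qed
  also have "\<dots> = 2 * unit_ball_vol 4 * (4 * (LINT s|lborel. (s * U s) * pd 1 (pd 1 \<xi>) s))" by (simp add: mult.assoc)
  finally have A: "(LINT x|lborel. f x * \<phi> x) = - (2 * unit_ball_vol 4 * (4 * (LINT s|lborel. (s * U s) * pd 1 (pd 1 \<xi>) s)))" .
  have "(LINT x|lborel. f x * \<phi> x) = (LINT x::real^4|lborel. (\<lambda>s. F s * \<zeta> s) ((norm x)\<^sup>2))"
    using sq_borel[OF f] test_borel[OF \<phi>] by (intro integral_cong_AE) (use F in \<open>auto simp: \<phi>_def\<close>)
  also have "\<dots> = (LINT s|lborel. jac s * (F s * \<zeta> s))" by (rule radial_integral) measurable
  also have "\<dots> = (LINT s|lborel. 2 * unit_ball_vol 4 * (F s * \<xi> s))"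
  proof (rule Bochner_Integration.integral_cong[OF refl])
    fix s :: real
    show "jac s * (F s * \<zeta> s) = 2 * unit_ball_vol 4 * (F s * \<xi> s)"
    proof (cases "s < c")
      case True
      then show ?thesis using c by (simp add: \<zeta>_def)
    next
      case False
      then have "jac s = 2 * unit_ball_vol 4 * s" "s \<noteq> 0" using c by (auto simp: jac_pos)
      then show ?thesis by (simp add: \<zeta>_def)
    qed
  qed
  also have "\<dots> = 2 * unit_ball_vol 4 * (LINT s|lborel. F s * \<xi> s)" by simp
  finally have B: "(LINT x|lborel. f x * \<phi> x) = 2 * unit_ball_vol 4 * (LINT s|lborel. F s * \<xi> s)" .
  have "2 * unit_ball_vol 4 * (4 * (LINT s|lborel. (s * U s) * pd 1 (pd 1 \<xi>) s)) = 2 * unit_ball_vol 4 * (- (LINT s|lborel. F s * \<xi> s))"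
    using A B by simp
  then show ?thesis using ub4 unfolding mult_cancel_left by argo
qed

section \<open>Weak solutions of the ordinary differential equation are classical\<close>

lemma pd_zero_open:
  assumes "open S" "x \<in> S" "\<And>y. y \<in> S \<Longrightarrow> f y = 0"
  shows "pd b f x = 0"
proof (rule pd_eq)
  show "(f has_derivative (\<lambda>_. 0)) (at x)"
    by (rule has_derivative_transform_within_open[OF has_derivative_const[of 0] assms(1,2)]) (simp add: assms(3))
qed

lemma second_pd_reflect:
  fixes \<rho> :: "real \<Rightarrow> real"
  assumes \<rho>: "test_function \<rho>"
  shows "pd 1 (pd 1 (\<lambda>y. \<rho> (x - y))) y = pd 1 (pd 1 \<rho>) (x - y)"
proof -
  have t: "test_function (pd 1 \<rho>)" using test_pd[OF \<rho>, of 1] by simp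
  have "pd 1 (\<lambda>y. \<rho> (x - y)) = (\<lambda>y. - 1 * pd 1 \<rho> (x - y))" using test_pd_reflect[OF \<rho>, of 1 x] by auto
  moreover have "pd 1 (\<lambda>y. - 1 * pd 1 \<rho> (x - y)) y = - 1 * pd 1 (\<lambda>y. pd 1 \<rho> (x - y)) y"
    by (rule pd_cmult[of 0]) (rule test_Ck[OF test_reflect[OF t]])
  ultimately show ?thesis using test_pd_reflect[OF t, of 1 x y] by simp
qed

lemma taylor_integral:
  fixes w :: "real \<Rightarrow> real"
  assumes w: "smooth w" and at: "a \<le> t"
  shows "w t = w a + pd 1 w a * (t - a) + (LINT s|lborel. indicator {a..t} s * ((t - s) * pd 1 (pd 1 w) s))"
proof -
  have w1: "smooth (pd 1 w)" using w C_k_SucD(2)[of _ w 1] by simp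
  have w2: "smooth (pd 1 (pd 1 w))" using w1 C_k_SucD(2)[of _ "pd 1 w" 1] by simp
  have d: "(w has_real_derivative pd 1 w s) (at s)" "(pd 1 w has_real_derivative pd 1 (pd 1 w) s) (at s)" for s
    using w w1 by (blast intro: C_k_real_deriv[of 0])+
  have "(LINT s|lborel. ((t - s) * pd 1 (pd 1 w) s) * indicator {a..t} s) = (w t + (t - t) * pd 1 w t) - (w a + (t - a) * pd 1 w a)"
  proof (rule integral_FTC_Icc_real[OF at])
    fix s
    have "((\<lambda>s. w s + (t - s) * pd 1 w s) has_real_derivative pd 1 w s + ((0 - 1) * pd 1 w s + pd 1 (pd 1 w) s * (t - s))) (at s)"
      by (intro DERIV_add DERIV_mult DERIV_diff DERIV_const DERIV_ident d)
    then show "((\<lambda>s. w s + (t - s) * pd 1 w s) has_real_derivative (t - s) * pd 1 (pd 1 w) s) (at s)" by (simp add: mult.commute)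
    have "isCont (pd 1 (pd 1 w)) s" using C_k_cont[of 0 "pd 1 (pd 1 w)" UNIV] w2 by (simp add: continuous_on_eq_continuous_at)
    then show "isCont (\<lambda>s. (t - s) * pd 1 (pd 1 w) s) s" by (intro continuous_intros)
  qed
  then show ?thesis by (simp add: mult_ac)
qed

lemma AE_lborel_pick:
  assumes "AE t in lborel. P t" "c < (d::real)"
  obtains t where "c < t" "t < d" "P t"
proof (rule ccontr)
  assume n: "\<not> thesis"
  have "AE t in lborel. t \<notin> {c<..<d}" using assms(1) by eventually_elim (use n that in auto)
  then have "emeasure lborel {c<..<d} = 0" by (subst (asm) AE_iff_measurable[of "{c<..<d}"]) auto
  then show False using assms(2) by simp
qed

lemma affine_limit:
  fixes A B :: "nat \<Rightarrow> real"
  assumes "x \<noteq> y" "convergent (\<lambda>n. A n + B n * x)" "convergent (\<lambda>n. A n + B n * y)"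
  obtains A' B' where "A \<longlonglongrightarrow> A'" "B \<longlonglongrightarrow> B'"
proof -
  obtain L M where L: "(\<lambda>n. A n + B n * x) \<longlonglongrightarrow> L" "(\<lambda>n. A n + B n * y) \<longlonglongrightarrow> M" using assms unfolding convergent_def by blast
  have "(\<lambda>n. ((A n + B n * x) - (A n + B n * y)) / (x - y)) \<longlonglongrightarrow> (L - M) / (x - y)" using assms(1) by (intro tendsto_intros L) simp
  moreover have "((A n + B n * x) - (A n + B n * y)) / (x - y) = B n" for n using assms(1) by (simp add: right_diff_distrib[symmetric])
  ultimately have B: "B \<longlonglongrightarrow> (L - M) / (x - y)" by simp
  have "(\<lambda>n. (A n + B n * x) - B n * x) \<longlonglongrightarrow> L - (L - M) / (x - y) * x" by (intro tendsto_intros L B)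
  then show ?thesis using that B by simp
qed

text \<open>The weak form of \<open>4 Y'' = - H\<close> on the open half-line. Test functions vanish
  below some \<open>c > 0\<close> and square integrability is local away from 0, since the change of
  variables is singular at the origin.\<close>

definition weak_ode :: "(real \<Rightarrow> real) \<Rightarrow> (real \<Rightarrow> real) \<Rightarrow> bool" where
  "weak_ode Y H \<longleftrightarrow> (\<forall>c>0. \<forall>d. sq (\<lambda>s. indicator {c..d} s * Y s) \<and> sq (\<lambda>s. indicator {c..d} s * H s)) \<and>
    (\<forall>\<xi> c. test_function \<xi> \<longrightarrow> c > 0 \<longrightarrow> (\<forall>s<c. \<xi> s = 0) \<longrightarrow>
       4 * (LINT s|lborel. Y s * pd 1 (pd 1 \<xi>) s) = - (LINT s|lborel. H s * \<xi> s))"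

text \<open>Mollification makes the equation classical on \<open>{a..b}\<close>, where Taylor's
  formula expresses the mollified function by an affine part and a double integral of
  \<open>h n\<close>. The double integrals converge; along a subsequence the affine parts then
  converge at almost every point, and two such points determine both coefficients.\<close>

lemma weak_ode_bounded:
  assumes w: "weak_ode Y H" and a: "0 < a" "a < b"
  obtains A B where "AE t in lborel. a < t \<and> t < b \<longrightarrow> Y t = A + B * (t - a) - (LINT s|lborel. indicator {a..t} s * ((t - s) * H s)) / 4"
proof -
  \<comment> \<open>The margins \<open>a/2\<close> and 1 around \<open>{a..b}\<close> leave room for
    the support of the reflected kernel, once its radius is below both.\<close>
  define Wt where "Wt s = indicator {a/2..b+1} s * Y s" for s
  define Ht where "Ht s = indicator {a/2..b+1} s * H s" for s
  have sW: "sq Wt" and sH: "sq Ht" using w a unfolding weak_ode_def Wt_def[abs_def] Ht_def[abs_def] by auto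
  have tm: "test_function (moll n :: real \<Rightarrow> real)" for n using moll_mollifier by (auto simp: mollifier_def)
  define w h where "w n = conv (moll n) Wt" and "h n = conv (moll n) Ht" for n
  have ws: "smooth (w n)" for n unfolding w_def using conv_Ck[OF sq_loc[OF sW] tm] by blast
  have hs: "continuous_on UNIV (h n)" for n unfolding h_def using conv_Ck[OF sq_loc[OF sH] tm] C_k_cont by blast
  obtain N where N: "1 / real (Suc N) < min (a/2) 1" using nat_approx_posE[of "min (a/2) 1"] a by auto
  have w2: "pd 1 (pd 1 (w n)) t = - h n t / 4" if t: "a \<le> t" "t \<le> b" and n: "n \<ge> N" for n t
  proof -
    have n1: "1 / real (Suc n) < a/2" "1 / real (Suc n) < 1"
    proof -
      have "1 / real (Suc n) \<le> 1 / real (Suc N)" using n by (intro divide_left_mono) auto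
      moreover have "1 / real (Suc N) < a/2" "1 / real (Suc N) < 1" using N by (simp_all only: min_less_iff_conj)
      ultimately show "1 / real (Suc n) < a/2" "1 / real (Suc n) < 1" by linarith+
    qed
    define \<xi> where "\<xi> s = moll n (t - s)" for s
    have t\<xi>: "test_function \<xi>" unfolding \<xi>_def[abs_def] by (rule test_reflect[OF tm])
    have z: "\<xi> s = 0" if "s < a/2 \<or> s > b + 1" for s
      unfolding \<xi>_def
    proof (rule moll_0)
      have "a / 2 \<le> \<bar>t - s\<bar> \<or> 1 \<le> \<bar>t - s\<bar>" using that t a by linarith
      then show "1 / real (Suc n) \<le> norm (t - s)" using n1 unfolding real_norm_def by linarith
    qed
    have z2: "pd 1 (pd 1 \<xi>) s = 0" if "s < a/2 \<or> s > b + 1" for s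
    proof -
      define S where "S = {..<a/2} \<union> {b+1<..}"
      have S: "open S" "s \<in> S" using that by (auto simp: S_def)
      have "pd 1 \<xi> y = 0" if "y \<in> S" for y by (rule pd_zero_open[OF S(1) that]) (auto simp: S_def z)
      then show ?thesis by (rule pd_zero_open[OF S])
    qed
    have "pd 1 (pd 1 (w n)) t = conv (pd 1 (pd 1 (moll n))) Wt t"
    proof -
      have "pd 1 (w n) = conv (pd 1 (moll n)) Wt" unfolding w_def using pd_conv[OF sq_loc[OF sW] tm, of 1] by auto
      then show ?thesis using pd_conv[OF sq_loc[OF sW] test_pd[OF tm], of 1 1 n t] by simp
    qed
    also have "\<dots> = (LINT s|lborel. Wt s * pd 1 (pd 1 \<xi>) s)" unfolding conv_def \<xi>_def[abs_def] second_pd_reflect[OF tm] ..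
    also have "\<dots> = (LINT s|lborel. Y s * pd 1 (pd 1 \<xi>) s)"
    proof (rule Bochner_Integration.integral_cong[OF refl])
      show "Wt s * pd 1 (pd 1 \<xi>) s = Y s * pd 1 (pd 1 \<xi>) s" for s
        by (cases "s < a/2 \<or> s > b + 1") (simp_all add: z2 Wt_def not_less)
    qed
    also have "4 * \<dots> = - (LINT s|lborel. H s * \<xi> s)" using w t\<xi> z a unfolding weak_ode_def by (metis half_gt_zero)
    also have "(LINT s|lborel. H s * \<xi> s) = (LINT s|lborel. Ht s * \<xi> s)"
    proof (rule Bochner_Integration.integral_cong[OF refl])
      show "H s * \<xi> s = Ht s * \<xi> s" for s
        by (cases "s < a/2 \<or> s > b + 1") (simp_all add: z Ht_def not_less)
    qed
    also have "\<dots> = h n t" unfolding h_def conv_def \<xi>_def ..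
    finally show ?thesis by simp
  qed
  define J where "J t = (LINT s|lborel. indicator {a..t} s * ((t - s) * H s))" for t
  define Jn where "Jn n t = (LINT s|lborel. h n s * (indicator {a..t} s * (t - s)))" for n t
  have ty: "w n t = w n a + pd 1 (w n) a * (t - a) - Jn n t / 4" if t: "a \<le> t" "t \<le> b" and n: "n \<ge> N" for n t
  proof -
    have "(LINT s|lborel. indicator {a..t} s * ((t - s) * pd 1 (pd 1 (w n)) s)) = (LINT s|lborel. (- 1/4) * (h n s * (indicator {a..t} s * (t - s))))"
      by (rule Bochner_Integration.integral_cong[OF refl]) (use w2[OF _ _ n] t in \<open>auto simp: indicator_def\<close>)
    then show ?thesis using taylor_integral[OF ws t(1), of n] unfolding Jn_def by simp
  qed
  have lh: "l2lim h Ht" unfolding h_def[abs_def] by (rule l2lim_conv[OF sH])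
  have Jl: "(\<lambda>n. Jn n t) \<longlonglongrightarrow> J t" if t: "a \<le> t" "t \<le> b" for t
  proof -
    have "sq (\<lambda>s. indicator {a..t} s * (t - s))" unfolding sq_def
    proof
      have "integrable lborel (\<lambda>x. indicator {a..t} x *\<^sub>R (t - x)\<^sup>2)"
        by (rule borel_integrable_compact) (auto intro!: continuous_intros)
      moreover have "indicator {a..t} x *\<^sub>R (t - x)\<^sup>2 = (indicator {a..t} x * (t - x))\<^sup>2" for x :: real by (simp add: indicator_def)
      ultimately show "integrable lborel (\<lambda>x. (indicator {a..t} x * (t - x))\<^sup>2)" by simp
    qed measurable
    from l2lim_integral_l[OF lh this]
    have "(\<lambda>n. Jn n t) \<longlonglongrightarrow> (LINT s|lborel. Ht s * (indicator {a..t} s * (t - s)))" unfolding Jn_def .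
    also have "(LINT s|lborel. Ht s * (indicator {a..t} s * (t - s))) = J t" unfolding J_def
      by (rule Bochner_Integration.integral_cong[OF refl]) (use t a in \<open>auto simp: Ht_def indicator_def\<close>)
    finally show ?thesis .
  qed
  have lw: "l2lim w Wt" unfolding w_def[abs_def] by (rule l2lim_conv[OF sW])
  obtain r :: "nat \<Rightarrow> nat" where r: "strict_mono r" "AE t in lborel. (\<lambda>n. w (r n) t) \<longlonglongrightarrow> Wt t" using l2lim_AE[OF lw] by blast
  have rN: "eventually (\<lambda>n. r n \<ge> N) sequentially" using filterlim_subseq[OF r(1)] by (simp add: filterlim_at_top)
  have lim: "(\<lambda>n. w (r n) a + pd 1 (w (r n)) a * (t - a)) \<longlonglongrightarrow> Y t + J t / 4"
    if t: "a < t" "t < b" and l: "(\<lambda>n. w (r n) t) \<longlonglongrightarrow> Wt t" for t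
  proof -
    have 1: "(\<lambda>n. w (r n) t + Jn (r n) t / 4) \<longlonglongrightarrow> Wt t + J t / 4"
      using LIMSEQ_subseq_LIMSEQ[OF Jl[of t] r(1)] t by (intro tendsto_intros l) (auto simp: o_def)
    have 2: "Wt t = Y t" using t a by (simp add: Wt_def indicator_def)
    have 3: "eventually (\<lambda>n. w (r n) t + Jn (r n) t / 4 = w (r n) a + pd 1 (w (r n)) a * (t - a)) sequentially"
      using rN by eventually_elim (use ty[of t] t in auto)
    from Lim_transform_eventually[OF 1 3] show ?thesis unfolding 2 .
  qed
  obtain t1 where t1: "a < t1" "t1 < (a + b) / 2" "(\<lambda>n. w (r n) t1) \<longlonglongrightarrow> Wt t1" using AE_lborel_pick[OF r(2), of a "(a + b) / 2"] a by auto
  obtain t2 where t2: "(a + b) / 2 < t2" "t2 < b" "(\<lambda>n. w (r n) t2) \<longlonglongrightarrow> Wt t2" using AE_lborel_pick[OF r(2), of "(a + b) / 2" b] a by auto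
  have "convergent (\<lambda>n. w (r n) a + pd 1 (w (r n)) a * (t1 - a))" "convergent (\<lambda>n. w (r n) a + pd 1 (w (r n)) a * (t2 - a))"
  proof -
    have "a < t1" "t1 < b" "a < t2" "t2 < b" using t1 t2 a by auto
    then show "convergent (\<lambda>n. w (r n) a + pd 1 (w (r n)) a * (t1 - a))" "convergent (\<lambda>n. w (r n) a + pd 1 (w (r n)) a * (t2 - a))"
      using convergentI[OF lim[OF _ _ t1(3)]] convergentI[OF lim[OF _ _ t2(3)]] by blast+
  qed
  then obtain A B where AB: "(\<lambda>n. w (r n) a) \<longlonglongrightarrow> A" "(\<lambda>n. pd 1 (w (r n)) a) \<longlonglongrightarrow> B"
    using affine_limit[of "t1 - a" "t2 - a" "\<lambda>n. w (r n) a" "\<lambda>n. pd 1 (w (r n)) a"] t1 t2 by auto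
  have "AE t in lborel. a < t \<and> t < b \<longrightarrow> Y t = A + B * (t - a) - J t / 4" using r(2)
  proof eventually_elim
    case (elim t)
    show ?case
    proof
      assume t: "a < t \<and> t < b"
      have "(\<lambda>n. w (r n) a + pd 1 (w (r n)) a * (t - a)) \<longlonglongrightarrow> A + B * (t - a)" by (intro tendsto_intros AB)
      from LIMSEQ_unique[OF this lim[OF _ _ elim]] t show "Y t = A + B * (t - a) - J t / 4" by simp
    qed
  qed
  then show ?thesis using that unfolding J_def by blast
qed

text \<open>The intervals from \<open>a\<close> to \<open>a + Suc n\<close> overlap, and two affine
  functions that agree at two points coincide, so one pair of coefficients serves the whole
  half-line.\<close>

lemma weak_ode_integrated:
  assumes w: "weak_ode Y H" and a: "0 < a"
  obtains A B where "AE t in lborel. a < t \<longrightarrow> Y t = A + B * (t - a) - (LINT s|lborel. indicator {a..t} s * ((t - s) * H s)) / 4"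
proof -
  define J where "J t = (LINT s|lborel. indicator {a..t} s * ((t - s) * H s))" for t
  have ex: "\<exists>A B. AE t in lborel. a < t \<and> t < a + real (Suc n) \<longrightarrow> Y t = A + B * (t - a) - J t / 4" for n
  proof -
    have "a < a + real (Suc n)" by simp
    from weak_ode_bounded[OF w a this] show ?thesis unfolding J_def by blast
  qed
  define P where "P n A B \<longleftrightarrow> (AE t in lborel. a < t \<and> t < a + real (Suc n) \<longrightarrow> Y t = A + B * (t - a) - J t / 4)" for n A B
  have "\<forall>n. \<exists>A B. P n A B" unfolding P_def using ex by blast
  then obtain A B where "\<And>n. P n (A n) (B n)" by metis
  then have AB: "AE t in lborel. a < t \<and> t < a + real (Suc n) \<longrightarrow> Y t = A n + B n * (t - a) - J t / 4" for n unfolding P_def by blast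
  have eq: "A n = A 0 \<and> B n = B 0" for n
  proof -
    have AE: "AE t in lborel. a < t \<and> t < a + 1 \<longrightarrow> A n + B n * (t - a) = A 0 + B 0 * (t - a)"
      using AB[of n] AB[of 0] by eventually_elim auto
    obtain x where x: "a < x" "x < a + 1/2" "a < x \<and> x < a + 1 \<longrightarrow> A n + B n * (x - a) = A 0 + B 0 * (x - a)"
      using AE_lborel_pick[OF AE, of a "a + 1/2"] by auto
    obtain y where y: "a + 1/2 < y" "y < a + 1" "a < y \<and> y < a + 1 \<longrightarrow> A n + B n * (y - a) = A 0 + B 0 * (y - a)"
      using AE_lborel_pick[OF AE, of "a + 1/2" "a + 1"] by auto
    have e: "A n + B n * (x - a) = A 0 + B 0 * (x - a)" "A n + B n * (y - a) = A 0 + B 0 * (y - a)" using x y by auto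
    then have "(B n - B 0) * (y - x) = 0" by (simp add: algebra_simps)
    then have "B n = B 0" using x y by simp
    then show ?thesis using e by simp
  qed
  have "AE t in lborel. \<forall>n. a < t \<and> t < a + real (Suc n) \<longrightarrow> Y t = A n + B n * (t - a) - J t / 4" using AB by (subst AE_all_countable) blast
  then have "AE t in lborel. a < t \<longrightarrow> Y t = A 0 + B 0 * (t - a) - J t / 4"
  proof eventually_elim
    case (elim t)
    obtain n where "t < a + real (Suc n)" using reals_Archimedean2[of "t - a"] by (metis add.commute diff_less_eq less_SucI of_nat_less_iff order_less_trans lessI)
    then show ?case using elim eq[of n] by metis
  qed
  then show ?thesis using that unfolding J_def by blast
qed

definition prim :: "real \<Rightarrow> (real \<Rightarrow> real) \<Rightarrow> real \<Rightarrow> real" where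
  "prim a G t = (LINT s|lborel. indicator {a..t} s * G s)"

lemma prim_eq_integral:
  assumes "integrable lborel (\<lambda>s. indicator {a..t} s * G s)"
  shows "prim a G t = integral {a..t} G" "G integrable_on {a..t}"
proof -
  have "set_integrable lborel {a..t} G" using assms by (simp add: set_integrable_def)
  from set_borel_integral_eq_integral[OF this] show "prim a G t = integral {a..t} G" "G integrable_on {a..t}"
    by (simp_all add: prim_def set_lebesgue_integral_def)
qed

lemma prim_continuous:
  assumes i: "\<And>t. integrable lborel (\<lambda>s. indicator {a..t} s * G s)"
  shows "continuous_on {a..} (prim a G)"
  unfolding continuous_on_eq_continuous_within
proof
  fix t assume t: "t \<in> {a..}"
  have "continuous_on {a..t+1} (prim a G)"
    using indefinite_integral_continuous_1[OF prim_eq_integral(2)[OF i], of "t + 1"] prim_eq_integral(1)[OF i] by simp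
  then have "continuous (at t within {a..t+1}) (prim a G)" using t by (auto simp: continuous_on_eq_continuous_within)
  moreover have "at t within {a..t+1} = at t within {a..}"
    by (rule at_within_nhd[of _ "{..<t+1}"]) auto
  ultimately show "continuous (at t within {a..}) (prim a G)" by (simp add: continuous_within)
qed

lemma continuous_prim_integrable:
  fixes G :: "real \<Rightarrow> real"
  assumes "continuous_on {a..} G"
  shows "integrable lborel (\<lambda>s. indicator {a..t} s * G s)"
proof -
  have "set_integrable lborel {a..t} G" by (rule borel_integrable_atLeastAtMost') (rule continuous_on_subset[OF assms], auto)
  then show ?thesis by (simp add: set_integrable_def)
qed

lemma prim_deriv:
  assumes c: "continuous_on {a..} G" and t: "t > a"
  shows "(prim a G has_real_derivative G t) (at t)"
proof -
  have "((\<lambda>t. integral {a..t} G) has_real_derivative G t) (at t within {a..t+1})"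
    by (rule integral_has_real_derivative) (use t continuous_on_subset[OF c] in auto)
  then have "(prim a G has_real_derivative G t) (at t within {a..t+1})"
    using prim_eq_integral(1)[OF continuous_prim_integrable[OF c]] by (simp add: prim_eq_integral(1)[OF continuous_prim_integrable[OF c], abs_def])
  moreover have "at t within {a..t+1} = at t" by (rule at_within_interior) (use t in auto)
  ultimately show ?thesis by simp
qed

text \<open>Splitting the kernel \<open>t - s\<close> expresses the double integral by two
  primitives, which are continuous already for locally integrable \<open>H\<close>. This gives the
  continuous representative that makes the nonlinearity continuous in turn.\<close>

lemma weak_ode_continuous:
  assumes w: "weak_ode Y H" and a: "0 < a"
  obtains w A B where "continuous_on {a..} w" "AE t in lborel. a < t \<longrightarrow> Y t = w t"
    "\<And>t. w t = A + B * (t - a) - (t * prim a H t - prim a (\<lambda>s. s * H s) t) / 4"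
proof -
  obtain A B where AB: "AE t in lborel. a < t \<longrightarrow> Y t = A + B * (t - a) - (LINT s|lborel. indicator {a..t} s * ((t - s) * H s)) / 4"
    using weak_ode_integrated[OF w a] by blast
  have i1: "integrable lborel (\<lambda>s. indicator {a..t} s * H s)" and i2: "integrable lborel (\<lambda>s. indicator {a..t} s * (s * H s))" for t
  proof -
    have s: "sq (\<lambda>s. indicator {a..t} s * H s)" using w a unfolding weak_ode_def by blast
    have c: "sq (\<lambda>s::real. indicator {a..t} s * f s)" if "continuous_on UNIV f" for f unfolding sq_def
    proof
      have "integrable lborel (\<lambda>x. indicator {a..t} x *\<^sub>R (f x)\<^sup>2)"
        by (rule borel_integrable_compact) (auto intro!: continuous_intros continuous_on_subset[OF that])
      moreover have "indicator {a..t} x *\<^sub>R (f x)\<^sup>2 = (indicator {a..t} x * f x)\<^sup>2" for x :: real by (simp add: indicator_def)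
      ultimately show "integrable lborel (\<lambda>x. (indicator {a..t} x * f x)\<^sup>2)" by simp
      have [measurable]: "f \<in> borel_measurable borel" by (rule borel_measurable_continuous_onI[OF that])
      show "(\<lambda>s::real. indicator {a..t} s * f s) \<in> borel_measurable borel" by measurable
    qed
    have "integrable lborel (\<lambda>s. (indicator {a..t} s * 1) * (indicator {a..t} s * H s))" by (intro sq_mult_integrable s c continuous_intros)
    then show "integrable lborel (\<lambda>s. indicator {a..t} s * H s)" by (rule Bochner_Integration.integrable_cong[THEN iffD1, OF refl, rotated]) (auto simp: indicator_def)
    have "integrable lborel (\<lambda>s. (indicator {a..t} s * s) * (indicator {a..t} s * H s))" by (intro sq_mult_integrable s c continuous_intros)
    then show "integrable lborel (\<lambda>s. indicator {a..t} s * (s * H s))" by (rule Bochner_Integration.integrable_cong[THEN iffD1, OF refl, rotated]) (auto simp: indicator_def)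
  qed
  have e: "(LINT s|lborel. indicator {a..t} s * ((t - s) * H s)) = t * prim a H t - prim a (\<lambda>s. s * H s) t" for t
  proof -
    have "(LINT s|lborel. indicator {a..t} s * ((t - s) * H s)) = (LINT s|lborel. t * (indicator {a..t} s * H s) - indicator {a..t} s * (s * H s))"
      by (rule Bochner_Integration.integral_cong[OF refl]) (simp add: algebra_simps)
    also have "\<dots> = t * prim a H t - prim a (\<lambda>s. s * H s) t"
      unfolding prim_def using i1 i2 by (subst Bochner_Integration.integral_diff) auto
    finally show ?thesis .
  qed
  show ?thesis
  proof (rule that[of "\<lambda>t. A + B * (t - a) - (t * prim a H t - prim a (\<lambda>s. s * H s) t) / 4" A B])
    show "continuous_on {a..} (\<lambda>t. A + B * (t - a) - (t * prim a H t - prim a (\<lambda>s. s * H s) t) / 4)"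
      by (intro continuous_intros prim_continuous i1 i2) auto
    show "AE t in lborel. a < t \<longrightarrow> Y t = A + B * (t - a) - (t * prim a H t - prim a (\<lambda>s. s * H s) t) / 4" using AB unfolding e .
  qed simp
qed

lemma prim_cong_AE:
  assumes "G \<in> borel_measurable borel" "G' \<in> borel_measurable borel" "AE s in lborel. a < s \<longrightarrow> G s = G' s"
  shows "prim a G t = prim a G' t"
  unfolding prim_def
proof (rule integral_cong_AE)
  show "AE s in lborel. indicator {a..t} s * G s = indicator {a..t} s * G' s"
    using assms(3) AE_lborel_singleton[of a] by eventually_elim (auto simp: indicator_def)
qed (use assms in measurable)

text \<open>Once \<open>H\<close> agrees almost everywhere with a continuous \<open>h\<close>, the
  primitives are differentiable. The two terms \<open>t * h t\<close> cancel, so the first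
  derivative contains only the primitive of \<open>h\<close> and can be differentiated
  again.\<close>

lemma weak_ode_classical:
  assumes w: "\<And>t. w t = A + B * (t - a) - (t * prim a H t - prim a (\<lambda>s. s * H s) t) / 4"
    and H[measurable]: "H \<in> borel_measurable borel" and h: "continuous_on {a..} h" and e: "AE s in lborel. a < s \<longrightarrow> H s = h s" and t: "t > a"
  shows "(w has_real_derivative B - prim a h t / 4) (at t)" "((\<lambda>t. B - prim a h t / 4) has_real_derivative - (h t / 4)) (at t)"
proof -
  \<comment> \<open>\<open>h\<close> is known to be continuous only on \<open>{a..}\<close>;
    extended by 0 from there it is Borel measurable on the whole line.\<close>
  define h' where "h' s = indicator {a..} s * h s" for s
  have [measurable]: "h' \<in> borel_measurable borel"
    using borel_measurable_continuous_on_indicator[OF _ h] unfolding h'_def[abs_def] by simp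
  have eq: "indicator {a..t} s * h' s = indicator {a..t} s * h s" "indicator {a..t} s * (s * h' s) = indicator {a..t} s * (s * h s)" for t s by (auto simp: h'_def indicator_def)
  have 1: "prim a H t = prim a h t" for t
  proof -
    have "prim a H t = prim a h' t"
    proof (rule prim_cong_AE)
      show "AE s in lborel. a < s \<longrightarrow> H s = h' s" using e by eventually_elim (simp add: h'_def)
    qed measurable
    then show ?thesis unfolding prim_def eq .
  qed
  have 2: "prim a (\<lambda>s. s * H s) t = prim a (\<lambda>s. s * h s) t" for t
  proof -
    have "prim a (\<lambda>s. s * H s) t = prim a (\<lambda>s. s * h' s) t"
    proof (rule prim_cong_AE)
      show "AE s in lborel. a < s \<longrightarrow> s * H s = s * h' s" using e by eventually_elim (simp add: h'_def)
    qed measurable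
    then show ?thesis unfolding prim_def eq .
  qed
  have c: "continuous_on {a..} (\<lambda>s. s * h s)" by (intro continuous_intros h)
  have "((\<lambda>t. A + B * (t - a) - (t * prim a h t - prim a (\<lambda>s. s * h s) t) / 4) has_real_derivative
     (0 + B * (1 - 0)) - ((1 * prim a h t + h t * t) - t * h t) / 4) (at t)"
    by (intro DERIV_diff DERIV_add DERIV_cdivide DERIV_mult DERIV_cmult DERIV_const DERIV_ident prim_deriv h c t)
  moreover have "w = (\<lambda>t. A + B * (t - a) - (t * prim a h t - prim a (\<lambda>s. s * h s) t) / 4)" using w 1 2 by auto
  ultimately show "(w has_real_derivative B - prim a h t / 4) (at t)" by (simp add: mult.commute)
  have "((\<lambda>t. B - prim a h t / 4) has_real_derivative 0 - h t / 4) (at t)"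
    by (intro DERIV_diff DERIV_cdivide DERIV_const prim_deriv h t)
  then show "((\<lambda>t. B - prim a h t / 4) has_real_derivative - (h t / 4)) (at t)" by simp
qed

lemma nonlin_continuous:
  fixes f g :: "real \<Rightarrow> real"
  assumes f: "continuous_on S f" and g: "continuous_on S g" and p: "p > 2"
  shows "continuous_on S (\<lambda>s. nonlin \<mu> \<alpha> \<beta> p (f s) (g s))"
proof -
  have "continuous_on S (\<lambda>s. \<bar>f s\<bar> powr (p - 2))"
    using p by (intro continuous_on_powr' continuous_intros f) auto
  then show ?thesis unfolding nonlin_def
    by (intro continuous_on_add continuous_on_mult continuous_on_power continuous_on_const f g)
qed

text \<open>Away from 0 the weight \<open>jac\<close> is bounded below by its value \<open>k\<close>
  at \<open>c\<close>.\<close>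

lemma sq_jac_local:
  assumes [measurable]: "h \<in> borel_measurable borel" and i: "integrable lborel (\<lambda>s. jac s * (h s)\<^sup>2)" and c: "c > 0"
  shows "sq (\<lambda>s. indicator {c..d} s * h s)"
  unfolding sq_def
proof
  define k where "k = 2 * unit_ball_vol (4::real) * c"
  have k: "k > 0" unfolding k_def using c ub4 by (intro mult_pos_pos) auto
  show "integrable lborel (\<lambda>x. (indicator {c..d} x * h x)\<^sup>2)"
  proof (rule Bochner_Integration.integrable_bound)
    show "integrable lborel (\<lambda>s. inverse k * (jac s * (h s)\<^sup>2))" using i by simp
    show "AE s in lborel. norm ((indicator {c..d} s * h s)\<^sup>2) \<le> norm (inverse k * (jac s * (h s)\<^sup>2))"
    proof (intro always_eventually allI)
      fix s
      have "k \<le> jac s" if "s \<ge> c" unfolding k_def using that c ub4 by (subst jac_pos) (auto intro!: mult_left_mono)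
      then have "1 \<le> inverse k * jac s" if "s \<ge> c" using that k by (simp add: field_simps)
      then have "(indicator {c..d} s * h s)\<^sup>2 \<le> (inverse k * jac s) * (h s)\<^sup>2"
        using k jac_nonneg[of s] mult_right_mono[of 1 "inverse k * jac s" "(h s)\<^sup>2"] by (auto simp: indicator_def)
      then show "norm ((indicator {c..d} s * h s)\<^sup>2) \<le> norm (inverse k * (jac s * (h s)\<^sup>2))"
        using k jac_nonneg[of s] by (simp add: mult.assoc)
    qed
  qed measurable
qed measurable

lemma sq_radial:
  fixes f :: "real^4 \<Rightarrow> real"
  assumes f: "sq f" and [measurable]: "F \<in> borel_measurable borel" and F: "AE x in lborel. f x = F ((norm x)\<^sup>2)"
  shows "integrable lborel (\<lambda>s. jac s * (F s)\<^sup>2)"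
proof -
  have "integrable lborel (\<lambda>x::real^4. (F ((norm x)\<^sup>2))\<^sup>2)"
  proof (rule integrable_cong_AE_imp)
    show "integrable lborel (\<lambda>x. (f x)\<^sup>2)" using f by (simp add: sq_def)
    show "AE x in lborel. (f x)\<^sup>2 = (F ((norm x)\<^sup>2))\<^sup>2" using F by eventually_elim simp
  qed measurable
  then show ?thesis by (subst (asm) radial_integral(1)) measurable
qed

lemma radial_weak_ode:
  fixes u f :: "real^4 \<Rightarrow> real"
  assumes W: "W u g" and f: "sq f"
    and eq: "\<And>\<psi>. test_function \<psi> \<Longrightarrow> (\<Sum>i\<in>Basis. LINT x|lborel. g i x * pd i \<psi> x) = (LINT x|lborel. f x * \<psi> x)"
    and [measurable]: "U \<in> borel_measurable borel" "F \<in> borel_measurable borel"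
    and U: "AE x in lborel. u x = U ((norm x)\<^sup>2)" and F: "AE x in lborel. f x = F ((norm x)\<^sup>2)"
  shows "weak_ode (\<lambda>s. s * U s) F"
  unfolding weak_ode_def
proof (intro conjI allI impI)
  fix c d :: real assume c: "c > 0"
  have "sq (\<lambda>s. (indicator {c..d} s * s) * (indicator {c..d} s * U s))"
  proof (rule sq_bdd_mult)
    show "sq (\<lambda>s. indicator {c..d} s * U s)" by (intro sq_jac_local sq_radial[OF WD(1)[OF W] _ U] c) measurable
    show "\<bar>indicator {c..d} s * s\<bar> \<le> \<bar>c\<bar> + \<bar>d\<bar>" for s by (auto simp: indicator_def)
  qed measurable
  moreover have "(\<lambda>s. (indicator {c..d} s * s) * (indicator {c..d} s * U s)) = (\<lambda>s. indicator {c..d} s * (s * U s))"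
    by (auto simp: indicator_def)
  ultimately show "sq (\<lambda>s. indicator {c..d} s * (s * U s))" by simp
  show "sq (\<lambda>s. indicator {c..d} s * F s)" by (intro sq_jac_local sq_radial[OF f _ F] c) measurable
next
  fix \<xi> c assume "test_function \<xi>" "c > (0::real)" "\<forall>s<c. \<xi> s = 0"
  then show "4 * (LINT s|lborel. s * U s * pd 1 (pd 1 \<xi>) s) = - (LINT s|lborel. F s * \<xi> s)"
    by (intro radial_weak_equation[OF W f eq _ _ U F]) auto
qed

context sys
begin

text \<open>The origin is a singular point of the equation in \<open>s\<close>, so everything is
  done on \<open>{a..}\<close> for arbitrary \<open>a > 0\<close>, with continuous representatives
  \<open>w\<close> and \<open>z\<close> of \<open>s * P s\<close> and \<open>s * Q s\<close> that
  depend on \<open>a\<close>. The conclusions that \<open>P\<close> vanishes beyond \<open>a\<close>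
  are combined over \<open>a = 1 / Suc n\<close>.\<close>

lemma radial_vanish:
  assumes l: "l1 < 0" and p3: "8 / 3 < p"
    and ru: "AE x in lborel. u x = \<rho>1 (norm x)" and rv: "AE x in lborel. v x = \<rho>2 (norm x)"
  shows "n2 u = 0"
proof -
  obtain P where P[measurable]: "P \<in> borel_measurable borel" and uP: "AE x in lborel. u x = P ((norm x)\<^sup>2)"
    using radial_borel_representative[OF sq_borel[OF WD(1)[OF Wu]] ru] by blast
  obtain Q where Q[measurable]: "Q \<in> borel_measurable borel" and vQ: "AE x in lborel. v x = Q ((norm x)\<^sup>2)"
    using radial_borel_representative[OF sq_borel[OF WD(1)[OF Wv]] rv] by blast
  define F1 where "F1 s = nonlin \<mu>1 \<alpha>1 \<beta> p (P s) (Q s) - l1 * P s" for s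
  define F2 where "F2 s = nonlin \<mu>2 \<alpha>2 \<beta> p (Q s) (P s) - l2 * Q s" for s
  have [measurable]: "F1 \<in> borel_measurable borel" "F2 \<in> borel_measurable borel"
    unfolding F1_def[abs_def] F2_def[abs_def] nonlin_def by measurable
  have F1: "AE x in lborel. fu x = F1 ((norm x)\<^sup>2)" using uP vQ by eventually_elim (simp add: F1_def)
  have F2: "AE x in lborel. fv x = F2 ((norm x)\<^sup>2)" using uP vQ by eventually_elim (simp add: F2_def)
  have w1: "weak_ode (\<lambda>s. s * P s) F1" by (rule radial_weak_ode[OF Wu sq_fu eq_u _ _ uP F1]) measurable
  have w2: "weak_ode (\<lambda>s. s * Q s) F2" by (rule radial_weak_ode[OF Wv sq_fv eq_v _ _ vQ F2]) measurable
  define R where "R s = (P s)\<^sup>2 + (Q s)\<^sup>2 + P s ^ 4 + Q s ^ 4" for s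
  have [measurable]: "R \<in> borel_measurable borel" unfolding R_def[abs_def] by measurable
  have iR: "integrable lborel (\<lambda>s. jac s * R s)"
  proof -
    have "integrable lborel (\<lambda>x::real^4. R ((norm x)\<^sup>2))"
    proof (rule integrable_cong_AE_imp[OF int_dom])
      show "AE x in lborel. (u x)\<^sup>2 + (v x)\<^sup>2 + u x ^ 4 + v x ^ 4 = R ((norm x)\<^sup>2)"
        using uP vQ by eventually_elim (simp add: R_def)
    qed measurable
    then show ?thesis by (subst (asm) radial_integral(1)) measurable
  qed
  have van: "AE s in lborel. a < s \<longrightarrow> P s = 0" if a: "a > 0" for a
  proof -
    obtain w A B where w: "continuous_on {a..} w" "AE t in lborel. a < t \<longrightarrow> t * P t = w t"
       "\<And>t. w t = A + B * (t - a) - (t * prim a F1 t - prim a (\<lambda>s. s * F1 s) t) / 4"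
      using weak_ode_continuous[OF w1 a] by blast
    obtain z A' B' where z: "continuous_on {a..} z" "AE t in lborel. a < t \<longrightarrow> t * Q t = z t"
       "\<And>t. z t = A' + B' * (t - a) - (t * prim a F2 t - prim a (\<lambda>s. s * F2 s) t) / 4"
      using weak_ode_continuous[OF w2 a] by blast
    have PQ: "AE t in lborel. a < t \<longrightarrow> P t = w t / t \<and> Q t = z t / t"
      using w(2) z(2) by eventually_elim (use a in \<open>auto simp: field_simps\<close>)
    define h1 where "h1 s = nonlin \<mu>1 \<alpha>1 \<beta> p (w s / s) (z s / s) - l1 * (w s / s)" for s
    define h2 where "h2 s = nonlin \<mu>2 \<alpha>2 \<beta> p (z s / s) (w s / s) - l2 * (z s / s)" for s
    have cw: "continuous_on {a..} (\<lambda>s. w s / s)" "continuous_on {a..} (\<lambda>s. z s / s)"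
      using a by (auto intro!: continuous_intros w z)
    have ch: "continuous_on {a..} h1" "continuous_on {a..} h2"
      unfolding h1_def[abs_def] h2_def[abs_def] using p3
      by (intro continuous_on_diff nonlin_continuous continuous_on_mult continuous_on_const cw; simp)+
    have e: "AE s in lborel. a < s \<longrightarrow> F1 s = h1 s" "AE s in lborel. a < s \<longrightarrow> F2 s = h2 s"
      using PQ by (eventually_elim, simp add: F1_def F2_def h1_def h2_def)+
    define \<sigma> where "\<sigma> t = (w t)\<^sup>2 / t + w t ^ 4 / t ^ 3 + (z t)\<^sup>2 / t + z t ^ 4 / t ^ 3" for t
    have c\<sigma>: "continuous_on {a..} \<sigma>" unfolding \<sigma>_def[abs_def] using a by (auto intro!: continuous_intros w z)
    \<comment> \<open>Almost everywhere beyond \<open>a\<close>, \<open>jac s * R s\<close> is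
      \<open>2 * unit_ball_vol 4\<close> times \<open>\<sigma> s\<close>, so the norms of the
      solution bound the primitive of \<sigma> uniformly.\<close>
    define C where "C = (LINT s|lborel. jac s * R s) / (2 * unit_ball_vol 4)"
    have S: "prim a \<sigma> t \<le> C" for t
    proof -
      have "prim a \<sigma> t \<le> (LINT s|lborel. jac s * R s / (2 * unit_ball_vol 4))" unfolding prim_def
      proof (rule integral_mono_AE)
        show "integrable lborel (\<lambda>s. indicator {a..t} s * \<sigma> s)" by (rule continuous_prim_integrable[OF c\<sigma>])
        show "integrable lborel (\<lambda>s. jac s * R s / (2 * unit_ball_vol 4))" using iR by simp
        show "AE s in lborel. indicator {a..t} s * \<sigma> s \<le> jac s * R s / (2 * unit_ball_vol 4)"
          using PQ AE_lborel_singleton[of a]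
        proof eventually_elim
          case (elim s)
          have R0: "0 \<le> jac s * R s / (2 * unit_ball_vol 4)"
            unfolding R_def using jac_nonneg[of s] ub4 by (intro divide_nonneg_nonneg mult_nonneg_nonneg add_nonneg_nonneg) auto
          show ?case
          proof (cases "a < s")
            case True
            then have s: "s > 0" and P: "P s = w s / s" "Q s = z s / s" using a elim by auto
            have "jac s * R s / (2 * unit_ball_vol 4) = s * R s"
            proof -
              have "unit_ball_vol 4 \<noteq> (0::real)" using ub4 by linarith
              then show ?thesis unfolding jac_pos(1)[OF s] by simp
            qed
            also have "\<dots> = \<sigma> s" unfolding R_def \<sigma>_def P using s
              by (simp add: field_simps power2_eq_square power3_eq_cube power4_eq_xxxx)
            finally show ?thesis using R0 by (auto simp: indicator_def)
          next
            case False
            then show ?thesis using elim(2) R0 by (simp add: indicator_def)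
          qed
        qed
      qed
      then show ?thesis by (simp add: C_def)
    qed
    have "w b = 0" if b: "b > a" for b
    proof (rule ode_vanish[where a=a and S="prim a \<sigma>" and C=C and w=w and z=z])
      show "0 \<le> a" "0 < - l1" "8 / 3 < p" "p < 4" "a < b" using a l p3 U.p b by auto
      fix t assume t: "t > a"
      then have t0: "t > 0" using a by simp
      show "(w has_real_derivative B - prim a h1 t / 4) (at t)" by (rule weak_ode_classical[OF w(3) _ ch(1) e(1) t]) measurable
      show "(z has_real_derivative B' - prim a h2 t / 4) (at t)" by (rule weak_ode_classical[OF z(3) _ ch(2) e(2) t]) measurable
      have "((\<lambda>t. B - prim a h1 t / 4) has_real_derivative - (h1 t / 4)) (at t)" by (rule weak_ode_classical[OF w(3) _ ch(1) e(1) t]) measurable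
      also have "- (h1 t / 4) = - ((- l1 + qf \<mu>1 \<alpha>1 \<beta> p w z t) * w t / (4 * t))"
        unfolding h1_def nonlin_def qf_def using t0 by (simp add: field_simps power2_eq_square power3_eq_cube)
      finally show "((\<lambda>t. B - prim a h1 t / 4) has_real_derivative - ((- l1 + qf \<mu>1 \<alpha>1 \<beta> p w z t) * w t / (4 * t))) (at t)" .
      have "((\<lambda>t. B' - prim a h2 t / 4) has_real_derivative - (h2 t / 4)) (at t)" by (rule weak_ode_classical[OF z(3) _ ch(2) e(2) t]) measurable
      also have "- (h2 t / 4) = - ((- l2 + qf \<mu>2 \<alpha>2 \<beta> p z w t) * z t / (4 * t))"
        unfolding h2_def nonlin_def qf_def using t0 by (simp add: field_simps power2_eq_square power3_eq_cube)
      finally show "((\<lambda>t. B' - prim a h2 t / 4) has_real_derivative - ((- l2 + qf \<mu>2 \<alpha>2 \<beta> p z w t) * z t / (4 * t))) (at t)" .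
      show "(prim a \<sigma> has_real_derivative (w t)\<^sup>2 / t + w t ^ 4 / t ^ 3 + (z t)\<^sup>2 / t + z t ^ 4 / t ^ 3) (at t)"
        using prim_deriv[OF c\<sigma> t] by (simp add: \<sigma>_def)
      show "prim a \<sigma> t \<le> C" by (rule S)
    qed
    with PQ show ?thesis by (auto elim: eventually_mono)
  qed
  have "AE s in lborel. \<forall>n. 1 / real (Suc n) < s \<longrightarrow> P s = 0" using van by (subst AE_all_countable) simp
  then have "AE s in lborel. s > 0 \<longrightarrow> P s = 0"
  proof eventually_elim
    case (elim s)
    then show ?case using nat_approx_posE[of s] by metis
  qed
  then have "AE x::real^4 in lborel. P ((norm x)\<^sup>2) = 0" by (subst radial_AE) measurable
  then have "AE x in lborel. (u x)\<^sup>2 = 0" using uP by eventually_elim simp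
  then show ?thesis unfolding n2_def by (rule integral_eq_zero_AE)
qed

end

section \<open>Passage from Lebesgue measurable to Borel functions\<close>

lemma lebesgue_representative:
  assumes "f \<in> borel_measurable lebesgue"
  obtains f' :: "'a::euclidean_space \<Rightarrow> real" where "f' \<in> borel_measurable borel" "AE x in lebesgue. f x = f' x"
  using completion_ex_borel_measurable_real[of f lborel] assms by (auto simp: AE_completion_iff)

lemma integral_lebesgue_eq:
  fixes f f' :: "'a::euclidean_space \<Rightarrow> real"
  assumes f: "f \<in> borel_measurable lebesgue" "f' \<in> borel_measurable borel" "AE x in lebesgue. f x = f' x"
  shows "(LINT x|lebesgue. f x) = (LINT x|lborel. f' x)" "integrable lebesgue f \<longleftrightarrow> integrable lborel f'"
proof -
  have m: "f' \<in> borel_measurable lebesgue" using f(2) by (intro measurable_completion) simp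
  show "(LINT x|lebesgue. f x) = (LINT x|lborel. f' x)"
    using integral_cong_AE[OF f(1) m f(3)] integral_completion[of f' lborel] f(2) by simp
  show "integrable lebesgue f \<longleftrightarrow> integrable lborel f'"
    using integrable_cong_AE[OF f(1) m f(3)] integrable_completion[of f' lborel] f(2) by simp
qed

text \<open>The definition of a solution uses \<open>lebesgue\<close> and the inner product with a
  vector-valued gradient; the proof uses \<open>lborel\<close> and a family of components. Each
  component of the gradient gets its own Borel representative, and integrals do not see the null
  sets.\<close>

lemma weq_representative:
  fixes u v :: "real^4 \<Rightarrow> real"
  assumes L: "L2 u" "u0 \<in> borel_measurable borel" "AE x in lebesgue. u x = u0 x"
    "L2 v" "v0 \<in> borel_measurable borel" "AE x in lebesgue. v x = v0 x"
    and eq: "weak_eq l u (\<lambda>x. nonlin \<mu> \<alpha> \<beta> p (u x) (v x))"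
  obtains g where "weq l u0 g (\<lambda>x. nonlin \<mu> \<alpha> \<beta> p (u0 x) (v0 x))"
proof -
  obtain g where g: "L2 g" "weak_gradient u g" "\<And>\<phi>. test_function \<phi> \<Longrightarrow>
      (LINT x|lebesgue. g x \<bullet> grad \<phi> x) + l * (LINT x|lebesgue. u x * \<phi> x) = (LINT x|lebesgue. nonlin \<mu> \<alpha> \<beta> p (u x) (v x) * \<phi> x)"
    using eq unfolding weak_eq_def by blast
  have [measurable]: "u \<in> borel_measurable lebesgue" "v \<in> borel_measurable lebesgue" "g \<in> borel_measurable lebesgue"
    using L g by (auto simp: L2_def)
  note [measurable] = L(2,5)
  have gb[measurable]: "(\<lambda>x. g x \<bullet> b) \<in> borel_measurable lebesgue" for b by measurable
  define P where "P b f' \<longleftrightarrow> f' \<in> borel_measurable borel \<and> (AE x in lebesgue. g x \<bullet> b = f' x)" for b f'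
  have "\<forall>b. \<exists>f'. P b f'" unfolding P_def using lebesgue_representative[OF gb] by blast
  then obtain g0 where "\<And>b. P b (g0 b)" by metis
  then have g0[measurable]: "g0 b \<in> borel_measurable borel" and gg: "AE x in lebesgue. g x \<bullet> b = g0 b x" for b by (auto simp: P_def)
  have su: "sq u0" unfolding sq_def
  proof
    show "integrable lborel (\<lambda>x. (u0 x)\<^sup>2)"
    proof (rule integral_lebesgue_eq(2)[THEN iffD1])
      show "integrable lebesgue (\<lambda>x. (u x)\<^sup>2)" using L(1) by (simp add: L2_def)
      show "AE x in lebesgue. (u x)\<^sup>2 = (u0 x)\<^sup>2" using L(3) by eventually_elim simp
    qed measurable
  qed (rule L)
  have sg: "sq (g0 b)" if b: "b \<in> Basis" for b unfolding sq_def
  proof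
    show "integrable lborel (\<lambda>x. (g0 b x)\<^sup>2)"
    proof (rule integral_lebesgue_eq(2)[THEN iffD1])
      show "integrable lebesgue (\<lambda>x. (g x \<bullet> b)\<^sup>2)"
      proof (rule Bochner_Integration.integrable_bound)
        show "integrable lebesgue (\<lambda>x. (norm (g x))\<^sup>2)" using g(1) by (simp add: L2_def)
        have "(g x \<bullet> b)\<^sup>2 \<le> (norm (g x))\<^sup>2" for x using Basis_le_norm[OF b, of "g x"] by (simp add: abs_le_square_iff[symmetric])
        then show "AE x in lebesgue. norm ((g x \<bullet> b)\<^sup>2) \<le> norm ((norm (g x))\<^sup>2)" by simp
      qed measurable
      show "AE x in lebesgue. (g x \<bullet> b)\<^sup>2 = (g0 b x)\<^sup>2" using gg[of b] by eventually_elim simp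
    qed measurable
  qed (rule g0)
  have tm: "\<phi> \<in> borel_measurable borel" "\<phi> \<in> borel_measurable lebesgue" if "test_function \<phi>" for \<phi> :: "real^4 \<Rightarrow> real"
  proof -
    show "\<phi> \<in> borel_measurable borel" by (rule test_borel[OF that])
    then show "\<phi> \<in> borel_measurable lebesgue" by (intro measurable_completion) simp
  qed
  have uu: "(LINT x|lebesgue. u x * \<phi> x) = (LINT x|lborel. u0 x * \<phi> x)" if \<phi>: "test_function \<phi>" for \<phi>
  proof (rule integral_lebesgue_eq(1))
    note [measurable] = tm[OF \<phi>]
    show "(\<lambda>x. u x * \<phi> x) \<in> borel_measurable lebesgue" "(\<lambda>x. u0 x * \<phi> x) \<in> borel_measurable borel" by measurable
    show "AE x in lebesgue. u x * \<phi> x = u0 x * \<phi> x" using L(3) by eventually_elim simp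
  qed
  have gu: "(LINT x|lebesgue. (g x \<bullet> b) * \<phi> x) = (LINT x|lborel. g0 b x * \<phi> x)" if \<phi>: "test_function \<phi>" for \<phi> b
  proof (rule integral_lebesgue_eq(1))
    note [measurable] = tm[OF \<phi>]
    show "(\<lambda>x. (g x \<bullet> b) * \<phi> x) \<in> borel_measurable lebesgue" "(\<lambda>x. g0 b x * \<phi> x) \<in> borel_measurable borel" by measurable
    show "AE x in lebesgue. (g x \<bullet> b) * \<phi> x = g0 b x * \<phi> x" using gg[of b] by eventually_elim simp
  qed
  have wd: "wd b u0 (g0 b)" if b: "b \<in> Basis" for b unfolding wd_def
  proof (intro allI impI)
    fix \<phi> :: "real^4 \<Rightarrow> real" assume \<phi>: "test_function \<phi>"
    have "(LINT x|lebesgue. u x * (grad \<phi> x \<bullet> b)) = - (LINT x|lebesgue. (g x \<bullet> b) * \<phi> x)"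
      using g(2) \<phi> b unfolding weak_gradient_def by blast
    then show "(LINT x|lborel. u0 x * pd b \<phi> x) = - (LINT x|lborel. g0 b x * \<phi> x)"
      unfolding grad_inner[OF b] uu[OF test_pd[OF \<phi> b]] gu[OF \<phi>] .
  qed
  have W: "W u0 g0" unfolding W_def using su sg wd by blast
  have "weq l u0 g0 (\<lambda>x. nonlin \<mu> \<alpha> \<beta> p (u0 x) (v0 x))" unfolding weq_def
  proof (intro conjI W allI impI)
    fix \<phi> :: "real^4 \<Rightarrow> real" assume \<phi>: "test_function \<phi>"
    note [measurable] = tm[OF \<phi>]
    have [measurable]: "pd b \<phi> \<in> borel_measurable borel" "pd b \<phi> \<in> borel_measurable lebesgue" if "b \<in> Basis" for b
      using tm[OF test_pd[OF \<phi> that]] by auto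
    have "(LINT x|lebesgue. g x \<bullet> grad \<phi> x) = (LINT x|lebesgue. (\<Sum>b\<in>Basis. (g x \<bullet> b) * pd b \<phi> x))"
    proof -
      have "g x \<bullet> grad \<phi> x = (\<Sum>b\<in>Basis. (g x \<bullet> b) * pd b \<phi> x)" for x
        by (subst euclidean_inner) (simp add: grad_inner)
      then show ?thesis by (simp only:)
    qed
    also have "\<dots> = (LINT x|lborel. (\<Sum>b\<in>Basis. g0 b x * pd b \<phi> x))"
    proof (rule integral_lebesgue_eq(1))
      show "(\<lambda>x. \<Sum>b\<in>Basis. (g x \<bullet> b) * pd b \<phi> x) \<in> borel_measurable lebesgue" by measurable
      show "(\<lambda>x. \<Sum>b\<in>Basis. g0 b x * pd b \<phi> x) \<in> borel_measurable borel" by measurable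
      have "AE x in lebesgue. \<forall>b\<in>Basis. g x \<bullet> b = g0 b x" using gg by (subst AE_finite_all) auto
      then show "AE x in lebesgue. (\<Sum>b\<in>Basis. (g x \<bullet> b) * pd b \<phi> x) = (\<Sum>b\<in>Basis. g0 b x * pd b \<phi> x)" by eventually_elim simp
    qed
    also have "\<dots> = (\<Sum>b\<in>Basis. LINT x|lborel. g0 b x * pd b \<phi> x)"
      by (intro Bochner_Integration.integral_sum sq_mult_integrable sg test_sq test_pd \<phi>)
    finally have 1: "(LINT x|lebesgue. g x \<bullet> grad \<phi> x) = (\<Sum>b\<in>Basis. LINT x|lborel. g0 b x * pd b \<phi> x)" .
    have "(LINT x|lebesgue. nonlin \<mu> \<alpha> \<beta> p (u x) (v x) * \<phi> x) = (LINT x|lborel. nonlin \<mu> \<alpha> \<beta> p (u0 x) (v0 x) * \<phi> x)"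
    proof (rule integral_lebesgue_eq(1))
      show "(\<lambda>x. nonlin \<mu> \<alpha> \<beta> p (u x) (v x) * \<phi> x) \<in> borel_measurable lebesgue" unfolding nonlin_def by measurable
      show "(\<lambda>x. nonlin \<mu> \<alpha> \<beta> p (u0 x) (v0 x) * \<phi> x) \<in> borel_measurable borel" unfolding nonlin_def by measurable
      show "AE x in lebesgue. nonlin \<mu> \<alpha> \<beta> p (u x) (v x) * \<phi> x = nonlin \<mu> \<alpha> \<beta> p (u0 x) (v0 x) * \<phi> x"
        using L(3,6) by eventually_elim simp
    qed
    then show "(\<Sum>b\<in>Basis. LINT x|lborel. g0 b x * pd b \<phi> x) + l * (LINT x|lborel. u0 x * \<phi> x) = (LINT x|lborel. nonlin \<mu> \<alpha> \<beta> p (u0 x) (v0 x) * \<phi> x)"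
      using g(3)[OF \<phi>] 1 uu[OF \<phi>] by simp
  qed
  then show ?thesis using that by blast
qed

lemma no_normalized_solution:
  fixes \<mu>1 \<mu>2 a1 a2 \<beta> p \<alpha>1 \<alpha>2 :: real
  assumes pos: "\<mu>1 > 0" "\<mu>2 > 0" "a1 > 0" "a2 > 0" "\<beta> > 0" and p: "2 < p" "p < 4" and \<alpha>: "\<alpha>1 < 0" "\<alpha>2 < 0"
    and sol: "normalized_solution \<mu>1 \<mu>2 \<alpha>1 \<alpha>2 \<beta> p a1 a2 l1 l2 u v"
  shows "\<not> (positive_ae u \<and> positive_ae v)" "p > 8 / 3 \<Longrightarrow> \<not> (radial_ae u \<and> radial_ae v)"
proof -
  have L: "L2 u" "L2 v" and eu: "weak_eq l1 u (\<lambda>x. nonlin \<mu>1 \<alpha>1 \<beta> p (u x) (v x))" and ev: "weak_eq l2 v (\<lambda>x. nonlin \<mu>2 \<alpha>2 \<beta> p (v x) (u x))"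
    and n: "(LINT x|lebesgue. (u x)\<^sup>2) = a1\<^sup>2" "(LINT x|lebesgue. (v x)\<^sup>2) = a2\<^sup>2"
    using sol unfolding normalized_solution_def H1_def nonlin_def by blast+
  have m: "u \<in> borel_measurable lebesgue" "v \<in> borel_measurable lebesgue" using L by (auto simp: L2_def)
  obtain u0 where u0: "u0 \<in> borel_measurable borel" "AE x in lebesgue. u x = u0 x" using lebesgue_representative[OF m(1)] by blast
  obtain v0 where v0: "v0 \<in> borel_measurable borel" "AE x in lebesgue. v x = v0 x" using lebesgue_representative[OF m(2)] by blast
  obtain g where g: "weq l1 u0 g (\<lambda>x. nonlin \<mu>1 \<alpha>1 \<beta> p (u0 x) (v0 x))" using weq_representative[OF L(1) u0 L(2) v0 eu] by blast
  obtain k where k: "weq l2 v0 k (\<lambda>x. nonlin \<mu>2 \<alpha>2 \<beta> p (v0 x) (u0 x))" using weq_representative[OF L(2) v0 L(1) u0 ev] by blast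
  have W: "W u0 g" "W v0 k" using g k by (auto simp: weq_def)
  interpret S: sys \<mu>1 \<mu>2 \<alpha>1 \<alpha>2 \<beta> p l1 l2 u0 v0 g k
    by unfold_locales (use pos p \<alpha> g k W in auto)
  \<comment> \<open>The exchanged system, so that in the radial case whichever multiplier is
    negative can play the part of \<open>l1\<close>.\<close>
  interpret S': sys \<mu>2 \<mu>1 \<alpha>2 \<alpha>1 \<beta> p l2 l1 v0 u0 k g
    by unfold_locales
  \<comment> \<open>The prescribed masses make both components nonzero, so in the radial case the
    vanishing of either one is a contradiction.\<close>
  have n2: "n2 u0 > 0" "n2 v0 > 0"
  proof -
    note [measurable] = m u0(1) v0(1)
    have "(LINT x|lebesgue. (u x)\<^sup>2) = n2 u0" unfolding n2_def
      by (rule integral_lebesgue_eq) (measurable, use u0(2) in \<open>auto elim: eventually_mono\<close>)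
    moreover have "(LINT x|lebesgue. (v x)\<^sup>2) = n2 v0" unfolding n2_def
      by (rule integral_lebesgue_eq) (measurable, use v0(2) in \<open>auto elim: eventually_mono\<close>)
    moreover have "a1\<^sup>2 > 0" "a2\<^sup>2 > 0" using pos by simp_all
    ultimately show "n2 u0 > 0" "n2 v0 > 0" using n by linarith+
  qed
  have l: "l1 < 0 \<or> l2 < 0"
  proof (rule ccontr)
    assume "\<not> ?thesis"
    then have "0 \<le> l1 * n2 u0" "0 \<le> l2 * n2 v0" using n2 by auto
    then show False using S.multiplier_neg[OF \<alpha>(1) n2(1)] by linarith
  qed
  show "\<not> (positive_ae u \<and> positive_ae v)"
  proof
    assume "positive_ae u \<and> positive_ae v"
    then have "AE x in lebesgue. u x > 0" "AE x in lebesgue. v x > 0" by (auto simp: positive_ae_def)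
    then have "AE x in lebesgue. u0 x > 0" "AE x in lebesgue. v0 x > 0" using u0(2) v0(2) by (eventually_elim, simp)+
    then have "AE x in lborel. u0 x > 0" "AE x in lborel. v0 x > 0" by (simp_all add: AE_completion_iff)
    then show False using l S.U.no_positive S.V.no_positive by blast
  qed
  show "\<not> (radial_ae u \<and> radial_ae v)" if p3: "p > 8 / 3"
  proof
    assume "radial_ae u \<and> radial_ae v"
    then obtain \<rho>1 \<rho>2 where r: "AE x in lebesgue. u x = \<rho>1 (norm x)" "AE x in lebesgue. v x = \<rho>2 (norm x)" unfolding radial_ae_def by blast
    have "AE x in lebesgue. u0 x = \<rho>1 (norm x)" using r(1) u0(2) by eventually_elim simp
    then have 1: "AE x in lborel. u0 x = \<rho>1 (norm x)" by (simp add: AE_completion_iff)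
    have "AE x in lebesgue. v0 x = \<rho>2 (norm x)" using r(2) v0(2) by eventually_elim simp
    then have 2: "AE x in lborel. v0 x = \<rho>2 (norm x)" by (simp add: AE_completion_iff)
    show False using l S.radial_vanish[OF _ p3 1 2] S'.radial_vanish[OF _ p3 2 1] n2 by auto
  qed
qed

theorem theorem1p1:
  fixes \<mu>1 \<mu>2 a1 a2 \<beta> p \<alpha>1 \<alpha>2 :: real
  assumes "\<mu>1 > 0" "\<mu>2 > 0" "a1 > 0" "a2 > 0" "\<beta> > 0"
    and "2 < p" "p < 4"
    and "\<alpha>1 < 0" "\<alpha>2 < 0"
  shows "(\<nexists>l1 l2 u v. normalized_solution \<mu>1 \<mu>2 \<alpha>1 \<alpha>2 \<beta> p a1 a2 l1 l2 u v \<and>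
            positive_ae u \<and> positive_ae v) \<and>
         (p > 8 / 3 \<longrightarrow>
           (\<nexists>l1 l2 u v. normalized_solution \<mu>1 \<mu>2 \<alpha>1 \<alpha>2 \<beta> p a1 a2 l1 l2 u v \<and>
              \<not> (zero_ae u \<and> zero_ae v) \<and> radial_ae u \<and> radial_ae v))"
  using no_normalized_solution[OF assms] by blast

end
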